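(* Let $\mathcal{O}\subset\mathcal{A}\subset\mathbb{R}^n$ be closed convex sets with non-empty interior, let $\Gamma\subset\mathrm{Conv}(\mathbb{R}^n)$ be an $(\mathcal{A},\mathcal{O})$-cone, and let $d\in\mathbb{N}$. For every $Z\in\mathrm{PV}_{d,n+d}(\Gamma,\mathbb{R})$ there exists a unique function $\phi\in C_c(\mathbb{R}^n,\mathrm{Sym}^d(\mathbb{R}^n\times\mathbb{R}))$ with $\operatorname{supp}\phi\subset\operatorname{int}\mathcal{O}$ such that $$Z(f)=\int_{\mathbb{R}^n\times\mathbb{R}^n}\phi(x)[y,f(x)]\,d\Theta_0(f;(x,y))\quad\text{for all } f\in\Gamma.$$ Conversely, the right-hand side of this equation defines an element of $\mathrm{PV}_{d,n+d}(\Gamma,\mathbb{R})$ for every such function $\phi$.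
   Context: $\mathrm{Conv}(\mathbb{R}^n)$ is the set of convex, lower semi-continuous functions $f:\mathbb{R}^n\to\mathbb{R}\cup\{\infty\}$ that are proper (not identically $\infty$), with the metrizable topology of epi-convergence: $f_j\to f$ iff for every $x$, (i) $f(x)\le\liminf_j f_j(x_j)$ for every sequence $x_j\to x$, and (ii) there is a sequence $x_j\to x$ with $f(x)=\lim_j f_j(x_j)$. Subsets carry the induced topology. $\operatorname{dom}f=\{x:f(x)<\infty\}$; $I_A$ is the function equal to $0$ on $A$ and $\infty$ off $A$. $\mathcal{K}^{n+1}$ is the set of non-empty compact convex subsets of $\mathbb{R}^{n+1}=\mathbb{R}^n\times\mathbb{R}$, and $h_K(z)=\sup_{w\in K}\langle z,w\rangle$ is the support function. $\Gamma\subset\mathrm{Conv}(\mathbb{R}^n)$ is an $(\mathcal{A},\mathcal{O})$-cone if: $\Gamma$ is closed under pointwise addition and multiplication by $t>0$; $\mathcal{O}\subset\operatorname{dom}f\subset\mathcal{A}$ for every $f\in\Gamma$; $I_{\mathcal{A}},I_{\mathcal{O}}\in\Gamma$; and $h_K(\cdot,-1)+I_{\mathcal{A}}\in\Gamma$ for every $K\in\mathcal{K}^{n+1}$. A map $Z:\Gamma\to\mathbb{R}$ is a valuation if $Z(f\vee h)+Z(f\wedge h)=Z(f)+Z(h)$ whenever $f,h,f\vee h,f\wedge h\in\Gamma$ (pointwise maximum and minimum). It is polynomial of degree at most $d$ if for every $f\in\Gamma$ the map $\ell\mapsto Z(f+\ell)$ is a polynomial of degree at most $d$ on the space $\mathrm{Aff}(n)\cong\mathbb{R}^{n+1}$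 of affine functions on $\mathbb{R}^n$. $\mathrm{PV}_{d,k}(\Gamma,\mathbb{R})$ is the space of continuous valuations $Z:\Gamma\to\mathbb{R}$ that are polynomial of degree at most $d$ and satisfy $Z(tf)=t^kZ(f)$ for all $t>0$, $f\in\Gamma$. $\mathrm{Sym}^d(\mathbb{R}^n\times\mathbb{R})$ is the space of symmetric tensors of rank $d$, identified with the space of real homogeneous polynomials of degree $d$ on $\mathbb{R}^n\times\mathbb{R}$; for $\phi(x)$ in this space, $\phi(x)[y,s]$ is the value of the polynomial $\phi(x)$ at $(y,s)\in\mathbb{R}^n\times\mathbb{R}$. The integrand is understood to be $0$ for $x\notin\operatorname{supp}\phi$ (on $\operatorname{supp}\phi\subset\operatorname{int}\mathcal{O}$, $f$ is finite). $C_c$ denotes continuous compactly supported functions. $\Theta_0(f;\cdot)$ is the Hessian measure of order $0$ of $f\in\mathrm{Conv}(\mathbb{R}^n)$, the non-negative Borel measure on $\mathbb{R}^n\times\mathbb{R}^n$ with $\Theta_0(f;B)=\mathcal{L}^n(\{y\in\mathbb{R}^n:\exists x\in\mathbb{R}^n,\ (x,y)\in B,\ y\in\partial f(x)\})$, where $\mathcal{L}^n$ is Lebesgue measure and $\partial f(x)=\{y:f(z)\ge f(x)+\langle z-x,y\rangle\ \forall z\in\mathbb{R}^n\}$ is the subgradient. When $f$ is $C^2$ on all of $\mathbb{R}^n$, the integral equals $\int_{\mathbb{R}^n}\phi(x)[\nabla f(x),f(x)]\det(D^2f(x))\,dx$. *)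

theory Defs
  imports "HOL-Analysis.Analysis"
begin

definition ereal_convex :: "('a::real_vector \<Rightarrow> ereal) \<Rightarrow> bool" where
  "ereal_convex f \<longleftrightarrow> (\<forall>x y. \<forall>t\<in>{0<..<1}.
     f ((1 - t) *\<^sub>R x + t *\<^sub>R y) \<le> ereal (1 - t) * f x + ereal t * f y)"

definition lsc :: "('a::topological_space \<Rightarrow> ereal) \<Rightarrow> bool" where
  "lsc f \<longleftrightarrow> (\<forall>x. f x \<le> Liminf (at x) f)"

definition Conv :: "((real^'n) \<Rightarrow> ereal) set" where
  "Conv = {f. (\<forall>x. f x \<noteq> -\<infinity>) \<and> (\<exists>x. f x \<noteq> \<infinity>) \<and> ereal_convex f \<and> lsc f}"

definition effective_domain :: "('a \<Rightarrow> ereal) \<Rightarrow> 'a set" where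
  "effective_domain f = {x. f x < \<infinity>}"

definition convex_indicator :: "'a set \<Rightarrow> 'a \<Rightarrow> ereal" where
  "convex_indicator A x = (if x \<in> A then 0 else \<infinity>)"

definition support_function :: "'a::real_inner set \<Rightarrow> 'a \<Rightarrow> real" where
  "support_function K z = (SUP w\<in>K. z \<bullet> w)"

definition subdifferential :: "('a::real_inner \<Rightarrow> ereal) \<Rightarrow> 'a \<Rightarrow> 'a set" where
  "subdifferential f x = {y. \<forall>z. f z \<ge> f x + ereal ((z - x) \<bullet> y)}"

definition epi_converges :: "(nat \<Rightarrow> 'a::topological_space \<Rightarrow> ereal) \<Rightarrow> ('a \<Rightarrow> ereal) \<Rightarrow> bool" where
  "epi_converges fs f \<longleftrightarrow> (\<forall>x.
     (\<forall>X. X \<longlonglongrightarrow> x \<longrightarrow> f x \<le> liminf (\<lambda>j. fs j (X j))) \<and>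
     (\<exists>X. X \<longlonglongrightarrow> x \<and> (\<lambda>j. fs j (X j)) \<longlonglongrightarrow> f x))"

text \<open>
  A metrizable topology is determined by its convergent sequences, its open sets being the
  sequentially open ones. The lemmas \<open>metrizable_epi_topology\<close> and \<open>limitin_epi_topology\<close> below
  show that the topology defined in this way on \<^const>\<open>Conv\<close> is metrizable and that its
  convergent sequences are exactly the epi-convergent ones.
\<close>

definition epi_topology :: "((real^'n) \<Rightarrow> ereal) topology" where
  "epi_topology = topology (\<lambda>U. U \<subseteq> Conv \<and>
     (\<forall>f\<in>U. \<forall>fs. range fs \<subseteq> Conv \<and> epi_converges fs f \<longrightarrow> (\<forall>\<^sub>F j in sequentially. fs j \<in> U)))"

definition AO_cone ::
    "(real^'n) set \<Rightarrow> (real^'n) set \<Rightarrow> ((real^'n) \<Rightarrow> ereal) set \<Rightarrow> bool" where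
  "AO_cone \<A> \<O> \<Gamma> \<longleftrightarrow>
     \<Gamma> \<subseteq> Conv \<and>
     (\<forall>f\<in>\<Gamma>. \<forall>h\<in>\<Gamma>. (\<lambda>x. f x + h x) \<in> \<Gamma>) \<and>
     (\<forall>f\<in>\<Gamma>. \<forall>t>0. (\<lambda>x. ereal t * f x) \<in> \<Gamma>) \<and>
     (\<forall>f\<in>\<Gamma>. \<O> \<subseteq> effective_domain f \<and> effective_domain f \<subseteq> \<A>) \<and>
     convex_indicator \<A> \<in> \<Gamma> \<and> convex_indicator \<O> \<in> \<Gamma> \<and>
     (\<forall>K :: ((real^'n) \<times> real) set. K \<noteq> {} \<and> compact K \<and> convex K \<longrightarrow>
        (\<lambda>x. ereal (support_function K (x, -1)) + convex_indicator \<A> x) \<in> \<Gamma>)"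

definition multi_indices :: "nat \<Rightarrow> ('a::euclidean_space \<Rightarrow> nat) set" where
  "multi_indices k = {\<alpha>. (\<forall>b. b \<notin> Basis \<longrightarrow> \<alpha> b = 0) \<and> (\<Sum>b\<in>Basis. \<alpha> b) = k}"

lemma finite_multi_indices: "finite (multi_indices k :: ('a::euclidean_space \<Rightarrow> nat) set)"
proof (rule finite_subset)
  show "multi_indices k \<subseteq> {\<alpha> :: 'a \<Rightarrow> nat. \<forall>b. (b \<in> Basis \<longrightarrow> \<alpha> b \<in> {..k}) \<and> (b \<notin> Basis \<longrightarrow> \<alpha> b = 0)}"
    by (auto simp: multi_indices_def intro: member_le_sum)
  show "finite {\<alpha> :: 'a \<Rightarrow> nat. \<forall>b. (b \<in> Basis \<longrightarrow> \<alpha> b \<in> {..k}) \<and> (b \<notin> Basis \<longrightarrow> \<alpha> b = 0)}"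
    by (rule finite_set_of_finite_funs) simp_all
qed

definition homogeneous_polynomial :: "nat \<Rightarrow> ('a::euclidean_space \<Rightarrow> real) \<Rightarrow> bool" where
  "homogeneous_polynomial k p \<longleftrightarrow>
     (\<exists>c. \<forall>x. p x = (\<Sum>\<alpha>\<in>multi_indices k. c \<alpha> * (\<Prod>b\<in>Basis. (x \<bullet> b) ^ \<alpha> b)))"

definition polynomial_of_degree_le :: "nat \<Rightarrow> ('a::euclidean_space \<Rightarrow> real) \<Rightarrow> bool" where
  "polynomial_of_degree_le d p \<longleftrightarrow>
     (\<exists>q. (\<forall>k\<le>d. homogeneous_polynomial k (q k)) \<and> (\<forall>x. p x = (\<Sum>k\<le>d. q k x)))"

definition valuation_on ::
    "('a \<Rightarrow> ereal) set \<Rightarrow> (('a \<Rightarrow> ereal) \<Rightarrow> real) \<Rightarrow> bool" where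
  "valuation_on \<Gamma> Z \<longleftrightarrow> (\<forall>f\<in>\<Gamma>. \<forall>h\<in>\<Gamma>.
     (\<lambda>x. max (f x) (h x)) \<in> \<Gamma> \<and> (\<lambda>x. min (f x) (h x)) \<in> \<Gamma> \<longrightarrow>
     Z (\<lambda>x. max (f x) (h x)) + Z (\<lambda>x. min (f x) (h x)) = Z f + Z h)"

text \<open>
  The affine function \<open>\<lambda>x. y \<bullet> x + s\<close> is identified with the pair \<open>(y, s)\<close>.
\<close>

definition polynomial_valued ::
    "nat \<Rightarrow> ((real^'n) \<Rightarrow> ereal) set \<Rightarrow> (((real^'n) \<Rightarrow> ereal) \<Rightarrow> real) \<Rightarrow> bool" where
  "polynomial_valued d \<Gamma> Z \<longleftrightarrow> (\<forall>f\<in>\<Gamma>.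
     polynomial_of_degree_le d (\<lambda>(y :: real^'n, s :: real). Z (\<lambda>x. f x + ereal (y \<bullet> x + s))))"

text \<open>
  A functional on \<open>\<Gamma>\<close> is represented by a total function, of which only the values on \<open>\<Gamma>\<close> matter.
\<close>

definition PV ::
    "nat \<Rightarrow> nat \<Rightarrow> ((real^'n) \<Rightarrow> ereal) set \<Rightarrow> (((real^'n) \<Rightarrow> ereal) \<Rightarrow> real) set" where
  "PV d k \<Gamma> = {Z.
     continuous_map (subtopology epi_topology \<Gamma>) euclideanreal Z \<and>
     valuation_on \<Gamma> Z \<and>
     polynomial_valued d \<Gamma> Z \<and>
     (\<forall>f\<in>\<Gamma>. \<forall>t>0. Z (\<lambda>x. ereal t * f x) = t ^ k * Z f)}"

definition Sym :: "nat \<Rightarrow> ((real^'n) \<times> real \<Rightarrow> real) set" where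
  "Sym d = {p. homogeneous_polynomial d p}"

definition tensor_support :: "((real^'n) \<Rightarrow> (real^'n) \<times> real \<Rightarrow> real) \<Rightarrow> (real^'n) set" where
  "tensor_support \<phi> = closure {x. \<phi> x \<noteq> (\<lambda>_. 0)}"

text \<open>
  Continuity refers to the topology of pointwise convergence on functions, which is the one of
  the type class instance. On the finite-dimensional vector space \<^term>\<open>Sym d\<close> it induces the usual
  topology, since there is only one Hausdorff vector space topology on it.
\<close>

definition Cc_Sym :: "nat \<Rightarrow> ((real^'n) \<Rightarrow> (real^'n) \<times> real \<Rightarrow> real) set" where
  "Cc_Sym d = {\<phi>. range \<phi> \<subseteq> Sym d \<and> continuous_on UNIV \<phi> \<and> compact (tensor_support \<phi>)}"

text \<open>
  The sets measured here need not be Borel, but for \<open>f \<in> Conv\<close> they are Lebesgue measurable: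
  almost every \<open>y\<close> belongs to at most one of the sets \<open>subdifferential f x\<close>. This is also
  why the set function is countably additive.
\<close>

definition hessian_measure0 :: "((real^'n) \<Rightarrow> ereal) \<Rightarrow> ((real^'n) \<times> (real^'n)) measure" where
  "hessian_measure0 f = measure_of UNIV (sets borel)
     (\<lambda>B. emeasure lebesgue {y. \<exists>x. (x, y) \<in> B \<and> y \<in> subdifferential f x})"

text \<open>
  For \<open>f\<close> in an \<open>(\<A>, \<O>)\<close>-cone and \<open>tensor_support \<phi> \<subseteq> interior \<O>\<close>, the coercion
  \<^const>\<open>real_of_ereal\<close> is only relevant at points where \<open>f\<close> is finite, because outside of its
  support \<open>\<phi>\<close> is the zero polynomial.
\<close>

definition hessian_integrand ::
    "((real^'n) \<Rightarrow> (real^'n) \<times> real \<Rightarrow> real) \<Rightarrow> ((real^'n) \<Rightarrow> ereal) \<Rightarrow> (real^'n) \<times> (real^'n) \<Rightarrow> real" where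
  "hessian_integrand \<phi> f = (\<lambda>(x, y). \<phi> x (y, real_of_ereal (f x)))"


section \<open>The topology of epi-convergence is metrizable\<close>

definition ereal_epigraph :: "('a \<Rightarrow> ereal) \<Rightarrow> ('a \<times> real) set" where
  "ereal_epigraph f = {(x, r). f x \<le> ereal r}"

lemma lsc_sequentially:
  fixes f :: "'a::topological_space \<Rightarrow> ereal"
  assumes "lsc f" "X \<longlonglongrightarrow> x" "c < f x"
  shows "\<forall>\<^sub>F j in sequentially. c < f (X j)"
proof -
  have "\<forall>\<^sub>F z in at x. c < f z"
    using assms(1,3) unfolding lsc_def le_Liminf_iff by blast
  then have "\<forall>\<^sub>F z in nhds x. c < f z"
    using assms(3) by (auto simp: eventually_at_filter elim: eventually_mono)
  then show ?thesis
    using assms(2) unfolding filterlim_iff by blast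
qed

lemma closed_epigraph:
  fixes f :: "(real^'n) \<Rightarrow> ereal"
  assumes "f \<in> Conv"
  shows "closed (ereal_epigraph f)"
  unfolding closed_sequential_limits
proof (intro allI impI, elim conjE)
  fix X :: "nat \<Rightarrow> (real^'n) \<times> real" and l
  assume X: "\<forall>n. X n \<in> ereal_epigraph f" "X \<longlonglongrightarrow> l"
  show "l \<in> ereal_epigraph f"
  proof (rule ccontr)
    assume "l \<notin> ereal_epigraph f"
    then have "ereal (snd l) < f (fst l)"
      by (auto simp: ereal_epigraph_def case_prod_unfold)
    then obtain c where c: "ereal (snd l) < ereal c" "ereal c < f (fst l)"
      using ereal_dense2 by blast
    have "\<forall>\<^sub>F j in sequentially. ereal c < f (fst (X j))"
      using assms X(2) c by (intro lsc_sequentially[of f _ "fst l"]) (auto simp: Conv_def intro: tendsto_fst)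
    moreover have "\<forall>\<^sub>F j in sequentially. snd (X j) < c"
      using c X(2) by (intro order_tendstoD(2)[OF tendsto_snd]) auto
    ultimately have "\<forall>\<^sub>F j in sequentially. False"
    proof eventually_elim
      case (elim j)
      have "f (fst (X j)) \<le> ereal (snd (X j))"
        using X(1) by (auto simp: ereal_epigraph_def case_prod_unfold)
      also have "\<dots> < ereal c" using elim by simp
      finally show ?case using elim by simp
    qed
    then show False by simp
  qed
qed

lemma epigraph_nonempty:
  assumes "f \<in> Conv"
  shows "ereal_epigraph f \<noteq> {}"
proof -
  obtain x where "f x \<noteq> \<infinity>" "f x \<noteq> -\<infinity>" using assms by (auto simp: Conv_def)
  then have "(x, real_of_ereal (f x)) \<in> ereal_epigraph f"
    by (cases "f x") (auto simp: ereal_epigraph_def)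
  then show ?thesis by blast
qed

lemma epigraph_eq_imp_eq:
  assumes "ereal_epigraph f = ereal_epigraph g"
  shows "f = g"
proof
  fix x
  have "f x \<le> ereal r \<longleftrightarrow> g x \<le> ereal r" for r
  proof -
    have "(x, r) \<in> ereal_epigraph f \<longleftrightarrow> (x, r) \<in> ereal_epigraph g" using assms by simp
    then show ?thesis by (simp add: ereal_epigraph_def)
  qed
  then show "f x = g x"
    by (metis ereal_dense2 linorder_not_le order_less_imp_le nless_le)
qed

lemma mem_epigraph_iff_infdist:
  assumes "f \<in> Conv"
  shows "p \<in> ereal_epigraph f \<longleftrightarrow> infdist p (ereal_epigraph f) = 0"
  using closed_epigraph[OF assms] epigraph_nonempty[OF assms] in_closed_iff_infdist_zero by blast

lemma epigraph_nearest:
  assumes "f \<in> Conv"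
  obtains q where "q \<in> ereal_epigraph f" "dist p q = infdist p (ereal_epigraph f)"
  using infdist_attains_inf[OF closed_epigraph[OF assms] epigraph_nonempty[OF assms]] by metis

lemma epi_converges_imp_infdist:
  assumes fs: "range fs \<subseteq> Conv" and f: "f \<in> Conv" and epi: "epi_converges fs f"
  shows "(\<lambda>j. infdist p (ereal_epigraph (fs j))) \<longlonglongrightarrow> infdist p (ereal_epigraph f)"
proof (rule order_tendstoI)
  fix a assume a: "infdist p (ereal_epigraph f) < a"
  obtain x r where q: "(x, r) \<in> ereal_epigraph f" "dist p (x, r) = infdist p (ereal_epigraph f)"
    using epigraph_nearest[OF f, of p] by (metis prod.exhaust)
  define e where "e = (a - infdist p (ereal_epigraph f)) / 2"
  have e: "e > 0" using a by (simp add: e_def)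
  obtain X where X: "X \<longlonglongrightarrow> x" "(\<lambda>j. fs j (X j)) \<longlonglongrightarrow> f x"
    using epi unfolding epi_converges_def by blast
  have "f x < ereal (r + e)"
    using order.strict_trans1[of "f x" "ereal r" "ereal (r + e)"] q(1) e
    by (simp add: ereal_epigraph_def)
  then have "\<forall>\<^sub>F j in sequentially. fs j (X j) < ereal (r + e)"
    using X(2) order_tendstoD(2) by blast
  moreover have "\<forall>\<^sub>F j in sequentially. dist (X j) x < e"
    using X(1) e by (simp add: tendsto_iff)
  ultimately show "\<forall>\<^sub>F j in sequentially. infdist p (ereal_epigraph (fs j)) < a"
  proof eventually_elim
    case (elim j)
    have "(X j, r + e) \<in> ereal_epigraph (fs j)" using elim by (simp add: ereal_epigraph_def)
    then have "infdist p (ereal_epigraph (fs j)) \<le> dist p (X j, r + e)" by (rule infdist_le)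
    also have "\<dots> \<le> dist p (x, r) + dist (x, r) (X j, r + e)" by (rule dist_triangle)
    also have "dist (x, r) (X j, r + e) \<le> dist x (X j) + dist r (r + e)"
      unfolding dist_Pair_Pair by (rule sqrt_sum_squares_le_sum) auto
    also have "dist x (X j) + dist r (r + e) < e + e"
      using elim e by (simp add: dist_commute dist_real_def)
    finally show ?case using q(2) by (simp add: e_def)
  qed
next
  fix a assume a: "a < infdist p (ereal_epigraph f)"
  show "\<forall>\<^sub>F j in sequentially. a < infdist p (ereal_epigraph (fs j))"
  proof (rule ccontr)
    assume "\<not> ?thesis"
    then have freq: "\<exists>\<^sub>F j in sequentially. infdist p (ereal_epigraph (fs j)) \<le> a"
      by (simp add: frequently_def not_le)
    define S where "S = {j. infdist p (ereal_epigraph (fs j)) \<le> a}"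
    have "infinite S" using freq
      by (simp add: S_def cofinite_eq_sequentially[symmetric] frequently_cofinite)
    define s where "s = enumerate S"
    have s: "strict_mono s" "\<And>k. s k \<in> S"
      using \<open>infinite S\<close> by (auto simp: s_def strict_mono_enumerate enumerate_in_set)
    have "\<exists>q. q \<in> ereal_epigraph (fs j) \<and> dist p q = infdist p (ereal_epigraph (fs j))" for j
      using epigraph_nearest[of "fs j" p] fs by blast
    then obtain Q where Q: "\<And>j. Q j \<in> ereal_epigraph (fs j)"
        "\<And>j. dist p (Q j) = infdist p (ereal_epigraph (fs j))"
      by metis
    have "\<forall>k. (Q \<circ> s) k \<in> cball p a"
      using s(2) Q(2) by (auto simp: S_def)
    then obtain l u where l: "l \<in> cball p a" and u: "strict_mono u" "((Q \<circ> s) \<circ> u) \<longlonglongrightarrow> l"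
      using compact_cball[of p a] unfolding compact_def by metis
    define v where "v = s \<circ> u"
    have v: "strict_mono v" using s(1) u(1) by (simp add: v_def strict_mono_o)
    have Qv: "(\<lambda>k. Q (v k)) \<longlonglongrightarrow> l" using u(2) by (simp add: v_def o_def)
    obtain x r where xr: "l = (x, r)" by (cases l)
    define X where "X j = (if j \<in> range v then fst (Q j) else x)" for j
    have "X \<longlonglongrightarrow> x"
    proof (rule tendstoI)
      fix e :: real assume "e > 0"
      have "\<forall>\<^sub>F k in sequentially. dist (fst (Q (v k))) x < e"
        using tendsto_fst[OF Qv] \<open>e > 0\<close> by (simp add: tendsto_iff xr)
      then obtain N where N: "\<And>k. k \<ge> N \<Longrightarrow> dist (fst (Q (v k))) x < e"
        by (auto simp: eventually_sequentially)
      have "dist (X j) x < e" if "j \<ge> v N" for j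
      proof (cases "j \<in> range v")
        case True
        then obtain k where "j = v k" by blast
        moreover from this that v have "k \<ge> N" by (simp add: strict_mono_less_eq)
        ultimately show ?thesis using N by (simp add: X_def)
      qed (use \<open>e > 0\<close> in \<open>simp add: X_def\<close>)
      then show "\<forall>\<^sub>F j in sequentially. dist (X j) x < e"
        by (auto simp: eventually_sequentially)
    qed
    then have "f x \<le> liminf (\<lambda>j. fs j (X j))"
      using epi by (simp add: epi_converges_def)
    also have "\<dots> \<le> liminf ((\<lambda>j. fs j (X j)) \<circ> v)"
      by (rule liminf_subseq_mono[OF v])
    also have "\<dots> \<le> liminf (\<lambda>k. ereal (snd (Q (v k))))"
      using Q(1) by (intro Liminf_mono always_eventually) (auto simp: X_def ereal_epigraph_def case_prod_unfold)
    also have "\<dots> = ereal r"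
      using tendsto_snd[OF Qv] by (intro lim_imp_Liminf) (auto simp: xr)
    finally have "l \<in> ereal_epigraph f" by (simp add: xr ereal_epigraph_def)
    then have "infdist p (ereal_epigraph f) \<le> dist p l" by (rule infdist_le)
    with l a show False by simp
  qed
qed

lemma infdist_imp_epi_converges:
  assumes fs: "range fs \<subseteq> Conv" and f: "f \<in> Conv"
    and lim: "\<And>p. (\<lambda>j. infdist p (ereal_epigraph (fs j))) \<longlonglongrightarrow> infdist p (ereal_epigraph f)"
  shows "epi_converges fs f"
proof -
  have low: "f x \<le> liminf (\<lambda>j. fs j (X j))" if X: "X \<longlonglongrightarrow> x" for x X
  proof (rule ccontr)
    assume "\<not> ?thesis"
    then have "liminf (\<lambda>j. fs j (X j)) < f x" by simp
    then obtain c where c: "liminf (\<lambda>j. fs j (X j)) < ereal c" "ereal c < f x"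
      using ereal_dense2 by blast
    have "\<not> (\<forall>\<^sub>F j in sequentially. ereal c < fs j (X j))"
    proof
      assume "\<forall>\<^sub>F j in sequentially. ereal c < fs j (X j)"
      then have "ereal c \<le> liminf (\<lambda>j. fs j (X j))"
        by (intro Liminf_bounded) (auto elim: eventually_mono)
      with c(1) show False by simp
    qed
    then have freq: "\<exists>\<^sub>F j in sequentially. fs j (X j) \<le> ereal c"
      by (simp add: frequently_def not_le)
    have "infdist (x, c) (ereal_epigraph f) \<le> 0"
    proof (rule ccontr)
      assume "\<not> ?thesis"
      then have pos: "infdist (x, c) (ereal_epigraph f) / 2 > 0"
          "infdist (x, c) (ereal_epigraph f) / 2 < infdist (x, c) (ereal_epigraph f)" by auto
      have "\<forall>\<^sub>F j in sequentially. dist (X j) x < infdist (x, c) (ereal_epigraph f) / 2"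
        using X pos(1) unfolding tendsto_iff by blast
      moreover have "\<forall>\<^sub>F j in sequentially.
          infdist (x, c) (ereal_epigraph f) / 2 < infdist (x, c) (ereal_epigraph (fs j))"
        using lim pos(2) by (rule order_tendstoD(1))
      ultimately have "\<forall>\<^sub>F j in sequentially. \<not> fs j (X j) \<le> ereal c"
      proof eventually_elim
        case (elim j)
        show ?case
        proof
          assume "fs j (X j) \<le> ereal c"
          then have "(X j, c) \<in> ereal_epigraph (fs j)" by (simp add: ereal_epigraph_def)
          then have "infdist (x, c) (ereal_epigraph (fs j)) \<le> dist (x, c) (X j, c)" by (rule infdist_le)
          also have "\<dots> = dist (X j) x" by (simp add: dist_Pair_Pair dist_commute)
          finally show False using elim by simp
        qed
      qed
      with freq show False by (simp add: frequently_def)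
    qed
    then have "(x, c) \<in> ereal_epigraph f"
      using mem_epigraph_iff_infdist[OF f] infdist_nonneg by (metis order_antisym)
    with c(2) show False by (simp add: ereal_epigraph_def)
  qed
  have "\<exists>X. X \<longlonglongrightarrow> x \<and> (\<lambda>j. fs j (X j)) \<longlonglongrightarrow> f x" for x
  proof (cases "f x = \<infinity>")
    case True
    have "\<infinity> \<le> liminf (\<lambda>j. fs j x)" using low[of "\<lambda>_. x" x] True by simp
    then have "(\<lambda>j. fs j x) \<longlonglongrightarrow> \<infinity>"
      using Liminf_le_Limsup[of sequentially "\<lambda>j. fs j x"]
      by (intro Liminf_eq_Limsup) auto
    then show ?thesis using True by (intro exI[of _ "\<lambda>_. x"]) simp
  next
    case False
    then obtain r where r: "f x = ereal r" using f by (cases "f x") (auto simp: Conv_def)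
    then have "(x, r) \<in> ereal_epigraph f" by (simp add: ereal_epigraph_def)
    then have "infdist (x, r) (ereal_epigraph f) = 0"
      by (simp only: mem_epigraph_iff_infdist[OF f])
    then have lim0: "(\<lambda>j. infdist (x, r) (ereal_epigraph (fs j))) \<longlonglongrightarrow> 0" using lim[of "(x, r)"] by simp
    have "\<exists>q. q \<in> ereal_epigraph (fs j) \<and> dist (x, r) q = infdist (x, r) (ereal_epigraph (fs j))" for j
      using epigraph_nearest[of "fs j" "(x, r)"] fs by blast
    then obtain Q where Q: "\<And>j. Q j \<in> ereal_epigraph (fs j)"
        "\<And>j. dist (x, r) (Q j) = infdist (x, r) (ereal_epigraph (fs j))"
      by metis
    have QL: "Q \<longlonglongrightarrow> (x, r)"
      using lim0 by (subst tendsto_dist_iff) (simp add: dist_commute[of _ "(x, r)"] Q(2))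
    then have X: "(\<lambda>j. fst (Q j)) \<longlonglongrightarrow> x" and R: "(\<lambda>j. snd (Q j)) \<longlonglongrightarrow> r"
      using tendsto_fst[OF QL] tendsto_snd[OF QL] by simp_all
    have "limsup (\<lambda>j. fs j (fst (Q j))) \<le> limsup (\<lambda>j. ereal (snd (Q j)))"
      using Q(1) by (intro Limsup_mono always_eventually) (auto simp: ereal_epigraph_def case_prod_unfold)
    also have "\<dots> = f x"
      using R r by (intro lim_imp_Limsup) auto
    finally have "limsup (\<lambda>j. fs j (fst (Q j))) \<le> f x" .
    then have "(\<lambda>j. fs j (fst (Q j))) \<longlonglongrightarrow> f x"
      using low[OF X] Liminf_le_Limsup[of sequentially "\<lambda>j. fs j (fst (Q j))"]
      by (intro Liminf_eq_Limsup) auto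
    then show ?thesis using X by blast
  qed
  with low show ?thesis by (auto simp: epi_converges_def)
qed

lemma ex_dense_seq: "\<exists>p :: nat \<Rightarrow> (real^'n) \<times> real. closure (range p) = UNIV"
proof -
  obtain D :: "((real^'n) \<times> real) set" where D: "countable D" "UNIV \<subseteq> closure D"
    by (rule separable[of "UNIV :: ((real^'n) \<times> real) set"])
  have "D \<noteq> {}" using D(2) by auto
  then have "range (from_nat_into D) = D" using D(1) by (rule range_from_nat_into)
  then have "closure (range (from_nat_into D)) = UNIV" using D(2) by auto
  then show ?thesis by blast
qed

definition dense_seq :: "nat \<Rightarrow> (real^'n) \<times> real" where
  "dense_seq = (SOME p. closure (range p) = UNIV)"

lemma closure_range_dense_seq: "closure (range (dense_seq :: nat \<Rightarrow> (real^'n) \<times> real)) = UNIV"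
  unfolding dense_seq_def by (rule someI_ex[OF ex_dense_seq])

lemma dense_seq_near:
  fixes p :: "(real^'n) \<times> real"
  assumes "e > 0"
  obtains k where "dist p (dense_seq k) < e"
proof -
  have "p \<in> closure (range dense_seq)" by (simp add: closure_range_dense_seq)
  then show ?thesis using assms that unfolding closure_approachable by (metis dist_commute rangeE)
qed

definition epi_profile :: "((real^'n) \<Rightarrow> ereal) \<Rightarrow> nat \<Rightarrow> real" where
  "epi_profile f k = infdist (dense_seq k) (ereal_epigraph f)"

lemma infdist_lim_dense:
  fixes fs :: "nat \<Rightarrow> (real^'n) \<Rightarrow> ereal"
  assumes "\<And>k. (\<lambda>j. epi_profile (fs j) k) \<longlonglongrightarrow> epi_profile f k"
  shows "(\<lambda>j. infdist p (ereal_epigraph (fs j))) \<longlonglongrightarrow> infdist p (ereal_epigraph f)"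
proof (rule tendstoI)
  fix e :: real assume "e > 0"
  then obtain k where k: "dist p (dense_seq k) < e / 3" using dense_seq_near[of "e / 3" p] by auto
  have "\<forall>\<^sub>F j in sequentially. dist (epi_profile (fs j) k) (epi_profile f k) < e / 3"
    using tendstoD[OF assms[of k], of "e / 3"] \<open>e > 0\<close> by simp
  then show "\<forall>\<^sub>F j in sequentially. dist (infdist p (ereal_epigraph (fs j))) (infdist p (ereal_epigraph f)) < e"
  proof eventually_elim
    case (elim j)
    have "\<bar>infdist p (ereal_epigraph (fs j)) - epi_profile (fs j) k\<bar> < e / 3"
        "\<bar>infdist p (ereal_epigraph f) - epi_profile f k\<bar> < e / 3"
      unfolding epi_profile_def
      using infdist_triangle_abs[of p _ "dense_seq k"] k order.strict_trans1 by blast+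
    with elim show ?case unfolding dist_real_def by linarith
  qed
qed

lemma tendsto_fun_iff:
  fixes F :: "nat \<Rightarrow> nat \<Rightarrow> real"
  shows "F \<longlonglongrightarrow> l \<longleftrightarrow> (\<forall>k. (\<lambda>j. F j k) \<longlonglongrightarrow> l k)"
proof -
  have "F \<longlonglongrightarrow> l \<longleftrightarrow> limitin (product_topology (\<lambda>_. euclidean) UNIV) F l sequentially"
    by (simp add: euclidean_product_topology)
  also have "\<dots> \<longleftrightarrow> (\<forall>k. (\<lambda>j. F j k) \<longlonglongrightarrow> l k)"
    by (simp add: limitin_componentwise)
  finally show ?thesis .
qed

lemma epi_converges_iff_profile:
  assumes "range fs \<subseteq> Conv" "f \<in> Conv"
  shows "epi_converges fs f \<longleftrightarrow> (\<lambda>j. epi_profile (fs j)) \<longlonglongrightarrow> epi_profile f"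
proof
  assume "epi_converges fs f"
  then show "(\<lambda>j. epi_profile (fs j)) \<longlonglongrightarrow> epi_profile f"
    unfolding tendsto_fun_iff epi_profile_def using epi_converges_imp_infdist[OF assms] by blast
next
  assume "(\<lambda>j. epi_profile (fs j)) \<longlonglongrightarrow> epi_profile f"
  then show "epi_converges fs f"
    unfolding tendsto_fun_iff using infdist_lim_dense infdist_imp_epi_converges[OF assms] by blast
qed

lemma inj_on_epi_profile: "inj_on epi_profile (Conv :: ((real^'n) \<Rightarrow> ereal) set)"
proof (rule inj_onI)
  fix f g :: "(real^'n) \<Rightarrow> ereal"
  assume fg: "f \<in> Conv" "g \<in> Conv" "epi_profile f = epi_profile g"
  have "(\<lambda>j::nat. infdist p (ereal_epigraph f)) \<longlonglongrightarrow> infdist p (ereal_epigraph g)" for p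
    by (rule infdist_lim_dense) (simp add: fg(3))
  then have "infdist p (ereal_epigraph f) = infdist p (ereal_epigraph g)" for p
    by (simp add: LIMSEQ_const_iff)
  then have "ereal_epigraph f = ereal_epigraph g"
    by (intro set_eqI) (simp add: mem_epigraph_iff_infdist[OF fg(1)] mem_epigraph_iff_infdist[OF fg(2)])
  then show "f = g" by (rule epigraph_eq_imp_eq)
qed

definition epi_dist :: "((real^'n) \<Rightarrow> ereal) \<Rightarrow> ((real^'n) \<Rightarrow> ereal) \<Rightarrow> real" where
  "epi_dist f g = dist (epi_profile f) (epi_profile g)"

interpretation epi: Metric_space "Conv :: ((real^'n) \<Rightarrow> ereal) set" epi_dist
proof
  fix f g h :: "(real^'n) \<Rightarrow> ereal"
  show "0 \<le> epi_dist f g" "epi_dist f g = epi_dist g f"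
    by (simp_all add: epi_dist_def dist_commute)
  show "epi_dist f g = 0 \<longleftrightarrow> f = g" if "f \<in> Conv" "g \<in> Conv"
    using inj_on_epi_profile that by (auto simp: epi_dist_def inj_on_def)
  show "epi_dist f h \<le> epi_dist f g + epi_dist g h" if "f \<in> Conv" "g \<in> Conv" "h \<in> Conv"
    by (simp add: epi_dist_def dist_triangle)
qed

lemma epi_converges_iff_dist:
  assumes "range fs \<subseteq> Conv" "f \<in> Conv"
  shows "epi_converges fs f \<longleftrightarrow> (\<forall>e>0. \<forall>\<^sub>F j in sequentially. epi_dist (fs j) f < e)"
  unfolding epi_converges_iff_profile[OF assms] tendsto_iff epi_dist_def ..

lemma openin_epi_mtopology_iff:
  "openin epi.mtopology U \<longleftrightarrow> U \<subseteq> Conv \<and>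
     (\<forall>f\<in>U. \<forall>fs. range fs \<subseteq> Conv \<and> epi_converges fs f \<longrightarrow> (\<forall>\<^sub>F j in sequentially. fs j \<in> U))"
  (is "?L \<longleftrightarrow> ?R")
proof
  assume ?L
  then have L: "U \<subseteq> Conv" "\<And>f. f \<in> U \<Longrightarrow> \<exists>r>0. epi.mball f r \<subseteq> U"
    by (simp_all add: epi.openin_mtopology)
  have "\<forall>\<^sub>F j in sequentially. fs j \<in> U"
    if seq: "f \<in> U" "range fs \<subseteq> Conv" "epi_converges fs f" for f fs
  proof -
    obtain r where r: "r > 0" "epi.mball f r \<subseteq> U"
      using L(2)[OF seq(1)] by blast
    have f: "f \<in> Conv" using L(1) seq(1) by blast
    have "\<forall>\<^sub>F j in sequentially. epi_dist (fs j) f < r"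
      using seq(3) r(1) unfolding epi_converges_iff_dist[OF seq(2) f] by blast
    then show ?thesis
    proof eventually_elim
      case (elim j)
      then have "fs j \<in> epi.mball f r"
        using f seq(2) by (auto simp: epi.in_mball epi.commute)
      then show ?case using r(2) by blast
    qed
  qed
  with L(1) show ?R by blast
next
  assume R: ?R
  have "\<exists>r>0. epi.mball f r \<subseteq> U" if "f \<in> U" for f
  proof (rule ccontr)
    assume "\<not> ?thesis"
    then have "\<exists>g. g \<in> epi.mball f (inverse (real (Suc j))) \<and> g \<notin> U" for j
      by (metis inverse_positive_iff_positive of_nat_0_less_iff subsetI zero_less_Suc)
    then obtain gs where gs: "\<And>j. gs j \<in> epi.mball f (inverse (real (Suc j)))" "\<And>j. gs j \<notin> U"
      by metis
    have f: "f \<in> Conv" using R that by blast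
    have C: "range gs \<subseteq> Conv" using gs(1) by (auto simp: epi.in_mball)
    have le: "epi_dist (gs j) f < inverse (real (Suc j))" for j
      using gs(1)[of j] by (auto simp: epi.in_mball epi.commute)
    have "epi_converges gs f"
      unfolding epi_converges_iff_dist[OF C f]
    proof (intro allI impI)
      fix e :: real assume "e > 0"
      have "\<forall>\<^sub>F j in sequentially. inverse (real (Suc j)) < e"
        using LIMSEQ_inverse_real_of_nat \<open>e > 0\<close> order_tendstoD(2) by blast
      then show "\<forall>\<^sub>F j in sequentially. epi_dist (gs j) f < e"
        by eventually_elim (use le in \<open>metis order.strict_trans\<close>)
    qed
    then have "\<forall>\<^sub>F j in sequentially. gs j \<in> U" using R that C by blast
    then show False using gs(2) by simp
  qed
  then show ?L using R by (auto simp: epi.openin_mtopology)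
qed

lemma epi_topology_eq_mtopology: "epi_topology = epi.mtopology"
  unfolding epi_topology_def openin_epi_mtopology_iff[symmetric] by (rule openin_inverse)

lemma openin_epi_topology:
  "openin epi_topology U \<longleftrightarrow> U \<subseteq> Conv \<and>
     (\<forall>f\<in>U. \<forall>fs. range fs \<subseteq> Conv \<and> epi_converges fs f \<longrightarrow> (\<forall>\<^sub>F j in sequentially. fs j \<in> U))"
  unfolding epi_topology_eq_mtopology by (rule openin_epi_mtopology_iff)

lemma topspace_epi_topology: "topspace epi_topology = Conv"
  by (simp add: epi_topology_eq_mtopology)

lemma metrizable_epi_topology: "metrizable_space epi_topology"
  unfolding epi_topology_eq_mtopology by (rule epi.metrizable_space_mtopology)

lemma limitin_epi_topology:
  assumes "range fs \<subseteq> Conv" "f \<in> Conv"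
  shows "limitin epi_topology fs f sequentially \<longleftrightarrow> epi_converges fs f"
  using assms unfolding epi_topology_eq_mtopology epi.limitin_metric epi_converges_iff_dist[OF assms]
  by (auto simp: image_subset_iff)

end

theory Submission
  imports Defs
begin

text \<open>
  For \<open>x \<notin> \<O>\<close> nothing is seen by \<open>Z\<close>: the values of \<open>Z\<close> at \<open>f + M \<ell>\<^sub>+\<close> (\<open>\<ell>\<close> affine) are polynomial
  in \<open>M\<close>, and \<open>f + \<Sum>\<^sub>i M\<^sub>i (\<ell>\<^sub>i)\<^sub>+\<close> converges to \<open>f + I\<^sub>\<O>\<close> if \<open>\<O>\<close> is the intersection of the half-spaces
  \<open>\<ell>\<^sub>i \<le> 0\<close>, hence \<open>Z(f + I\<^sub>\<O>) = Z(f)\<close>. By homogeneity, \<open>Z(f) = 0\<close> if \<open>f \<ge> 0\<close> vanishes on a suitable compact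
  subset of the interior of \<open>\<O>\<close>.

  The density is found on the side of the conjugate functions. For a finite convex \<open>u\<close> and a box \<open>Q\<close>,
  let \<open>E(Q)\<close> be the value of \<open>Z\<close> at the conjugate of \<open>u + I\<^sub>Q\<close>. Cutting \<open>Q\<close> by a hyperplane is an instance
  of the valuation property. If \<open>u\<close> is \<open>C\<^sup>1\<^sup>,\<^sup>1\<close>, then rescaling a box of size \<open>\<epsilon>\<close> to unit size
  makes \<open>u\<close> affine up to \<open>O(\<epsilon>)\<close>, with a linear part of size \<open>1/\<epsilon>\<close>; homogeneity of degree \<open>n + d\<close> and
  polynomiality of degree \<open>d\<close> give \<open>E(Q) = \<epsilon>\<^sup>n (\<phi>(\<nabla>u(w))[w, \<langle>\<nabla>u(w), w\<rangle> - u(w)] + o(1))\<close>, where \<open>\<phi>(x\<^sub>0)[y, c]\<close> is the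
  leading coefficient of \<open>Z\<close> at \<open>h(x - x\<^sub>0) + \<tau> (\<langle>y, x - x\<^sub>0\<rangle> + c)\<close> as a polynomial in \<open>\<tau>\<close> and \<open>h\<close> is the support function
  of the unit cube. So degenerate boxes do not contribute, and \<open>E(Q)\<close> is the integral of the density over \<open>Q\<close>.
  Such conjugates are dense, which determines \<open>Z\<close>, and the same formula for \<open>\<phi>\<close> recovers the density of the
  integral functional.
\<close>


section \<open>Polynomials\<close>

text \<open>What shapes the proof is how little \<open>\<Gamma>\<close> is known to contain: sums,
  positive multiples, \<open>I_A\<close>, \<open>I_O\<close> and the functions
  \<open>h_K(\<cdot>,-1) + I_A\<close>. The test functions come from suitable \<open>K\<close>: a
  point gives an affine function, a segment a hinge, a truncated epigraph over \<open>Q\<close> the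
  conjugate of \<open>u + I_Q\<close>. Cutting \<open>Q\<close> by a hyperplane keeps the maximum
  and the minimum of two such conjugates in this class. The box lies in the space of gradients, so
  the factor \<open>\<epsilon>^n\<close> is the Lebesgue measure of gradients that defines the
  Hessian measure. The regularity of \<open>u\<close> is that of the conjugate of
  \<open>f + \<kappa> |x|^2\<close>. That the density vanishes off a compact set \<open>C\<close>
  inside \<open>\<O>\<close> cannot be read off from the functions that define it, which need not be
  nonnegative or vanish on \<open>C\<close>. Instead the affine function
  \<open>\<langle>x0, w\<rangle> - c\<close> is joined by a maximum to the support function of
  \<open>C\<close>; small boxes near \<open>y\<close> see only the affine function, while boxes
  containing the origin give functions on which \<open>Z\<close> vanishes. For the converse,
  subgradients are replaced by minimizers over a compact convex body around the support of
  \<open>\<phi>\<close>, where all functions are finite and continuous.\<close>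

definition lagrange_basis :: "nat \<Rightarrow> nat \<Rightarrow> real \<Rightarrow> real" where
  "lagrange_basis d i t = (\<Prod>m\<in>{..d} - {i}. (t - real m) / (real i - real m))"

text \<open>The coefficient of \<open>t ^ d\<close> in \<open>lagrange_basis d i\<close>. Weighted
  with it, the values at the nodes \<open>0..d\<close> give the \<open>d\<close>-th forward
  difference divided by \<open>d!\<close>, that is, the leading coefficient.\<close>

definition leading_weight :: "nat \<Rightarrow> nat \<Rightarrow> real" where
  "leading_weight d i = (\<Prod>m\<in>{..d} - {i}. 1 / (real i - real m))"

lemma lagrange_basis_nodes:
  assumes "i \<le> d" "j \<le> d"
  shows "lagrange_basis d i (real j) = (if i = j then 1 else 0)"
proof (cases "i = j")
  case True
  then show ?thesis by (auto simp: lagrange_basis_def intro!: prod.neutral)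
next
  case False
  then have "j \<in> {..d} - {i}" using assms by auto
  then show ?thesis using False unfolding lagrange_basis_def by (auto intro!: prod_zero)
qed

text \<open>Both sides are polynomials in \<open>t\<close> of degree at most \<open>d\<close> and
  agree at the \<open>d + 1\<close> nodes.\<close>

lemma power_eq_lagrange:
  assumes "k \<le> d"
  shows "t ^ k = (\<Sum>i\<le>d. real i ^ k * lagrange_basis d i t)"
proof -
  define P where "P i = (\<Prod>m\<in>{..d} - {i}. [: - real m / (real i - real m), 1 / (real i - real m) :])" for i
  define Q where "Q = (\<Sum>i\<le>d. smult (real i ^ k) (P i))"
  have P: "poly (P i) x = lagrange_basis d i x" for i x
    unfolding P_def lagrange_basis_def poly_prod
    by (intro prod.cong refl) (simp add: diff_divide_distrib)
  have Q: "poly Q x = (\<Sum>i\<le>d. real i ^ k * lagrange_basis d i x)" for x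
    by (simp add: Q_def poly_sum P)
  have degP: "degree (P i) \<le> d" if "i \<le> d" for i
  proof -
    have "degree (P i) \<le> (\<Sum>m\<in>{..d} - {i}. degree [: - real m / (real i - real m), 1 / (real i - real m) :])"
      unfolding P_def by (rule degree_prod_sum_le[unfolded o_def]) simp
    also have "\<dots> \<le> (\<Sum>m\<in>{..d} - {i}. 1)" by (intro sum_mono) auto
    also have "\<dots> = d" using that by simp
    finally show ?thesis .
  qed
  have degQ: "degree Q \<le> d"
    unfolding Q_def by (intro degree_sum_le) (auto intro: order.trans[OF degree_smult_le] degP)
  have "monom 1 k = Q"
  proof (rule poly_eqI_degree)
    show "poly (monom 1 k) x = poly Q x" if x: "x \<in> real ` {..d}" for x
    proof -
      obtain j where j: "x = real j" "j \<le> d" using x by auto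
      have "poly Q x = (\<Sum>i\<le>d. if i = j then real i ^ k else 0)"
        unfolding Q j(1) using j(2) by (intro sum.cong refl) (simp add: lagrange_basis_nodes)
      then show ?thesis using j by (simp add: poly_monom)
    qed
    have card: "card (real ` {..d}) = Suc d" by (subst card_image) (auto simp: inj_on_def)
    show "degree (monom (1::real) k) < card (real ` {..d})"
      using assms by (simp add: card degree_monom_eq)
    show "degree Q < card (real ` {..d})" using degQ by (simp add: card)
  qed
  then have "poly (monom 1 k) t = poly Q t" by simp
  then show ?thesis by (simp add: Q poly_monom)
qed

lemma lagrange_interpolation:
  assumes "\<And>t. p t = (\<Sum>k\<le>d. a k * t ^ k)"
  shows "p t = (\<Sum>i\<le>d. p (real i) * lagrange_basis d i t)"
proof -
  have "p t = (\<Sum>k\<le>d. a k * (\<Sum>i\<le>d. real i ^ k * lagrange_basis d i t))"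
    unfolding assms[of t] by (intro sum.cong refl) (simp add: power_eq_lagrange[symmetric])
  also have "\<dots> = (\<Sum>i\<le>d. (\<Sum>k\<le>d. a k * real i ^ k) * lagrange_basis d i t)"
    by (simp add: sum_distrib_left sum_distrib_right mult_ac) (rule sum.swap)
  finally show ?thesis by (simp add: assms)
qed

lemma lagrange_basis_leading:
  assumes "i \<le> d"
  shows "((\<lambda>t. lagrange_basis d i t / t ^ d) \<longlongrightarrow> leading_weight d i) at_top"
proof -
  have "((\<lambda>t. \<Prod>m\<in>{..d} - {i}. (1 - real m / t) * (1 / (real i - real m))) \<longlongrightarrow>
      (\<Prod>m\<in>{..d} - {i}. (1 - 0) * (1 / (real i - real m)))) at_top"
    by (intro tendsto_prod tendsto_mult tendsto_diff tendsto_const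
        tendsto_divide_0[OF tendsto_const] filterlim_at_top_imp_at_infinity filterlim_ident)
  moreover have "\<forall>\<^sub>F t in at_top. (\<Prod>m\<in>{..d} - {i}. (1 - real m / t) * (1 / (real i - real m)))
      = lagrange_basis d i t / t ^ d"
    using eventually_gt_at_top[of 0]
  proof eventually_elim
    case (elim t)
    have "t ^ d = (\<Prod>m\<in>{..d} - {i}. t)" using assms by simp
    then have "lagrange_basis d i t / t ^ d = (\<Prod>m\<in>{..d} - {i}. (t - real m) / (real i - real m) / t)"
      unfolding lagrange_basis_def by (simp only: prod_dividef)
    also have "\<dots> = (\<Prod>m\<in>{..d} - {i}. (1 - real m / t) * (1 / (real i - real m)))"
      using elim by (intro prod.cong refl) (simp add: field_simps)
    finally show ?case by simp
  qed
  ultimately show ?thesis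
    unfolding leading_weight_def by (simp add: filterlim_cong)
qed

text \<open>The polynomial may change with \<open>j\<close>: in the interpolation formula the
  weights depend on \<open>\<tau> j\<close> only, so convergence at the fixed nodes
  \<open>0..d\<close> controls values at arguments that escape to infinity.\<close>

lemma leading_weight_lim:
  fixes \<tau> :: "nat \<Rightarrow> real"
  assumes "\<And>j t. p j t = (\<Sum>k\<le>d. a j k * t ^ k)"
    and "filterlim \<tau> at_top sequentially"
    and "\<And>i. i \<le> d \<Longrightarrow> (\<lambda>j. p j (real i)) \<longlonglongrightarrow> P i"
  shows "(\<lambda>j. p j (\<tau> j) / \<tau> j ^ d) \<longlonglongrightarrow> (\<Sum>i\<le>d. leading_weight d i * P i)"
proof -
  have "p j (\<tau> j) / \<tau> j ^ d = (\<Sum>i\<le>d. (lagrange_basis d i (\<tau> j) / \<tau> j ^ d) * p j (real i))" for j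
    unfolding lagrange_interpolation[of "p j", OF assms(1), of "\<tau> j"]
    by (simp add: sum_divide_distrib mult.commute)
  moreover have "(\<lambda>j. \<Sum>i\<le>d. (lagrange_basis d i (\<tau> j) / \<tau> j ^ d) * p j (real i)) \<longlonglongrightarrow>
      (\<Sum>i\<le>d. leading_weight d i * P i)"
    by (intro tendsto_sum tendsto_mult assms(3)
        filterlim_compose[OF lagrange_basis_leading assms(2)]) auto
  ultimately show ?thesis by simp
qed

text \<open>The preceding limit for the constant sequence \<open>t ^ k\<close>, whose quotient by
  \<open>t ^ d\<close> is known.\<close>

lemma sum_leading_weight_power:
  assumes "k \<le> d"
  shows "(\<Sum>i\<le>d. leading_weight d i * real i ^ k) = (if k = d then 1 else 0)"
proof -
  have "(\<lambda>j. real j ^ k / real j ^ d) \<longlonglongrightarrow> (\<Sum>i\<le>d. leading_weight d i * real i ^ k)"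
  proof (rule leading_weight_lim[where p = "\<lambda>_ t. t ^ k" and a = "\<lambda>_ m. if m = k then 1 else 0"])
    show "t ^ k = (\<Sum>m\<le>d. (if m = k then 1 else 0) * t ^ m)" for t :: real
      using assms by (simp add: if_distrib[of "\<lambda>x. x * _"] cong: if_cong)
    show "filterlim real at_top sequentially" by (rule filterlim_real_sequentially)
  qed simp
  moreover have "(\<lambda>j. real j ^ k / real j ^ d) \<longlonglongrightarrow> (if k = d then 1 else 0)"
  proof (cases "k = d")
    case True
    have "\<forall>\<^sub>F j in sequentially. real j ^ k / real j ^ d = 1"
      using eventually_gt_at_top[of "0::nat"] by eventually_elim (simp add: True)
    then show ?thesis using True by (simp add: tendsto_eventually)
  next
    case False
    then have "k < d" using assms by simp
    have "(\<lambda>j. inverse (real j) ^ (d - k)) \<longlonglongrightarrow> 0 ^ (d - k)"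
      by (intro tendsto_power) (rule tendsto_inverse_0_at_top[OF filterlim_real_sequentially])
    moreover have "\<forall>\<^sub>F j in sequentially. inverse (real j) ^ (d - k) = real j ^ k / real j ^ d"
      using eventually_gt_at_top[of "0::nat"]
    proof eventually_elim
      case (elim j)
      have "real j ^ d = real j ^ k * real j ^ (d - k)"
        using \<open>k < d\<close> by (simp add: power_add[symmetric])
      then show ?case using elim by (simp add: field_simps)
    qed
    ultimately show ?thesis using False \<open>k < d\<close> by (simp add: filterlim_cong power_0_left)
  qed
  ultimately show ?thesis by (rule LIMSEQ_unique)
qed

section \<open>Homogeneous polynomials and polynomials of bounded degree in several
  variables\<close>

lemma homogeneous_polynomial_zero: "homogeneous_polynomial k (\<lambda>_. 0)"
  unfolding homogeneous_polynomial_def by (intro exI[of _ "\<lambda>_. 0"]) simp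

lemma homogeneous_polynomial_add:
  assumes "homogeneous_polynomial k p" "homogeneous_polynomial k q"
  shows "homogeneous_polynomial k (\<lambda>x. p x + q x)"
proof -
  obtain c c' where "\<forall>x. p x = (\<Sum>\<alpha>\<in>multi_indices k. c \<alpha> * (\<Prod>b\<in>Basis. (x \<bullet> b) ^ \<alpha> b))"
    "\<forall>x. q x = (\<Sum>\<alpha>\<in>multi_indices k. c' \<alpha> * (\<Prod>b\<in>Basis. (x \<bullet> b) ^ \<alpha> b))"
    using assms unfolding homogeneous_polynomial_def by blast
  then show ?thesis unfolding homogeneous_polynomial_def
    by (intro exI[of _ "\<lambda>\<alpha>. c \<alpha> + c' \<alpha>"]) (simp add: sum.distrib distrib_right)
qed

lemma homogeneous_polynomial_cmult:
  assumes "homogeneous_polynomial k p"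
  shows "homogeneous_polynomial k (\<lambda>x. r * p x)"
proof -
  obtain c where "\<forall>x. p x = (\<Sum>\<alpha>\<in>multi_indices k. c \<alpha> * (\<Prod>b\<in>Basis. (x \<bullet> b) ^ \<alpha> b))"
    using assms unfolding homogeneous_polynomial_def by blast
  then show ?thesis unfolding homogeneous_polynomial_def
    by (intro exI[of _ "\<lambda>\<alpha>. r * c \<alpha>"]) (simp add: sum_distrib_left mult.assoc)
qed

lemma homogeneous_polynomial_sum:
  assumes "\<And>i. i \<in> I \<Longrightarrow> homogeneous_polynomial k (p i)"
  shows "homogeneous_polynomial k (\<lambda>x. \<Sum>i\<in>I. p i x)"
  using assms
  by (induction I rule: infinite_finite_induct)
    (auto intro: homogeneous_polynomial_zero homogeneous_polynomial_add)

lemma homogeneous_polynomial_monomial: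
  assumes "\<alpha> \<in> multi_indices k"
  shows "homogeneous_polynomial k (\<lambda>x. \<Prod>b\<in>Basis. (x \<bullet> b) ^ \<alpha> b)"
  unfolding homogeneous_polynomial_def
proof (intro exI[of _ "\<lambda>\<beta>. if \<beta> = \<alpha> then 1 else 0"] allI)
  fix x :: 'a
  show "(\<Prod>b\<in>Basis. (x \<bullet> b) ^ \<alpha> b)
    = (\<Sum>\<beta>\<in>multi_indices k. (if \<beta> = \<alpha> then 1 else 0) * (\<Prod>b\<in>Basis. (x \<bullet> b) ^ \<beta> b))"
    using assms by (simp add: if_distrib[of "\<lambda>x. x * _"] finite_multi_indices cong: if_cong)
qed

lemma homogeneous_polynomial_mult:
  fixes p q :: "'a::euclidean_space \<Rightarrow> real"
  assumes "homogeneous_polynomial k p" "homogeneous_polynomial l q"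
  shows "homogeneous_polynomial (k + l) (\<lambda>x. p x * q x)"
proof -
  obtain c c' where c: "\<And>x. p x = (\<Sum>\<alpha>\<in>multi_indices k. c \<alpha> * (\<Prod>b\<in>Basis. (x \<bullet> b) ^ \<alpha> b))"
    and c': "\<And>x. q x = (\<Sum>\<alpha>\<in>multi_indices l. c' \<alpha> * (\<Prod>b\<in>Basis. (x \<bullet> b) ^ \<alpha> b))"
    using assms unfolding homogeneous_polynomial_def by blast
  have "p x * q x = (\<Sum>\<alpha>\<in>multi_indices k. \<Sum>\<beta>\<in>multi_indices l.
      (c \<alpha> * c' \<beta>) * (\<Prod>b\<in>Basis. (x \<bullet> b) ^ (\<alpha> b + \<beta> b)))" for x
    unfolding c c' sum_product
    by (intro sum.cong refl) (simp add: power_add prod.distrib mult_ac)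
  moreover have "homogeneous_polynomial (k + l) (\<lambda>x. \<Sum>\<alpha>\<in>multi_indices k. \<Sum>\<beta>\<in>multi_indices l.
      (c \<alpha> * c' \<beta>) * (\<Prod>b\<in>Basis. (x \<bullet> b) ^ (\<alpha> b + \<beta> b)))"
  proof (intro homogeneous_polynomial_sum homogeneous_polynomial_cmult)
    fix \<alpha> \<beta> :: "'a \<Rightarrow> nat" assume "\<alpha> \<in> multi_indices k" "\<beta> \<in> multi_indices l"
    then have "(\<lambda>b. \<alpha> b + \<beta> b) \<in> multi_indices (k + l)"
      by (simp add: multi_indices_def sum.distrib)
    then show "homogeneous_polynomial (k + l) (\<lambda>x. \<Prod>b\<in>Basis. (x \<bullet> b) ^ (\<alpha> b + \<beta> b))"
      by (rule homogeneous_polynomial_monomial)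
  qed
  ultimately show ?thesis by simp
qed

lemma homogeneous_polynomial_scaleR:
  assumes "homogeneous_polynomial k p"
  shows "p (t *\<^sub>R x) = t ^ k * p x"
proof -
  obtain c where c: "\<And>x. p x = (\<Sum>\<alpha>\<in>multi_indices k. c \<alpha> * (\<Prod>b\<in>Basis. (x \<bullet> b) ^ \<alpha> b))"
    using assms unfolding homogeneous_polynomial_def by blast
  have "(\<Prod>b\<in>Basis. (t *\<^sub>R x \<bullet> b) ^ \<alpha> b) = t ^ k * (\<Prod>b\<in>Basis. (x \<bullet> b) ^ \<alpha> b)"
    if "\<alpha> \<in> multi_indices k" for \<alpha>
  proof -
    have "(\<Prod>b\<in>Basis. t ^ \<alpha> b) = t ^ k"
      using that by (simp add: power_sum[symmetric] multi_indices_def)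
    then show ?thesis by (simp add: power_mult_distrib prod.distrib)
  qed
  then show ?thesis unfolding c sum_distrib_left by (intro sum.cong refl) simp
qed

lemma homogeneous_polynomial_inner: "homogeneous_polynomial 1 (\<lambda>x::'a::euclidean_space. x \<bullet> v)"
proof -
  have "homogeneous_polynomial 1 (\<lambda>x::'a. x \<bullet> b)" if b: "b \<in> Basis" for b
  proof -
    define \<alpha> where "\<alpha> = (\<lambda>i::'a. if i = b then 1 else 0 :: nat)"
    have \<alpha>: "\<alpha> \<in> multi_indices 1"
      using b by (auto simp: multi_indices_def \<alpha>_def)
    have "(\<Prod>i\<in>Basis. (x \<bullet> i) ^ \<alpha> i) = x \<bullet> b" for x :: 'a
    proof -
      have "(\<Prod>i\<in>Basis. (x \<bullet> i) ^ \<alpha> i) = (\<Prod>i\<in>Basis. if i = b then x \<bullet> i else 1)"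
        by (intro prod.cong) (auto simp: \<alpha>_def)
      then show ?thesis using b by simp
    qed
    then show ?thesis using homogeneous_polynomial_monomial[OF \<alpha>] by simp
  qed
  then have "homogeneous_polynomial 1 (\<lambda>x::'a. \<Sum>b\<in>Basis. (v \<bullet> b) * (x \<bullet> b))"
    by (intro homogeneous_polynomial_sum homogeneous_polynomial_cmult)
  moreover have "(\<Sum>b\<in>Basis. (v \<bullet> b) * (x \<bullet> b)) = x \<bullet> v" for x :: 'a
    by (subst euclidean_inner[of x v]) (simp add: mult.commute)
  ultimately show ?thesis by simp
qed

lemma homogeneous_polynomial_const: "homogeneous_polynomial 0 (\<lambda>_::'a::euclidean_space. r)"
  using homogeneous_polynomial_cmult[OF homogeneous_polynomial_monomial[of "\<lambda>_::'a. 0" 0], of r]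
  by (simp add: multi_indices_def)

lemma homogeneous_imp_degree_le:
  assumes "homogeneous_polynomial k p" "k \<le> d"
  shows "polynomial_of_degree_le d p"
  unfolding polynomial_of_degree_le_def
proof (intro exI[of _ "\<lambda>l. if l = k then p else (\<lambda>_. 0)"] conjI allI impI)
  fix x
  have "(\<Sum>l\<le>d. (if l = k then p else (\<lambda>_. 0)) x) = (\<Sum>l\<le>d. if l = k then p x else 0)"
    by (intro sum.cong) auto
  then show "p x = (\<Sum>l\<le>d. (if l = k then p else (\<lambda>_. 0)) x)" using assms(2) by simp
qed (auto simp: assms homogeneous_polynomial_zero)

lemma polynomial_degree_le_add:
  assumes "polynomial_of_degree_le d p" "polynomial_of_degree_le d q"
  shows "polynomial_of_degree_le d (\<lambda>x. p x + q x)"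
proof -
  obtain r s where "\<forall>k\<le>d. homogeneous_polynomial k (r k)" "\<forall>x. p x = (\<Sum>k\<le>d. r k x)"
    "\<forall>k\<le>d. homogeneous_polynomial k (s k)" "\<forall>x. q x = (\<Sum>k\<le>d. s k x)"
    using assms unfolding polynomial_of_degree_le_def by blast
  then show ?thesis unfolding polynomial_of_degree_le_def
    by (intro exI[of _ "\<lambda>k x. r k x + s k x"]) (simp add: sum.distrib homogeneous_polynomial_add)
qed

lemma polynomial_degree_le_cmult:
  assumes "polynomial_of_degree_le d p"
  shows "polynomial_of_degree_le d (\<lambda>x. c * p x)"
proof -
  obtain r where "\<forall>k\<le>d. homogeneous_polynomial k (r k)" "\<forall>x. p x = (\<Sum>k\<le>d. r k x)"
    using assms unfolding polynomial_of_degree_le_def by blast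
  then show ?thesis unfolding polynomial_of_degree_le_def
    by (intro exI[of _ "\<lambda>k x. c * r k x"]) (simp add: sum_distrib_left homogeneous_polynomial_cmult)
qed

lemma polynomial_degree_le_const: "polynomial_of_degree_le d (\<lambda>_::'a::euclidean_space. r)"
  by (rule homogeneous_imp_degree_le[OF homogeneous_polynomial_const]) simp

lemma polynomial_degree_le_sum:
  assumes "\<And>i. i \<in> I \<Longrightarrow> polynomial_of_degree_le d (p i)"
  shows "polynomial_of_degree_le d (\<lambda>x. \<Sum>i\<in>I. p i x)"
  using assms
  by (induction I rule: infinite_finite_induct)
    (auto intro: polynomial_degree_le_const polynomial_degree_le_add)

lemma polynomial_degree_le_mult:
  assumes "polynomial_of_degree_le d p" "polynomial_of_degree_le e q"
  shows "polynomial_of_degree_le (d + e) (\<lambda>x. p x * q x)"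
proof -
  obtain r s where r: "\<forall>k\<le>d. homogeneous_polynomial k (r k)" "\<forall>x. p x = (\<Sum>k\<le>d. r k x)"
    and s: "\<forall>k\<le>e. homogeneous_polynomial k (s k)" "\<forall>x. q x = (\<Sum>k\<le>e. s k x)"
    using assms unfolding polynomial_of_degree_le_def by blast
  have "polynomial_of_degree_le (d + e) (\<lambda>x. \<Sum>k\<le>d. \<Sum>l\<le>e. r k x * s l x)"
    by (intro polynomial_degree_le_sum homogeneous_imp_degree_le[OF homogeneous_polynomial_mult])
      (use r s in auto)
  then show ?thesis using r(2) s(2) by (simp add: sum_product)
qed

lemma polynomial_degree_le_power:
  assumes "polynomial_of_degree_le e p"
  shows "polynomial_of_degree_le (m * e) (\<lambda>x. p x ^ m)"
  by (induction m) (auto intro: polynomial_degree_le_const polynomial_degree_le_mult[OF assms])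

lemma polynomial_degree_le_prod:
  assumes "finite I" "\<And>i. i \<in> I \<Longrightarrow> polynomial_of_degree_le (e i) (p i)"
  shows "polynomial_of_degree_le (\<Sum>i\<in>I. e i) (\<lambda>x. \<Prod>i\<in>I. p i x)"
  using assms
  by (induction I rule: finite_induct)
    (auto intro: polynomial_degree_le_const polynomial_degree_le_mult)

lemma polynomial_degree_le_mono:
  assumes "polynomial_of_degree_le d p" "d \<le> e"
  shows "polynomial_of_degree_le e p"
  using polynomial_degree_le_mult[OF assms(1) polynomial_degree_le_const[of "e - d" 1]] assms(2) by simp

lemma polynomial_degree_le_inner: "polynomial_of_degree_le 1 (\<lambda>x::'a::euclidean_space. x \<bullet> v)"
  by (rule homogeneous_imp_degree_le[OF homogeneous_polynomial_inner]) simp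

lemma polynomial_degree_le_affine:
  "polynomial_of_degree_le 1 (\<lambda>x::'a::euclidean_space. r + x \<bullet> v)"
  by (intro polynomial_degree_le_add polynomial_degree_le_const polynomial_degree_le_inner)

lemma polynomial_degree_le_compose:
  fixes p :: "'b::euclidean_space \<Rightarrow> real" and T :: "'a::euclidean_space \<Rightarrow> 'b"
  assumes p: "polynomial_of_degree_le d p"
    and T: "\<And>b. b \<in> Basis \<Longrightarrow> polynomial_of_degree_le 1 (\<lambda>x. T x \<bullet> b)"
  shows "polynomial_of_degree_le d (\<lambda>x. p (T x))"
proof -
  obtain q where q: "\<forall>k\<le>d. homogeneous_polynomial k (q k)" "\<forall>x. p x = (\<Sum>k\<le>d. q k x)"
    using p unfolding polynomial_of_degree_le_def by blast
  have "polynomial_of_degree_le d (\<lambda>x. q k (T x))" if k: "k \<le> d" for k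
  proof -
    obtain c where c: "\<And>x. q k x = (\<Sum>\<alpha>\<in>multi_indices k. c \<alpha> * (\<Prod>b\<in>Basis. (x \<bullet> b) ^ \<alpha> b))"
      using q(1) k unfolding homogeneous_polynomial_def by blast
    have mono: "polynomial_of_degree_le d (\<lambda>x. \<Prod>b\<in>Basis. (T x \<bullet> b) ^ \<alpha> b)" if \<alpha>: "\<alpha> \<in> multi_indices k"
      for \<alpha> :: "'b \<Rightarrow> nat"
    proof -
      have "polynomial_of_degree_le (\<Sum>b\<in>Basis. \<alpha> b * 1) (\<lambda>x. \<Prod>b\<in>Basis. (T x \<bullet> b) ^ \<alpha> b)"
        by (rule polynomial_degree_le_prod[OF finite_Basis polynomial_degree_le_power[OF T]])
      then show ?thesis by (rule polynomial_degree_le_mono) (use \<alpha> k in \<open>simp add: multi_indices_def\<close>)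
    qed
    show ?thesis unfolding c by (rule polynomial_degree_le_sum, rule polynomial_degree_le_cmult, rule mono)
  qed
  then have "polynomial_of_degree_le d (\<lambda>x. \<Sum>k\<le>d. q k (T x))"
    by (intro polynomial_degree_le_sum) auto
  then show ?thesis using q(2) by simp
qed

lemma polynomial_degree_le_line:
  fixes p :: "'a::euclidean_space \<Rightarrow> real"
  assumes "polynomial_of_degree_le d p"
  shows "\<exists>a. \<forall>t. p (w + t *\<^sub>R z) = (\<Sum>k\<le>d. a k * t ^ k)"
proof -
  have "polynomial_of_degree_le d (\<lambda>t::real. p (w + t *\<^sub>R z))"
  proof (rule polynomial_degree_le_compose[OF assms])
    show "polynomial_of_degree_le 1 (\<lambda>t::real. (w + t *\<^sub>R z) \<bullet> b)" for b
      using polynomial_degree_le_affine[of "w \<bullet> b" "z \<bullet> b"]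
      by (simp add: inner_add_left)
  qed
  then obtain q where q: "\<forall>k\<le>d. homogeneous_polynomial k (q k)"
      "\<forall>t. p (w + t *\<^sub>R z) = (\<Sum>k\<le>d. q k t)"
    unfolding polynomial_of_degree_le_def by blast
  have qk: "q k t = q k 1 * t ^ k" if "k \<le> d" for k and t :: real
    using homogeneous_polynomial_scaleR[of k "q k" t 1] q(1) that by (simp add: mult.commute)
  have "p (w + t *\<^sub>R z) = (\<Sum>k\<le>d. q k 1 * t ^ k)" for t
    unfolding q(2)[rule_format] by (intro sum.cong refl qk) simp
  then show ?thesis by (intro exI[of _ "\<lambda>k. q k 1"] allI)
qed

text \<open>The weights multiply the component of degree \<open>k\<close> by
  \<open>\<Sum>i\<le>d. leading_weight d i * i ^ k\<close>, so exactly the component of degree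
  \<open>d\<close> survives.\<close>

lemma homogeneous_leading_part:
  fixes p :: "'a::euclidean_space \<Rightarrow> real"
  assumes "polynomial_of_degree_le d p"
  shows "homogeneous_polynomial d (\<lambda>z. \<Sum>i\<le>d. leading_weight d i * p (real i *\<^sub>R z))"
proof -
  obtain q where q: "\<forall>k\<le>d. homogeneous_polynomial k (q k)" "\<forall>x. p x = (\<Sum>k\<le>d. q k x)"
    using assms unfolding polynomial_of_degree_le_def by blast
  have "(\<Sum>i\<le>d. leading_weight d i * p (real i *\<^sub>R z)) = q d z" for z
  proof -
    have "(\<Sum>i\<le>d. leading_weight d i * p (real i *\<^sub>R z))
        = (\<Sum>i\<le>d. \<Sum>k\<le>d. (leading_weight d i * real i ^ k) * q k z)"
      unfolding q(2)[rule_format] sum_distrib_left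
      by (intro sum.cong refl) (use q(1) in \<open>simp add: homogeneous_polynomial_scaleR\<close>)
    also have "\<dots> = (\<Sum>k\<le>d. (\<Sum>i\<le>d. leading_weight d i * real i ^ k) * q k z)"
      by (subst sum.swap) (simp add: sum_distrib_right)
    also have "\<dots> = (\<Sum>k\<le>d. if k = d then q k z else 0)"
      by (intro sum.cong refl) (simp add: sum_leading_weight_power)
    finally show ?thesis by simp
  qed
  then show ?thesis using q(1) by simp
qed

text \<open>The leading coefficient of \<open>p (w + t *\<^sub>R z)\<close> in \<open>t\<close> does
  not see \<open>w\<close>: divided by \<open>t ^ d\<close> this is \<open>p (z + w / t)\<close>, by
  homogeneity. Later this removes the integration variable when the density is recovered from an
  average over the unit cube.\<close>

lemma leading_part_shifted:
  assumes "homogeneous_polynomial d p"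
  shows "(\<Sum>i\<le>d. leading_weight d i * p (w + real i *\<^sub>R z)) = p z"
proof -
  have pd: "polynomial_of_degree_le d p" by (rule homogeneous_imp_degree_le[OF assms]) simp
  obtain a where a: "\<And>t. p (w + t *\<^sub>R z) = (\<Sum>k\<le>d. a k * t ^ k)"
    using polynomial_degree_le_line[OF pd, of w z] by blast
  \<comment> \<open>This expansion gives the continuity of \<open>p\<close> at \<open>z\<close> in
    the direction \<open>w\<close>.\<close>
  obtain a' where a': "\<And>t. p (z + t *\<^sub>R w) = (\<Sum>k\<le>d. a' k * t ^ k)"
    using polynomial_degree_le_line[OF pd, of z w] by blast
  have lim1: "(\<lambda>j. p (w + real j *\<^sub>R z) / real j ^ d) \<longlonglongrightarrow>
      (\<Sum>i\<le>d. leading_weight d i * p (w + real i *\<^sub>R z))"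
    by (rule leading_weight_lim[where p = "\<lambda>_ t. p (w + t *\<^sub>R z)" and a = "\<lambda>_. a"])
      (auto simp: a filterlim_real_sequentially)
  have "(\<lambda>j. \<Sum>k\<le>d. a' k * inverse (real j) ^ k) \<longlonglongrightarrow> (\<Sum>k\<le>d. a' k * 0 ^ k)"
    by (intro tendsto_sum tendsto_mult tendsto_const tendsto_power) (rule tendsto_inverse_0_at_top[OF filterlim_real_sequentially])
  then have lim2: "(\<lambda>j. p (z + inverse (real j) *\<^sub>R w)) \<longlonglongrightarrow> p (z + 0 *\<^sub>R w)"
    unfolding a' .
  have "\<forall>\<^sub>F j in sequentially. p (z + inverse (real j) *\<^sub>R w) = p (w + real j *\<^sub>R z) / real j ^ d"
    using eventually_gt_at_top[of "0::nat"]
  proof eventually_elim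
    case (elim j)
    have "w + real j *\<^sub>R z = real j *\<^sub>R (z + inverse (real j) *\<^sub>R w)"
      using elim by (simp add: scaleR_add_right)
    then show ?case using elim by (simp add: homogeneous_polynomial_scaleR[OF assms])
  qed
  then have "(\<lambda>j. p (w + real j *\<^sub>R z) / real j ^ d) \<longlonglongrightarrow> p z"
    using lim2 by (simp add: filterlim_cong)
  then show ?thesis using lim1 LIMSEQ_unique by blast
qed

lemma polynomial_degree_le_continuous:
  assumes "polynomial_of_degree_le d p"
  shows "continuous_on UNIV p"
proof -
  obtain q where q: "\<forall>k\<le>d. homogeneous_polynomial k (q k)" "\<forall>x. p x = (\<Sum>k\<le>d. q k x)"
    using assms unfolding polynomial_of_degree_le_def by blast
  have "continuous_on UNIV (q k)" if k: "k \<le> d" for k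
  proof -
    obtain c where c: "\<And>x. q k x = (\<Sum>\<alpha>\<in>multi_indices k. c \<alpha> * (\<Prod>b\<in>Basis. (x \<bullet> b) ^ \<alpha> b))"
      using q(1) k unfolding homogeneous_polynomial_def by blast
    show ?thesis unfolding c by (intro continuous_intros)
  qed
  then have "continuous_on UNIV (\<lambda>x. \<Sum>k\<le>d. q k x)" by (intro continuous_intros) auto
  then show ?thesis using q(2) by (simp add: fun_eq_iff[symmetric])
qed

lemma polynomial_degree_le_lagrange_basis:
  "i \<le> d \<Longrightarrow> polynomial_of_degree_le d (\<lambda>x::'a::euclidean_space. lagrange_basis d i (x \<bullet> b))"
proof -
  assume i: "i \<le> d"
  have lin: "polynomial_of_degree_le 1 (\<lambda>x::'a. (x \<bullet> b - real m) / (real i - real m))" for m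
  proof -
    have "polynomial_of_degree_le 1 (\<lambda>x::'a. (1 / (real i - real m)) * (- real m + x \<bullet> b))"
      by (intro polynomial_degree_le_cmult polynomial_degree_le_affine)
    then show ?thesis by (simp add: divide_simps algebra_simps)
  qed
  have "polynomial_of_degree_le (\<Sum>m\<in>{..d} - {i}. 1)
      (\<lambda>x::'a. \<Prod>m\<in>{..d} - {i}. (x \<bullet> b - real m) / (real i - real m))"
    by (intro polynomial_degree_le_prod lin) auto
  then show ?thesis using i by (simp add: lagrange_basis_def)
qed

text \<open>
  The cardinal functions of the grid \<open>{0..d}\<^sup>N\<close> have too high a degree, but only their
  components of degree at most \<open>d\<close> contribute.
\<close>

lemma polynomial_degree_le_reproducing:
  "\<exists>(Gr :: 'a::euclidean_space set) (\<Lambda> :: 'a \<Rightarrow> 'a \<Rightarrow> real). finite Gr \<and>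
    (\<forall>g\<in>Gr. polynomial_of_degree_le d (\<Lambda> g)) \<and>
    (\<forall>p z. polynomial_of_degree_le d p \<longrightarrow> p z = (\<Sum>g\<in>Gr. p g * \<Lambda> g z))"
proof -
  define I where "I = (\<Pi>\<^sub>E b\<in>(Basis::'a set). {..d})"
  define pt where "pt = (\<lambda>\<kappa>. \<Sum>b\<in>(Basis::'a set). real (\<kappa> b) *\<^sub>R b)"
  define B where "B = (\<lambda>\<kappa> (z::'a). \<Prod>b\<in>Basis. lagrange_basis d (\<kappa> b) (z \<bullet> b))"
  define D where "D = DIM('a) * d"
  have finI: "finite I" unfolding I_def by (intro finite_PiE) auto
  have pt: "pt \<kappa> \<bullet> b = real (\<kappa> b)" if "b \<in> Basis" for \<kappa> b
    using that by (simp add: pt_def)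
  have dD: "d \<le> D" using DIM_positive[where 'a='a] by (cases "DIM('a)") (auto simp: D_def)
  have hom: "p z = (\<Sum>\<kappa>\<in>I. p (pt \<kappa>) * B \<kappa> z)" if k: "k \<le> d" and p: "homogeneous_polynomial k p" for k p z
  proof -
    obtain c where c: "\<And>x. p x = (\<Sum>\<alpha>\<in>multi_indices k. c \<alpha> * (\<Prod>b\<in>Basis. (x \<bullet> b) ^ \<alpha> b))"
      using p unfolding homogeneous_polynomial_def by blast
    have mono: "(\<Prod>b\<in>Basis. (z \<bullet> b) ^ \<alpha> b) = (\<Sum>\<kappa>\<in>I. (\<Prod>b\<in>Basis. (pt \<kappa> \<bullet> b) ^ \<alpha> b) * B \<kappa> z)"
      if \<alpha>: "\<alpha> \<in> multi_indices k" for \<alpha>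
    proof -
      have le: "\<alpha> b \<le> d" if "b \<in> Basis" for b
      proof -
        have "\<alpha> b \<le> (\<Sum>b\<in>Basis. \<alpha> b)" using that by (intro member_le_sum) auto
        then show ?thesis using \<alpha> k by (simp add: multi_indices_def)
      qed
      have "(\<Prod>b\<in>Basis. (z \<bullet> b) ^ \<alpha> b)
          = (\<Prod>b\<in>Basis. \<Sum>i\<in>{..d}. real i ^ \<alpha> b * lagrange_basis d i (z \<bullet> b))"
        using le by (intro prod.cong refl power_eq_lagrange) auto
      also have "\<dots> = (\<Sum>\<kappa>\<in>I. \<Prod>b\<in>Basis. real (\<kappa> b) ^ \<alpha> b * lagrange_basis d (\<kappa> b) (z \<bullet> b))"
        unfolding I_def by (rule prod_sum_PiE) auto
      finally show ?thesis by (simp add: prod.distrib B_def pt)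
    qed
    have "p z = (\<Sum>\<alpha>\<in>multi_indices k. c \<alpha> * (\<Sum>\<kappa>\<in>I. (\<Prod>b\<in>Basis. (pt \<kappa> \<bullet> b) ^ \<alpha> b) * B \<kappa> z))"
      unfolding c[of z] by (intro sum.cong refl) (simp add: mono)
    also have "\<dots> = (\<Sum>\<kappa>\<in>I. p (pt \<kappa>) * B \<kappa> z)"
      unfolding c by (simp add: sum_distrib_left sum_distrib_right mult_ac) (rule sum.swap)
    finally show ?thesis .
  qed
  have le: "p z = (\<Sum>\<kappa>\<in>I. p (pt \<kappa>) * B \<kappa> z)" if p: "polynomial_of_degree_le d p" for p z
  proof -
    obtain q where q: "\<forall>k\<le>d. homogeneous_polynomial k (q k)" "\<forall>x. p x = (\<Sum>k\<le>d. q k x)"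
      using p unfolding polynomial_of_degree_le_def by blast
    have "p z = (\<Sum>k\<le>d. \<Sum>\<kappa>\<in>I. q k (pt \<kappa>) * B \<kappa> z)" using q by (simp add: hom)
    also have "\<dots> = (\<Sum>\<kappa>\<in>I. p (pt \<kappa>) * B \<kappa> z)"
      by (subst sum.swap) (simp add: q(2) sum_distrib_right)
    finally show ?thesis .
  qed
  have "polynomial_of_degree_le D (B \<kappa>)" if "\<kappa> \<in> I" for \<kappa>
  proof -
    have "polynomial_of_degree_le (\<Sum>b\<in>(Basis::'a set). d) (B \<kappa>)"
      unfolding B_def using that
      by (intro polynomial_degree_le_prod polynomial_degree_le_lagrange_basis) (auto simp: I_def)
    then show ?thesis by (simp add: D_def)
  qed
  then have "\<forall>\<kappa>\<in>I. \<exists>q. (\<forall>k\<le>D. homogeneous_polynomial k (q k)) \<and> (\<forall>z. B \<kappa> z = (\<Sum>k\<le>D. q k z))"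
    unfolding polynomial_of_degree_le_def by blast
  then obtain C where "\<forall>\<kappa>\<in>I. (\<forall>k\<le>D. homogeneous_polynomial k (C \<kappa> k)) \<and> (\<forall>z. B \<kappa> z = (\<Sum>k\<le>D. C \<kappa> k z))"
    unfolding bchoice_iff by blast
  then have C: "\<And>\<kappa> k. \<kappa> \<in> I \<Longrightarrow> k \<le> D \<Longrightarrow> homogeneous_polynomial k (C \<kappa> k)"
      "\<And>\<kappa> z. \<kappa> \<in> I \<Longrightarrow> B \<kappa> z = (\<Sum>k\<le>D. C \<kappa> k z)" by auto
  define L where "L \<kappa> z = (\<Sum>k\<le>d. C \<kappa> k z)" for \<kappa> z
  have L: "polynomial_of_degree_le d (L \<kappa>)" if "\<kappa> \<in> I" for \<kappa>
    unfolding L_def using that dD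
    by (intro polynomial_degree_le_sum homogeneous_imp_degree_le[OF C(1)]) auto
  have rep: "p z = (\<Sum>\<kappa>\<in>I. p (pt \<kappa>) * L \<kappa> z)" if p: "polynomial_of_degree_le d p" for p z
  proof -
    obtain a where a: "\<And>t. p (0 + t *\<^sub>R z) = (\<Sum>k\<le>d. a k * t ^ k)"
      using polynomial_degree_le_line[OF p, of 0 z] by blast
    define b where "b k = (\<Sum>\<kappa>\<in>I. p (pt \<kappa>) * C \<kappa> k z)" for k
    \<comment> \<open>Evaluating at \<open>t *\<^sub>R z\<close> separates the degrees. The
      left-hand side has degree at most \<open>d\<close> in \<open>t\<close>, so comparing
      coefficients leaves exactly the truncation \<open>L\<close> of the cardinal functions.\<close>
    have "(\<Sum>k\<le>D. (if k \<le> d then a k else 0) * t ^ k) = (\<Sum>k\<le>D. b k * t ^ k)" for t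
    proof -
      have "(\<Sum>k\<le>D. (if k \<le> d then a k else 0) * t ^ k) = (\<Sum>k\<in>{..D} \<inter> {k. k \<le> d}. a k * t ^ k)"
        by (subst sum.inter_restrict) (auto intro!: sum.cong)
      also have "{..D} \<inter> {k. k \<le> d} = {..d}" using dD by auto
      also have "(\<Sum>k\<le>d. a k * t ^ k) = p (t *\<^sub>R z)" using a[of t] by simp
      also have "\<dots> = (\<Sum>\<kappa>\<in>I. p (pt \<kappa>) * (\<Sum>k\<le>D. t ^ k * C \<kappa> k z))"
        unfolding le[OF p, of "t *\<^sub>R z"]
        by (intro sum.cong refl arg_cong2[of _ _ _ _ "(*)"])
          (simp add: C(2) homogeneous_polynomial_scaleR[OF C(1)])
      also have "\<dots> = (\<Sum>k\<le>D. b k * t ^ k)"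
        by (simp add: b_def sum_distrib_left sum_distrib_right mult_ac) (rule sum.swap)
      finally show ?thesis .
    qed
    then have eq: "\<forall>k\<le>D. (if k \<le> d then a k else 0) = b k"
      by (subst polyfun_eq_coeffs[symmetric]) auto
    have ab: "a k = b k" if "k \<le> d" for k using eq[rule_format, of k] that dD by simp
    have "p z = (\<Sum>k\<le>d. a k)" using a[of 1] by simp
    also have "\<dots> = (\<Sum>k\<le>d. b k)" using ab by simp
    also have "\<dots> = (\<Sum>\<kappa>\<in>I. p (pt \<kappa>) * L \<kappa> z)"
      unfolding b_def L_def by (subst sum.swap) (simp add: sum_distrib_left)
    finally show ?thesis .
  qed
  have inj: "inj_on pt I"
  proof (rule inj_onI)
    fix \<kappa> \<kappa>' assume "\<kappa> \<in> I" "\<kappa>' \<in> I" "pt \<kappa> = pt \<kappa>'"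
    then show "\<kappa> = \<kappa>'"
      unfolding I_def by (intro PiE_ext[of \<kappa>]) (auto, metis pt of_nat_eq_iff)
  qed
  show ?thesis
  proof (intro exI[of _ "pt ` I"] exI[of _ "\<lambda>g. L (inv_into I pt g)"] conjI ballI allI impI)
    show "finite (pt ` I)" using finI by simp
    show "polynomial_of_degree_le d (L (inv_into I pt g))" if "g \<in> pt ` I" for g
      using that L inj by auto
    show "p z = (\<Sum>g\<in>pt ` I. p g * L (inv_into I pt g) z)" if "polynomial_of_degree_le d p" for p z
      using rep[OF that, of z] inj by (simp add: sum.reindex)
  qed
qed

text \<open>On the line from a point of \<open>U\<close> to \<open>z\<close> the polynomial has
  infinitely many roots.\<close>

lemma homogeneous_polynomial_vanishes:
  fixes p :: "'a::euclidean_space \<Rightarrow> real"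
  assumes p: "homogeneous_polynomial d p" and U: "open U" "U \<noteq> {}" "\<And>z. z \<in> U \<Longrightarrow> p z = 0"
  shows "p = (\<lambda>_. 0)"
proof
  fix z
  obtain w where w: "w \<in> U" using U by blast
  obtain e where e: "e > 0" "ball w e \<subseteq> U" using U(1) w openE by blast
  have pd: "polynomial_of_degree_le d p" by (rule homogeneous_imp_degree_le[OF p]) simp
  obtain a where a: "\<And>t. p (w + t *\<^sub>R (z - w)) = (\<Sum>k\<le>d. a k * t ^ k)"
    using polynomial_degree_le_line[OF pd, of w "z - w"] by blast
  have "infinite {t. (\<Sum>k\<le>d. a k * t ^ k) = 0}"
  proof (rule infinite_super)
    define r where "r = e / (1 + norm (z - w))"
    have r: "r > 0" using e by (simp add: r_def add_pos_nonneg)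
    show "infinite {0<..<r}" using r by (rule infinite_Ioo)
    show "{0<..<r} \<subseteq> {t. (\<Sum>k\<le>d. a k * t ^ k) = 0}"
    proof
      fix t assume t: "t \<in> {0<..<r}"
      have "t * norm (z - w) \<le> t * (1 + norm (z - w))" using t by (simp add: algebra_simps)
      also have "\<dots> < e" using t by (simp add: r_def pos_less_divide_eq add_pos_nonneg)
      finally have "w + t *\<^sub>R (z - w) \<in> U" using e(2) t by (auto simp: dist_norm)
      then show "t \<in> {t. (\<Sum>k\<le>d. a k * t ^ k) = 0}" using a[of t] U(3) by simp
    qed
  qed
  then have "\<forall>k\<le>d. a k = 0" using polyfun_finite_roots[of a d] by blast
  then show "p z = 0" using a[of 1] by simp
qed


section \<open>Closed monotone relations and the Hessian measure\<close>

text \<open>A closed set is a countable union of compact sets, so its continuous image is an F-sigma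
  set. Projections of closed relations are therefore Borel, although projections of Borel sets need
  not be.\<close>

lemma borel_image_closed_sigma_compact:
  fixes C :: "'a::euclidean_space set" and f :: "'a \<Rightarrow> 'b::euclidean_space"
  assumes "closed C" "continuous_on UNIV f"
  shows "f ` C \<in> sets borel"
proof -
  have "C = (\<Union>n. C \<inter> cball 0 (real n))"
    by (auto simp: real_arch_simple)
  then have "f ` C = (\<Union>n. f ` (C \<inter> cball 0 (real n)))" by (metis image_UN)
  moreover have "f ` (C \<inter> cball 0 (real n)) \<in> sets borel" for n
    by (rule borel_closed[OF compact_imp_closed[OF compact_continuous_image[OF
            continuous_on_subset[OF assms(2) subset_UNIV] closed_Int_compact[OF assms(1) compact_cball]]]])
  ultimately show ?thesis by simp
qed

text \<open>Averaging over the translates of \<open>E\<close> by \<open>t *\<^sub>R e\<close>,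
  \<open>0 \<le> t \<le> 1\<close>, does not change the measure. After exchanging the integrals only
  the lines in direction \<open>e\<close> are seen; this is Fubini without splitting the space into
  coordinates.\<close>

lemma null_set_if_null_on_lines:
  fixes E :: "'a::euclidean_space set"
  assumes E[measurable]: "E \<in> sets borel"
    and lines: "\<And>y. emeasure lborel {t \<in> {0..1::real}. t *\<^sub>R e + y \<in> E} = 0"
  shows "E \<in> null_sets lborel"
proof -
  have meas: "(\<lambda>(t, y). indicator {0..1} t * indicator E (t *\<^sub>R e + y) :: ennreal)
      \<in> borel_measurable (lborel \<Otimes>\<^sub>M lborel)"
    by measurable
  have "(\<integral>\<^sup>+y. indicator E (t *\<^sub>R e + y) \<partial>lborel) = emeasure lborel E" for t
  proof -
    have "(\<integral>\<^sup>+y. indicator E y \<partial>lborel) = (\<integral>\<^sup>+y. indicator E y \<partial>distr lborel borel ((+) (t *\<^sub>R e)))"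
      by (simp add: lborel_distr_plus)
    also have "\<dots> = (\<integral>\<^sup>+y. indicator E (t *\<^sub>R e + y) \<partial>lborel)"
      by (subst nn_integral_distr) auto
    finally show ?thesis by simp
  qed
  then have "(\<integral>\<^sup>+t. (\<integral>\<^sup>+y. indicator {0..1} t * indicator E (t *\<^sub>R e + y) \<partial>lborel) \<partial>lborel)
      = (\<integral>\<^sup>+t. indicator {0..1::real} t * emeasure lborel E \<partial>lborel)"
    by (subst nn_integral_cmult) auto
  also have "\<dots> = emeasure lborel E"
    by (subst nn_integral_multc) auto
  finally have "emeasure lborel E
      = (\<integral>\<^sup>+t. (\<integral>\<^sup>+y. indicator {0..1::real} t * indicator E (t *\<^sub>R e + y) \<partial>lborel) \<partial>lborel)" ..
  also have "\<dots> = (\<integral>\<^sup>+y. (\<integral>\<^sup>+t. indicator {0..1::real} t * indicator E (t *\<^sub>R e + y) \<partial>lborel) \<partial>lborel)"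
    by (rule lborel_pair.Fubini'[symmetric]) (rule meas)
  also have "\<dots> = (\<integral>\<^sup>+y. 0 \<partial>(lborel :: 'a measure))"
  proof (rule nn_integral_cong)
    fix y :: 'a
    have "(\<integral>\<^sup>+t. indicator {0..1::real} t * indicator E (t *\<^sub>R e + y) \<partial>lborel)
        = (\<integral>\<^sup>+t. indicator {t \<in> {0..1::real}. t *\<^sub>R e + y \<in> E} t \<partial>lborel)"
      by (intro nn_integral_cong) (auto simp: indicator_def)
    also have "\<dots> = emeasure lborel {t \<in> {0..1::real}. t *\<^sub>R e + y \<in> E}"
      by (rule nn_integral_indicator) measurable
    finally show "(\<integral>\<^sup>+t. indicator {0..1::real} t * indicator E (t *\<^sub>R e + y) \<partial>lborel) = 0"
      using lines by simp
  qed
  finally show ?thesis by (simp add: null_sets_def)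
qed

definition monotone_rel :: "('a::real_inner \<times> 'a) set \<Rightarrow> bool" where
  "monotone_rel G \<longleftrightarrow> (\<forall>x y x' y'. (x, y) \<in> G \<longrightarrow> (x', y') \<in> G \<longrightarrow> 0 \<le> (x - x') \<bullet> (y - y'))"

text \<open>If \<open>y\<close> has two preimages, then in some coordinate \<open>k\<close> they are
  separated by rationals \<open>p < q\<close>, so \<open>y\<close> lies in one of countably many
  sets \<open>E (k, p, q)\<close>. By monotonicity the \<open>k\<close>-th coordinate of a preimage
  cannot decrease along a line in direction \<open>k\<close>, so each such line meets
  \<open>E (k, p, q)\<close> in at most one point.\<close>

lemma AE_monotone_relation_unique:
  fixes G :: "('a::euclidean_space \<times> 'a) set"
  assumes closed: "closed G"
    and mono: "monotone_rel G"
  shows "AE y in lebesgue. \<forall>x x'. (x, y) \<in> G \<longrightarrow> (x', y) \<in> G \<longrightarrow> x = x'"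
proof -
  define E where "E = (\<lambda>(k::'a, p::real, q).
    snd ` (G \<inter> {z. fst z \<bullet> k \<le> p}) \<inter> snd ` (G \<inter> {z. q \<le> fst z \<bullet> k}))"
  define I where "I = {(k::'a, p::real, q). k \<in> Basis \<and> p \<in> \<rat> \<and> q \<in> \<rat> \<and> p < q}"
  have "countable ((Basis::'a set) \<times> (\<rat> :: real set) \<times> (\<rat> :: real set))"
    by (intro countable_SIGMA countable_rat countable_finite finite_Basis)
  moreover have "I \<subseteq> Basis \<times> \<rat> \<times> \<rat>" by (auto simp: I_def)
  ultimately have "countable I" by (rule countable_subset[rotated])
  moreover have "E i \<in> null_sets lborel" if "i \<in> I" for i
  proof -
    obtain k p q where i: "i = (k, p, q)" by (metis prod_cases3)
    then have kpq: "k \<in> Basis" "p < q" using that by (auto simp: I_def)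
    have cl: "closed {z::'a \<times> 'a. fst z \<bullet> k \<le> p}" "closed {z::'a \<times> 'a. q \<le> fst z \<bullet> k}"
      by (intro closed_Collect_le continuous_intros)+
    have [measurable]: "E (k, p, q) \<in> sets borel"
      unfolding E_def split
      by (intro sets.Int borel_image_closed_sigma_compact closed_Int closed cl continuous_intros)
    have "E (k, p, q) \<in> null_sets lborel"
    proof (rule null_set_if_null_on_lines[where e = k])
      fix y
      have "t = t'" if tt: "t *\<^sub>R k + y \<in> E (k, p, q)" "t' *\<^sub>R k + y \<in> E (k, p, q)" for t t'
      proof -
        have *: "\<not> s < s'" if s: "s *\<^sub>R k + y \<in> E (k, p, q)" "s' *\<^sub>R k + y \<in> E (k, p, q)" for s s'
        proof
          assume ss: "s < s'"
          obtain x x' where x: "(x, s *\<^sub>R k + y) \<in> G" "q \<le> x \<bullet> k" "(x', s' *\<^sub>R k + y) \<in> G" "x' \<bullet> k \<le> p"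
            using s unfolding E_def by auto
          have "0 \<le> (x - x') \<bullet> ((s *\<^sub>R k + y) - (s' *\<^sub>R k + y))" using mono x(1,3) unfolding monotone_rel_def by blast
          also have "(s *\<^sub>R k + y) - (s' *\<^sub>R k + y) = (s - s') *\<^sub>R k" by (simp add: algebra_simps)
          finally have "0 \<le> (s - s') * (x \<bullet> k - x' \<bullet> k)" by (simp add: inner_diff_left)
          then show False using ss x(2,4) kpq(2) by (auto simp: zero_le_mult_iff)
        qed
        show ?thesis using *[OF tt] *[OF tt(2,1)] by simp
      qed
      then have "\<exists>t0. {t \<in> {0..1::real}. t *\<^sub>R k + y \<in> E (k, p, q)} \<subseteq> {t0}" by blast
      then have "countable {t \<in> {0..1::real}. t *\<^sub>R k + y \<in> E (k, p, q)}"
        by (meson countable_subset countable_finite finite.intros)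
      then show "emeasure lborel {t \<in> {0..1::real}. t *\<^sub>R k + y \<in> E (k, p, q)} = 0"
        by (rule emeasure_lborel_countable)
    qed measurable
    then show ?thesis by (simp add: i)
  qed
  ultimately have "(\<Union>i\<in>I. E i) \<in> null_sets lborel" by (rule null_sets_UN')
  then have "AE y in lborel. y \<notin> (\<Union>i\<in>I. E i)" by (rule AE_not_in)
  moreover have "x = x'" if y: "y \<notin> (\<Union>i\<in>I. E i)" and x: "(x, y) \<in> G" "(x', y) \<in> G" for x x' y
  proof -
    have le: "z' \<bullet> k \<le> z \<bullet> k" if z: "(z, y) \<in> G" "(z', y) \<in> G" and k: "k \<in> Basis" for z z' k
    proof (rule ccontr)
      assume "\<not> ?thesis"
      then have "z \<bullet> k < z' \<bullet> k" by simp
      then obtain p where p: "p \<in> \<rat>" "z \<bullet> k < p" "p < z' \<bullet> k" using Rats_dense_in_real by blast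
      then obtain q where q: "q \<in> \<rat>" "p < q" "q < z' \<bullet> k" using Rats_dense_in_real by blast
      have "y \<in> E (k, p, q)"
        unfolding E_def split using z p q by (intro IntI image_eqI[of y snd "(z, y)"] image_eqI[of y snd "(z', y)"]) auto
      moreover have "(k, p, q) \<in> I" using k p q by (simp add: I_def)
      ultimately show False using y by blast
    qed
    show ?thesis using le[OF x] le[OF x(2,1)] by (intro euclidean_eqI[of x x']) (auto intro: antisym)
  qed
  ultimately have "AE y in lborel. \<forall>x x'. (x, y) \<in> G \<longrightarrow> (x', y) \<in> G \<longrightarrow> x = x'"
    by (auto elim!: eventually_mono)
  then show ?thesis by (rule AE_completion)
qed

text \<open>An arbitrary choice; for a closed monotone relation it is forced at almost every
  \<open>y\<close> in the range.\<close>

definition rel_selection :: "('a \<times> 'b) set \<Rightarrow> 'b \<Rightarrow> 'a" where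
  "rel_selection G y = (SOME x. (x, y) \<in> G)"

lemma rel_selection: "y \<in> snd ` G \<Longrightarrow> (rel_selection G y, y) \<in> G"
  unfolding rel_selection_def by (rule someI_ex) force

text \<open>Off the null set where preimages are not unique, the selection takes values in a closed
  set \<open>C\<close> exactly on the projection of \<open>G \<inter> C\<close>, which is
  Borel.\<close>

lemma rel_selection_measurable:
  fixes G :: "('a::euclidean_space \<times> 'a) set"
  assumes closed: "closed G"
    and mono: "monotone_rel G"
  shows "(\<lambda>y. (rel_selection G y, y)) \<in> borel_measurable (restrict_space lebesgue (snd ` G))"
    and "\<And>B. B \<in> sets borel \<Longrightarrow>
      emeasure lebesgue {y \<in> snd ` G. (rel_selection G y, y) \<in> B} = emeasure lebesgue (snd ` (G \<inter> B))"
    and "snd ` G \<in> sets lebesgue"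
proof -
  have bor: "snd ` C \<in> sets lebesgue" if "closed C" for C :: "('a \<times> 'a) set"
    using borel_image_closed_sigma_compact[OF that, of snd] by (simp add: continuous_on_snd)
  then show G: "snd ` G \<in> sets lebesgue" using closed by blast
  have unique: "AE y in lebesgue. \<forall>x x'. (x, y) \<in> G \<longrightarrow> (x', y) \<in> G \<longrightarrow> x = x'"
    by (rule AE_monotone_relation_unique[OF closed mono])
  have AE: "AE y in lebesgue. (y \<in> snd ` (G \<inter> B)) = (y \<in> {y \<in> snd ` G. (rel_selection G y, y) \<in> B})" for B
    using unique
  proof eventually_elim
    case (elim y)
    show ?case
    proof
      assume "y \<in> snd ` (G \<inter> B)"
      then obtain x where x: "(x, y) \<in> G" "(x, y) \<in> B" by auto
      then have "y \<in> snd ` G" by force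
      moreover have "rel_selection G y = x" using elim x(1) rel_selection[OF \<open>y \<in> snd ` G\<close>] by blast
      ultimately show "y \<in> {y \<in> snd ` G. (rel_selection G y, y) \<in> B}" using x by simp
    next
      assume "y \<in> {y \<in> snd ` G. (rel_selection G y, y) \<in> B}"
      then show "y \<in> snd ` (G \<inter> B)" using rel_selection[of y G] by (intro image_eqI[of y snd "(rel_selection G y, y)"]) auto
    qed
  qed
  \<comment> \<open>Completeness of Lebesgue measure turns the almost everywhere equality into
    measurability.\<close>
  have swap: "A \<in> sets lebesgue" if "AE y in lebesgue. (y \<in> A) = (y \<in> B)" "B \<in> sets lebesgue" for A B :: "'a set"
    by (rule completion.in_sets_AE[of B]) (use that in \<open>auto elim: eventually_mono\<close>)
  have cl: "{y \<in> snd ` G. (rel_selection G y, y) \<in> C} \<in> sets lebesgue" if "closed C" for C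
    by (rule swap[OF _ bor[OF closed_Int[OF closed that]]]) (use AE[of C] in \<open>auto elim: eventually_mono\<close>)
  show meas: "(\<lambda>y. (rel_selection G y, y)) \<in> borel_measurable (restrict_space lebesgue (snd ` G))"
  proof (rule borel_measurableI)
    fix S :: "('a \<times> 'a) set" assume "open S"
    then have "{y \<in> snd ` G. (rel_selection G y, y) \<in> - S} \<in> sets lebesgue" by (intro cl) auto
    then have "snd ` G - {y \<in> snd ` G. (rel_selection G y, y) \<in> - S} \<in> sets lebesgue"
      using G by blast
    moreover have "snd ` G - {y \<in> snd ` G. (rel_selection G y, y) \<in> - S}
        = (\<lambda>y. (rel_selection G y, y)) -` S \<inter> snd ` G" by auto
    ultimately show "(\<lambda>y. (rel_selection G y, y)) -` S \<inter> space (restrict_space lebesgue (snd ` G))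
        \<in> sets (restrict_space lebesgue (snd ` G))"
      using G by (subst sets_restrict_space_iff) (auto simp: space_restrict_space)
  qed
  fix B :: "('a \<times> 'a) set" assume B: "B \<in> sets borel"
  have "{y \<in> snd ` G. (rel_selection G y, y) \<in> B} = (\<lambda>y. (rel_selection G y, y)) -` B \<inter> space (restrict_space lebesgue (snd ` G))"
    by (auto simp: space_restrict_space)
  also have "\<dots> \<in> sets (restrict_space lebesgue (snd ` G))" by (rule measurable_sets[OF meas B])
  finally have m: "{y \<in> snd ` G. (rel_selection G y, y) \<in> B} \<in> sets lebesgue"
    using G by (subst (asm) sets_restrict_space_iff) auto
  show "emeasure lebesgue {y \<in> snd ` G. (rel_selection G y, y) \<in> B} = emeasure lebesgue (snd ` (G \<inter> B))"
    by (rule emeasure_eq_AE[OF _ m swap[OF _ m]]) (use AE[of B] in \<open>auto elim: eventually_mono\<close>)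
qed

section \<open>The Hessian measure as an image of Lebesgue measure\<close>

definition subgradient_graph :: "('a::real_inner \<Rightarrow> ereal) \<Rightarrow> ('a \<times> 'a) set" where
  "subgradient_graph f = {(x, y). y \<in> subdifferential f x}"

lemma subdifferential_finite:
  assumes "f \<in> Conv" "y \<in> subdifferential f x"
  shows "f x \<noteq> \<infinity>" "f x \<noteq> -\<infinity>"
proof -
  obtain z where z: "f z \<noteq> \<infinity>" using assms(1) by (auto simp: Conv_def)
  have "f z \<ge> f x + ereal ((z - x) \<bullet> y)" using assms(2) by (simp add: subdifferential_def)
  then show "f x \<noteq> \<infinity>" using z by auto
  show "f x \<noteq> -\<infinity>" using assms(1) by (auto simp: Conv_def)
qed

lemma subgradient_graph_closed:
  fixes f :: "real^'n \<Rightarrow> ereal"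
  assumes f: "f \<in> Conv"
  shows "closed (subgradient_graph f)"
  unfolding closed_sequential_limits
proof (intro allI impI, elim conjE)
  fix X :: "nat \<Rightarrow> (real^'n) \<times> (real^'n)" and l
  assume X: "\<forall>n. X n \<in> subgradient_graph f" "X \<longlonglongrightarrow> l"
  define x y where "x = fst l" and "y = snd l"
  have lim: "(\<lambda>j. fst (X j)) \<longlonglongrightarrow> x" "(\<lambda>j. snd (X j)) \<longlonglongrightarrow> y"
    unfolding x_def y_def using X(2) by (auto intro: tendsto_fst tendsto_snd)
  have "f z \<ge> f x + ereal ((z - x) \<bullet> y)" for z
  proof (cases "f z")
    case (real r)
    have "f x \<le> ereal (r - (z - x) \<bullet> y)"
    proof (rule ccontr)
      assume "\<not> ?thesis"
      then have "ereal (r - (z - x) \<bullet> y) < f x" by simp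
      then obtain c where c: "ereal (r - (z - x) \<bullet> y) < ereal c" "ereal c < f x" using ereal_dense2 by blast
      have "\<forall>\<^sub>F j in sequentially. ereal c < f (fst (X j))"
        using f lim(1) c(2) by (intro lsc_sequentially) (auto simp: Conv_def)
      moreover have "(\<lambda>j. r - (z - fst (X j)) \<bullet> snd (X j)) \<longlonglongrightarrow> r - (z - x) \<bullet> y"
        by (intro tendsto_intros lim)
      then have "\<forall>\<^sub>F j in sequentially. r - (z - fst (X j)) \<bullet> snd (X j) < c"
        using c(1) by (intro order_tendstoD(2)) auto
      ultimately have "\<forall>\<^sub>F j in sequentially. False"
      proof eventually_elim
        case (elim j)
        have "f (fst (X j)) + ereal ((z - fst (X j)) \<bullet> snd (X j)) \<le> ereal r"
          using X(1)[rule_format, of j] unfolding real[symmetric]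
          by (simp add: subgradient_graph_def subdifferential_def case_prod_unfold)
        then show False using elim by (cases "f (fst (X j))") auto
      qed
      then show False by simp
    qed
    then show ?thesis using real by (cases "f x") auto
  next
    case MInf then show ?thesis using f by (auto simp: Conv_def)
  qed simp
  then show "l \<in> subgradient_graph f"
    by (simp add: subgradient_graph_def subdifferential_def x_def y_def case_prod_unfold)
qed

lemma subgradient_graph_mono:
  fixes f :: "real^'n \<Rightarrow> ereal"
  assumes f: "f \<in> Conv"
  shows "monotone_rel (subgradient_graph f)"
  unfolding monotone_rel_def
proof (intro allI impI)
  fix x y x' y' assume "(x, y) \<in> subgradient_graph f" "(x', y') \<in> subgradient_graph f"
  then have s: "y \<in> subdifferential f x" "y' \<in> subdifferential f x'"
    by (auto simp: subgradient_graph_def)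
  obtain r where r: "f x = ereal r" using subdifferential_finite[OF f s(1)] by (cases "f x") auto
  obtain r' where r': "f x' = ereal r'" using subdifferential_finite[OF f s(2)] by (cases "f x'") auto
  have "f x' \<ge> f x + ereal ((x' - x) \<bullet> y)" "f x \<ge> f x' + ereal ((x - x') \<bullet> y')"
    using s by (auto simp: subdifferential_def)
  then have "r' \<ge> r + (x' - x) \<bullet> y" "r \<ge> r' + (x - x') \<bullet> y'" by (simp_all add: r r')
  then show "0 \<le> (x - x') \<bullet> (y - y')" by (simp add: algebra_simps inner_diff_left inner_diff_right)
qed

text \<open>On Borel sets the defining set function agrees with the image measure of a measurable
  selection, so \<open>measure_of\<close> returns that image measure. This contains the countable
  additivity of the set function.\<close>

lemma hessian_measure0_eq_distr:
  fixes f :: "real^'n \<Rightarrow> ereal"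
  assumes f: "f \<in> Conv"
  defines "G \<equiv> subgradient_graph f"
  shows "hessian_measure0 f
    = distr (restrict_space lebesgue (snd ` G)) borel (\<lambda>y. (rel_selection G y, y))" (is "_ = ?M")
proof -
  note meas = rel_selection_measurable[OF subgradient_graph_closed[OF f] subgradient_graph_mono[OF f],
      folded G_def]
  have eq: "emeasure lebesgue {y. \<exists>x. (x, y) \<in> B \<and> y \<in> subdifferential f x} = emeasure ?M B"
    if B: "B \<in> sets borel" for B
  proof -
    have "emeasure ?M B = emeasure (restrict_space lebesgue (snd ` G)) ((\<lambda>y. (rel_selection G y, y)) -` B \<inter> snd ` G)"
      using emeasure_distr[OF meas(1) B] space_lebesgue_on[of "snd ` G"] by presburger
    also have "\<dots> = emeasure lebesgue ((\<lambda>y. (rel_selection G y, y)) -` B \<inter> snd ` G)"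
      using meas(3) by (intro emeasure_restrict_space) auto
    also have "(\<lambda>y. (rel_selection G y, y)) -` B \<inter> snd ` G = {y \<in> snd ` G. (rel_selection G y, y) \<in> B}" by auto
    also have "emeasure lebesgue \<dots> = emeasure lebesgue (snd ` (G \<inter> B))" by (rule meas(2)[OF B])
    also have "snd ` (G \<inter> B) = {y. \<exists>x. (x, y) \<in> B \<and> y \<in> subdifferential f x}"
      by (force simp: G_def subgradient_graph_def)
    finally show ?thesis ..
  qed
  have "hessian_measure0 f = measure_of UNIV (sets borel) (emeasure ?M)"
    unfolding hessian_measure0_def
    by (rule measure_of_eq) (use eq sets.sigma_sets_eq[of borel] in \<open>auto\<close>)
  also have "\<dots> = ?M" using measure_of_of_measure[of ?M] by simp
  finally show ?thesis .
qed

lemma hessian_measure0_integral: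
  fixes f :: "real^'n \<Rightarrow> ereal" and h :: "(real^'n) \<times> (real^'n) \<Rightarrow> real"
  assumes f: "f \<in> Conv" and h: "h \<in> borel_measurable borel"
  defines "G \<equiv> subgradient_graph f"
  shows "integral\<^sup>L (hessian_measure0 f) h
      = (LINT y|lebesgue. indicator (snd ` G) y * h (rel_selection G y, y))"
    and "integrable (hessian_measure0 f) h
      \<longleftrightarrow> integrable lebesgue (\<lambda>y. indicator (snd ` G) y * h (rel_selection G y, y))"
proof -
  note meas = rel_selection_measurable[OF subgradient_graph_closed[OF f] subgradient_graph_mono[OF f],
      folded G_def]
  show "integral\<^sup>L (hessian_measure0 f) h
      = (LINT y|lebesgue. indicator (snd ` G) y * h (rel_selection G y, y))"
    unfolding hessian_measure0_eq_distr[OF f, folded G_def]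
    using meas(3) by (simp add: integral_distr[OF meas(1) h] integral_restrict_space)
  show "integrable (hessian_measure0 f) h
      \<longleftrightarrow> integrable lebesgue (\<lambda>y. indicator (snd ` G) y * h (rel_selection G y, y))"
    unfolding hessian_measure0_eq_distr[OF f, folded G_def]
    using meas(3) by (simp add: integrable_distr_eq[OF meas(1) h] integrable_restrict_space)
qed


section \<open>Integrals over minimizers on a compact convex set\<close>

text \<open>The hypothesis yields continuity in \<open>x\<close> for each fixed \<open>z\<close>
  only. The reproducing formula writes \<open>\<phi> x z\<close> as a finite sum of values
  \<open>\<phi> x g\<close> at fixed points times polynomials in \<open>z\<close>.\<close>

lemma Sym_joint_continuous:
  fixes \<phi> :: "real^'n \<Rightarrow> (real^'n) \<times> real \<Rightarrow> real"
  assumes "range \<phi> \<subseteq> Sym d" "continuous_on UNIV \<phi>"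
  shows "continuous_on UNIV (\<lambda>(x, z). \<phi> x z)"
proof -
  obtain Gr and \<Lambda> :: "(real^'n) \<times> real \<Rightarrow> (real^'n) \<times> real \<Rightarrow> real" where
    ex: "finite Gr \<and> (\<forall>g\<in>Gr. polynomial_of_degree_le d (\<Lambda> g)) \<and>
      (\<forall>p z. polynomial_of_degree_le d p \<longrightarrow> p z = (\<Sum>g\<in>Gr. p g * \<Lambda> g z))"
    using polynomial_degree_le_reproducing[where d = d and 'a = "(real^'n) \<times> real"] by (elim exE) (rule that)
  note Gr = ex[THEN conjunct1] ex[THEN conjunct2, THEN conjunct1, rule_format]
    ex[THEN conjunct2, THEN conjunct2, rule_format]
  have deg: "polynomial_of_degree_le d (\<phi> x)" for x
    using assms(1) by (intro homogeneous_imp_degree_le[where k = d]) (auto simp: Sym_def)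
  then have eq: "(\<lambda>(x, z). \<phi> x z) = (\<lambda>w. \<Sum>g\<in>Gr. \<phi> (fst w) g * \<Lambda> g (snd w))"
    by (auto simp: fun_eq_iff intro!: Gr(3)[OF deg])
  have "continuous_on UNIV (\<lambda>x. \<phi> x g)" for g
    using assms(2) by (rule continuous_on_product_then_coordinatewise)
  then have 1: "continuous_on UNIV (\<lambda>w. \<phi> (fst w) g)" for g
    by (rule continuous_on_compose2) (auto intro: continuous_on_fst continuous_on_id)
  have 2: "continuous_on UNIV (\<lambda>w. \<Lambda> g (snd w))" if "g \<in> Gr" for g
    by (rule continuous_on_compose2[OF polynomial_degree_le_continuous[OF Gr(2)[OF that]]])
      (auto intro: continuous_on_snd continuous_on_id)
  show ?thesis unfolding eq by (intro continuous_on_sum continuous_on_mult 1 2)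
qed

text \<open>By the reproducing formula the integral is determined by its values at finitely many
  points \<open>g\<close>, with coefficient polynomials that do not depend on \<open>y\<close>. So
  no measurable choice of the coefficients of \<open>p y\<close> enters.\<close>

lemma polynomial_degree_le_integral:
  fixes p :: "'b \<Rightarrow> 'a::euclidean_space \<Rightarrow> real"
  assumes "\<And>y. polynomial_of_degree_le d (p y)" "\<And>z. integrable M (\<lambda>y. p y z)"
  shows "polynomial_of_degree_le d (\<lambda>z. integral\<^sup>L M (\<lambda>y. p y z))"
proof -
  obtain Gr and \<Lambda> :: "'a \<Rightarrow> 'a \<Rightarrow> real" where
    ex: "finite Gr \<and> (\<forall>g\<in>Gr. polynomial_of_degree_le d (\<Lambda> g)) \<and>
      (\<forall>p z. polynomial_of_degree_le d p \<longrightarrow> p z = (\<Sum>g\<in>Gr. p g * \<Lambda> g z))"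
    using polynomial_degree_le_reproducing[where d = d and 'a = 'a] by (elim exE) (rule that)
  note Gr = ex[THEN conjunct1] ex[THEN conjunct2, THEN conjunct1, rule_format]
    ex[THEN conjunct2, THEN conjunct2, rule_format]
  have eq: "(\<lambda>z. integral\<^sup>L M (\<lambda>y. p y z)) = (\<lambda>z. \<Sum>g\<in>Gr. integral\<^sup>L M (\<lambda>y. p y g) * \<Lambda> g z)"
  proof
    fix z
    have "integral\<^sup>L M (\<lambda>y. p y z) = integral\<^sup>L M (\<lambda>y. \<Sum>g\<in>Gr. p y g * \<Lambda> g z)"
      by (intro Bochner_Integration.integral_cong refl Gr(3) assms)
    also have "\<dots> = (\<Sum>g\<in>Gr. integral\<^sup>L M (\<lambda>y. p y g * \<Lambda> g z))"
      by (intro Bochner_Integration.integral_sum integrable_mult_left assms)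
    finally show "integral\<^sup>L M (\<lambda>y. p y z) = (\<Sum>g\<in>Gr. integral\<^sup>L M (\<lambda>y. p y g) * \<Lambda> g z)" by simp
  qed
  show ?thesis
    by (subst eq) (intro polynomial_degree_le_sum polynomial_degree_le_cmult Gr)
qed

text \<open>The graph of the subdifferential of \<open>F\<close> extended by infinity off
  \<open>B\<close>, stated for arbitrary real \<open>F\<close>.\<close>

definition argmin_graph :: "'a::real_inner set \<Rightarrow> ('a \<Rightarrow> real) \<Rightarrow> ('a \<times> 'a) set" where
  "argmin_graph B F = {(x, y). x \<in> B \<and> (\<forall>z\<in>B. F x - x \<bullet> y \<le> F z - z \<bullet> y)}"

definition argmin_on :: "'a::real_inner set \<Rightarrow> ('a \<Rightarrow> real) \<Rightarrow> 'a \<Rightarrow> 'a" where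
  "argmin_on B F = rel_selection (argmin_graph B F)"

lemma argmin_graph_mono: "monotone_rel (argmin_graph B F)"
  unfolding monotone_rel_def
proof (intro allI impI)
  fix x y x' y' assume "(x, y) \<in> argmin_graph B F" "(x', y') \<in> argmin_graph B F"
  then have "F x - x \<bullet> y \<le> F x' - x' \<bullet> y" "F x' - x' \<bullet> y' \<le> F x - x \<bullet> y'"
    by (auto simp: argmin_graph_def)
  then show "0 \<le> (x - x') \<bullet> (y - y')" by (simp add: inner_diff_left inner_diff_right)
qed

lemma argmin_graph_closed:
  fixes B :: "'a::euclidean_space set"
  assumes "compact B" "continuous_on B F"
  shows "closed (argmin_graph B F)"
  unfolding closed_sequential_limits
proof (intro allI impI, elim conjE)
  fix X and l :: "'a \<times> 'a"
  assume X: "\<forall>n. X n \<in> argmin_graph B F" "X \<longlonglongrightarrow> l"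
  define x y where "x = fst l" and "y = snd l"
  have lim: "(\<lambda>j. fst (X j)) \<longlonglongrightarrow> x" "(\<lambda>j. snd (X j)) \<longlonglongrightarrow> y"
    unfolding x_def y_def using X(2) by (auto intro: tendsto_fst tendsto_snd)
  have B: "fst (X j) \<in> B" and le: "\<And>z. z \<in> B \<Longrightarrow> F (fst (X j)) - fst (X j) \<bullet> snd (X j) \<le> F z - z \<bullet> snd (X j)" for j
    using X(1)[rule_format, of j] by (auto simp: argmin_graph_def case_prod_unfold)
  have xB: "x \<in> B" by (rule closed_sequentially[OF compact_imp_closed[OF assms(1)] B lim(1)])
  have F: "(\<lambda>j. F (fst (X j))) \<longlonglongrightarrow> F x"
    using continuous_on_tendsto_compose[OF assms(2) lim(1) xB] B by simp
  have "F x - x \<bullet> y \<le> F z - z \<bullet> y" if "z \<in> B" for z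
  proof (rule LIMSEQ_le)
    show "(\<lambda>j. F (fst (X j)) - fst (X j) \<bullet> snd (X j)) \<longlonglongrightarrow> F x - x \<bullet> y"
      by (intro tendsto_diff tendsto_inner lim F)
    show "(\<lambda>j. F z - z \<bullet> snd (X j)) \<longlonglongrightarrow> F z - z \<bullet> y"
      by (intro tendsto_diff tendsto_inner lim tendsto_const)
  qed (use le[OF that] in auto)
  then show "l \<in> argmin_graph B F" using xB by (simp add: argmin_graph_def x_def y_def case_prod_unfold)
qed

lemma argmin_graph_surj:
  fixes B :: "'a::euclidean_space set"
  assumes "compact B" "B \<noteq> {}" "continuous_on B F"
  shows "snd ` argmin_graph B F = UNIV"
proof -
  have "\<exists>x\<in>B. \<forall>z\<in>B. F x - x \<bullet> y \<le> F z - z \<bullet> y" for y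
    using assms by (intro continuous_attains_inf continuous_intros)
  then have "\<exists>x. (x, y) \<in> argmin_graph B F" for y by (auto simp: argmin_graph_def)
  then show ?thesis by force
qed

text \<open>A local minimum of the convex function \<open>f - \<langle>\<cdot>, y\<rangle>\<close>
  is a global one.\<close>

lemma argmin_graph_interior_subgradient:
  fixes f :: "real^'n \<Rightarrow> ereal"
  assumes f: "f \<in> Conv" and B: "B \<subseteq> effective_domain f"
    and x: "x \<in> interior B" "(x, y) \<in> argmin_graph B (\<lambda>x. real_of_ereal (f x))"
  shows "(x, y) \<in> subgradient_graph f"
proof -
  have real: "f z = ereal (real_of_ereal (f z))" if "f z < \<infinity>" for z
    using that f by (cases "f z") (auto simp: Conv_def)
  have xB: "x \<in> B" using x(1) interior_subset by blast
  then have fx: "f x = ereal (real_of_ereal (f x))" using B by (intro real) (auto simp: effective_domain_def)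
  obtain e where e: "e > 0" "ball x e \<subseteq> B" using x(1) mem_interior by blast
  have "f z \<ge> f x + ereal ((z - x) \<bullet> y)" for z
  proof (cases "f z < \<infinity>")
    case True
    note fz = real[OF True]
    \<comment> \<open>Small enough for the point with parameter \<open>t\<close> on the segment from
      \<open>x\<close> to \<open>z\<close> to stay in the ball of radius \<open>e\<close>; the
      summand 1 covers \<open>z = x\<close>.\<close>
    define t where "t = min (1/2) (e / (2 * (1 + norm (z - x))))"
    have t: "0 < t" "t < 1" using e by (auto simp: t_def add_pos_nonneg)
    have "t * norm (z - x) \<le> e / (2 * (1 + norm (z - x))) * norm (z - x)"
      by (intro mult_right_mono) (auto simp: t_def)
    also have "\<dots> < e" using e by (simp add: divide_simps add_pos_nonneg) (smt (verit) mult_nonneg_nonneg norm_ge_zero)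
    finally have "dist x ((1 - t) *\<^sub>R x + t *\<^sub>R z) < e"
      using t by (simp add: dist_norm algebra_simps flip: scaleR_diff_right)
        (metis norm_minus_commute)
    then have w: "(1 - t) *\<^sub>R x + t *\<^sub>R z \<in> B" (is "?w \<in> B") using e(2) by auto
    then have fw: "f ?w = ereal (real_of_ereal (f ?w))" using B by (intro real) (auto simp: effective_domain_def)
    have "f ?w \<le> ereal (1 - t) * f x + ereal t * f z"
      using f t by (auto simp: Conv_def ereal_convex_def)
    then have "ereal (real_of_ereal (f ?w)) \<le> ereal (1 - t) * ereal (real_of_ereal (f x)) + ereal t * ereal (real_of_ereal (f z))"
      using fx fz fw by simp
    then have "real_of_ereal (f ?w) \<le> (1 - t) * real_of_ereal (f x) + t * real_of_ereal (f z)" by simp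
    moreover have "real_of_ereal (f x) - x \<bullet> y \<le> real_of_ereal (f ?w) - ?w \<bullet> y"
      using x(2) w by (auto simp: argmin_graph_def)
    ultimately have "t * (real_of_ereal (f x) + (z - x) \<bullet> y) \<le> t * real_of_ereal (f z)"
      by (simp add: algebra_simps inner_add_left inner_diff_left)
    then have "real_of_ereal (f x) + (z - x) \<bullet> y \<le> real_of_ereal (f z)" using t by simp
    then have "ereal (real_of_ereal (f x)) + ereal ((z - x) \<bullet> y) \<le> ereal (real_of_ereal (f z))" by simp
    then show ?thesis using fx fz by simp
  qed simp
  then show ?thesis by (simp add: subgradient_graph_def subdifferential_def)
qed

lemma subgradient_imp_argmin:
  fixes f :: "real^'n \<Rightarrow> ereal"
  assumes f: "f \<in> Conv" and B: "B \<subseteq> effective_domain f"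
    and x: "x \<in> B" "(x, y) \<in> subgradient_graph f"
  shows "(x, y) \<in> argmin_graph B (\<lambda>x. real_of_ereal (f x))"
proof -
  have real: "f z = ereal (real_of_ereal (f z))" if "z \<in> B" for z
    using that f B by (cases "f z") (auto simp: Conv_def effective_domain_def)
  have "real_of_ereal (f x) - x \<bullet> y \<le> real_of_ereal (f z) - z \<bullet> y" if "z \<in> B" for z
  proof -
    have "f z \<ge> f x + ereal ((z - x) \<bullet> y)"
      using x(2) by (auto simp: subgradient_graph_def subdifferential_def)
    then have "ereal (real_of_ereal (f z)) \<ge> ereal (real_of_ereal (f x)) + ereal ((z - x) \<bullet> y)"
      using real[OF that] real[OF x(1)] by simp
    then show ?thesis by (simp add: algebra_simps inner_diff_left)
  qed
  then show ?thesis using x(1) by (simp add: argmin_graph_def)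
qed

lemma Conv_borel_measurable:
  fixes f :: "real^'n \<Rightarrow> ereal"
  assumes "f \<in> Conv"
  shows "f \<in> borel_measurable borel"
  unfolding borel_measurable_ereal_iff_Ioi
proof
  fix a :: ereal
  have "closed (- {x. a < f x})"
    unfolding closed_sequential_limits
  proof (intro allI impI, elim conjE)
    fix X l assume X: "\<forall>j. X j \<in> - {x. a < f x}" "X \<longlonglongrightarrow> l"
    show "l \<in> - {x. a < f x}"
    proof
      assume "l \<in> {x. a < f x}"
      then have "\<forall>\<^sub>F j in sequentially. a < f (X j)"
        using assms X(2) by (intro lsc_sequentially[of f _ l]) (auto simp: Conv_def)
      then show False using X(1) by (auto simp: eventually_sequentially)
    qed
  qed
  then have "open {x. a < f x}" by (simp add: open_closed)
  then show "f -` {a<..} \<inter> space borel \<in> sets borel" by (simp add: vimage_def)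
qed

text \<open>The body \<open>B\<close> surrounds the support of \<open>\<phi>\<close>. Minimizing
  over \<open>B\<close> gives every \<open>y\<close> a minimizer and needs only the values of the
  function on \<open>B\<close>, whereas the subdifferential depends on all values of a possibly
  infinite function.\<close>

locale tensor_density =
  fixes d :: nat and \<phi> :: "real^'n \<Rightarrow> (real^'n) \<times> real \<Rightarrow> real" and B :: "(real^'n) set"
  assumes Cc: "\<phi> \<in> Cc_Sym d" and B: "compact B" "convex B" "interior B \<noteq> {}"
    and supp: "tensor_support \<phi> \<subseteq> interior B"
begin

lemma B_ne: "B \<noteq> {}" using B(3) interior_subset by blast

lemma hom: "homogeneous_polynomial d (\<phi> x)"
  using Cc by (auto simp: Cc_Sym_def Sym_def)

lemma cont: "continuous_on UNIV (\<lambda>(x, z). \<phi> x z)"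
  using Cc by (intro Sym_joint_continuous[of _ d]) (auto simp: Cc_Sym_def)

lemma tendsto_phi:
  assumes "(X \<longlongrightarrow> x) F" "(W \<longlongrightarrow> w) F"
  shows "((\<lambda>j. \<phi> (X j) (W j)) \<longlongrightarrow> \<phi> x w) F"
  using continuous_on_tendsto_compose[OF cont tendsto_Pair[OF assms]] by simp

lemma phi_zero: "x \<notin> tensor_support \<phi> \<Longrightarrow> \<phi> x w = 0"
proof -
  assume "x \<notin> tensor_support \<phi>"
  then have "x \<notin> {x. \<phi> x \<noteq> (\<lambda>_. 0)}" unfolding tensor_support_def
    using closure_subset[of "{x. \<phi> x \<noteq> (\<lambda>_. 0)}"] by blast
  then show "\<phi> x w = 0" by simp
qed

lemma compact_supp: "compact (tensor_support \<phi>)" using Cc by (simp add: Cc_Sym_def)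

text \<open>The integrand of the Hessian integral, read in the gradient variable \<open>y\<close>.
  It vanishes unless the minimizer lies in the support of \<open>\<phi>\<close>, hence in the
  interior of \<open>B\<close>.\<close>

definition argmin_density :: "(real^'n \<Rightarrow> real) \<Rightarrow> real^'n \<Rightarrow> real" where
  "argmin_density F y = \<phi> (argmin_on B F y) (y, F (argmin_on B F y))"

definition argmin_integral :: "(real^'n \<Rightarrow> real) \<Rightarrow> real" where
  "argmin_integral F = (LINT y|lebesgue. argmin_density F y)"

lemma argmin_on: "continuous_on B F \<Longrightarrow> (argmin_on B F y, y) \<in> argmin_graph B F"
  unfolding argmin_on_def by (rule rel_selection) (simp add: argmin_graph_surj[OF B(1) B_ne])

lemma argmin_on_in: "continuous_on B F \<Longrightarrow> argmin_on B F y \<in> B"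
  using argmin_on by (auto simp: argmin_graph_def)

lemma argmin_on_le: "continuous_on B F \<Longrightarrow> z \<in> B \<Longrightarrow>
    F (argmin_on B F y) - argmin_on B F y \<bullet> y \<le> F z - z \<bullet> y"
  using argmin_on[of F y] by (auto simp: argmin_graph_def)

lemma AE_argmin_unique:
  assumes "continuous_on B F"
  shows "AE y in lebesgue. \<forall>x. (x, y) \<in> argmin_graph B F \<longrightarrow> x = argmin_on B F y"
  using AE_monotone_relation_unique[OF argmin_graph_closed[OF B(1) assms] argmin_graph_mono]
  by eventually_elim (use argmin_on[OF assms] in blast)

lemma argmin_density_measurable:
  assumes F: "continuous_on B F"
  shows "argmin_density F \<in> borel_measurable lebesgue"
proof -
  have m: "(\<lambda>y. (argmin_on B F y, y)) \<in> borel_measurable lebesgue"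
    using rel_selection_measurable(1)[OF argmin_graph_closed[OF B(1) F] argmin_graph_mono]
      argmin_graph_surj[OF B(1) B_ne F] by (simp add: argmin_on_def lebesgue_on_UNIV_eq)
  \<comment> \<open>\<open>F\<close> is arbitrary off \<open>B\<close>. A continuous extension makes
    the density the composition of the measurable selection with a continuous function.\<close>
  have ext: "\<exists>F'. continuous_on UNIV F' \<and> (\<forall>x\<in>B. F' x = F x)"
    using Tietze_unbounded[of B F UNIV] F compact_imp_closed[OF B(1)] by (metis closed_closedin subtopology_UNIV)
  then obtain F' where F': "continuous_on UNIV F'" "\<forall>x\<in>B. F' x = F x" by blast
  have "continuous_on UNIV (\<lambda>p. (fst p, snd p, F' (fst p)))"
    by (intro continuous_intros continuous_on_compose2[OF F'(1)]) auto
  then have "continuous_on UNIV (\<lambda>p. \<phi> (fst p) (snd p, F' (fst p)))"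
    using continuous_on_compose2[OF cont, of UNIV "\<lambda>p. (fst p, snd p, F' (fst p))"] by simp
  then have "(\<lambda>p. \<phi> (fst p) (snd p, F' (fst p))) \<in> borel_measurable borel"
    by (rule borel_measurable_continuous_onI)
  from measurable_compose[OF m this]
  have "(\<lambda>y. \<phi> (argmin_on B F y) (y, F' (argmin_on B F y))) \<in> borel_measurable lebesgue" by simp
  moreover have "argmin_density F = (\<lambda>y. \<phi> (argmin_on B F y) (y, F' (argmin_on B F y)))"
    using F'(2) argmin_on_in[OF F] by (auto simp: argmin_density_def)
  ultimately show ?thesis by simp
qed

text \<open>
  A minimizer in the support of \<open>\<phi>\<close> can be moved in the direction of \<open>y\<close> inside \<open>B\<close>, which
  bounds \<open>y\<close> by the oscillation of the functions; a finite net is enough for the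
  values at the displaced points.
\<close>

lemma argmin_bound:
  fixes Fs :: "nat \<Rightarrow> real^'n \<Rightarrow> real"
  assumes low: "\<And>x c. x \<in> B \<Longrightarrow> c < F x \<Longrightarrow> \<exists>e>0. \<forall>\<^sub>F j in sequentially. \<forall>z\<in>B. dist z x < e \<longrightarrow> c < Fs j z"
    and rec: "\<And>x. x \<in> interior B \<Longrightarrow> \<exists>X. X \<longlonglongrightarrow> x \<and> (\<lambda>j. Fs j (X j)) \<longlonglongrightarrow> F x"
  obtains R where "\<forall>\<^sub>F j in sequentially. \<forall>x y. (x, y) \<in> argmin_graph B (Fs j) \<longrightarrow> x \<in> tensor_support \<phi>
    \<longrightarrow> norm y \<le> R \<and> \<bar>Fs j x\<bar> \<le> R"
proof -
  have "\<exists>m. \<forall>\<^sub>F j in sequentially. \<forall>z\<in>B. m < Fs j z"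
  proof -
    have "\<forall>x\<in>B. \<exists>e>0. \<forall>\<^sub>F j in sequentially. \<forall>z\<in>B. dist z x < e \<longrightarrow> F x - 1 < Fs j z"
      using low by simp
    then obtain e where e: "\<And>x. x \<in> B \<Longrightarrow> e x > 0"
      "\<And>x. x \<in> B \<Longrightarrow> \<forall>\<^sub>F j in sequentially. \<forall>z\<in>B. dist z x < e x \<longrightarrow> F x - 1 < Fs j z"
      unfolding bchoice_iff by blast
    have "B \<subseteq> (\<Union>x\<in>B. ball x (e x))" using e(1) by force
    then obtain T where T: "T \<subseteq> B" "finite T" "B \<subseteq> (\<Union>x\<in>T. ball x (e x))"
      using compactE_image[OF B(1), of B "\<lambda>x. ball x (e x)"] by auto
    define m where "m = Min ((\<lambda>x. F x - 1) ` T)"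
    have "\<forall>\<^sub>F j in sequentially. \<forall>x\<in>T. \<forall>z\<in>B. dist z x < e x \<longrightarrow> F x - 1 < Fs j z"
      using T e(2) by (intro eventually_ball_finite) auto
    then have "\<forall>\<^sub>F j in sequentially. \<forall>z\<in>B. m < Fs j z"
    proof eventually_elim
      case (elim j)
      show ?case
      proof
        fix z assume z: "z \<in> B"
        then obtain x where x: "x \<in> T" "z \<in> ball x (e x)" using T(3) by blast
        have "m \<le> F x - 1" unfolding m_def using x(1) T(2) by (intro Min_le) auto
        also have "\<dots> < Fs j z" using elim x z by (auto simp: dist_commute)
        finally show "m < Fs j z" .
      qed
    qed
    then show ?thesis by blast
  qed
  then obtain m where m: "\<forall>\<^sub>F j in sequentially. \<forall>z\<in>B. m < Fs j z" by blast
  obtain \<delta> where \<delta>: "\<delta> > 0" "{x + y | x y. x \<in> tensor_support \<phi> \<and> y \<in> cball 0 \<delta>} \<subseteq> interior B"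
  proof -
    have "tensor_support \<phi> \<inter> - interior B = {}" using supp by blast
    from separate_compact_closed[OF compact_supp closed_Compl[OF open_interior] this]
    obtain \<delta> where \<delta>: "\<delta> > 0" "\<forall>x\<in>tensor_support \<phi>. \<forall>y\<in>- interior B. \<delta> \<le> dist x y" by blast
    have "{x + y | x y. x \<in> tensor_support \<phi> \<and> y \<in> cball 0 (\<delta>/2)} \<subseteq> interior B"
    proof clarify
      fix x y assume "x \<in> tensor_support \<phi>" "y \<in> cball (0::real^'n) (\<delta>/2)"
      then show "x + y \<in> interior B" using \<delta>(2)[rule_format, of x "x + y"] \<delta>(1) by (force simp: dist_norm)
    qed
    then show ?thesis using that[of "\<delta>/2"] \<delta>(1) by simp
  qed
  \<comment> \<open>The points reached from the support by a displacement of length at most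
    \<open>\<delta>\<close>. A net of mesh \<open>\<delta>/4\<close> and recovery points within
    \<open>\<delta>/4\<close> of it lose at most half of the gain \<open>\<delta> * norm y\<close>
    of a displacement in direction \<open>y\<close>.\<close>
  define K where "K = {x + y | x y. x \<in> tensor_support \<phi> \<and> y \<in> cball 0 \<delta>}"
  have "compact K" unfolding K_def by (intro compact_sums compact_supp compact_cball)
  moreover have "K \<subseteq> (\<Union>p\<in>K. ball p (\<delta>/4))" using \<delta>(1) by force
  ultimately obtain T where T: "T \<subseteq> K" "finite T" "K \<subseteq> (\<Union>p\<in>T. ball p (\<delta>/4))"
    using compactE_image[of K K "\<lambda>p. ball p (\<delta>/4)"] by auto
  have KB: "K \<subseteq> interior B" using \<delta>(2) by (simp add: K_def)
  have "\<forall>p\<in>T. \<exists>X. X \<longlonglongrightarrow> p \<and> (\<lambda>j. Fs j (X j)) \<longlonglongrightarrow> F p" using rec T(1) KB by blast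
  then obtain X where X: "\<And>p. p \<in> T \<Longrightarrow> X p \<longlonglongrightarrow> p" "\<And>p. p \<in> T \<Longrightarrow> (\<lambda>j. Fs j (X p j)) \<longlonglongrightarrow> F p"
    unfolding bchoice_iff by blast
  \<comment> \<open>Inserting \<open>m\<close> gives the maximum a meaning when the support, and
    with it \<open>T\<close>, is empty.\<close>
  define M where "M = Max (insert m ((\<lambda>p. F p + 1) ` T))"
  have "\<forall>\<^sub>F j in sequentially. X p j \<in> B \<and> dist (X p j) p < \<delta>/4 \<and> Fs j (X p j) < F p + 1" if p: "p \<in> T" for p
  proof (intro eventually_conj)
    have "p \<in> interior B" using p T(1) KB by blast
    then have "\<forall>\<^sub>F j in sequentially. X p j \<in> interior B" using X(1)[OF p] topological_tendstoD open_interior by blast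
    then show "\<forall>\<^sub>F j in sequentially. X p j \<in> B" by eventually_elim (use interior_subset in blast)
    show "\<forall>\<^sub>F j in sequentially. dist (X p j) p < \<delta>/4" using X(1)[OF p] \<delta>(1) by (intro tendstoD) auto
    show "\<forall>\<^sub>F j in sequentially. Fs j (X p j) < F p + 1" using X(2)[OF p] by (intro order_tendstoD(2)) auto
  qed
  then have "\<forall>\<^sub>F j in sequentially. \<forall>p\<in>T. X p j \<in> B \<and> dist (X p j) p < \<delta>/4 \<and> Fs j (X p j) < F p + 1"
    using T(2) by (intro eventually_ball_finite) auto
  with m have "\<forall>\<^sub>F j in sequentially. \<forall>x y. (x, y) \<in> argmin_graph B (Fs j) \<longrightarrow> x \<in> tensor_support \<phi>
    \<longrightarrow> norm y \<le> max (2 * (M - m) / \<delta>) (\<bar>M\<bar> + \<bar>m\<bar>) \<and> \<bar>Fs j x\<bar> \<le> max (2 * (M - m) / \<delta>) (\<bar>M\<bar> + \<bar>m\<bar>)"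
  proof eventually_elim
    case (elim j)
    show ?case
    proof (intro allI impI)
      fix x y assume xy: "(x, y) \<in> argmin_graph B (Fs j)" and x: "x \<in> tensor_support \<phi>"
      \<comment> \<open>For \<open>y = 0\<close> this is the zero vector, and both facts about
        \<open>u\<close> below remain true.\<close>
      define u where "u = (\<delta> / norm y) *\<^sub>R y"
      have nu: "norm u \<le> \<delta>" using \<delta>(1) by (auto simp: u_def)
      have uy: "u \<bullet> y = \<delta> * norm y"
        by (cases "y = 0") (auto simp: u_def dot_square_norm power2_eq_square)
      have "x + u \<in> K" using x nu by (auto simp: K_def)
      then obtain p where p: "p \<in> T" "dist p (x + u) < \<delta>/4" using T(3) by (auto simp: dist_commute)
      define z where "z = X p j"
      have z: "z \<in> B" "dist z p < \<delta>/4" "Fs j z < F p + 1" using elim(2) p(1) by (auto simp: z_def)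
      have "F p + 1 \<le> M" unfolding M_def using T(2) p(1) by (intro Max_ge) auto
      then have zM: "Fs j z \<le> M" using z(3) by simp
      have "dist z (x + u) \<le> dist z p + dist p (x + u)" by (rule dist_triangle)
      then have "norm (z - (x + u)) \<le> \<delta>/2" using z(2) p(2) by (simp add: dist_norm)
      then have "\<bar>(z - (x + u)) \<bullet> y\<bar> \<le> \<delta>/2 * norm y"
        by (meson Cauchy_Schwarz_ineq2 mult_right_mono norm_ge_zero order_trans)
      then have "- ((z - (x + u)) \<bullet> y) \<le> \<delta>/2 * norm y" by linarith
      moreover have "(z - (x + u)) \<bullet> y = (z - x) \<bullet> y - \<delta> * norm y"
        by (simp add: inner_diff_left inner_add_left uy)
      ultimately have zx: "(z - x) \<bullet> y \<ge> \<delta>/2 * norm y" by simp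
      have min: "Fs j x - x \<bullet> y \<le> Fs j z - z \<bullet> y" using xy z(1) by (auto simp: argmin_graph_def)
      have xB: "m < Fs j x" using xy elim(1) by (auto simp: argmin_graph_def)
      have "\<delta>/2 * norm y \<le> M - m" using min zx xB zM by (simp add: inner_diff_left)
      then have "norm y \<le> 2 * (M - m) / \<delta>" using \<delta>(1) by (simp add: field_simps)
      moreover have "0 \<le> \<delta>/2 * norm y" using \<delta>(1) by simp
      then have "Fs j x \<le> M" using min zx zM by (simp add: inner_diff_left)
      then have "\<bar>Fs j x\<bar> \<le> \<bar>M\<bar> + \<bar>m\<bar>" using xB by linarith
      ultimately show "norm y \<le> max (2 * (M - m) / \<delta>) (\<bar>M\<bar> + \<bar>m\<bar>) \<and> \<bar>Fs j x\<bar> \<le> max (2 * (M - m) / \<delta>) (\<bar>M\<bar> + \<bar>m\<bar>)"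
        by auto
    qed
  qed
  then show ?thesis by (rule that)
qed

text \<open>The assumptions are the two halves of epi-convergence, localized to \<open>B\<close>.
  The bound on the relevant \<open>y\<close> and function values confines \<open>\<phi>\<close> to a
  compact set of arguments, which yields one integrable majorant for all large
  \<open>j\<close>.\<close>

lemma argmin_density_bound:
  fixes Fs :: "nat \<Rightarrow> real^'n \<Rightarrow> real"
  assumes "\<And>x c. x \<in> B \<Longrightarrow> c < F x \<Longrightarrow> \<exists>e>0. \<forall>\<^sub>F j in sequentially. \<forall>z\<in>B. dist z x < e \<longrightarrow> c < Fs j z"
    and "\<And>x. x \<in> interior B \<Longrightarrow> \<exists>X. X \<longlonglongrightarrow> x \<and> (\<lambda>j. Fs j (X j)) \<longlonglongrightarrow> F x"
    and F: "\<And>j. continuous_on B (Fs j)"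
  obtains R C where "\<forall>\<^sub>F j in sequentially. \<forall>y. \<bar>argmin_density (Fs j) y\<bar> \<le> C * indicator (cball 0 R) y"
proof -
  obtain R where R: "\<forall>\<^sub>F j in sequentially. \<forall>x y. (x, y) \<in> argmin_graph B (Fs j) \<longrightarrow> x \<in> tensor_support \<phi>
    \<longrightarrow> norm y \<le> R \<and> \<bar>Fs j x\<bar> \<le> R"
    using argmin_bound[of F Fs] assms by blast
  have "compact ((\<lambda>(x, z). \<phi> x z) ` (tensor_support \<phi> \<times> (cball 0 R \<times> cball 0 R)))"
    by (intro compact_continuous_image continuous_on_subset[OF cont] compact_Times compact_supp compact_cball) auto
  then obtain C where C0: "\<forall>w\<in>(\<lambda>(x, z). \<phi> x z) ` (tensor_support \<phi> \<times> (cball 0 R \<times> cball 0 R)). norm w \<le> C"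
    using compact_imp_bounded bounded_iff by metis
  have C: "\<bar>\<phi> x (y, s)\<bar> \<le> C" if "x \<in> tensor_support \<phi>" "norm y \<le> R" "\<bar>s\<bar> \<le> R" for x y s
    using C0[rule_format, OF image_eqI[of _ _ "(x, (y, s))"]] that by simp
  from R have "\<forall>\<^sub>F j in sequentially. \<forall>y. \<bar>argmin_density (Fs j) y\<bar> \<le> \<bar>C\<bar> * indicator (cball 0 R) y"
  proof eventually_elim
    case (elim j)
    show ?case
    proof
      fix y
      define x where "x = argmin_on B (Fs j) y"
      have xy: "(x, y) \<in> argmin_graph B (Fs j)" unfolding x_def by (rule argmin_on[OF F])
      show "\<bar>argmin_density (Fs j) y\<bar> \<le> \<bar>C\<bar> * indicator (cball 0 R) y"
      proof (cases "x \<in> tensor_support \<phi>")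
        case True
        then have "norm y \<le> R" "\<bar>Fs j x\<bar> \<le> R" using elim xy by auto
        moreover from this have "\<bar>\<phi> x (y, Fs j x)\<bar> \<le> \<bar>C\<bar>" using C[OF True] by fastforce
        ultimately show ?thesis by (simp add: argmin_density_def x_def)
      next
        case False
        then show ?thesis by (simp add: argmin_density_def x_def phi_zero)
      qed
    qed
  qed
  then show ?thesis by (rule that)
qed

text \<open>The preceding bound for the constant sequence \<open>F\<close>.\<close>

lemma argmin_density_integrable:
  assumes F: "continuous_on B F"
  shows "integrable lebesgue (argmin_density F)"
proof -
  have "\<exists>e>0. \<forall>\<^sub>F j in sequentially. \<forall>z\<in>B. dist z x < e \<longrightarrow> c < F z" if xc: "x \<in> B" "c < F x" for x c
  proof -
    have "F x - c > 0" using xc by simp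
    from F[unfolded continuous_on_iff, rule_format, OF xc(1) this]
    obtain e where "e > 0" "\<forall>z\<in>B. dist z x < e \<longrightarrow> dist (F z) (F x) < F x - c"
      by auto
    moreover have "c < F z" if "dist (F z) (F x) < F x - c" for z
      using that by (simp add: dist_real_def)
    ultimately show ?thesis by (intro exI[of _ e]) auto
  qed
  moreover have "\<exists>X. X \<longlonglongrightarrow> x \<and> (\<lambda>j::nat. F (X j)) \<longlonglongrightarrow> F x" for x
    by (rule exI[of _ "\<lambda>_. x"]) simp
  ultimately obtain R C where "\<forall>\<^sub>F j::nat in sequentially. \<forall>y. \<bar>argmin_density F y\<bar> \<le> C * indicator (cball 0 R) y"
    by (rule argmin_density_bound[OF _ _ F])
  then have RC: "\<bar>argmin_density F y\<bar> \<le> C * indicator (cball 0 R) y" for y by simp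
  have "integrable lebesgue (\<lambda>y::real^'n. C * indicator (cball 0 R) y)"
    by (intro integrable_mult_right integrable_real_indicator)
      (use emeasure_bounded_finite[OF bounded_cball] in auto)
  then show ?thesis
    by (rule Bochner_Integration.integrable_bound[OF _ argmin_density_measurable[OF F]])
      (use RC in \<open>auto intro!: always_eventually intro: order_trans[OF _ abs_ge_self]\<close>)
qed

end


section \<open>The integral over minimizers under translation, scaling, maximum, minimum and
  limits\<close>

lemma lebesgue_integral_translate:
  fixes h :: "'a::euclidean_space \<Rightarrow> real"
  assumes "h \<in> borel_measurable lebesgue"
  shows "(LINT y|lebesgue. h (v + y)) = (LINT y|lebesgue. h y)"
proof -
  have "(\<lambda>x. v + (\<Sum>j\<in>Basis. (1 * (x \<bullet> j)) *\<^sub>R j)) = (\<lambda>x. v + x)"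
    by (simp add: euclidean_representation)
  then have T: "lebesgue = density (distr lebesgue lebesgue (\<lambda>x. v + x)) (\<lambda>_. 1)"
      "(\<lambda>x. v + x) \<in> lebesgue \<rightarrow>\<^sub>M lebesgue"
    using lebesgue_affine_euclidean[of "\<lambda>_. 1" v] lebesgue_affine_measurable[of "\<lambda>_. 1" v] by simp_all
  have "(LINT y|lebesgue. h y) = (LINT y|distr lebesgue lebesgue (\<lambda>x. v + x). h y)"
    by (subst T(1)) (simp add: density_1)
  also have "\<dots> = (LINT y|lebesgue. h (v + y))" by (rule integral_distr[OF T(2) assms])
  finally show ?thesis by simp
qed

lemma lebesgue_integral_scale:
  fixes h :: "'a::euclidean_space \<Rightarrow> real"
  assumes "h \<in> borel_measurable lebesgue" "t > 0"
  shows "(LINT y|lebesgue. h y) = t ^ DIM('a) * (LINT y|lebesgue. h (t *\<^sub>R y))"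
proof -
  have "(\<lambda>x::'a. 0 + (\<Sum>j\<in>Basis. (t * (x \<bullet> j)) *\<^sub>R j)) = (\<lambda>x. t *\<^sub>R x)"
    by (simp add: scaleR_scaleR[symmetric] scaleR_sum_right[symmetric] euclidean_representation del: scaleR_scaleR)
  then have T: "lebesgue = density (distr lebesgue lebesgue (\<lambda>x::'a. t *\<^sub>R x)) (\<lambda>_. ennreal (t ^ DIM('a)))"
      "(\<lambda>x::'a. t *\<^sub>R x) \<in> lebesgue \<rightarrow>\<^sub>M lebesgue"
    using lebesgue_affine_euclidean[of "\<lambda>_::'a. t" 0] lebesgue_affine_measurable[of "\<lambda>_::'a. t" 0] assms(2)
    by simp_all
  have "(LINT y|lebesgue. h y) = (LINT y|density (distr lebesgue lebesgue (\<lambda>x. t *\<^sub>R x)) (\<lambda>_. ennreal (t ^ DIM('a))). h y)"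
    using T(1) by simp
  also have "\<dots> = (LINT y|distr lebesgue lebesgue (\<lambda>x. t *\<^sub>R x). t ^ DIM('a) * h y)"
    using assms by (subst integral_density) auto
  also have "\<dots> = (LINT y|lebesgue. t ^ DIM('a) * h (t *\<^sub>R y))"
    using assms by (intro integral_distr[OF T(2)]) auto
  finally show ?thesis by simp
qed

context tensor_density
begin

lemma argmin_integral_cong:
  assumes F: "continuous_on B F" and eq: "\<And>x. x \<in> B \<Longrightarrow> F x = F' x"
  shows "argmin_integral F = argmin_integral F'"
proof -
  have "argmin_graph B F = argmin_graph B F'" using eq by (auto simp: argmin_graph_def)
  then have "argmin_on B F = argmin_on B F'" by (simp add: argmin_on_def)
  then have "argmin_density F = argmin_density F'"
    using eq argmin_on_in[OF F] by (auto simp: argmin_density_def fun_eq_iff)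
  then show ?thesis by (simp add: argmin_integral_def)
qed

text \<open>
  The larger of the two minima is attained by the maximum as well: otherwise the two
  functions would agree somewhere on the segment between the two minimizers, and convexity of
  the minimum would make that point a second minimizer.
\<close>

lemma argmin_density_valuation_aux:
  assumes F: "continuous_on B F1" "continuous_on B F2"
    and conv: "convex_on B (\<lambda>x. min (F1 x) (F2 x))"
    and un: "\<And>x. (x, y) \<in> argmin_graph B F2 \<Longrightarrow> x = argmin_on B F2 y"
      "\<And>x. (x, y) \<in> argmin_graph B (\<lambda>x. max (F1 x) (F2 x)) \<Longrightarrow> x = argmin_on B (\<lambda>x. max (F1 x) (F2 x)) y"
      "\<And>x. (x, y) \<in> argmin_graph B (\<lambda>x. min (F1 x) (F2 x)) \<Longrightarrow> x = argmin_on B (\<lambda>x. min (F1 x) (F2 x)) y"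
    and le: "F1 (argmin_on B F1 y) - argmin_on B F1 y \<bullet> y \<le> F2 (argmin_on B F2 y) - argmin_on B F2 y \<bullet> y"
  shows "argmin_density (\<lambda>x. max (F1 x) (F2 x)) y + argmin_density (\<lambda>x. min (F1 x) (F2 x)) y
    = argmin_density F1 y + argmin_density F2 y"
proof -
  define x1 x2 where "x1 = argmin_on B F1 y" and "x2 = argmin_on B F2 y"
  note le = le[folded x1_def x2_def]
  have x1: "x1 \<in> B" "\<And>z. z \<in> B \<Longrightarrow> F1 x1 - x1 \<bullet> y \<le> F1 z - z \<bullet> y"
    and x2: "x2 \<in> B" "\<And>z. z \<in> B \<Longrightarrow> F2 x2 - x2 \<bullet> y \<le> F2 z - z \<bullet> y"
    unfolding x1_def x2_def using argmin_on_in argmin_on_le F by auto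
  have F1x1: "F1 x1 \<le> F2 x1" using le x2(2)[OF x1(1)] by simp
  have "(x1, y) \<in> argmin_graph B (\<lambda>x. min (F1 x) (F2 x))"
    unfolding argmin_graph_def
  proof (clarsimp simp: x1(1))
    fix z assume "z \<in> B"
    then show "min (F1 x1) (F2 x1) - x1 \<bullet> y \<le> min (F1 z) (F2 z) - z \<bullet> y"
      using x1(2)[of z] x2(2)[of z] le by (simp add: min_def)
  qed
  then have m: "argmin_on B (\<lambda>x. min (F1 x) (F2 x)) y = x1" using un(3) by simp
  have F2x2: "F1 x2 \<le> F2 x2"
  proof (rule ccontr)
    assume "\<not> F1 x2 \<le> F2 x2"
    then have gt: "F1 x2 > F2 x2" by simp
    define w where "w t = (1 - t) *\<^sub>R x1 + t *\<^sub>R x2" for t :: real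
    have wB: "w t \<in> B" if "t \<in> {0..1}" for t
      unfolding w_def using B(2) x1(1) x2(1) that by (intro convexD_alt) auto
    have "continuous_on {0..1} w" unfolding w_def by (intro continuous_intros)
    then have "continuous_on {0..1} (\<lambda>t. F1 (w t) - F2 (w t))"
      using wB by (intro continuous_on_diff continuous_on_compose2[OF F(1)] continuous_on_compose2[OF F(2)]) auto
    then obtain t where t: "0 \<le> t" "t \<le> 1" "F1 (w t) - F2 (w t) = 0"
      using IVT'[of "\<lambda>t. F1 (w t) - F2 (w t)" 0 0 1] F1x1 gt by (auto simp: w_def)
    have "min (F1 (w t)) (F2 (w t)) \<le> (1 - t) * min (F1 x1) (F2 x1) + t * min (F1 x2) (F2 x2)"
      unfolding w_def using conv x1(1) x2(1) t by (intro convex_onD) auto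
    then have "F2 (w t) \<le> (1 - t) * F1 x1 + t * F2 x2" using t(3) F1x1 gt by (simp add: min_def split: if_splits)
    moreover have "w t \<bullet> y = (1 - t) * (x1 \<bullet> y) + t * (x2 \<bullet> y)"
      by (simp add: w_def inner_add_left)
    ultimately have "F2 (w t) - w t \<bullet> y \<le> (1 - t) * (F1 x1 - x1 \<bullet> y) + t * (F2 x2 - x2 \<bullet> y)"
      by (simp add: algebra_simps)
    also have "\<dots> \<le> (1 - t) * (F2 x2 - x2 \<bullet> y) + t * (F2 x2 - x2 \<bullet> y)"
      using le t by (intro add_mono mult_left_mono) auto
    also have "\<dots> = F2 x2 - x2 \<bullet> y" by (simp add: algebra_simps)
    finally have "(w t, y) \<in> argmin_graph B F2"
      using x2(2) wB[of t] t unfolding argmin_graph_def by fastforce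
    then have "w t = x2" using un(1) by (simp add: x2_def)
    then show False using t(3) gt by simp
  qed
  have "(x2, y) \<in> argmin_graph B (\<lambda>x. max (F1 x) (F2 x))"
    unfolding argmin_graph_def
  proof (clarsimp simp: x2(1))
    fix z assume "z \<in> B"
    then show "max (F1 x2) (F2 x2) - x2 \<bullet> y \<le> max (F1 z) (F2 z) - z \<bullet> y"
      using x2(2)[of z] F2x2 by (simp add: max_def)
  qed
  then have M: "argmin_on B (\<lambda>x. max (F1 x) (F2 x)) y = x2" using un(2) by simp
  show ?thesis
    unfolding argmin_density_def m M x1_def[symmetric] x2_def[symmetric]
    using F1x1 F2x2 by (simp add: min_def max_def)
qed

lemma argmin_integral_valuation:
  assumes F: "continuous_on B F1" "continuous_on B F2"
    and conv: "convex_on B (\<lambda>x. min (F1 x) (F2 x))"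
  shows "argmin_integral (\<lambda>x. max (F1 x) (F2 x)) + argmin_integral (\<lambda>x. min (F1 x) (F2 x))
    = argmin_integral F1 + argmin_integral F2"
proof -
  have cM: "continuous_on B (\<lambda>x. max (F1 x) (F2 x))" and cm: "continuous_on B (\<lambda>x. min (F1 x) (F2 x))"
    using F by (auto intro: continuous_on_max continuous_on_min)
  note int = argmin_density_integrable[OF cM] argmin_density_integrable[OF cm]
    argmin_density_integrable[OF F(1)] argmin_density_integrable[OF F(2)]
  have comm: "(\<lambda>x. max (F2 x) (F1 x)) = (\<lambda>x. max (F1 x) (F2 x))" "(\<lambda>x. min (F2 x) (F1 x)) = (\<lambda>x. min (F1 x) (F2 x))"
    by (auto simp: max.commute min.commute)
  have "AE y in lebesgue. argmin_density (\<lambda>x. max (F1 x) (F2 x)) y + argmin_density (\<lambda>x. min (F1 x) (F2 x)) y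
    = argmin_density F1 y + argmin_density F2 y"
    using AE_argmin_unique[OF F(1)] AE_argmin_unique[OF F(2)] AE_argmin_unique[OF cM] AE_argmin_unique[OF cm]
  proof eventually_elim
    case (elim y)
    consider "F1 (argmin_on B F1 y) - argmin_on B F1 y \<bullet> y \<le> F2 (argmin_on B F2 y) - argmin_on B F2 y \<bullet> y"
      | "F2 (argmin_on B F2 y) - argmin_on B F2 y \<bullet> y \<le> F1 (argmin_on B F1 y) - argmin_on B F1 y \<bullet> y"
      by linarith
    then show ?case
    proof cases
      case 1
      show ?thesis
        by (rule argmin_density_valuation_aux[OF F conv _ _ _ 1]) (use elim in auto)
    next
      case 2
      have "argmin_density (\<lambda>x. max (F2 x) (F1 x)) y + argmin_density (\<lambda>x. min (F2 x) (F1 x)) y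
        = argmin_density F2 y + argmin_density F1 y"
        by (rule argmin_density_valuation_aux[OF F(2,1) _ _ _ _ 2]) (use elim conv in \<open>auto simp: comm\<close>)
      then show ?thesis by (simp add: comm)
    qed
  qed
  then have "(LINT y|lebesgue. argmin_density (\<lambda>x. max (F1 x) (F2 x)) y + argmin_density (\<lambda>x. min (F1 x) (F2 x)) y)
    = (LINT y|lebesgue. argmin_density F1 y + argmin_density F2 y)"
    using int by (intro integral_cong_AE borel_measurable_add) (auto intro: borel_measurable_integrable)
  then show ?thesis using int by (simp add: argmin_integral_def)
qed

text \<open>Minimal values and minimizers converge when the limiting minimizer is unique: recovery
  sequences bound the minimal values from above, and the lower bound with compactness of
  \<open>B - U\<close> keeps the minimizers in any neighbourhood \<open>U\<close> of the
  limit.\<close>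

lemma argmin_density_tendsto:
  fixes Fs :: "nat \<Rightarrow> real^'n \<Rightarrow> real"
  assumes low: "\<And>x c. x \<in> B \<Longrightarrow> c < F x \<Longrightarrow> \<exists>e>0. \<forall>\<^sub>F j in sequentially. \<forall>z\<in>B. dist z x < e \<longrightarrow> c < Fs j z"
    and rec: "\<And>x. x \<in> interior B \<Longrightarrow> \<exists>X. X \<longlonglongrightarrow> x \<and> (\<lambda>j. Fs j (X j)) \<longlonglongrightarrow> F x"
    and F: "continuous_on B F" "\<And>j. continuous_on B (Fs j)"
    and un: "\<And>x. (x, y) \<in> argmin_graph B F \<Longrightarrow> x = argmin_on B F y"
  shows "(\<lambda>j. argmin_density (Fs j) y) \<longlonglongrightarrow> argmin_density F y"
proof -
  define x where "x = argmin_on B F y"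
  define xs where "xs j = argmin_on B (Fs j) y" for j
  define \<mu> where "\<mu> = F x - x \<bullet> y"
  have x: "x \<in> B" "\<And>z. z \<in> B \<Longrightarrow> \<mu> \<le> F z - z \<bullet> y"
    unfolding x_def \<mu>_def using argmin_on_in argmin_on_le F by auto
  have xs: "xs j \<in> B" "\<And>z. z \<in> B \<Longrightarrow> Fs j (xs j) - xs j \<bullet> y \<le> Fs j z - z \<bullet> y" for j
    unfolding xs_def using argmin_on_in argmin_on_le F by auto
  have low': "\<exists>e>0. \<forall>\<^sub>F j in sequentially. \<forall>z\<in>B. dist z p < e \<longrightarrow> c < Fs j z - z \<bullet> y"
    if p: "p \<in> B" "c < F p - p \<bullet> y" for p c
  proof -
    define \<delta> where "\<delta> = (F p - p \<bullet> y - c) / 2"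
    have \<delta>: "\<delta> > 0" using p by (simp add: \<delta>_def)
    obtain e where e: "e > 0" "\<forall>\<^sub>F j in sequentially. \<forall>z\<in>B. dist z p < e \<longrightarrow> F p - \<delta> < Fs j z"
      using low[OF p(1), of "F p - \<delta>"] \<delta> by auto
    \<comment> \<open>Within distance \<open>e'\<close> the linear term
      \<open>\<langle>\<cdot>, y\<rangle>\<close> varies by at most \<open>\<delta>\<close>, half of
      the available gap.\<close>
    define e' where "e' = min e (\<delta> / (1 + norm y))"
    have e': "e' > 0" using e(1) \<delta> by (auto simp: e'_def add_pos_nonneg)
    have "\<forall>\<^sub>F j in sequentially. \<forall>z\<in>B. dist z p < e' \<longrightarrow> c < Fs j z - z \<bullet> y"
      using e(2)
    proof eventually_elim
      case (elim j)
      show ?case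
      proof (intro ballI impI)
        fix z assume z: "z \<in> B" "dist z p < e'"
        have "(z - p) \<bullet> y \<le> norm (z - p) * norm y" by (rule norm_cauchy_schwarz)
        also have "\<dots> \<le> \<delta> / (1 + norm y) * (1 + norm y)"
          using z(2) \<delta> by (intro mult_mono) (auto simp: e'_def dist_norm)
        also have "\<dots> = \<delta>" using norm_ge_zero[of y] by (simp add: field_simps add_nonneg_eq_0_iff)
        finally have "z \<bullet> y \<le> p \<bullet> y + \<delta>" by (simp add: inner_diff_left)
        moreover have "F p - \<delta> < Fs j z" using elim z by (auto simp: e'_def)
        ultimately show "c < Fs j z - z \<bullet> y" by (simp add: \<delta>_def field_simps)
      qed
    qed
    then show ?thesis using e' by blast
  qed
  have upper: "\<forall>\<^sub>F j in sequentially. Fs j (xs j) - xs j \<bullet> y < \<mu> + \<epsilon>" if \<epsilon>: "\<epsilon> > 0" for \<epsilon>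
  proof -
    \<comment> \<open>Recovery sequences exist only at interior points, while the minimizer may lie
      on the boundary. An interior point that is almost minimal serves instead.\<close>
    have "x \<in> closure (interior B)"
      using x(1) convex_closure_interior[OF B(2,3)] closure_closed[OF compact_imp_closed[OF B(1)]] by simp
    then obtain X where X: "\<And>j. X j \<in> interior B" "X \<longlonglongrightarrow> x" unfolding closure_sequential by blast
    have XB: "X j \<in> B" for j using X(1) interior_subset by blast
    have "(\<lambda>j. F (X j) - X j \<bullet> y) \<longlonglongrightarrow> F x - x \<bullet> y"
      by (intro tendsto_diff tendsto_inner X(2) tendsto_const continuous_on_tendsto_compose[OF F(1) X(2) x(1)])
        (simp add: XB)
    then have "\<forall>\<^sub>F j in sequentially. F (X j) - X j \<bullet> y < \<mu> + \<epsilon>"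
      using \<epsilon> by (intro order_tendstoD(2)) (auto simp: \<mu>_def)
    then obtain j0 where j0: "F (X j0) - X j0 \<bullet> y < \<mu> + \<epsilon>" by (auto simp: eventually_sequentially)
    obtain Z where Z: "Z \<longlonglongrightarrow> X j0" "(\<lambda>j. Fs j (Z j)) \<longlonglongrightarrow> F (X j0)" using rec[OF X(1)] by blast
    have "(\<lambda>j. Fs j (Z j) - Z j \<bullet> y) \<longlonglongrightarrow> F (X j0) - X j0 \<bullet> y"
      by (intro tendsto_diff tendsto_inner Z tendsto_const)
    then have "\<forall>\<^sub>F j in sequentially. Fs j (Z j) - Z j \<bullet> y < \<mu> + \<epsilon>" using j0 by (rule order_tendstoD(2))
    moreover have "\<forall>\<^sub>F j in sequentially. Z j \<in> interior B"
      using Z(1) X(1) topological_tendstoD open_interior by blast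
    ultimately show ?thesis
    proof eventually_elim
      case (elim j)
      then have "Z j \<in> B" using interior_subset by blast
      from xs(2)[OF this, of j] elim show ?case by simp
    qed
  qed
  have lim: "xs \<longlonglongrightarrow> x"
  proof (rule topological_tendstoI)
    fix U assume U: "open U" "x \<in> U"
    have "\<exists>\<eta>>0. \<exists>e>0. \<forall>\<^sub>F j in sequentially. \<forall>z\<in>B. dist z p < e \<longrightarrow> \<mu> + \<eta> < Fs j z - z \<bullet> y" if p: "p \<in> B - U" for p
    proof -
      have "F p - p \<bullet> y \<noteq> \<mu>"
      proof
        assume "F p - p \<bullet> y = \<mu>"
        then have "(p, y) \<in> argmin_graph B F" using p x(2) by (auto simp: argmin_graph_def)
        then have "p = x" using un by (simp add: x_def)
        then show False using p U(2) by blast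
      qed
      then have gt: "\<mu> < F p - p \<bullet> y" using x(2)[of p] p by auto
      define \<eta> where "\<eta> = (F p - p \<bullet> y - \<mu>) / 2"
      have "\<eta> > 0" "\<mu> + \<eta> < F p - p \<bullet> y" using gt by (auto simp: \<eta>_def field_simps)
      then show ?thesis using low'[of p "\<mu> + \<eta>"] p by blast
    qed
    then have "\<forall>p\<in>B - U. \<exists>\<eta> e. \<eta> > 0 \<and> e > 0 \<and> (\<forall>\<^sub>F j in sequentially. \<forall>z\<in>B. dist z p < e \<longrightarrow> \<mu> + \<eta> < Fs j z - z \<bullet> y)"
      by blast
    then obtain \<eta> e where e: "\<And>p. p \<in> B - U \<Longrightarrow> \<eta> p > 0" "\<And>p. p \<in> B - U \<Longrightarrow> e p > 0"
      "\<And>p. p \<in> B - U \<Longrightarrow> \<forall>\<^sub>F j in sequentially. \<forall>z\<in>B. dist z p < e p \<longrightarrow> \<mu> + \<eta> p < Fs j z - z \<bullet> y"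
      unfolding bchoice_iff by blast
    have "compact (B - U)" by (intro compact_diff B(1) U(1))
    moreover have "B - U \<subseteq> (\<Union>p\<in>B - U. ball p (e p))" using e(2) by force
    ultimately obtain T where T: "T \<subseteq> B - U" "finite T" "B - U \<subseteq> (\<Union>p\<in>T. ball p (e p))"
      using compactE_image[of "B - U" "B - U" "\<lambda>p. ball p (e p)"] by auto
    \<comment> \<open>The inserted 1 covers the case that \<open>T\<close> is empty.\<close>
    define m where "m = Min (insert 1 (\<eta> ` T))"
    have m: "m > 0" unfolding m_def using T(1,2) e(1) by (subst Min_gr_iff) auto
    have "\<forall>\<^sub>F j in sequentially. \<forall>p\<in>T. \<forall>z\<in>B. dist z p < e p \<longrightarrow> \<mu> + \<eta> p < Fs j z - z \<bullet> y"
      using T(1,2) e(3) by (intro eventually_ball_finite) auto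
    with upper[OF m] show "\<forall>\<^sub>F j in sequentially. xs j \<in> U"
    proof eventually_elim
      case (elim j)
      show ?case
      proof (rule ccontr)
        assume "xs j \<notin> U"
        then obtain p where p: "p \<in> T" "dist (xs j) p < e p" using T(3) xs(1)[of j] by (force simp: dist_commute)
        then have "\<mu> + \<eta> p < Fs j (xs j) - xs j \<bullet> y" using elim(2) xs(1)[of j] by blast
        moreover have "m \<le> \<eta> p" unfolding m_def using T(2) p(1) by (intro Min_le) auto
        ultimately show False using elim(1) by simp
      qed
    qed
  qed
  have "(\<lambda>j. Fs j (xs j) - xs j \<bullet> y) \<longlonglongrightarrow> \<mu>"
  proof (rule order_tendstoI)
    fix c assume "c < \<mu>"
    then obtain e where e: "e > 0" "\<forall>\<^sub>F j in sequentially. \<forall>z\<in>B. dist z x < e \<longrightarrow> c < Fs j z - z \<bullet> y"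
      using low'[OF x(1), of c] by (auto simp: \<mu>_def)
    from e(2) tendstoD[OF lim e(1)] show "\<forall>\<^sub>F j in sequentially. c < Fs j (xs j) - xs j \<bullet> y"
      by eventually_elim (use xs(1) in blast)
  next
    fix c assume "\<mu> < c"
    then show "\<forall>\<^sub>F j in sequentially. Fs j (xs j) - xs j \<bullet> y < c" using upper[of "c - \<mu>"] by simp
  qed
  then have "(\<lambda>j. Fs j (xs j) - xs j \<bullet> y + xs j \<bullet> y) \<longlonglongrightarrow> \<mu> + x \<bullet> y"
    by (intro tendsto_add tendsto_inner lim tendsto_const)
  then have "(\<lambda>j. Fs j (xs j)) \<longlonglongrightarrow> F x" by (simp add: \<mu>_def)
  then show ?thesis
    unfolding argmin_density_def x_def[symmetric] xs_def[symmetric]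
    by (intro tendsto_phi lim tendsto_Pair tendsto_const)
qed

lemma argmin_integral_tendsto:
  fixes Fs :: "nat \<Rightarrow> real^'n \<Rightarrow> real"
  assumes low: "\<And>x c. x \<in> B \<Longrightarrow> c < F x \<Longrightarrow> \<exists>e>0. \<forall>\<^sub>F j in sequentially. \<forall>z\<in>B. dist z x < e \<longrightarrow> c < Fs j z"
    and rec: "\<And>x. x \<in> interior B \<Longrightarrow> \<exists>X. X \<longlonglongrightarrow> x \<and> (\<lambda>j. Fs j (X j)) \<longlonglongrightarrow> F x"
    and F: "continuous_on B F" "\<And>j. continuous_on B (Fs j)"
  shows "(\<lambda>j. argmin_integral (Fs j)) \<longlonglongrightarrow> argmin_integral F"
proof -
  obtain R C where "\<forall>\<^sub>F j in sequentially. \<forall>y. \<bar>argmin_density (Fs j) y\<bar> \<le> C * indicator (cball 0 R) y"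
    by (rule argmin_density_bound[OF low rec F(2)])
  then obtain N where N: "\<And>j y. j \<ge> N \<Longrightarrow> \<bar>argmin_density (Fs j) y\<bar> \<le> C * indicator (cball 0 R) y"
    unfolding eventually_sequentially by blast
  have "integrable lebesgue (\<lambda>y::real^'n. C * indicator (cball 0 R) y)"
    by (intro integrable_mult_right integrable_real_indicator)
      (use emeasure_bounded_finite[OF bounded_cball] in auto)
  moreover have "AE y in lebesgue. (\<lambda>j. argmin_density (Fs (j + N)) y) \<longlonglongrightarrow> argmin_density F y"
    using AE_argmin_unique[OF F(1)]
  proof eventually_elim
    case (elim y)
    have "(\<lambda>j. argmin_density (Fs j) y) \<longlonglongrightarrow> argmin_density F y"
      by (rule argmin_density_tendsto[OF low rec F]) (use elim in auto)
    then show ?case by (rule LIMSEQ_ignore_initial_segment)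
  qed
  ultimately have "(\<lambda>j. argmin_integral (Fs (j + N))) \<longlonglongrightarrow> argmin_integral F"
    unfolding argmin_integral_def
    by (intro integral_dominated_convergence[where w = "\<lambda>y. C * indicator (cball 0 R) y"] argmin_density_measurable F)
      (auto intro!: always_eventually N)
  then show ?thesis by (rule LIMSEQ_offset)
qed

text \<open>Both choices are made from the same predicate, so the equality holds at every
  \<open>y\<close>, including those with several minimizers.\<close>

lemma argmin_on_affine: "argmin_on B (\<lambda>x. F x + (v \<bullet> x + s)) y = argmin_on B F (y - v)"
proof -
  have "(x, y) \<in> argmin_graph B (\<lambda>x. F x + (v \<bullet> x + s)) \<longleftrightarrow> (x, y - v) \<in> argmin_graph B F" for x
    by (auto simp: argmin_graph_def inner_diff_right inner_commute algebra_simps)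
  then show ?thesis by (simp add: argmin_on_def rel_selection_def)
qed

lemma argmin_on_scale:
  assumes "t > 0"
  shows "argmin_on B (\<lambda>x. t * F x) (t *\<^sub>R y) = argmin_on B F y"
proof -
  have "t * a - x \<bullet> (t *\<^sub>R y) \<le> t * b - z \<bullet> (t *\<^sub>R y) \<longleftrightarrow> a - x \<bullet> y \<le> b - z \<bullet> y" for a b x z
    using assms by (simp flip: right_diff_distrib)
  then have "(x, t *\<^sub>R y) \<in> argmin_graph B (\<lambda>x. t * F x) \<longleftrightarrow> (x, y) \<in> argmin_graph B F" for x
    by (simp add: argmin_graph_def)
  then show ?thesis by (simp add: argmin_on_def rel_selection_def)
qed

text \<open>Translating the gradient variable by \<open>v\<close> keeps the minimizer fixed. Then
  only the arguments of \<open>\<phi>\<close> depend on \<open>(v, s)\<close>, and they do so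
  affinely.\<close>

lemma argmin_integral_affine:
  assumes F: "continuous_on B F"
  shows "polynomial_of_degree_le d (\<lambda>(v, s). argmin_integral (\<lambda>x. F x + (v \<bullet> x + s)))"
proof -
  define p where "p y = (\<lambda>(v, s). \<phi> (argmin_on B F y) ((y + v), F (argmin_on B F y) + (v \<bullet> argmin_on B F y + s)))" for y
  have dens: "argmin_density (\<lambda>x. F x + (v \<bullet> x + s)) (v + y) = p y (v, s)" for v s y
    unfolding argmin_density_def argmin_on_affine p_def by (simp add: add.commute[of v y])
  have cF: "continuous_on B (\<lambda>x. F x + (v \<bullet> x + s))" for v s by (intro continuous_intros F)
  have eq: "argmin_integral (\<lambda>x. F x + (v \<bullet> x + s)) = (LINT y|lebesgue. p y (v, s))" for v s
    unfolding argmin_integral_def dens[symmetric]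
    by (rule lebesgue_integral_translate[symmetric]) (rule argmin_density_measurable[OF cF])
  have int: "integrable lebesgue (\<lambda>y. p y z)" for z
  proof (cases z)
    case (Pair v s)
    have "(\<lambda>x::real^'n. v + (\<Sum>j\<in>Basis. (1 * (x \<bullet> j)) *\<^sub>R j)) = (\<lambda>x. v + x)"
      by (simp add: euclidean_representation)
    then have T: "distr lebesgue lebesgue (\<lambda>x. v + x) = lebesgue" "(\<lambda>x. v + x) \<in> lebesgue \<rightarrow>\<^sub>M lebesgue"
      using lebesgue_affine_euclidean[of "\<lambda>_. 1" v] lebesgue_affine_measurable[of "\<lambda>_. 1" v]
      by (simp_all add: density_1)
    have "integrable (distr lebesgue lebesgue (\<lambda>x. v + x)) (argmin_density (\<lambda>x. F x + (v \<bullet> x + s)))"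
      unfolding T(1) by (rule argmin_density_integrable[OF cF])
    then have "integrable lebesgue (\<lambda>y. argmin_density (\<lambda>x. F x + (v \<bullet> x + s)) (v + y))"
      by (rule integrable_distr[OF T(2)])
    then show ?thesis by (simp add: dens Pair)
  qed
  have "polynomial_of_degree_le d (p y)" for y
  proof -
    define x where "x = argmin_on B F y"
    have "polynomial_of_degree_le d (\<lambda>z. \<phi> x ((y, F x) + (fst z, fst z \<bullet> x + snd z)))"
    proof (rule polynomial_degree_le_compose[OF homogeneous_imp_degree_le[OF hom order_refl]])
      fix b :: "(real^'n) \<times> real" assume "b \<in> Basis"
      have "(\<lambda>z. ((y, F x) + (fst z, fst z \<bullet> x + snd z)) \<bullet> b)
          = (\<lambda>z. (y, F x) \<bullet> b + z \<bullet> (fst b + snd b *\<^sub>R x, snd b))"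
        by (auto simp: inner_prod_def inner_add_left inner_add_right algebra_simps)
      then show "polynomial_of_degree_le 1 (\<lambda>z. ((y, F x) + (fst z, fst z \<bullet> x + snd z)) \<bullet> b)"
        by (simp only: polynomial_degree_le_affine)
    qed
    then show ?thesis by (simp add: p_def x_def case_prod_unfold)
  qed
  then have "polynomial_of_degree_le d (\<lambda>z. LINT y|lebesgue. p y z)"
    using int by (rule polynomial_degree_le_integral)
  moreover have "(\<lambda>(v, s). argmin_integral (\<lambda>x. F x + (v \<bullet> x + s))) = (\<lambda>z. LINT y|lebesgue. p y z)"
    by (auto simp: eq)
  ultimately show ?thesis by simp
qed

text \<open>The substitution of \<open>t *\<^sub>R y\<close> for \<open>y\<close> contributes
  \<open>t ^ n\<close>, the homogeneity of \<open>\<phi>\<close> contributes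
  \<open>t ^ d\<close>.\<close>

lemma argmin_integral_scale:
  assumes F: "continuous_on B F" and t: "t > 0"
  shows "argmin_integral (\<lambda>x. t * F x) = t ^ (CARD('n) + d) * argmin_integral F"
proof -
  have cF: "continuous_on B (\<lambda>x. t * F x)" by (intro continuous_intros F)
  have "argmin_density (\<lambda>x. t * F x) (t *\<^sub>R y) = t ^ d * argmin_density F y" for y
  proof -
    have "(t *\<^sub>R y, t * c) = t *\<^sub>R (y, c)" for c by simp
    then show ?thesis
      by (simp add: argmin_density_def argmin_on_scale[OF t] homogeneous_polynomial_scaleR[OF hom]
          del: scaleR_Pair)
  qed
  then show ?thesis
    unfolding argmin_integral_def
    by (subst lebesgue_integral_scale[OF argmin_density_measurable[OF cF] t]) (simp add: power_add)
qed

end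


section \<open>Epi-convergence and cones of convex functions\<close>

text \<open>The point \<open>(x, c)\<close> has positive distance from the epigraph of
  \<open>f\<close>, and distances to the epigraphs converge. So one neighbourhood of
  \<open>x\<close> serves all large \<open>j\<close>, which is stronger than the statement about
  single sequences.\<close>

lemma epi_converges_lower:
  fixes f :: "real^'n \<Rightarrow> ereal"
  assumes fs: "range fs \<subseteq> Conv" and f: "f \<in> Conv" and epi: "epi_converges fs f" and c: "ereal c < f x"
  shows "\<exists>e>0. \<forall>\<^sub>F j in sequentially. \<forall>z. dist z x < e \<longrightarrow> ereal c < fs j z"
proof -
  have "(x, c) \<notin> ereal_epigraph f" using c by (auto simp: ereal_epigraph_def)
  then have "infdist (x, c) (ereal_epigraph f) \<noteq> 0" using mem_epigraph_iff_infdist[OF f] by blast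
  then have pos: "infdist (x, c) (ereal_epigraph f) > 0" using infdist_nonneg by (metis order_less_le)
  define e where "e = infdist (x, c) (ereal_epigraph f) / 2"
  have e: "e > 0" "e < infdist (x, c) (ereal_epigraph f)" using pos by (auto simp: e_def)
  have "\<forall>\<^sub>F j in sequentially. e < infdist (x, c) (ereal_epigraph (fs j))"
    by (rule order_tendstoD(1)[OF epi_converges_imp_infdist[OF fs f epi] e(2)])
  then have "\<forall>\<^sub>F j in sequentially. \<forall>z. dist z x < e \<longrightarrow> ereal c < fs j z"
  proof eventually_elim
    case (elim j)
    show ?case
    proof (intro allI impI, rule ccontr)
      fix z assume z: "dist z x < e" "\<not> ereal c < fs j z"
      then have "(z, c) \<in> ereal_epigraph (fs j)" by (auto simp: ereal_epigraph_def)
      then have "infdist (x, c) (ereal_epigraph (fs j)) \<le> dist (x, c) (z, c)" by (rule infdist_le)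
      also have "\<dots> = dist z x" by (simp add: dist_Pair_Pair dist_commute)
      finally show False using elim z(1) by simp
    qed
  qed
  then show ?thesis using e(1) by blast
qed

text \<open>The topology is metrizable, so sequential continuity is enough.\<close>

lemma continuous_map_epi_topologyI:
  fixes \<Gamma> :: "(real^'n \<Rightarrow> ereal) set"
  assumes \<Gamma>: "\<Gamma> \<subseteq> Conv"
    and seq: "\<And>fs f. range fs \<subseteq> \<Gamma> \<Longrightarrow> f \<in> \<Gamma> \<Longrightarrow> epi_converges fs f \<Longrightarrow> (\<lambda>j. Z (fs j)) \<longlonglongrightarrow> Z f"
  shows "continuous_map (subtopology epi_topology \<Gamma>) euclideanreal Z"
proof -
  interpret sub: Submetric Conv epi_dist \<Gamma>
    by (simp add: Submetric_def Submetric_axioms_def epi.Metric_space_axioms \<Gamma>)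
  have "continuous_map sub.sub.mtopology euclideanreal Z"
    unfolding sub.sub.continuous_map_from_metric
  proof (intro conjI ballI allI impI)
    fix f U assume f: "f \<in> \<Gamma>" and U: "openin euclideanreal U \<and> Z f \<in> U"
    show "\<exists>r>0. \<forall>x. x \<in> \<Gamma> \<and> epi_dist f x < r \<longrightarrow> Z x \<in> U"
    proof (rule ccontr)
      assume "\<not> ?thesis"
      then have "\<forall>j. \<exists>g. g \<in> \<Gamma> \<and> epi_dist f g < inverse (real (Suc j)) \<and> Z g \<notin> U"
        by (metis inverse_positive_iff_positive of_nat_0_less_iff zero_less_Suc)
      then obtain gs where gs: "\<And>j. gs j \<in> \<Gamma>" "\<And>j. epi_dist f (gs j) < inverse (real (Suc j))" "\<And>j. Z (gs j) \<notin> U"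
        by metis
      have C: "range gs \<subseteq> Conv" "f \<in> Conv" using gs(1) f \<Gamma> by auto
      have "epi_converges gs f"
        unfolding epi_converges_iff_dist[OF C]
      proof (intro allI impI)
        fix e :: real assume "e > 0"
        have "\<forall>\<^sub>F j in sequentially. inverse (real (Suc j)) < e"
          using LIMSEQ_inverse_real_of_nat \<open>e > 0\<close> order_tendstoD(2) by blast
        then show "\<forall>\<^sub>F j in sequentially. epi_dist (gs j) f < e"
          by eventually_elim (use gs(2) epi.commute in \<open>metis order.strict_trans\<close>)
      qed
      then have "(\<lambda>j. Z (gs j)) \<longlonglongrightarrow> Z f" using gs(1) f by (intro seq) auto
      then have "\<forall>\<^sub>F j in sequentially. Z (gs j) \<in> U" using U topological_tendstoD by (metis open_openin)
      then show False using gs(3) by simp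
    qed
  qed auto
  then show ?thesis unfolding epi_topology_eq_mtopology sub.mtopology_submetric .
qed

lemma continuous_map_epi_topologyD:
  fixes \<Gamma> :: "(real^'n \<Rightarrow> ereal) set"
  assumes \<Gamma>: "\<Gamma> \<subseteq> Conv" and Z: "continuous_map (subtopology epi_topology \<Gamma>) euclideanreal Z"
    and fs: "range fs \<subseteq> \<Gamma>" "f \<in> \<Gamma>" "epi_converges fs f"
  shows "(\<lambda>j. Z (fs j)) \<longlonglongrightarrow> Z f"
proof -
  have "limitin epi_topology fs f sequentially"
    using fs \<Gamma> by (subst limitin_epi_topology) auto
  then have "limitin (subtopology epi_topology \<Gamma>) fs f sequentially"
    using fs by (auto simp: limitin_subtopology image_subset_iff)
  from continuous_map_limit[OF Z this] show ?thesis by (simp add: comp_def)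
qed

lemma Conv_finite:
  "f \<in> Conv \<Longrightarrow> x \<in> effective_domain f \<Longrightarrow> f x = ereal (real_of_ereal (f x))"
  by (cases "f x") (auto simp: Conv_def effective_domain_def)

lemma Conv_convex_on:
  assumes f: "f \<in> Conv" and S: "convex S" "S \<subseteq> effective_domain f"
  shows "convex_on S (\<lambda>x. real_of_ereal (f x))"
proof (rule convex_onI)
  fix t :: real and x y assume t: "0 < t" "t < 1" and xy: "x \<in> S" "y \<in> S"
  have z: "(1 - t) *\<^sub>R x + t *\<^sub>R y \<in> S" using S(1) xy t by (intro convexD_alt) auto
  have "f ((1 - t) *\<^sub>R x + t *\<^sub>R y) \<le> ereal (1 - t) * f x + ereal t * f y"
    using f t by (auto simp: Conv_def ereal_convex_def)
  also have "\<dots> = ereal ((1 - t) * real_of_ereal (f x) + t * real_of_ereal (f y))"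
    using Conv_finite[OF f, of x] Conv_finite[OF f, of y] xy S(2)
    by (metis plus_ereal.simps(1) subsetD times_ereal.simps(1))
  finally show "real_of_ereal (f ((1 - t) *\<^sub>R x + t *\<^sub>R y)) \<le> (1 - t) * real_of_ereal (f x) + t * real_of_ereal (f y)"
    using Conv_finite[OF f, of "(1 - t) *\<^sub>R x + t *\<^sub>R y"] z S(2) by (metis ereal_less_eq(3) subsetD)
qed (rule S(1))

lemma convex_on_eq:
  assumes "convex_on S f" "\<And>x. x \<in> S \<Longrightarrow> f x = g x"
  shows "convex_on S g"
proof (rule convex_onI)
  show S: "convex S" using assms(1) by (simp add: convex_on_def)
  fix t :: real and x y assume t: "0 < t" "t < 1" and xy: "x \<in> S" "y \<in> S"
  have "(1 - t) *\<^sub>R x + t *\<^sub>R y \<in> S" using S xy t by (intro convexD_alt) auto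
  then show "g ((1 - t) *\<^sub>R x + t *\<^sub>R y) \<le> (1 - t) * g x + t * g y"
    using convex_onD[OF assms(1), of t x y] t xy assms(2) by simp
qed

locale AO_setting =
  fixes \<A> \<O> :: "(real^'n) set" and \<Gamma> :: "(real^'n \<Rightarrow> ereal) set"
  assumes A: "closed \<A>" and O: "closed \<O>" "convex \<O>" "interior \<O> \<noteq> {}"
    and OA: "\<O> \<subseteq> \<A>" and cone: "AO_cone \<A> \<O> \<Gamma>"
begin

lemma Gamma_Conv: "\<Gamma> \<subseteq> Conv" and Gamma_add: "f \<in> \<Gamma> \<Longrightarrow> h \<in> \<Gamma> \<Longrightarrow> (\<lambda>x. f x + h x) \<in> \<Gamma>"
  and Gamma_scale: "f \<in> \<Gamma> \<Longrightarrow> t > 0 \<Longrightarrow> (\<lambda>x. ereal t * f x) \<in> \<Gamma>"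
  and Gamma_dom: "f \<in> \<Gamma> \<Longrightarrow> \<O> \<subseteq> effective_domain f" "f \<in> \<Gamma> \<Longrightarrow> effective_domain f \<subseteq> \<A>"
  and Gamma_O: "convex_indicator \<O> \<in> \<Gamma>"
  using cone by (auto simp: AO_cone_def)

lemma Gamma_support:
  fixes K :: "((real^'n) \<times> real) set"
  assumes "K \<noteq> {}" "compact K" "convex K"
  shows "(\<lambda>x. ereal (support_function K (x, -1)) + convex_indicator \<A> x) \<in> \<Gamma>"
  using cone assms unfolding AO_cone_def by simp

lemma Gamma_finite: "f \<in> \<Gamma> \<Longrightarrow> x \<in> \<O> \<Longrightarrow> f x = ereal (real_of_ereal (f x))"
  using Conv_finite[of f x] Gamma_Conv Gamma_dom by blast

lemma Gamma_infinite: "f \<in> \<Gamma> \<Longrightarrow> x \<notin> \<A> \<Longrightarrow> f x = \<infinity>"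
  using Gamma_dom(2)[of f] by (auto simp: effective_domain_def)

lemma Gamma_not_MInf: "f \<in> \<Gamma> \<Longrightarrow> f x \<noteq> -\<infinity>"
  using Gamma_Conv by (auto simp: Conv_def)

text \<open>Off \<open>\<A>\<close> the added function is invisible because \<open>f\<close> is infinite there.\<close>

lemma Gamma_add_real:
  assumes "f \<in> \<Gamma>" "(\<lambda>x. ereal (g x) + convex_indicator \<A> x) \<in> \<Gamma>"
  shows "(\<lambda>x. f x + ereal (g x)) \<in> \<Gamma>"
proof -
  have "(\<lambda>x. f x + (ereal (g x) + convex_indicator \<A> x)) \<in> \<Gamma>" by (rule Gamma_add[OF assms])
  also have "(\<lambda>x. f x + (ereal (g x) + convex_indicator \<A> x)) = (\<lambda>x. f x + ereal (g x))"
    using Gamma_infinite[OF assms(1)] by (auto simp: convex_indicator_def fun_eq_iff)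
  finally show ?thesis .
qed

lemma Gamma_affine_indicator: "(\<lambda>x. ereal (y \<bullet> x + s) + convex_indicator \<A> x) \<in> \<Gamma>"
proof -
  have "support_function {(y, -s)} (x, -1) = y \<bullet> x + s" for x
    by (simp add: support_function_def inner_prod_def inner_commute)
  then show ?thesis using Gamma_support[of "{(y, -s)}"] by simp
qed

lemma Gamma_affine: "f \<in> \<Gamma> \<Longrightarrow> (\<lambda>x. f x + ereal (y \<bullet> x + s)) \<in> \<Gamma>"
  by (rule Gamma_add_real[OF _ Gamma_affine_indicator])

lemma Gamma_hinge: "f \<in> \<Gamma> \<Longrightarrow> M \<ge> 0 \<Longrightarrow> (\<lambda>x. f x + ereal (M * max 0 (y \<bullet> x + s))) \<in> \<Gamma>"
proof (rule Gamma_add_real, assumption)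
  assume M: "M \<ge> 0"
  \<comment> \<open>The support function of a segment from the origin is the positive part of a
    linear function; at \<open>(x, -1)\<close> the end point gives
    \<open>M * (y \<bullet> x + s)\<close>.\<close>
  define K where "K = closed_segment (0, 0) (M *\<^sub>R y, - M * s)"
  have "support_function K (x, -1) = M * max 0 (y \<bullet> x + s)" for x
  proof -
    have im: "(\<lambda>w. (x, -1) \<bullet> w) ` K = (\<lambda>u. u * (M * (y \<bullet> x + s))) ` {0..1}"
      unfolding K_def closed_segment_image_interval image_image
      by (intro image_cong refl) (simp add: inner_prod_def inner_commute algebra_simps)
    show ?thesis
      unfolding support_function_def im
    proof (rule cSup_eq_maximum)
      show "M * max 0 (y \<bullet> x + s) \<in> (\<lambda>u. u * (M * (y \<bullet> x + s))) ` {0..1}"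
        by (cases "y \<bullet> x + s \<ge> 0") (auto intro: image_eqI[of _ _ 1] image_eqI[of _ _ 0])
      fix z assume "z \<in> (\<lambda>u. u * (M * (y \<bullet> x + s))) ` {0..1}"
      then obtain u where "u \<in> {0..1}" "z = u * (M * (y \<bullet> x + s))" by (rule imageE)
      then have u: "z = u * (M * (y \<bullet> x + s))" "0 \<le> u" "u \<le> 1" by simp_all
      show "z \<le> M * max 0 (y \<bullet> x + s)"
      proof (cases "y \<bullet> x + s \<ge> 0")
        case True
        then show ?thesis using u M by (simp add: mult_left_le_one_le)
      next
        case False
        then have "u * (M * (y \<bullet> x + s)) \<le> 0" using u M by (simp add: mult_nonneg_nonpos)
        then show ?thesis using u(1) False by simp
      qed
    qed
  qed
  moreover have "(\<lambda>x. ereal (support_function K (x, -1)) + convex_indicator \<A> x) \<in> \<Gamma>"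
    by (rule Gamma_support) (auto simp: K_def)
  ultimately show "(\<lambda>x. ereal (M * max 0 (y \<bullet> x + s)) + convex_indicator \<A> x) \<in> \<Gamma>" by simp
qed

lemma PV_tendsto:
  assumes "Z \<in> PV d k \<Gamma>" "range fs \<subseteq> \<Gamma>" "f \<in> \<Gamma>" "epi_converges fs f"
  shows "(\<lambda>j. Z (fs j)) \<longlonglongrightarrow> Z f"
  using assms by (intro continuous_map_epi_topologyD[OF Gamma_Conv]) (auto simp: PV_def)

lemma PV_scale: "Z \<in> PV d k \<Gamma> \<Longrightarrow> f \<in> \<Gamma> \<Longrightarrow> t > 0 \<Longrightarrow> Z (\<lambda>x. ereal t * f x) = t ^ k * Z f"
  by (auto simp: PV_def)

lemma PV_valuation:
  assumes "Z \<in> PV d k \<Gamma>" "f \<in> \<Gamma>" "h \<in> \<Gamma>" "(\<lambda>x. max (f x) (h x)) \<in> \<Gamma>" "(\<lambda>x. min (f x) (h x)) \<in> \<Gamma>"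
  shows "Z (\<lambda>x. max (f x) (h x)) + Z (\<lambda>x. min (f x) (h x)) = Z f + Z h"
  using assms by (auto simp: PV_def valuation_on_def)

lemma PV_polynomial: "Z \<in> PV d k \<Gamma> \<Longrightarrow> f \<in> \<Gamma> \<Longrightarrow>
    polynomial_of_degree_le d (\<lambda>(y, s). Z (\<lambda>x. f x + ereal (y \<bullet> x + s)))"
  by (auto simp: PV_def polynomial_valued_def)

end

section \<open>The integral functional on the cone\<close>

locale AO_density = AO_setting \<A> \<O> \<Gamma> + tensor_density d \<phi> B
  for \<A> \<O> :: "(real^'n) set" and \<Gamma> d \<phi> and B :: "(real^'n) set" +
  assumes BO: "B \<subseteq> interior \<O>"
begin

lemma B_dom: "f \<in> \<Gamma> \<Longrightarrow> B \<subseteq> effective_domain f"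
  using BO interior_subset Gamma_dom(1) by blast

lemma B_finite: "f \<in> \<Gamma> \<Longrightarrow> x \<in> B \<Longrightarrow> f x = ereal (real_of_ereal (f x))"
  using BO interior_subset Gamma_finite by blast

text \<open>A finite convex function is continuous on an open set, but possibly not up to the
  boundary of \<open>\<O>\<close>; hence \<open>B\<close> is taken in the interior.\<close>

lemma B_continuous:
  assumes f: "f \<in> \<Gamma>" shows "continuous_on B (\<lambda>x. real_of_ereal (f x))"
proof -
  have "convex_on (interior \<O>) (\<lambda>x. real_of_ereal (f x))"
    using f Gamma_Conv Gamma_dom(1)[OF f] interior_subset
    by (intro Conv_convex_on convex_interior O) blast+
  then have "continuous_on (interior \<O>) (\<lambda>x. real_of_ereal (f x))"
    by (rule convex_on_continuous[OF open_interior])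
  then show ?thesis using BO by (rule continuous_on_subset)
qed

lemma hessian_integrand_measurable:
  assumes f: "f \<in> \<Gamma>" shows "hessian_integrand \<phi> f \<in> borel_measurable borel"
proof -
  have [measurable]: "f \<in> borel_measurable borel" using f Gamma_Conv by (intro Conv_borel_measurable) auto
  have "(\<lambda>p. (fst p, (snd p, real_of_ereal (f (fst p))))) \<in> borel_measurable (borel :: ((real^'n) \<times> (real^'n)) measure)"
    by (intro borel_measurable_Pair borel_measurable_continuous_onI borel_measurable_real_of_ereal
        measurable_compose[OF _ \<open>f \<in> borel_measurable borel\<close>] continuous_on_fst continuous_on_snd continuous_on_id)
  from measurable_compose[OF this borel_measurable_continuous_onI[OF cont]]
  show ?thesis by (simp add: hessian_integrand_def case_prod_unfold)
qed

text \<open>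
  Almost every \<open>y\<close> is a subgradient of \<open>f\<close> at one point at most, and if this point lies in the
  support of \<open>\<phi>\<close>, then it is the minimizer on \<open>B\<close>. A minimizer in the interior of \<open>B\<close> is a global one.
\<close>

lemma hessian_integrand_AE:
  assumes f: "f \<in> \<Gamma>"
  shows "AE y in lebesgue. indicator (snd ` subgradient_graph f) y *
      hessian_integrand \<phi> f (rel_selection (subgradient_graph f) y, y)
    = argmin_density (\<lambda>x. real_of_ereal (f x)) y"
proof -
  have fC: "f \<in> Conv" using f Gamma_Conv by blast
  let ?F = "\<lambda>x. real_of_ereal (f x)"
  note cF = B_continuous[OF f]
  show ?thesis
    using AE_monotone_relation_unique[OF subgradient_graph_closed[OF fC] subgradient_graph_mono[OF fC]]
      AE_argmin_unique[OF cF]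
  proof eventually_elim
    case (elim y)
    define x where "x = argmin_on B ?F y"
    have x: "(x, y) \<in> argmin_graph B ?F" unfolding x_def by (rule argmin_on[OF cF])
    have dens: "argmin_density ?F y = \<phi> x (y, ?F x)" by (simp add: argmin_density_def x_def)
    show ?case
    proof (cases "x \<in> interior B")
      case True
      then have g: "(x, y) \<in> subgradient_graph f"
        by (intro argmin_graph_interior_subgradient[OF fC B_dom[OF f] _ x])
      then have y: "y \<in> snd ` subgradient_graph f" by force
      then have "rel_selection (subgradient_graph f) y = x" using elim(1) g rel_selection[OF y] by blast
      then show ?thesis using y dens by (simp add: hessian_integrand_def)
    next
      case False
      then have "x \<notin> tensor_support \<phi>" using supp by blast
      then have 0: "argmin_density ?F y = 0" by (simp add: dens phi_zero)
      have "hessian_integrand \<phi> f (rel_selection (subgradient_graph f) y, y) = 0"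
        if y: "y \<in> snd ` subgradient_graph f"
      proof -
        define x' where "x' = rel_selection (subgradient_graph f) y"
        have g: "(x', y) \<in> subgradient_graph f" unfolding x'_def by (rule rel_selection[OF y])
        have "x' \<notin> tensor_support \<phi>"
        proof
          assume "x' \<in> tensor_support \<phi>"
          then have int: "x' \<in> interior B" by (rule subsetD[OF supp])
          have "(x', y) \<in> argmin_graph B ?F"
            by (rule subgradient_imp_argmin[OF fC B_dom[OF f] subsetD[OF interior_subset int] g])
          then have "x' = x" using elim(2) by (simp add: x_def)
          then show False using int False by simp
        qed
        then show ?thesis by (simp add: hessian_integrand_def phi_zero x'_def)
      qed
      then show ?thesis using 0 by (auto simp: indicator_def)
    qed
  qed
qed

lemma hessian_integral_eq:
  assumes f: "f \<in> \<Gamma>"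
  shows "integrable (hessian_measure0 f) (hessian_integrand \<phi> f)"
    and "integral\<^sup>L (hessian_measure0 f) (hessian_integrand \<phi> f) = argmin_integral (\<lambda>x. real_of_ereal (f x))"
proof -
  have fC: "f \<in> Conv" using f Gamma_Conv by blast
  note meas = rel_selection_measurable[OF subgradient_graph_closed[OF fC] subgradient_graph_mono[OF fC]]
  note AE = hessian_integrand_AE[OF f]
  note int = argmin_density_integrable[OF B_continuous[OF f]]
  have m: "(\<lambda>y. indicator (snd ` subgradient_graph f) y *
      hessian_integrand \<phi> f (rel_selection (subgradient_graph f) y, y)) \<in> borel_measurable lebesgue"
    using measurable_compose[OF meas(1) hessian_integrand_measurable[OF f]] meas(3)
    by (simp add: borel_measurable_restrict_space_iff)
  show "integrable (hessian_measure0 f) (hessian_integrand \<phi> f)"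
    unfolding hessian_measure0_integral(2)[OF fC hessian_integrand_measurable[OF f]]
    using AE int m borel_measurable_integrable[OF int] by (subst integrable_cong_AE) auto
  show "integral\<^sup>L (hessian_measure0 f) (hessian_integrand \<phi> f) = argmin_integral (\<lambda>x. real_of_ereal (f x))"
    unfolding hessian_measure0_integral(1)[OF fC hessian_integrand_measurable[OF f]] argmin_integral_def
    using AE m borel_measurable_integrable[OF int] by (intro integral_cong_AE) auto
qed

abbreviation Zphi :: "(real^'n \<Rightarrow> ereal) \<Rightarrow> real" where
  "Zphi f \<equiv> integral\<^sup>L (hessian_measure0 f) (hessian_integrand \<phi> f)"

lemma Zphi_tendsto:
  assumes fs: "range fs \<subseteq> \<Gamma>" and f: "f \<in> \<Gamma>" and epi: "epi_converges fs f"
  shows "(\<lambda>j. Zphi (fs j)) \<longlonglongrightarrow> Zphi f"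
proof -
  have fsj: "fs j \<in> \<Gamma>" for j using fs by blast
  have C: "range fs \<subseteq> Conv" "f \<in> Conv" using fs f Gamma_Conv by auto
  have "(\<lambda>j. argmin_integral (\<lambda>x. real_of_ereal (fs j x))) \<longlonglongrightarrow> argmin_integral (\<lambda>x. real_of_ereal (f x))"
  proof (rule argmin_integral_tendsto)
    fix x c assume x: "x \<in> B" "c < real_of_ereal (f x)"
    then have "ereal c < f x" using B_finite[OF f x(1)] by (metis less_ereal.simps(1))
    then obtain e where e: "e > 0" "\<forall>\<^sub>F j in sequentially. \<forall>z. dist z x < e \<longrightarrow> ereal c < fs j z"
      using epi_converges_lower[OF C epi] by blast
    from e(2) have "\<forall>\<^sub>F j in sequentially. \<forall>z\<in>B. dist z x < e \<longrightarrow> c < real_of_ereal (fs j z)"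
      by eventually_elim (use B_finite[OF fsj] in \<open>metis less_ereal.simps(1)\<close>)
    then show "\<exists>e>0. \<forall>\<^sub>F j in sequentially. \<forall>z\<in>B. dist z x < e \<longrightarrow> c < real_of_ereal (fs j z)"
      using e(1) by blast
  next
    fix x assume x: "x \<in> interior B"
    then have "x \<in> B" using interior_subset by blast
    obtain X where X: "X \<longlonglongrightarrow> x" "(\<lambda>j. fs j (X j)) \<longlonglongrightarrow> f x"
      using epi unfolding epi_converges_def by blast
    have "(\<lambda>j. real_of_ereal (fs j (X j))) \<longlonglongrightarrow> real_of_ereal (f x)"
      using X(2) B_finite[OF f \<open>x \<in> B\<close>] by (metis lim_real_of_ereal)
    then show "\<exists>X. X \<longlonglongrightarrow> x \<and> (\<lambda>j. real_of_ereal (fs j (X j))) \<longlonglongrightarrow> real_of_ereal (f x)"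
      using X(1) by blast
  qed (intro B_continuous f fsj)+
  then show ?thesis by (simp add: hessian_integral_eq(2)[OF f] hessian_integral_eq(2)[OF fsj])
qed

lemma Zphi_PV: "Zphi \<in> PV d (CARD('n) + d) \<Gamma>"
  unfolding PV_def
proof (intro CollectI conjI ballI allI impI)
  show "continuous_map (subtopology epi_topology \<Gamma>) euclideanreal Zphi"
    by (intro continuous_map_epi_topologyI Gamma_Conv Zphi_tendsto)
  show "valuation_on \<Gamma> Zphi"
    unfolding valuation_on_def
  proof (intro ballI impI, elim conjE)
    fix f h assume fh: "f \<in> \<Gamma>" "h \<in> \<Gamma>" and M: "(\<lambda>x. max (f x) (h x)) \<in> \<Gamma>" and m: "(\<lambda>x. min (f x) (h x)) \<in> \<Gamma>"
    have eqM: "real_of_ereal (max (f x) (h x)) = max (real_of_ereal (f x)) (real_of_ereal (h x))"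
      and eqm: "real_of_ereal (min (f x) (h x)) = min (real_of_ereal (f x)) (real_of_ereal (h x))" if "x \<in> B" for x
      using B_finite[OF fh(1) that] B_finite[OF fh(2) that]
      by (cases "f x"; cases "h x"; simp add: max_def min_def)+
    have "convex_on B (\<lambda>x. real_of_ereal (min (f x) (h x)))"
      using m Gamma_Conv B_dom[OF m] B(2) by (intro Conv_convex_on) auto
    then have "convex_on B (\<lambda>x. min (real_of_ereal (f x)) (real_of_ereal (h x)))"
      by (rule convex_on_eq) (rule eqm)
    from argmin_integral_valuation[OF B_continuous[OF fh(1)] B_continuous[OF fh(2)] this]
    show "Zphi (\<lambda>x. max (f x) (h x)) + Zphi (\<lambda>x. min (f x) (h x)) = Zphi f + Zphi h"
      unfolding hessian_integral_eq(2)[OF fh(1)] hessian_integral_eq(2)[OF fh(2)] hessian_integral_eq(2)[OF M] hessian_integral_eq(2)[OF m]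
      using argmin_integral_cong[OF B_continuous[OF M] eqM] argmin_integral_cong[OF B_continuous[OF m] eqm] by simp
  qed
  show "polynomial_valued d \<Gamma> Zphi"
    unfolding polynomial_valued_def
  proof
    fix f assume f: "f \<in> \<Gamma>"
    have "Zphi (\<lambda>x. f x + ereal (v \<bullet> x + s)) = argmin_integral (\<lambda>x. real_of_ereal (f x) + (v \<bullet> x + s))" for v s
    proof -
      have "real_of_ereal (f x + ereal (v \<bullet> x + s)) = real_of_ereal (f x) + (v \<bullet> x + s)" if "x \<in> B" for x
        using B_finite[OF f that] by (metis plus_ereal.simps(1) real_of_ereal.simps(1))
      then show ?thesis
        unfolding hessian_integral_eq(2)[OF Gamma_affine[OF f]]
        by (intro argmin_integral_cong B_continuous Gamma_affine f) auto
    qed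
    then show "polynomial_of_degree_le d (\<lambda>(y, s). Zphi (\<lambda>x. f x + ereal (y \<bullet> x + s)))"
      using argmin_integral_affine[OF B_continuous[OF f]] by simp
  qed
  fix f and t :: real assume f: "f \<in> \<Gamma>" and t: "t > 0"
  show "Zphi (\<lambda>x. ereal t * f x) = t ^ (CARD('n) + d) * Zphi f"
    unfolding hessian_integral_eq(2)[OF f] hessian_integral_eq(2)[OF Gamma_scale[OF f t]]
    by (subst argmin_integral_scale[OF B_continuous[OF f] t, symmetric])
      (intro argmin_integral_cong B_continuous Gamma_scale f t, simp)
qed

end


section \<open>Criteria for epi-convergence, and the given valuation\<close>

text \<open>Recovery sequences have to be provided only where \<open>f\<close> is finite: at the
  other points the lower half already forces the values to tend to infinity along the constant
  sequence.\<close>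

lemma epi_convergesI:
  fixes f :: "real^'n \<Rightarrow> ereal"
  assumes ninf: "\<And>x. f x \<noteq> -\<infinity>"
    and low: "\<And>x X c. X \<longlonglongrightarrow> x \<Longrightarrow> ereal c < f x \<Longrightarrow> \<forall>\<^sub>F j in sequentially. ereal c < fs j (X j)"
    and up: "\<And>x. f x \<noteq> \<infinity> \<Longrightarrow> \<exists>X. X \<longlonglongrightarrow> x \<and> (\<forall>c. f x < ereal c \<longrightarrow> (\<forall>\<^sub>F j in sequentially. fs j (X j) < ereal c))"
  shows "epi_converges fs f"
  unfolding epi_converges_def
proof (intro allI conjI impI)
  have low': "\<forall>\<^sub>F j in sequentially. a < fs j (X j)" if X: "X \<longlonglongrightarrow> x" and a: "a < f x" for X x a
  proof -
    obtain c where c: "a < ereal c" "ereal c < f x" using ereal_dense2[OF a] by blast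
    from low[OF X c(2)] show ?thesis by eventually_elim (use c(1) in \<open>rule order.strict_trans\<close>)
  qed
  show "f x \<le> liminf (\<lambda>j. fs j (X j))" if "X \<longlonglongrightarrow> x" for x X
    unfolding le_Liminf_iff using low'[OF that] by blast
  show "\<exists>X. X \<longlonglongrightarrow> x \<and> (\<lambda>j. fs j (X j)) \<longlonglongrightarrow> f x" for x
  proof (cases "f x = \<infinity>")
    case True
    have "(\<lambda>j. fs j x) \<longlonglongrightarrow> f x"
      unfolding True tendsto_PInfty using low[of "\<lambda>_. x" x] True by simp
    then show ?thesis by (intro exI[of _ "\<lambda>_. x"]) simp
  next
    case False
    then obtain X where X: "X \<longlonglongrightarrow> x" "\<And>c. f x < ereal c \<Longrightarrow> \<forall>\<^sub>F j in sequentially. fs j (X j) < ereal c"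
      using up by blast
    have "(\<lambda>j. fs j (X j)) \<longlonglongrightarrow> f x"
    proof (rule order_tendstoI)
      fix a assume "f x < a"
      then obtain c where c: "f x < ereal c" "ereal c < a" using ereal_dense2 by blast
      from X(2)[OF c(1)] show "\<forall>\<^sub>F j in sequentially. fs j (X j) < a"
        by eventually_elim (use c(2) in \<open>auto elim: order.strict_trans\<close>)
    qed (rule low'[OF X(1)])
    then show ?thesis using X(1) by blast
  qed
qed

text \<open>Convergence along all convergent sequences is stronger than epi-convergence. At points
  of \<open>A\<close> the constant sequence is a recovery sequence, and off \<open>A\<close> the
  closedness of \<open>A\<close> makes the values infinite eventually.\<close>

lemma epi_converges_indicator_continuous:
  fixes g :: "real^'n \<Rightarrow> real"
  assumes A: "closed A" and g: "\<And>X x. X \<longlonglongrightarrow> x \<Longrightarrow> (\<lambda>j. gs j (X j)) \<longlonglongrightarrow> g x"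
  shows "epi_converges (\<lambda>j x. ereal (gs j x) + convex_indicator A x) (\<lambda>x. ereal (g x) + convex_indicator A x)"
proof (rule epi_convergesI)
  show "ereal (g x) + convex_indicator A x \<noteq> -\<infinity>" for x by (auto simp: convex_indicator_def)
next
  fix x X c assume X: "X \<longlonglongrightarrow> x" and c: "ereal c < ereal (g x) + convex_indicator A x"
  show "\<forall>\<^sub>F j in sequentially. ereal c < ereal (gs j (X j)) + convex_indicator A (X j)"
  proof (cases "x \<in> A")
    case True
    then have "\<forall>\<^sub>F j in sequentially. c < gs j (X j)"
      using c by (intro order_tendstoD(1)[OF g[OF X]]) (simp add: convex_indicator_def)
    then show ?thesis by eventually_elim (simp add: convex_indicator_def)
  next
    case False
    then have "\<forall>\<^sub>F j in sequentially. X j \<in> - A"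
      using X A by (intro topological_tendstoD) auto
    then show ?thesis by eventually_elim (simp add: convex_indicator_def)
  qed
next
  fix x assume "ereal (g x) + convex_indicator A x \<noteq> \<infinity>"
  then have x: "x \<in> A" by (auto simp: convex_indicator_def split: if_splits)
  have "\<forall>\<^sub>F j in sequentially. ereal (gs j x) + convex_indicator A x < ereal c"
    if c: "ereal (g x) + convex_indicator A x < ereal c" for c
  proof -
    have "\<forall>\<^sub>F j in sequentially. gs j x < c"
      using c x by (intro order_tendstoD(2)[OF g[OF tendsto_const]]) (simp add: convex_indicator_def)
    then show ?thesis by eventually_elim (simp add: convex_indicator_def x)
  qed
  then show "\<exists>X. X \<longlonglongrightarrow> x \<and> (\<forall>c. ereal (g x) + convex_indicator A x < ereal c \<longrightarrow>
      (\<forall>\<^sub>F j in sequentially. ereal (gs j (X j)) + convex_indicator A (X j) < ereal c))"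
    by (intro exI[of _ "\<lambda>_. x"]) simp
qed

text \<open>The complement of \<open>S\<close> is covered by open half-spaces, and by Lindelof
  countably many of them suffice. A sequence is needed because hinges are added one at a
  time.\<close>

lemma closed_convex_countable_halfspaces:
  fixes S :: "'a::euclidean_space set"
  assumes "closed S" "convex S"
  obtains ys :: "nat \<Rightarrow> 'a" and ss :: "nat \<Rightarrow> real" where "S = {x. \<forall>i. ys i \<bullet> x + ss i \<le> 0}"
proof -
  define P where "P = {(y, s). \<forall>x\<in>S. y \<bullet> x + s \<le> (0::real)}"
  define H where "H = (\<lambda>(y::'a, s). {x. y \<bullet> x + s > 0})"
  have "open U" if "U \<in> H ` P" for U
    using that by (auto simp: H_def intro!: open_Collect_less continuous_intros)
  then obtain \<F> where F: "\<F> \<subseteq> H ` P" "countable \<F>" "\<Union>\<F> = \<Union>(H ` P)" using Lindelof by metis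
  then obtain Q where Q: "Q \<subseteq> P" "countable Q" "\<F> = H ` Q"
    using countable_subset_image[of \<F> H P] by blast
  \<comment> \<open>The trivial inequality \<open>0 \<le> 0\<close> makes the set nonempty, so that
    it can be enumerated by the natural numbers.\<close>
  define Q' where "Q' = insert (0, 0) Q"
  have Q': "Q' \<subseteq> P" "countable Q'" "Q' \<noteq> {}" using Q by (auto simp: Q'_def P_def)
  define h where "h = from_nat_into Q'"
  have h: "range h = Q'" unfolding h_def using Q'(2,3) by (intro range_from_nat_into) auto
  have "S = {x. \<forall>i. fst (h i) \<bullet> x + snd (h i) \<le> 0}"
  proof (intro equalityI subsetI)
    fix x assume x: "x \<in> S"
    have "h i \<in> P" for i using h Q'(1) by blast
    then show "x \<in> {x. \<forall>i. fst (h i) \<bullet> x + snd (h i) \<le> 0}" using x by (force simp: P_def case_prod_unfold)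
  next
    fix x assume x: "x \<in> {x. \<forall>i. fst (h i) \<bullet> x + snd (h i) \<le> 0}"
    show "x \<in> S"
    proof (rule ccontr)
      assume "x \<notin> S"
      then obtain a b where ab: "a \<bullet> x < b" "\<forall>z\<in>S. b < a \<bullet> z"
        using separating_hyperplane_closed_point[OF assms(2,1)] by blast
      then have "(- a, b) \<in> P" by (force simp: P_def)
      moreover have "x \<in> H (- a, b)" using ab(1) by (simp add: H_def)
      ultimately have "x \<in> \<Union>\<F>" using F(3) by blast
      then obtain q where q: "q \<in> Q" "x \<in> H q" using Q(3) by blast
      then obtain i where "h i = q" using h by (metis Q'_def insertCI rangeE)
      then show False using q(2) x by (auto simp: H_def case_prod_unfold not_le[symmetric])
    qed
  qed
  then show ?thesis by (rule that)
qed

locale PV_setting = AO_setting \<A> \<O> \<Gamma> for \<A> \<O> :: "(real^'n) set" and \<Gamma> +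
  fixes d :: nat and Z :: "(real^'n \<Rightarrow> ereal) \<Rightarrow> real"
  assumes PV: "Z \<in> PV d (CARD('n) + d) \<Gamma>"
begin

lemma Z_scale: "f \<in> \<Gamma> \<Longrightarrow> t > 0 \<Longrightarrow> Z (\<lambda>x. ereal t * f x) = t ^ (CARD('n) + d) * Z f"
  by (rule PV_scale[OF PV])

lemma Z_line:
  assumes "f \<in> \<Gamma>"
  shows "\<exists>a. \<forall>t. Z (\<lambda>x. f x + ereal (t * (y \<bullet> x + s))) = (\<Sum>k\<le>d. a k * t ^ k)"
proof -
  obtain a where a: "\<forall>t. (\<lambda>(y, s). Z (\<lambda>x. f x + ereal (y \<bullet> x + s))) ((0, 0) + t *\<^sub>R (y, s)) = (\<Sum>k\<le>d. a k * t ^ k)"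
    using polynomial_degree_le_line[OF PV_polynomial[OF PV assms], of "(0, 0)" "(y, s)"] by blast
  then have "Z (\<lambda>x. f x + ereal (t * (y \<bullet> x + s))) = (\<Sum>k\<le>d. a k * t ^ k)" for t
    by (simp add: distrib_left)
  then show ?thesis by (intro exI[of _ a] allI)
qed

subsection \<open>Reduction to functions with effective domain \<open>\<O>\<close>\<close>

text \<open>\<open>M\<close> is the weight of the hinge and \<open>\<sigma>\<close> that of the
  affine function itself. For fixed \<open>M\<close> the value of \<open>Z\<close> is polynomial in
  \<open>\<sigma>\<close>; the valuation property transports this to \<open>M\<close>.\<close>

definition hinged :: "(real^'n \<Rightarrow> ereal) \<Rightarrow> real^'n \<Rightarrow> real \<Rightarrow> real \<Rightarrow> real \<Rightarrow> real^'n \<Rightarrow> ereal" where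
  "hinged f y s M \<sigma> = (\<lambda>x. f x + ereal (M * max 0 (y \<bullet> x + s) + \<sigma> * (y \<bullet> x + s)))"

lemma hinged_Gamma:
  assumes "f \<in> \<Gamma>" "M \<ge> 0"
  shows "hinged f y s M \<sigma> \<in> \<Gamma>"
proof -
  have "(\<lambda>x. f x + ereal (M * max 0 (y \<bullet> x + s)) + ereal ((\<sigma> *\<^sub>R y) \<bullet> x + \<sigma> * s)) \<in> \<Gamma>"
    by (intro Gamma_affine Gamma_hinge assms)
  then show ?thesis by (simp add: hinged_def add.assoc distrib_left)
qed

text \<open>The two functions on the right differ by \<open>N\<close> times an affine function, so
  their maximum and minimum switch at the same hyperplane as the hinge and are of the same form.
  \<open>N \<le> M\<close> keeps the hinge weight of the minimum nonnegative.\<close>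

lemma hinged_step:
  assumes f: "f \<in> \<Gamma>" and N: "0 \<le> N" "N \<le> M"
  shows "Z (hinged f y s (M + N) \<sigma>) + Z (hinged f y s (M - N) (\<sigma> + N))
    = Z (hinged f y s M \<sigma>) + Z (hinged f y s M (\<sigma> + N))"
proof -
  have add: "max (f x + ereal a) (f x + ereal b) = f x + ereal (max a b)"
    "min (f x + ereal a) (f x + ereal b) = f x + ereal (min a b)" for x a b
    using Gamma_not_MInf[OF f, of x] by (cases "f x"; simp add: max_def min_def)+
  have "max (M * max 0 l + \<sigma> * l) (M * max 0 l + (\<sigma> + N) * l) = (M + N) * max 0 l + \<sigma> * l" for l
    using N mult_nonneg_nonpos[of N l] by (cases "l \<ge> 0") (auto simp: max_def algebra_simps)
  then have eM: "(\<lambda>x. max (hinged f y s M \<sigma> x) (hinged f y s M (\<sigma> + N) x)) = hinged f y s (M + N) \<sigma>"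
    by (auto simp: hinged_def add)
  have "min (M * max 0 l + \<sigma> * l) (M * max 0 l + (\<sigma> + N) * l) = (M - N) * max 0 l + (\<sigma> + N) * l" for l
    using N mult_nonneg_nonpos[of N l] by (cases "l \<ge> 0") (auto simp: max_def min_def algebra_simps)
  then have em: "(\<lambda>x. min (hinged f y s M \<sigma> x) (hinged f y s M (\<sigma> + N) x)) = hinged f y s (M - N) (\<sigma> + N)"
    by (auto simp: hinged_def add)
  show ?thesis
    using PV_valuation[OF PV hinged_Gamma[OF f, of M y s \<sigma>] hinged_Gamma[OF f, of M y s "\<sigma> + N"]]
      hinged_Gamma[OF f, of "M + N" y s \<sigma>] hinged_Gamma[OF f, of "M - N" y s "\<sigma> + N"] N
    by (simp add: eM em)
qed

text \<open>
  By the previous identity the increments in the direction of the hinge are values of one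
  polynomial.
\<close>

lemma hinged_bounded_imp_const:
  assumes f: "f \<in> \<Gamma>" and bd: "\<And>M. M \<ge> T \<Longrightarrow> \<bar>Z (hinged f y s M 0)\<bar> \<le> R" and M: "M \<ge> 0"
  shows "Z (hinged f y s M 0) = Z f"
proof (cases "M = 0")
  case True
  then show ?thesis by (simp add: hinged_def)
next
  case False
  then have M: "M > 0" using M by simp
  define w where "w j \<sigma> = Z (hinged f y s (real j * M) \<sigma>)" for j :: nat and \<sigma>
  define g where "g \<sigma> = w 1 \<sigma> - w 0 \<sigma>" for \<sigma>
  have inc: "w (Suc j) \<sigma> - w j \<sigma> = g (\<sigma> + real j * M)" for j \<sigma>
  proof (induction j arbitrary: \<sigma>)
    case 0
    then show ?case by (simp add: g_def)
  next
    case (Suc j)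
    have "w (Suc (Suc j)) \<sigma> + w j (\<sigma> + M) = w (Suc j) \<sigma> + w (Suc j) (\<sigma> + M)"
      using hinged_step[OF f, of M "real (Suc j) * M" y s \<sigma>] M by (simp add: w_def algebra_simps)
    then show ?case using Suc[of "\<sigma> + M"] by (simp add: algebra_simps)
  qed
  have poly: "\<exists>a. \<forall>t. w j t = (\<Sum>k\<le>d. a k * t ^ k)" for j
    using Z_line[OF hinged_Gamma[OF f, of "real j * M" y s 0], of y s] M
    by (simp add: w_def hinged_def add.assoc)
  obtain a0 where a0: "\<And>t. w 0 t = (\<Sum>k\<le>d. a0 k * t ^ k)" using poly[of 0] by blast
  obtain a1 where a1': "\<forall>t. w 1 t = (\<Sum>k\<le>d. a1 k * t ^ k)" using poly[of 1] by (elim exE)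
  note a1 = a1'[rule_format]
  define a where "a k = a1 k - a0 k" for k
  have g: "g t = (\<Sum>k\<le>d. a k * t ^ k)" for t
    unfolding g_def a0 a1 by (simp add: a_def left_diff_distrib sum_subtractf)
  obtain j0 where j0: "T \<le> real j0 * M" using M by (metis ex_less_of_nat_mult less_imp_le)
  have wR: "\<bar>w j 0\<bar> \<le> R" if "j \<ge> j0" for j
  proof -
    have "real j0 * M \<le> real j * M" using that M by simp
    then show ?thesis unfolding w_def using j0 by (intro bd) linarith
  qed
  have gR: "\<bar>g (real j * M)\<bar> \<le> 2 * R" if "j \<ge> j0" for j
    using inc[of j 0] wR[of j] wR[of "Suc j"] that by simp
  \<comment> \<open>The increments at \<open>\<sigma> = 0\<close> are the values of \<open>g\<close>
    at \<open>j * M\<close> and are eventually bounded by \<open>2 * R\<close>, which excludes a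
    nonconstant polynomial \<open>g\<close>.\<close>
  have high: "a k = 0" if k: "k \<noteq> 0" "k \<le> d" for k
  proof (rule ccontr)
    assume "a k \<noteq> 0"
    then have "eventually (\<lambda>z. norm (\<Sum>i\<le>d. a i * z ^ i) \<ge> 2 * R + 1) at_infinity"
      using k by (intro polyfun_extremal) auto
    then obtain b where b: "\<And>z. norm z \<ge> b \<Longrightarrow> \<bar>g z\<bar> \<ge> 2 * R + 1"
      unfolding eventually_at_infinity g by auto
    obtain j1 where j1: "b \<le> real j1 * M" using M by (metis ex_less_of_nat_mult less_imp_le)
    have "b \<le> real (max j0 j1) * M" using j1 M by (smt (verit) max.cobounded2 mult_right_mono of_nat_mono)
    then have "\<bar>g (real (max j0 j1) * M)\<bar> \<ge> 2 * R + 1" using M by (intro b) simp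
    then show False using gR[of "max j0 j1"] by simp
  qed
  have gc: "g t = a 0" for t
  proof -
    have "g t = (\<Sum>k\<le>d. if k = 0 then a 0 else 0)" unfolding g by (intro sum.cong refl) (auto simp: high)
    then show ?thesis by simp
  qed
  \<comment> \<open>With constant increments the values grow linearly in \<open>j\<close>, so their
    boundedness leaves only the increment 0.\<close>
  have wlin: "w (j0 + j) 0 = w j0 0 + real j * a 0" for j
  proof (induction j)
    case (Suc j)
    then show ?case using inc[of "j0 + j" 0] gc by (simp add: algebra_simps)
  qed simp
  have "a 0 = 0"
  proof (rule ccontr)
    assume "a 0 \<noteq> 0"
    then obtain j where j: "2 * R < real j * \<bar>a 0\<bar>" using ex_less_of_nat_mult[of "\<bar>a 0\<bar>"] by auto
    have "\<bar>real j * a 0\<bar> \<le> 2 * R" using wlin[of j] wR[of "j0 + j"] wR[of j0] by simp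
    then show False using j by (simp add: abs_mult)
  qed
  then have "w 1 0 = w 0 0" using gc[of 0] by (simp add: g_def)
  then show ?thesis by (simp add: w_def hinged_def)
qed

definition multi_hinged ::
    "(nat \<Rightarrow> real^'n) \<Rightarrow> (nat \<Rightarrow> real) \<Rightarrow> (real^'n \<Rightarrow> ereal) \<Rightarrow> nat \<Rightarrow> (nat \<Rightarrow> real) \<Rightarrow> real^'n \<Rightarrow> ereal" where
  "multi_hinged ys ss f j M = (\<lambda>x. f x + ereal (\<Sum>i<j. M i * max 0 (ys i \<bullet> x + ss i)))"

lemma multi_hinged_Suc: "multi_hinged ys ss f (Suc j) M = multi_hinged ys ss (hinged f (ys j) (ss j) (M j) 0) j M"
  by (simp add: multi_hinged_def hinged_def add.assoc add.commute)

lemma multi_hinged_Gamma: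
  assumes "f \<in> \<Gamma>" "\<And>i. M i \<ge> 0"
  shows "multi_hinged ys ss f j M \<in> \<Gamma>"
  using assms(1)
proof (induction j arbitrary: f)
  case (Suc j)
  show ?case unfolding multi_hinged_Suc by (intro Suc hinged_Gamma assms(2))
qed (simp add: multi_hinged_def)

text \<open>The hinges are removed one at a time. The bound is uniform in all weights above
  \<open>T\<close> so that it survives fixing the last weight and applying the induction hypothesis
  to the others.\<close>

lemma multi_hinged_bounded_imp_const:
  assumes "f \<in> \<Gamma>" "T \<ge> 0" "\<And>M. (\<And>i. M i \<ge> T) \<Longrightarrow> \<bar>Z (multi_hinged ys ss f j M)\<bar> \<le> R"
    and "\<And>i. M i \<ge> T"
  shows "Z (multi_hinged ys ss f j M) = Z f"
  using assms
proof (induction j arbitrary: f M)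
  case 0
  then show ?case by (simp add: multi_hinged_def)
next
  case (Suc j)
  have const: "Z (multi_hinged ys ss (hinged f (ys j) (ss j) m 0) j M') = Z (hinged f (ys j) (ss j) m 0)"
    if m: "m \<ge> T" and M': "\<And>i. M' i \<ge> T" for m M'
  proof (rule Suc.IH[OF _ Suc.prems(2) _ M'])
    show "hinged f (ys j) (ss j) m 0 \<in> \<Gamma>" using m Suc.prems(2) by (intro hinged_Gamma Suc.prems) simp
    fix M'' :: "nat \<Rightarrow> real" assume M'': "\<And>i. T \<le> M'' i"
    have "multi_hinged ys ss (hinged f (ys j) (ss j) m 0) j M'' = multi_hinged ys ss f (Suc j) (M''(j := m))"
      unfolding multi_hinged_Suc by (simp add: multi_hinged_def)
    moreover have "T \<le> (M''(j := m)) i" for i using M'' m by simp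
    from Suc.prems(3)[OF this] have "\<bar>Z (multi_hinged ys ss f (Suc j) (M''(j := m)))\<bar> \<le> R" .
    ultimately show "\<bar>Z (multi_hinged ys ss (hinged f (ys j) (ss j) m 0) j M'')\<bar> \<le> R" by simp
  qed
  have "\<bar>Z (hinged f (ys j) (ss j) m 0)\<bar> \<le> R" if m: "m \<ge> T" for m
  proof -
    have "\<bar>Z (multi_hinged ys ss f (Suc j) ((\<lambda>_. T)(j := m)))\<bar> \<le> R"
      using m by (intro Suc.prems(3)) auto
    moreover have "multi_hinged ys ss f (Suc j) ((\<lambda>_. T)(j := m)) = multi_hinged ys ss (hinged f (ys j) (ss j) m 0) j (\<lambda>_. T)"
      unfolding multi_hinged_Suc by (simp add: multi_hinged_def)
    ultimately show ?thesis using const[OF m, of "\<lambda>_. T"] by simp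
  qed
  then have "Z (hinged f (ys j) (ss j) (M j) 0) = Z f"
    using Suc.prems(2) Suc.prems(4)[of j] by (intro hinged_bounded_imp_const[OF Suc.prems(1)]) auto
  then show ?case unfolding multi_hinged_Suc using const[of "M j" M] Suc.prems(4) by simp
qed

text \<open>Off \<open>\<O>\<close> one violated inequality is enough: once \<open>j\<close> exceeds
  its index, the corresponding term is at least \<open>real j\<close> times a positive number. On
  \<open>\<O>\<close> all hinges vanish.\<close>

lemma multi_hinged_epi_converges:
  assumes f: "f \<in> \<Gamma>" and Oeq: "\<O> = {x. \<forall>i. ys i \<bullet> x + ss i \<le> 0}" and M: "\<And>j i. M j i \<ge> real j"
  shows "epi_converges (\<lambda>j. multi_hinged ys ss f j (M j)) (\<lambda>x. f x + convex_indicator \<O> x)"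
proof (rule epi_convergesI)
  show "f x + convex_indicator \<O> x \<noteq> -\<infinity>" for x
    using Gamma_not_MInf[OF f, of x] by (auto simp: convex_indicator_def)
  have lsc: "lsc f" using f Gamma_Conv by (auto simp: Conv_def)
  have M0: "M j i \<ge> 0" for j i using M[of j i] by (meson of_nat_0_le_iff order_trans)
  have nn: "0 \<le> (\<Sum>i<j. M j i * max 0 (ys i \<bullet> x + ss i))" for j x
    using M0 by (intro sum_nonneg) auto
  fix x X c assume X: "X \<longlonglongrightarrow> x" and c: "ereal c < f x + convex_indicator \<O> x"
  show "\<forall>\<^sub>F j in sequentially. ereal c < multi_hinged ys ss f j (M j) (X j)"
  proof (cases "x \<in> \<O>")
    case True
    then have "ereal c < f x" using c by (simp add: convex_indicator_def)
    from lsc_sequentially[OF lsc X this] show ?thesis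
    proof eventually_elim
      case (elim j)
      have "f (X j) + 0 \<le> f (X j) + ereal (\<Sum>i<j. M j i * max 0 (ys i \<bullet> X j + ss i))"
        using nn by (intro add_left_mono) simp
      then show ?case using elim by (simp add: multi_hinged_def)
    qed
  next
    case False
    then obtain i where i: "ys i \<bullet> x + ss i > 0" using Oeq by (auto simp: not_le)
    obtain b where b: "ereal b < f x"
      using Gamma_not_MInf[OF f, of x] by (metis ereal_dense2 ereal_infty_less(2) less_ereal.simps(5) MInfty_neq_ereal(1) ereal_less_eq(2) order_le_less)
    define l where "l = (ys i \<bullet> x + ss i) / 2"
    have l: "l > 0" using i by (simp add: l_def)
    have "(\<lambda>j. ys i \<bullet> X j + ss i) \<longlonglongrightarrow> ys i \<bullet> x + ss i" by (intro tendsto_intros X)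
    then have "\<forall>\<^sub>F j in sequentially. l < ys i \<bullet> X j + ss i"
      using i by (intro order_tendstoD(1)) (auto simp: l_def)
    moreover have "\<forall>\<^sub>F j in sequentially. real j > (c - b) / l"
      using filterlim_real_sequentially by (simp add: filterlim_at_top_dense)
    ultimately show ?thesis using lsc_sequentially[OF lsc X b] eventually_gt_at_top[of i]
    proof eventually_elim
      case (elim j)
      have "c - b < real j * l" using elim(2) l by (simp add: field_simps)
      also have "\<dots> \<le> M j i * max 0 (ys i \<bullet> X j + ss i)"
        using elim(1) l M[of j i] by (intro mult_mono) auto
      also have "\<dots> \<le> (\<Sum>i<j. M j i * max 0 (ys i \<bullet> X j + ss i))"
        using elim(4) M0 by (intro member_le_sum) auto
      finally have "c < b + (\<Sum>i<j. M j i * max 0 (ys i \<bullet> X j + ss i))" by simp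
      then have "ereal c < ereal b + ereal (\<Sum>i<j. M j i * max 0 (ys i \<bullet> X j + ss i))" by simp
      also have "\<dots> \<le> f (X j) + ereal (\<Sum>i<j. M j i * max 0 (ys i \<bullet> X j + ss i))"
        using elim(3) by (intro add_right_mono) simp
      finally show ?case by (simp add: multi_hinged_def)
    qed
  qed
next
  fix x assume "f x + convex_indicator \<O> x \<noteq> \<infinity>"
  then have x: "x \<in> \<O>" by (auto simp: convex_indicator_def split: if_splits)
  then have "max 0 (ys i \<bullet> x + ss i) = 0" for i using Oeq by auto
  then have "multi_hinged ys ss f j (M j) x = f x" for j by (simp add: multi_hinged_def flip: zero_ereal_def)
  then show "\<exists>X. X \<longlonglongrightarrow> x \<and> (\<forall>c. f x + convex_indicator \<O> x < ereal c \<longrightarrow>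
      (\<forall>\<^sub>F j in sequentially. multi_hinged ys ss f j (M j) (X j) < ereal c))"
    using x by (intro exI[of _ "\<lambda>_. x"]) (simp add: convex_indicator_def)
qed

lemma Z_restrict_O:
  assumes f: "f \<in> \<Gamma>"
  shows "Z (\<lambda>x. f x + convex_indicator \<O> x) = Z f"
proof -
  obtain ys :: "nat \<Rightarrow> real^'n" and ss where Oeq: "\<O> = {x. \<forall>i. ys i \<bullet> x + ss i \<le> 0}"
    using closed_convex_countable_halfspaces[OF O(1,2)] by blast
  define fO where "fO = (\<lambda>x. f x + convex_indicator \<O> x)"
  have fO: "fO \<in> \<Gamma>" unfolding fO_def by (rule Gamma_add[OF f Gamma_O])
  have lim: "(\<lambda>j. Z (multi_hinged ys ss f j (M j))) \<longlonglongrightarrow> Z fO" if M: "\<And>j i. M j i \<ge> real j" for M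
  proof (rule PV_tendsto[OF PV _ fO])
    have "M j i \<ge> 0" for j i using M[of j i] by (meson of_nat_0_le_iff order_trans)
    then show "range (\<lambda>j. multi_hinged ys ss f j (M j)) \<subseteq> \<Gamma>" using multi_hinged_Gamma[OF f] by blast
    show "epi_converges (\<lambda>j. multi_hinged ys ss f j (M j)) fO"
      unfolding fO_def by (rule multi_hinged_epi_converges[OF f Oeq M])
  qed
  \<comment> \<open>The limit is the same for every choice of weights
    \<open>M j i \<ge> real j\<close>. If no uniform bound held eventually, then choosing bad
    weights wherever they exist would contradict this.\<close>
  have "\<exists>j0. \<forall>j\<ge>j0. \<forall>M. (\<forall>i. M i \<ge> real j) \<longrightarrow> \<bar>Z (multi_hinged ys ss f j M)\<bar> \<le> \<bar>Z fO\<bar> + 1"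
  proof (rule ccontr)
    assume neg: "\<not> ?thesis"
    define bad where "bad j M \<longleftrightarrow> (\<forall>i. M i \<ge> real j) \<and> \<not> \<bar>Z (multi_hinged ys ss f j M)\<bar> \<le> \<bar>Z fO\<bar> + 1" for j M
    \<comment> \<open>The default weights at indices without bad ones make the whole sequence
      admissible for \<open>lim\<close>.\<close>
    define M where "M j = (if \<exists>M. bad j M then SOME M. bad j M else (\<lambda>_. real j))" for j
    have badM: "bad j (M j)" if "\<exists>M. bad j M" for j using someI_ex[OF that] that by (simp add: M_def)
    have "M j i \<ge> real j" for j i
      using badM[of j] by (cases "\<exists>M. bad j M") (auto simp: bad_def M_def)
    then have "(\<lambda>j. Z (multi_hinged ys ss f j (M j))) \<longlonglongrightarrow> Z fO" by (rule lim)
    then have "\<forall>\<^sub>F j in sequentially. \<bar>Z (multi_hinged ys ss f j (M j))\<bar> < \<bar>Z fO\<bar> + 1"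
      by (intro order_tendstoD(2)[OF tendsto_rabs]) auto
    then obtain j0 where j0: "\<And>j. j \<ge> j0 \<Longrightarrow> \<bar>Z (multi_hinged ys ss f j (M j))\<bar> < \<bar>Z fO\<bar> + 1"
      unfolding eventually_sequentially by blast
    obtain j M' where "j \<ge> j0" "bad j M'" using neg unfolding bad_def by blast
    then have "bad j (M j)" using badM by blast
    then show False using j0[OF \<open>j \<ge> j0\<close>] by (simp add: bad_def)
  qed
  then obtain j0 where j0: "\<And>j M. j \<ge> j0 \<Longrightarrow> (\<And>i. M i \<ge> real j) \<Longrightarrow> \<bar>Z (multi_hinged ys ss f j M)\<bar> \<le> \<bar>Z fO\<bar> + 1"
    by blast
  have "Z (multi_hinged ys ss f j (\<lambda>_. real j)) = Z f" if "j \<ge> j0" for j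
    by (rule multi_hinged_bounded_imp_const[OF f, of "real j"]) (use j0[OF that] in auto)
  then have "(\<lambda>j. Z (multi_hinged ys ss f j (\<lambda>_. real j))) \<longlonglongrightarrow> Z f"
    by (intro tendsto_eventually) (auto simp: eventually_sequentially)
  moreover have "(\<lambda>j. Z (multi_hinged ys ss f j (\<lambda>_. real j))) \<longlonglongrightarrow> Z fO" by (rule lim) simp
  ultimately have "Z fO = Z f" by (rule LIMSEQ_unique[rotated])
  then show ?thesis by (simp add: fO_def)
qed

text \<open>
  If \<open>f \<ge> 0\<close> vanishes on a large compact subset of the interior of \<open>\<O>\<close>, then any multiple of it is
  close to the indicator of \<open>\<O>\<close>, while \<open>Z\<close> is homogeneous.
\<close>

lemma Z_vanishes_off_compact:
  obtains C where "compact C" "convex C" "C \<noteq> {}" "C \<subseteq> interior \<O>"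
    "\<forall>f\<in>\<Gamma>. (\<forall>x. 0 \<le> f x) \<longrightarrow> (\<forall>x\<in>C. f x = 0) \<longrightarrow> Z f = 0"
proof -
  \<comment> \<open>The points of norm at most \<open>j\<close> whose closed ball of radius
    \<open>1 / (j + 1)\<close> lies in \<open>\<O>\<close>; these compact convex sets approach every
    point of \<open>\<O>\<close>.\<close>
  define C where "C j = {x. norm x \<le> real j} \<inter> (\<Inter>z\<in>cball 0 (1 / real (Suc j)). {x. x + z \<in> \<O>})" for j :: nat
  obtain p r where p: "r > 0" "cball p r \<subseteq> \<O>"
    using O(3) mem_interior_cball by (metis ex_in_conv)
  have Ccl: "closed {x. x + z \<in> \<O>}" for z
  proof -
    have "continuous_on UNIV (\<lambda>x. x + z)" by (intro continuous_intros)
    from closed_vimage[OF O(1) this] show ?thesis by (simp add: vimage_def)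
  qed
  have "closed (C j)" for j
    unfolding C_def by (intro closed_Int closed_INT ballI Ccl closed_Collect_le continuous_intros)
  moreover have "bounded (C j)" for j by (rule bounded_subset[OF bounded_cball[of 0 "real j"]]) (auto simp: C_def)
  ultimately have Ccomp: "compact (C j)" for j by (simp add: compact_eq_bounded_closed)
  have "convex {x. x + z \<in> \<O>}" for z
  proof (rule convexI)
    fix x y :: "real^'n" and u v :: real assume *: "x \<in> {x. x + z \<in> \<O>}" "y \<in> {x. x + z \<in> \<O>}" "0 \<le> u" "0 \<le> v" "u + v = 1"
    then have "u *\<^sub>R (x + z) + v *\<^sub>R (y + z) \<in> \<O>" using O(2) by (auto simp: convex_def)
    also have "u *\<^sub>R (x + z) + v *\<^sub>R (y + z) = u *\<^sub>R x + v *\<^sub>R y + (u + v) *\<^sub>R z" by (simp add: algebra_simps)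
    finally show "u *\<^sub>R x + v *\<^sub>R y \<in> {x. x + z \<in> \<O>}" using * by simp
  qed
  moreover have "convex {x :: real^'n. norm x \<le> real j}" for j
    using convex_cball[of "0 :: real^'n" "real j"] by (simp add: cball_def dist_norm)
  ultimately have Cconv: "convex (C j)" for j unfolding C_def by (intro convex_Int convex_INT) auto
  have Cint: "C j \<subseteq> interior \<O>" for j
  proof
    fix x assume x: "x \<in> C j"
    have "cball x (1 / real (Suc j)) \<subseteq> \<O>"
    proof
      fix w assume "w \<in> cball x (1 / real (Suc j))"
      then have "w - x \<in> cball 0 (1 / real (Suc j))" by (simp add: dist_norm norm_minus_commute)
      then have "x + (w - x) \<in> \<O>" using x unfolding C_def by blast
      then show "w \<in> \<O>" by simp
    qed
    then show "x \<in> interior \<O>" by (intro mem_interior_cball[THEN iffD2] exI[of _ "1 / real (Suc j)"]) simp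
  qed
  have near: "\<exists>X. X \<longlonglongrightarrow> x \<and> (\<forall>\<^sub>F j in sequentially. X j \<in> C j)" if x: "x \<in> \<O>" for x
  proof -
    \<comment> \<open>Moving \<open>x\<close> towards \<open>p\<close> by the fraction
      \<open>t j\<close> carries along the ball of radius \<open>r\<close> about \<open>p\<close>,
      shrunk to radius \<open>t j * r = 1 / (j + 1)\<close>, which is what membership in
      \<open>C j\<close> asks for.\<close>
    define t where "t j = inverse (real (Suc j)) / r" for j
    define X where "X j = (1 - t j) *\<^sub>R x + t j *\<^sub>R p" for j
    have t0: "t \<longlonglongrightarrow> 0" unfolding t_def using tendsto_divide[OF LIMSEQ_inverse_real_of_nat tendsto_const[of r]] p(1) by simp
    then have "X \<longlonglongrightarrow> (1 - 0) *\<^sub>R x + 0 *\<^sub>R p" unfolding X_def by (intro tendsto_intros)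
    then have lim: "X \<longlonglongrightarrow> x" by simp
    have "\<forall>\<^sub>F j in sequentially. t j < 1" using t0 by (intro order_tendstoD(2)) auto
    moreover have "\<forall>\<^sub>F j in sequentially. norm (X j) < norm x + 1"
      by (rule order_tendstoD(2)[OF tendsto_norm[OF lim]]) simp
    moreover have "\<forall>\<^sub>F j in sequentially. real j > norm x + 1"
      using filterlim_real_sequentially by (simp add: filterlim_at_top_dense)
    ultimately have "\<forall>\<^sub>F j in sequentially. X j \<in> C j"
    proof eventually_elim
      case (elim j)
      have tp: "t j > 0" using p(1) by (simp add: t_def)
      have "X j + z \<in> \<O>" if z: "z \<in> cball 0 (1 / real (Suc j))" for z
      proof -
        have "t j * r = 1 / real (Suc j)" using p(1) by (simp add: t_def inverse_eq_divide)
        then have "norm z \<le> t j * r" using z by simp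
        then have "norm ((1 / t j) *\<^sub>R z) \<le> r" using tp by (simp add: field_simps)
        then have "p + (1 / t j) *\<^sub>R z \<in> \<O>" using p(2) by (auto simp: dist_norm)
        then have "(1 - t j) *\<^sub>R x + t j *\<^sub>R (p + (1 / t j) *\<^sub>R z) \<in> \<O>"
          using O(2) x elim(1) tp by (intro convexD_alt) auto
        also have "(1 - t j) *\<^sub>R x + t j *\<^sub>R (p + (1 / t j) *\<^sub>R z) = X j + z"
          using tp by (simp add: X_def algebra_simps)
        finally show ?thesis .
      qed
      then show ?case using elim by (simp add: C_def)
    qed
    then show ?thesis using lim by blast
  qed
  have "p \<in> \<O>" using p by force
  then obtain X where "\<forall>\<^sub>F j in sequentially. X j \<in> C j" using near by blast
  then obtain N where N: "\<And>j. j \<ge> N \<Longrightarrow> C j \<noteq> {}" by (auto simp: eventually_sequentially)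
  have "\<exists>j\<ge>N. \<forall>f\<in>\<Gamma>. (\<forall>x. 0 \<le> f x) \<longrightarrow> (\<forall>x\<in>C j. f x = 0) \<longrightarrow> Z f = 0"
  proof (rule ccontr)
    assume "\<not> ?thesis"
    then have "\<forall>j. \<exists>f. j \<ge> N \<longrightarrow> f \<in> \<Gamma> \<and> (\<forall>x. 0 \<le> f x) \<and> (\<forall>x\<in>C j. f x = 0) \<and> Z f \<noteq> 0" by blast
    then obtain f' where f': "\<And>j. j \<ge> N \<Longrightarrow> f' j \<in> \<Gamma> \<and> (\<forall>x. 0 \<le> f' j x) \<and> (\<forall>x\<in>C j. f' j x = 0) \<and> Z (f' j) \<noteq> 0"
      by metis
    define f where "f j = f' (j + N)" for j
    have f: "f j \<in> \<Gamma>" "\<And>x. 0 \<le> f j x" "\<And>x. x \<in> C (j + N) \<Longrightarrow> f j x = 0" "Z (f j) \<noteq> 0" for j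
      using f'[of "j + N"] by (auto simp: f_def)
    \<comment> \<open>Chosen so that \<open>M j * \<bar>Z (f j)\<bar> \<ge> j\<close>; being at
      least 1, it only grows when raised to the power of homogeneity.\<close>
    define M where "M j = max 1 (real j / \<bar>Z (f j)\<bar>)" for j
    have M: "M j \<ge> 1" for j by (simp add: M_def)
    \<comment> \<open>The indicator fixes the limit outside \<open>\<O>\<close>, where
      \<open>f j\<close> is not controlled, and by \<open>Z_restrict_O\<close> it does not change
      the value of \<open>Z\<close>.\<close>
    define g where "g j = (\<lambda>x. ereal (M j) * f j x + convex_indicator \<O> x)" for j
    have sc: "(\<lambda>x. ereal (M j) * f j x) \<in> \<Gamma>" for j
      using M[of j] by (intro Gamma_scale f) simp
    have gG: "g j \<in> \<Gamma>" for j unfolding g_def by (intro Gamma_add sc Gamma_O)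
    have "epi_converges g (convex_indicator \<O>)"
    proof (rule epi_convergesI)
      show "convex_indicator \<O> x \<noteq> -\<infinity>" for x by (simp add: convex_indicator_def)
      have nn: "0 \<le> ereal (M j) * f j x" for j x using M[of j] f(2) by simp
      have ge: "convex_indicator \<O> x \<le> g j x" for j x
        unfolding g_def using add_right_mono[OF nn[of j x], of "convex_indicator \<O> x"] by simp
      fix x X c assume X: "X \<longlonglongrightarrow> x" and c: "ereal c < convex_indicator \<O> x"
      have "\<forall>\<^sub>F j in sequentially. ereal c < convex_indicator \<O> (X j)"
      proof (cases "x \<in> \<O>")
        case True
        then have "c < 0" using c by (simp add: convex_indicator_def)
        then show ?thesis by (intro always_eventually) (simp add: convex_indicator_def)
      next
        case False
        then have "\<forall>\<^sub>F j in sequentially. X j \<in> - \<O>" using X O(1) by (intro topological_tendstoD) auto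
        then show ?thesis by eventually_elim (simp add: convex_indicator_def)
      qed
      then show "\<forall>\<^sub>F j in sequentially. ereal c < g j (X j)"
        by eventually_elim (erule order.strict_trans2[OF _ ge])
    next
      fix x assume "convex_indicator \<O> x \<noteq> \<infinity>"
      then have x: "x \<in> \<O>" by (auto simp: convex_indicator_def split: if_splits)
      then obtain X where X: "X \<longlonglongrightarrow> x" "\<forall>\<^sub>F j in sequentially. X j \<in> C j" using near by blast
      define Y where "Y j = X (j + N)" for j
      have Y: "Y \<longlonglongrightarrow> x" unfolding Y_def using X(1) by (rule LIMSEQ_ignore_initial_segment)
      have "\<forall>\<^sub>F j in sequentially. Y j \<in> C (j + N)"
        using X(2) unfolding Y_def by (rule eventually_sequentially_seg[THEN iffD2])
      then have "\<forall>\<^sub>F j in sequentially. g j (Y j) = 0"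
      proof eventually_elim
        case (elim j)
        then have "Y j \<in> \<O>" using Cint interior_subset by blast
        then show ?case using f(3)[OF elim] by (simp add: g_def convex_indicator_def)
      qed
      then have "\<forall>c. convex_indicator \<O> x < ereal c \<longrightarrow> (\<forall>\<^sub>F j in sequentially. g j (Y j) < ereal c)"
        using x by (auto simp: convex_indicator_def elim: eventually_mono)
      then show "\<exists>X. X \<longlonglongrightarrow> x \<and> (\<forall>c. convex_indicator \<O> x < ereal c \<longrightarrow> (\<forall>\<^sub>F j in sequentially. g j (X j) < ereal c))"
        using Y by blast
    qed
    then have "(\<lambda>j. Z (g j)) \<longlonglongrightarrow> Z (convex_indicator \<O>)"
      using gG by (intro PV_tendsto[OF PV _ Gamma_O]) auto
    then have "Bseq (\<lambda>j. Z (g j))" by (rule convergent_imp_Bseq[OF convergentI])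
    then obtain K where K: "\<And>j. \<bar>Z (g j)\<bar> \<le> K" unfolding Bseq_def by auto
    have big: "real j \<le> \<bar>Z (g j)\<bar>" for j
    proof -
      have "Z (g j) = M j ^ (CARD('n) + d) * Z (f j)"
        unfolding g_def Z_restrict_O[OF sc] using M[of j] by (intro Z_scale f) simp
      moreover have "M j ^ 1 \<le> M j ^ (CARD('n) + d)" using M[of j] zero_less_card_finite[where 'a='n] by (intro power_increasing) linarith+
      then have "M j * \<bar>Z (f j)\<bar> \<le> M j ^ (CARD('n) + d) * \<bar>Z (f j)\<bar>" by (intro mult_right_mono) auto
      moreover have "real j \<le> M j * \<bar>Z (f j)\<bar>" using f(4)[of j] by (simp add: M_def field_simps max_def)
      ultimately show ?thesis using M[of j] by (simp add: abs_mult)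
    qed
    obtain j :: nat where "K < real j" using reals_Archimedean2 by blast
    then show False using big[of j] K[of j] by simp
  qed
  then obtain j where j: "j \<ge> N" "\<forall>f\<in>\<Gamma>. (\<forall>x. 0 \<le> f x) \<longrightarrow> (\<forall>x\<in>C j. f x = 0) \<longrightarrow> Z f = 0"
    by (elim exE conjE)
  show ?thesis by (rule that[OF Ccomp Cconv N[OF j(1)] Cint j(2)])
qed

end


section \<open>Restricted conjugates\<close>

text \<open>The Legendre conjugate of \<open>u + I_Q\<close>. For compact nonempty \<open>Q\<close>
  and continuous \<open>u\<close> it is finite and Lipschitz on the whole space.\<close>

definition leg :: "('a::euclidean_space \<Rightarrow> real) \<Rightarrow> 'a set \<Rightarrow> 'a \<Rightarrow> real" where
  "leg u Q x = (SUP w\<in>Q. x \<bullet> w - u w)"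

lemma leg_attained:
  assumes "compact Q" "Q \<noteq> {}" "continuous_on Q u"
  obtains w where "w \<in> Q" "leg u Q x = x \<bullet> w - u w"
proof -
  have "continuous_on Q (\<lambda>w. x \<bullet> w - u w)" by (intro continuous_intros assms)
  then obtain w where w: "w \<in> Q" "\<forall>z\<in>Q. x \<bullet> z - u z \<le> x \<bullet> w - u w"
    using continuous_attains_sup[OF assms(1,2)] by blast
  have "leg u Q x = x \<bullet> w - u w"
    unfolding leg_def using w by (intro cSup_eq_maximum) auto
  then show ?thesis using w(1) that by blast
qed

lemma leg_upper:
  assumes "compact Q" "continuous_on Q u" "w \<in> Q"
  shows "x \<bullet> w - u w \<le> leg u Q x"
proof -
  have "compact ((\<lambda>w. x \<bullet> w - u w) ` Q)"
    by (intro compact_continuous_image continuous_intros assms)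
  then show ?thesis unfolding leg_def
    using assms(3) by (intro cSUP_upper bounded_imp_bdd_above compact_imp_bounded)
qed

lemma leg_least: "Q \<noteq> {} \<Longrightarrow> (\<And>w. w \<in> Q \<Longrightarrow> x \<bullet> w - u w \<le> c) \<Longrightarrow> leg u Q x \<le> c"
  unfolding leg_def by (intro cSUP_least)

lemma leg_diff_le:
  assumes Q: "compact Q" "Q \<noteq> {}" "continuous_on Q u" and R: "\<And>w. w \<in> Q \<Longrightarrow> norm w \<le> R"
  shows "\<bar>leg u Q x - leg u Q y\<bar> \<le> norm (x - y) * R"
proof -
  have "leg u Q x \<le> leg u Q y + norm (x - y) * R" for x y
  proof (rule leg_least[OF Q(2)])
    fix w assume w: "w \<in> Q"
    have "(x - y) \<bullet> w \<le> norm (x - y) * norm w" by (rule norm_cauchy_schwarz)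
    also have "\<dots> \<le> norm (x - y) * R" by (intro mult_left_mono R w) auto
    finally show "x \<bullet> w - u w \<le> leg u Q y + norm (x - y) * R"
      using leg_upper[OF Q(1,3) w, of y] by (simp add: inner_diff_left)
  qed
  from this[of x y] this[of y x] show ?thesis by (simp add: norm_minus_commute abs_le_iff)
qed

lemma leg_tendsto:
  assumes Q: "compact Q" "Q \<noteq> {}" "continuous_on Q u" and X: "X \<longlonglongrightarrow> x"
  shows "(\<lambda>j. leg u Q (X j)) \<longlonglongrightarrow> leg u Q x"
proof -
  obtain R where R: "\<And>w. w \<in> Q \<Longrightarrow> norm w \<le> R"
    using compact_imp_bounded[OF Q(1)] unfolding bounded_iff by blast
  have "(\<lambda>j. norm (X j - x) * R) \<longlonglongrightarrow> 0"
    using tendsto_mult_left_zero[OF tendsto_norm_zero[OF LIM_zero[OF X]]] .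
  then have "(\<lambda>j. leg u Q (X j) - leg u Q x) \<longlonglongrightarrow> 0"
    by (rule Lim_null_comparison[rotated]) (use leg_diff_le[OF Q R] in \<open>auto intro!: always_eventually\<close>)
  then show ?thesis by (rule LIM_zero_cancel)
qed

text \<open>A box given by its lower corner and its side lengths, so that cutting and rescaling
  become linear operations on the second argument and degenerate boxes have zero components.\<close>

definition slab :: "'a::euclidean_space \<Rightarrow> 'a \<Rightarrow> 'a set" where
  "slab a t = cbox a (a + t)"

lemma mem_slab: "w \<in> slab a t \<longleftrightarrow> (\<forall>i\<in>Basis. a \<bullet> i \<le> w \<bullet> i \<and> w \<bullet> i \<le> a \<bullet> i + t \<bullet> i)"
  by (simp add: slab_def mem_box inner_add_left)

lemma slab_compact_convex: "compact (slab a t)" "convex (slab a t)"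
  by (simp_all add: slab_def)

lemma slab_nonempty: "(\<And>i. i \<in> Basis \<Longrightarrow> 0 \<le> t \<bullet> i) \<Longrightarrow> a \<in> slab a t"
  by (simp add: mem_slab)

lemma slab_cut:
  fixes a t k :: "'a::euclidean_space"
  assumes k: "k \<in> Basis" and \<tau>: "0 \<le> \<tau>" "\<tau> \<le> t \<bullet> k"
  shows "slab a t \<inter> {w. w \<bullet> k \<le> a \<bullet> k + \<tau>} = slab a (t - (t \<bullet> k - \<tau>) *\<^sub>R k)"
    and "slab a t \<inter> {w. a \<bullet> k + \<tau> \<le> w \<bullet> k} = slab (a + \<tau> *\<^sub>R k) (t - \<tau> *\<^sub>R k)"
    and "slab a t \<inter> {w. w \<bullet> k = a \<bullet> k + \<tau>} = slab (a + \<tau> *\<^sub>R k) (t - (t \<bullet> k) *\<^sub>R k)"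
proof -
  have ki: "k \<bullet> i = (if i = k then 1 else 0)" if "i \<in> Basis" for i
    using that k by (simp add: inner_Basis)
  have all: "(\<forall>i\<in>Basis. P i) \<longleftrightarrow> P k \<and> (\<forall>i\<in>Basis - {k}. P i)" for P using k by blast
  show "slab a t \<inter> {w. w \<bullet> k \<le> a \<bullet> k + \<tau>} = slab a (t - (t \<bullet> k - \<tau>) *\<^sub>R k)"
    "slab a t \<inter> {w. a \<bullet> k + \<tau> \<le> w \<bullet> k} = slab (a + \<tau> *\<^sub>R k) (t - \<tau> *\<^sub>R k)"
    "slab a t \<inter> {w. w \<bullet> k = a \<bullet> k + \<tau>} = slab (a + \<tau> *\<^sub>R k) (t - (t \<bullet> k) *\<^sub>R k)"
    using \<tau> by (auto simp: set_eq_iff mem_slab all inner_diff_left inner_add_left ki k)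
qed

text \<open>\<open>g\<close> plays the role of the gradient. The nonnegative remainder makes
  \<open>u\<close> convex, and the quadratic bound is the form in which a Lipschitz gradient is
  used.\<close>

definition C11 :: "('a::euclidean_space \<Rightarrow> real) \<Rightarrow> ('a \<Rightarrow> 'a) \<Rightarrow> real \<Rightarrow> bool" where
  "C11 u g L \<longleftrightarrow> continuous_on UNIV g \<and>
    (\<forall>w z. 0 \<le> u z - u w - (z - w) \<bullet> g w \<and> u z - u w - (z - w) \<bullet> g w \<le> L * (norm (z - w))\<^sup>2)"

lemma C11_convex:
  fixes u :: "'a::euclidean_space \<Rightarrow> real"
  assumes "C11 u g L"
  shows "convex_on UNIV u"
proof (rule convex_onI)
  fix t :: real and x y :: 'a assume t: "0 < t" "t < 1"
  define w where "w = (1 - t) *\<^sub>R x + t *\<^sub>R y"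
  have "u w + (x - w) \<bullet> g w \<le> u x" "u w + (y - w) \<bullet> g w \<le> u y"
    using assms unfolding C11_def by (smt (verit))+
  then have "(1 - t) * (u w + (x - w) \<bullet> g w) + t * (u w + (y - w) \<bullet> g w) \<le> (1 - t) * u x + t * u y"
    using t by (intro add_mono mult_left_mono) auto
  moreover have "(1 - t) * ((x - w) \<bullet> g w) + t * ((y - w) \<bullet> g w) = ((1 - t) *\<^sub>R x + t *\<^sub>R y - w) \<bullet> g w"
    by (simp add: inner_diff_left inner_add_left algebra_simps)
  moreover have "(1 - t) *\<^sub>R x + t *\<^sub>R y - w = 0" by (simp add: w_def)
  moreover have "(1 - t) * (u w + (x - w) \<bullet> g w) + t * (u w + (y - w) \<bullet> g w)
      = u w + ((1 - t) * ((x - w) \<bullet> g w) + t * ((y - w) \<bullet> g w))" by (simp add: algebra_simps)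
  ultimately show "u ((1 - t) *\<^sub>R x + t *\<^sub>R y) \<le> (1 - t) * u x + t * u y" by (simp add: w_def[symmetric])
qed simp

lemma convex_on_UNIV_continuous: "convex_on UNIV u \<Longrightarrow> continuous_on S (u :: 'a::euclidean_space \<Rightarrow> real)"
  using convex_on_continuous[OF open_UNIV] continuous_on_subset by blast

lemma C11_continuous: "C11 u g L \<Longrightarrow> continuous_on S u"
  by (rule convex_on_UNIV_continuous[OF C11_convex])

text \<open>The dyadic pieces of the box are compared with the volume of dimension \<open>card S\<close>.\<close>

lemma bisection_zero:
  fixes G :: "'a::euclidean_space \<Rightarrow> 'a \<Rightarrow> real"
  assumes S: "S \<subseteq> Basis" and s: "\<And>i. i \<in> Basis \<Longrightarrow> 0 \<le> s \<bullet> i" "\<And>i. i \<in> Basis - S \<Longrightarrow> s \<bullet> i = 0"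
    and split: "\<And>a t k. k \<in> S \<Longrightarrow> (\<And>i. i \<in> Basis \<Longrightarrow> 0 \<le> t \<bullet> i) \<Longrightarrow> (\<And>i. i \<in> Basis - S \<Longrightarrow> t \<bullet> i = 0) \<Longrightarrow>
      G a t = G a (t - (t \<bullet> k / 2) *\<^sub>R k) + G (a + (t \<bullet> k / 2) *\<^sub>R k) (t - (t \<bullet> k / 2) *\<^sub>R k)"
    and lim: "\<And>a a' \<epsilon>. a \<longlonglongrightarrow> a' \<Longrightarrow> (\<And>j. \<epsilon> j > 0) \<Longrightarrow> \<epsilon> \<longlonglongrightarrow> 0 \<Longrightarrow>
      (\<lambda>j. G (a j) (\<epsilon> j *\<^sub>R s) / \<epsilon> j ^ card S) \<longlonglongrightarrow> 0"
  shows "G a0 s = 0"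
proof -
  \<comment> \<open>The box with corner \<open>a\<close> and sides \<open>t\<close> is contained in
    the original one, so that all corners stay in a compact set.\<close>
  define inP where "inP a t \<longleftrightarrow> (\<forall>i\<in>Basis. a0 \<bullet> i \<le> a \<bullet> i \<and> a \<bullet> i + t \<bullet> i \<le> a0 \<bullet> i + s \<bullet> i)" for a t
  have finS: "finite S" using S finite_Basis finite_subset by blast
  have half: "\<bar>G a t\<bar> \<le> 2 ^ card S * \<beta>"
    if t: "\<And>i. i \<in> Basis \<Longrightarrow> 0 \<le> t \<bullet> i" "\<And>i. i \<in> Basis - S \<Longrightarrow> t \<bullet> i = 0"
      and bd: "\<And>a. inP a ((1/2) *\<^sub>R t) \<Longrightarrow> \<bar>G a ((1/2) *\<^sub>R t)\<bar> \<le> \<beta>" and a: "inP a t" for a t \<beta>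
  proof -
    \<comment> \<open>The sides in \<open>U\<close> have full length, the others are halved. Each
      direction added to \<open>U\<close> costs one cut, hence a factor 2.\<close>
    define T where "T U = (1/2) *\<^sub>R t + (\<Sum>k\<in>U. (t \<bullet> k / 2) *\<^sub>R k)" for U
    have Ti: "T U \<bullet> i = (if i \<in> U then t \<bullet> i else t \<bullet> i / 2)" if "U \<subseteq> S" "i \<in> Basis" for U i
    proof -
      have U: "finite U" "U \<subseteq> Basis" using that(1) finS S finite_subset by blast+
      have "(\<Sum>k\<in>U. (t \<bullet> k / 2) *\<^sub>R k) \<bullet> i = (\<Sum>k\<in>U. if k = i then t \<bullet> i / 2 else 0)"
        unfolding inner_sum_left using U(2) that(2) by (intro sum.cong refl) (auto simp: inner_Basis)
      then show ?thesis using U(1) by (simp add: T_def inner_add_left)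
    qed
    have *: "\<bar>G a (T U)\<bar> \<le> 2 ^ card U * \<beta>" if "U \<subseteq> S" "inP a (T U)" for U a
    proof -
      have "finite U" using that(1) finS finite_subset by blast
      then show ?thesis using that
      proof (induction U arbitrary: a rule: finite_induct)
        case empty
        then show ?case using bd by (simp add: T_def)
      next
        case (insert k U)
        have k: "k \<in> S" "k \<in> Basis" "U \<subseteq> S" using insert.prems(1) S by auto
        have Tk: "T (insert k U) \<bullet> k = t \<bullet> k" using Ti[OF insert.prems(1) k(2)] by simp
        have TU: "T (insert k U) - (t \<bullet> k / 2) *\<^sub>R k = T U" using insert.hyps by (simp add: T_def)
        have nn: "0 \<le> T (insert k U) \<bullet> i" if "i \<in> Basis" for i using Ti[OF insert.prems(1) that] t(1)[OF that] by simp
        have z: "T (insert k U) \<bullet> i = 0" if "i \<in> Basis - S" for i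
          using Ti[OF insert.prems(1), of i] t(2)[OF that] that by auto
        have eq: "G a (T (insert k U)) = G a (T U) + G (a + (t \<bullet> k / 2) *\<^sub>R k) (T U)"
          using split[OF k(1) nn z, of a] unfolding Tk TU by blast
        have Pk: "inP a (T U)" "inP (a + (t \<bullet> k / 2) *\<^sub>R k) (T U)"
        proof -
          have "T U \<bullet> i \<le> T (insert k U) \<bullet> i" if "i \<in> Basis" for i
            using Ti[OF k(3) that] Ti[OF insert.prems(1) that] t(1)[OF that] by auto
          then show "inP a (T U)" using insert.prems(2) unfolding inP_def by fastforce
          have "a0 \<bullet> i \<le> (a + (t \<bullet> k / 2) *\<^sub>R k) \<bullet> i \<and> (a + (t \<bullet> k / 2) *\<^sub>R k) \<bullet> i + T U \<bullet> i \<le> a0 \<bullet> i + s \<bullet> i"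
            if i: "i \<in> Basis" for i
          proof -
            have "(a + (t \<bullet> k / 2) *\<^sub>R k) \<bullet> i = a \<bullet> i + (t \<bullet> k / 2) * (k \<bullet> i)" by (simp add: inner_add_left)
            moreover have "(t \<bullet> k / 2) * (k \<bullet> i) + T U \<bullet> i = T (insert k U) \<bullet> i"
              using arg_cong[OF TU, of "\<lambda>v. v \<bullet> i"] by (simp add: inner_diff_left)
            moreover have "0 \<le> (t \<bullet> k / 2) * (k \<bullet> i)" using t(1)[OF k(2)] k(2) i by (simp add: inner_Basis)
            ultimately show ?thesis using insert.prems(2) i unfolding inP_def by fastforce
          qed
          then show "inP (a + (t \<bullet> k / 2) *\<^sub>R k) (T U)" unfolding inP_def by blast
        qed
        show ?case
          using insert.IH[OF k(3) Pk(1)] insert.IH[OF k(3) Pk(2)] insert.hyps unfolding eq by simp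
      qed
    qed
    have "T S = t"
    proof (rule euclidean_eqI)
      fix i :: 'a assume i: "i \<in> Basis"
      show "T S \<bullet> i = t \<bullet> i" using Ti[OF order_refl i] t(2)[of i] i by auto
    qed
    then show ?thesis using *[of S a] a by simp
  qed
  have iter: "\<bar>G a s\<bar> \<le> (2 ^ card S) ^ m * \<beta>"
    if bd: "\<And>a. inP a ((1/2) ^ m *\<^sub>R s) \<Longrightarrow> \<bar>G a ((1/2) ^ m *\<^sub>R s)\<bar> \<le> \<beta>" and a: "inP a s" for a m \<beta>
    using bd
  proof (induction m arbitrary: \<beta>)
    case 0
    then show ?case using a by simp
  next
    case (Suc m)
    have "\<bar>G a ((1/2) ^ m *\<^sub>R s)\<bar> \<le> 2 ^ card S * \<beta>" if "inP a ((1/2) ^ m *\<^sub>R s)" for a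
      using that Suc.prems by (intro half[of "(1/2) ^ m *\<^sub>R s"]) (auto simp: s)
    from Suc.IH[OF this] show ?case by (simp add: mult_ac)
  qed
  \<comment> \<open>Uniformity in the position comes from compactness: corners of counterexamples
    would accumulate, against the assumption on convergent corners.\<close>
  have small: "\<exists>m. \<forall>a. inP a ((1/2) ^ m *\<^sub>R s) \<longrightarrow> \<bar>G a ((1/2) ^ m *\<^sub>R s)\<bar> \<le> \<eta> * ((1/2) ^ m) ^ card S" if \<eta>: "\<eta> > 0" for \<eta>
  proof (rule ccontr)
    assume "\<not> ?thesis"
    then have "\<forall>m. \<exists>a. inP a ((1/2) ^ m *\<^sub>R s) \<and> \<eta> * ((1/2) ^ m) ^ card S < \<bar>G a ((1/2) ^ m *\<^sub>R s)\<bar>"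
      by (auto simp: not_le)
    then obtain a where a: "\<And>m. inP (a m) ((1/2) ^ m *\<^sub>R s)" "\<And>m. \<eta> * ((1/2) ^ m) ^ card S < \<bar>G (a m) ((1/2) ^ m *\<^sub>R s)\<bar>"
      by metis
    have "a m \<in> slab a0 s" for m
    proof -
      have "0 \<le> (1/2) ^ m * (s \<bullet> i)" if "i \<in> Basis" for i using s(1)[OF that] by simp
      then show ?thesis using a(1)[of m] unfolding inP_def mem_slab by fastforce
    qed
    then obtain a' r where r: "strict_mono r" "(a \<circ> r) \<longlonglongrightarrow> a'"
      using slab_compact_convex(1)[of a0 s] unfolding compact_def by metis
    have "(\<lambda>m. (1/2::real) ^ m) \<longlonglongrightarrow> 0" by (intro LIMSEQ_power_zero) simp
    then have e0: "(\<lambda>j. (1/2::real) ^ r j) \<longlonglongrightarrow> 0" using LIMSEQ_subseq_LIMSEQ[OF _ r(1)] by (simp add: o_def)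
    have "(\<lambda>j. G ((a \<circ> r) j) ((1/2) ^ r j *\<^sub>R s) / ((1/2) ^ r j) ^ card S) \<longlonglongrightarrow> 0"
      by (rule lim[OF r(2) _ e0]) simp
    then have "\<forall>\<^sub>F j in sequentially. \<bar>G ((a \<circ> r) j) ((1/2) ^ r j *\<^sub>R s) / ((1/2) ^ r j) ^ card S\<bar> < \<eta>"
      using \<eta> by (intro order_tendstoD(2)[OF tendsto_rabs_zero]) auto
    then obtain j where j: "\<bar>G (a (r j)) ((1/2) ^ r j *\<^sub>R s) / ((1/2) ^ r j) ^ card S\<bar> < \<eta>"
      by (auto simp: eventually_sequentially)
    have "((1/2::real) ^ r j) ^ card S > 0" by simp
    then have "\<bar>G (a (r j)) ((1/2) ^ r j *\<^sub>R s)\<bar> < \<eta> * ((1/2) ^ r j) ^ card S"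
      using j by (simp only: abs_divide abs_of_pos pos_divide_less_eq)
    then show False using a(2)[of "r j"] by simp
  qed
  have "\<bar>G a0 s\<bar> \<le> \<eta>" if \<eta>: "\<eta> > 0" for \<eta>
  proof -
    obtain m where m: "\<forall>a. inP a ((1/2) ^ m *\<^sub>R s) \<longrightarrow> \<bar>G a ((1/2) ^ m *\<^sub>R s)\<bar> \<le> \<eta> * ((1/2) ^ m) ^ card S"
      using small[OF \<eta>] by blast
    have "\<bar>G a0 s\<bar> \<le> (2 ^ card S) ^ m * (\<eta> * ((1/2) ^ m) ^ card S)"
      by (rule iter) (use m in \<open>auto simp: inP_def\<close>)
    also have "(2 ^ card S) ^ m * (\<eta> * ((1/2) ^ m) ^ card S) = \<eta> * ((2 * (1/2)) ^ m) ^ card S"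
      unfolding power_mult_distrib by (simp add: power_mult[symmetric] mult.commute)
    finally show ?thesis by simp
  qed
  then show ?thesis by (metis abs_ge_zero abs_eq_0 dense_ge order_antisym)
qed

section \<open>The valuation as a function of a convex set in the gradient space\<close>

context PV_setting
begin

definition legA :: "(real^'n \<Rightarrow> real) \<Rightarrow> (real^'n) set \<Rightarrow> real^'n \<Rightarrow> ereal" where
  "legA u Q = (\<lambda>x. ereal (leg u Q x) + convex_indicator \<A> x)"

text \<open>\<open>K\<close> is the epigraph of \<open>u\<close> over \<open>Q\<close>, cut off at
  the maximum of \<open>u\<close> to make it compact. In direction \<open>(x, -1)\<close> only its
  lower boundary counts, so its support function there is the restricted conjugate.\<close>

lemma legA_Gamma:
  assumes u: "convex_on UNIV u" and Q: "compact Q" "convex Q" "Q \<noteq> {}"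
  shows "legA u Q \<in> \<Gamma>"
proof -
  note cu = convex_on_UNIV_continuous[OF u]
  obtain m where m: "\<And>w. w \<in> Q \<Longrightarrow> u w \<le> m"
    using continuous_attains_sup[OF Q(1,3) cu] by blast
  obtain l where l: "\<And>w. w \<in> Q \<Longrightarrow> l \<le> u w"
    using continuous_attains_inf[OF Q(1,3) cu] by blast
  define K where "K = (Q \<times> {l..m}) \<inter> {p. u (fst p) \<le> snd p}"
  have "closed {p :: (real^'n) \<times> real. u (fst p) \<le> snd p}"
    by (intro closed_Collect_le continuous_intros continuous_on_compose2[OF cu[of UNIV]]) auto
  then have "compact K" unfolding K_def
    by (intro compact_Int_closed compact_Times Q compact_Icc)
  moreover have "convex K"
  proof -
    have "convex {p :: (real^'n) \<times> real. u (fst p) \<le> snd p}"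
    proof (rule convexI)
      fix p q :: "(real^'n) \<times> real" and a b :: real
      assume *: "p \<in> {p. u (fst p) \<le> snd p}" "q \<in> {p. u (fst p) \<le> snd p}" "0 \<le> a" "0 \<le> b" "a + b = 1"
      have "u (a *\<^sub>R fst p + b *\<^sub>R fst q) \<le> a * u (fst p) + b * u (fst q)"
        using u * unfolding convex_on_def by blast
      also have "\<dots> \<le> a * snd p + b * snd q" using * by (intro add_mono mult_left_mono) auto
      finally show "a *\<^sub>R p + b *\<^sub>R q \<in> {p. u (fst p) \<le> snd p}" by simp
    qed
    then show ?thesis unfolding K_def by (intro convex_Int convex_Times Q) auto
  qed
  moreover have Kne: "K \<noteq> {}"
  proof -
    obtain w where "w \<in> Q" using Q(3) by blast
    then have "(w, u w) \<in> K" using l m by (simp add: K_def)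
    then show ?thesis by blast
  qed
  ultimately have "(\<lambda>x. ereal (support_function K (x, -1)) + convex_indicator \<A> x) \<in> \<Gamma>"
    by (intro Gamma_support)
  moreover have "support_function K (x, -1) = leg u Q x" for x
    unfolding support_function_def
  proof (rule antisym)
    show "(SUP w\<in>K. (x, -1) \<bullet> w) \<le> leg u Q x"
    proof (rule cSUP_least[OF Kne])
      fix p assume p: "p \<in> K"
      then have "fst p \<in> Q" "u (fst p) \<le> snd p" by (auto simp: K_def)
      then show "(x, -1) \<bullet> p \<le> leg u Q x"
        using leg_upper[OF Q(1) cu, of "fst p" x] by (simp add: inner_prod_def)
    qed
    have "bounded ((\<lambda>w. (x, -1) \<bullet> w) ` K)"
      by (intro compact_imp_bounded compact_continuous_image continuous_intros \<open>compact K\<close>)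
    then have bdd: "bdd_above ((\<lambda>w. (x, -1) \<bullet> w) ` K)" by (rule bounded_imp_bdd_above)
    show "leg u Q x \<le> (SUP w\<in>K. (x, -1) \<bullet> w)"
    proof (rule leg_least[OF Q(3)])
      fix w assume "w \<in> Q"
      then have "(w, u w) \<in> K" using l m by (simp add: K_def)
      from cSUP_upper[OF this bdd] show "x \<bullet> w - u w \<le> (SUP w\<in>K. (x, -1) \<bullet> w)"
        by (simp add: inner_prod_def)
    qed
  qed
  ultimately show ?thesis by (simp add: legA_def)
qed

definition E :: "(real^'n \<Rightarrow> real) \<Rightarrow> (real^'n) set \<Rightarrow> real" where
  "E u Q = Z (legA u Q)"

text \<open>The maximum of the conjugates over the two halves is the conjugate over
  \<open>Q\<close>. Their minimum is the conjugate over the common section: a segment joining the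
  halves crosses the hyperplane, and the concavity of
  \<open>w \<mapsto> \<langle>x, w\<rangle> - u w\<close> bounds the smaller end value by the value
  at the crossing.\<close>

lemma E_cut:
  assumes u: "convex_on UNIV u" and Q: "compact Q" "convex Q"
    and ne: "Q \<inter> {w. w \<bullet> k \<le> c} \<noteq> {}" "Q \<inter> {w. c \<le> w \<bullet> k} \<noteq> {}"
  shows "E u Q + E u (Q \<inter> {w. w \<bullet> k = c}) = E u (Q \<inter> {w. w \<bullet> k \<le> c}) + E u (Q \<inter> {w. c \<le> w \<bullet> k})"
proof -
  define Q1 Q2 Q0 where "Q1 = Q \<inter> {w. w \<bullet> k \<le> c}" and "Q2 = Q \<inter> {w. c \<le> w \<bullet> k}" and "Q0 = Q \<inter> {w. w \<bullet> k = c}"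
  note cu = convex_on_UNIV_continuous[OF u]
  have cl: "closed {w. w \<bullet> k \<le> c}" "closed {w. c \<le> w \<bullet> k}" "closed {w. w \<bullet> k = c}"
    by (intro closed_Collect_le closed_Collect_eq continuous_intros)+
  have cv: "convex {w. w \<bullet> k \<le> c}" "convex {w. c \<le> w \<bullet> k}" "convex {w. w \<bullet> k = c}"
    using convex_halfspace_le[where a = k and b = c] convex_halfspace_ge[where a = k and b = c]
      convex_hyperplane[where a = k and b = c]
    by (simp_all add: inner_commute)
  have comp: "compact Q1" "compact Q2" "compact Q0" unfolding Q1_def Q2_def Q0_def
    by (intro compact_Int_closed Q cl)+
  have conv: "convex Q1" "convex Q2" "convex Q0" unfolding Q1_def Q2_def Q0_def
    by (intro convex_Int Q cv)+
  have cross: "\<exists>w\<in>Q0. min (x \<bullet> w1 - u w1) (x \<bullet> w2 - u w2) \<le> x \<bullet> w - u w"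
    if w: "w1 \<in> Q1" "w2 \<in> Q2" for w1 w2 x
  proof -
    \<comment> \<open>If the denominator vanishes, both points lie on the hyperplane and the
      crossing may be taken at \<open>w1\<close>.\<close>
    define t where "t = (if w2 \<bullet> k = w1 \<bullet> k then 0 else (c - w1 \<bullet> k) / (w2 \<bullet> k - w1 \<bullet> k))"
    have le: "w1 \<bullet> k \<le> c" "c \<le> w2 \<bullet> k" "w1 \<in> Q" "w2 \<in> Q" using w by (auto simp: Q1_def Q2_def)
    have t: "0 \<le> t" "t \<le> 1" using le by (auto simp: t_def divide_simps)
    define w where "w = (1 - t) *\<^sub>R w1 + t *\<^sub>R w2"
    have "w \<bullet> k = w1 \<bullet> k + t * (w2 \<bullet> k - w1 \<bullet> k)" by (simp add: w_def inner_add_left algebra_simps)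
    also have "\<dots> = c" using le by (auto simp: t_def)
    finally have "w \<in> Q0" using convexD_alt[OF Q(2) le(3,4) t] by (simp add: Q0_def w_def)
    moreover have "u w \<le> (1 - t) * u w1 + t * u w2"
      unfolding w_def using u t by (intro convex_onD) auto
    moreover have "(1 - t) * min (x \<bullet> w1 - u w1) (x \<bullet> w2 - u w2) + t * min (x \<bullet> w1 - u w1) (x \<bullet> w2 - u w2)
        \<le> (1 - t) * (x \<bullet> w1 - u w1) + t * (x \<bullet> w2 - u w2)"
      using t by (intro add_mono mult_left_mono) auto
    then have "min (x \<bullet> w1 - u w1) (x \<bullet> w2 - u w2) \<le> (1 - t) * (x \<bullet> w1 - u w1) + t * (x \<bullet> w2 - u w2)"
      by (simp add: algebra_simps)
    moreover have "x \<bullet> w = (1 - t) * (x \<bullet> w1) + t * (x \<bullet> w2)" by (simp add: w_def inner_add_right)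
    ultimately show ?thesis by (intro bexI[of _ w]) (simp_all add: algebra_simps)
  qed
  have ne1: "Q1 \<noteq> {}" "Q2 \<noteq> {}" using ne by (auto simp: Q1_def Q2_def)
  have ne0: "Q0 \<noteq> {}" using cross ne1 by blast
  have neQ: "Q \<noteq> {}" using ne by blast
  have sub: "leg u Q' x \<le> leg u Q'' x" if "Q' \<subseteq> Q''" "Q' \<noteq> {}" "compact Q''" for Q' Q'' x
    using that leg_upper[OF that(3) cu] by (intro leg_least) auto
  have max: "max (leg u Q1 x) (leg u Q2 x) = leg u Q x" for x
  proof (rule antisym)
    show "max (leg u Q1 x) (leg u Q2 x) \<le> leg u Q x"
      using sub[of Q1 Q] sub[of Q2 Q] ne1 Q(1) by (simp add: Q1_def Q2_def)
    obtain w where w: "w \<in> Q" "leg u Q x = x \<bullet> w - u w" using leg_attained[OF Q(1) neQ cu] by blast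
    then have "w \<in> Q1 \<or> w \<in> Q2" by (auto simp: Q1_def Q2_def)
    then show "leg u Q x \<le> max (leg u Q1 x) (leg u Q2 x)"
      using w(2) leg_upper[OF comp(1) cu, of w x] leg_upper[OF comp(2) cu, of w x] by auto
  qed
  have min: "min (leg u Q1 x) (leg u Q2 x) = leg u Q0 x" for x
  proof (rule antisym)
    have "Q0 \<subseteq> Q1" "Q0 \<subseteq> Q2" by (auto simp: Q0_def Q1_def Q2_def)
    then show "leg u Q0 x \<le> min (leg u Q1 x) (leg u Q2 x)" using sub ne0 comp by simp
    obtain w1 where w1: "w1 \<in> Q1" "leg u Q1 x = x \<bullet> w1 - u w1" using leg_attained[OF comp(1) ne1(1) cu] by blast
    obtain w2 where w2: "w2 \<in> Q2" "leg u Q2 x = x \<bullet> w2 - u w2" using leg_attained[OF comp(2) ne1(2) cu] by blast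
    obtain w where "w \<in> Q0" "min (leg u Q1 x) (leg u Q2 x) \<le> x \<bullet> w - u w"
      using cross[OF w1(1) w2(1), of x] w1(2) w2(2) by auto
    then show "min (leg u Q1 x) (leg u Q2 x) \<le> leg u Q0 x"
      using leg_upper[OF comp(3) cu, of w x] by simp
  qed
  have eM: "(\<lambda>x. max (legA u Q1 x) (legA u Q2 x)) = legA u Q"
    by (auto simp: legA_def convex_indicator_def max[symmetric])
  have em: "(\<lambda>x. min (legA u Q1 x) (legA u Q2 x)) = legA u Q0"
    by (auto simp: legA_def convex_indicator_def min[symmetric])
  have "Z (legA u Q) + Z (legA u Q0) = Z (legA u Q1) + Z (legA u Q2)"
    using PV_valuation[OF PV legA_Gamma[OF u comp(1) conv(1) ne1(1)] legA_Gamma[OF u comp(2) conv(2) ne1(2)]]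
      legA_Gamma[OF u Q neQ] legA_Gamma[OF u comp(3) conv(3) ne0] by (simp add: eM em)
  then show ?thesis by (simp add: E_def Q1_def Q2_def Q0_def)
qed

lemma E_slab_cut:
  assumes u: "convex_on UNIV u" and t: "\<And>i. i \<in> Basis \<Longrightarrow> 0 \<le> t \<bullet> i" and k: "k \<in> Basis" and \<tau>: "0 \<le> \<tau>" "\<tau> \<le> t \<bullet> k"
  shows "E u (slab a t) + E u (slab (a + \<tau> *\<^sub>R k) (t - (t \<bullet> k) *\<^sub>R k))
    = E u (slab a (t - (t \<bullet> k - \<tau>) *\<^sub>R k)) + E u (slab (a + \<tau> *\<^sub>R k) (t - \<tau> *\<^sub>R k))"
proof -
  have ki: "k \<bullet> i = (if i = k then 1 else 0)" if "i \<in> Basis" for i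
    using that k by (simp add: inner_Basis)
  have "a \<in> slab a (t - (t \<bullet> k - \<tau>) *\<^sub>R k)" "a + \<tau> *\<^sub>R k \<in> slab (a + \<tau> *\<^sub>R k) (t - \<tau> *\<^sub>R k)"
    by (rule slab_nonempty, use t \<tau> k ki in \<open>auto simp: inner_diff_left\<close>)+
  then show ?thesis
    using E_cut[OF u slab_compact_convex, of a t k "a \<bullet> k + \<tau>"] unfolding slab_cut[OF k \<tau>] by blast
qed

end


lemma leg_linear: "leg (\<lambda>w. v \<bullet> w) Q x = leg (\<lambda>_. 0) Q (x - v)"
  by (simp add: leg_def inner_diff_left)

lemma One_inner: "i \<in> Basis \<Longrightarrow> One \<bullet> i = 1"
  by (simp add: inner_sum_left inner_Basis if_distrib cong: if_cong)

lemma integral_small_cube: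
  fixes \<psi> :: "'a::euclidean_space \<Rightarrow> real"
  assumes \<psi>: "continuous_on UNIV \<psi>" and a: "a \<longlonglongrightarrow> a'" and e: "\<And>j. e j > 0" "e \<longlonglongrightarrow> 0"
  shows "(\<lambda>j. integral (slab (a j) (e j *\<^sub>R One)) \<psi> / e j ^ DIM('a)) \<longlonglongrightarrow> \<psi> a'"
proof (rule tendstoI)
  fix \<eta> :: real assume \<eta>: "\<eta> > 0"
  from \<psi>[unfolded continuous_on_iff, rule_format, OF UNIV_I half_gt_zero[OF \<eta>], of a']
  obtain \<delta> where \<delta>: "\<delta> > 0" "\<forall>x. dist x a' < \<delta> \<longrightarrow> dist (\<psi> x) (\<psi> a') < \<eta> / 2"
    by auto
  have "(\<lambda>j. dist (a j) a' + e j * norm (One::'a)) \<longlonglongrightarrow> 0 + 0 * norm (One::'a)"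
    by (intro tendsto_add tendsto_mult tendsto_const e(2) tendsto_dist_iff[THEN iffD1, OF a])
  then have "\<forall>\<^sub>F j in sequentially. dist (a j) a' + e j * norm (One::'a) < \<delta>"
    using \<delta> by (intro order_tendstoD(2)) auto
  then show "\<forall>\<^sub>F j in sequentially. dist (integral (slab (a j) (e j *\<^sub>R One)) \<psi> / e j ^ DIM('a)) (\<psi> a') < \<eta>"
  proof eventually_elim
    case (elim j)
    let ?Q = "slab (a j) (e j *\<^sub>R One)"
    have content: "measure lborel ?Q = e j ^ DIM('a)"
      using e(1)[of j] by (simp add: slab_def content_cbox_cases inner_add_left One_inner)
    have int: "\<psi> integrable_on ?Q"
      unfolding slab_def by (rule integrable_continuous) (rule continuous_on_subset[OF \<psi> subset_UNIV])
    have bound: "norm (\<psi> x - \<psi> a') \<le> \<eta> / 2" if x: "x \<in> ?Q" for x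
    proof -
      have "norm (x - a j) \<le> norm (e j *\<^sub>R (One::'a))"
        using x e(1)[of j] by (intro norm_le_componentwise) (auto simp: mem_slab inner_diff_left One_inner)
      then have "dist x (a j) \<le> e j * norm (One::'a)" using e(1)[of j] by (simp add: dist_norm)
      then have "dist x a' < \<delta>" using dist_triangle[of x a' "a j"] elim by linarith
      then show ?thesis using \<delta> by (force simp: dist_norm)
    qed
    have "((\<lambda>x. \<psi> x - \<psi> a') has_integral (integral ?Q \<psi> - measure lborel ?Q *\<^sub>R \<psi> a')) (cbox (a j) (a j + e j *\<^sub>R One))"
      using int unfolding slab_def by (intro has_integral_diff has_integral_const integrable_integral)
    then have "norm (integral ?Q \<psi> - measure lborel ?Q *\<^sub>R \<psi> a') \<le> \<eta> / 2 * measure lborel (cbox (a j) (a j + e j *\<^sub>R One))"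
      by (rule has_integral_bound[rotated]) (use \<eta> bound in \<open>auto simp: slab_def\<close>)
    then have le: "\<bar>integral ?Q \<psi> - e j ^ DIM('a) * \<psi> a'\<bar> \<le> \<eta> / 2 * e j ^ DIM('a)"
      using content by (simp add: slab_def)
    have pos: "e j ^ DIM('a) > 0" using e(1)[of j] by simp
    have "integral ?Q \<psi> / e j ^ DIM('a) - \<psi> a' = (integral ?Q \<psi> - e j ^ DIM('a) * \<psi> a') / e j ^ DIM('a)"
      using e(1)[of j] by (simp add: diff_divide_distrib)
    then have "\<bar>integral ?Q \<psi> / e j ^ DIM('a) - \<psi> a'\<bar> \<le> \<eta> / 2"
      using le pos by (simp add: abs_divide pos_divide_le_eq)
    then show ?case using \<eta> by (simp add: dist_real_def)
  qed
qed

section \<open>Asymptotics on small boxes, degenerate boxes and cubes\<close>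

context PV_setting
begin

text \<open>The first summand is the support function of the box, moved to the apex
  \<open>x0\<close>; its subgradients at \<open>x0\<close> fill the box. It is the conjugate of the
  linear function \<open>x0\<close> restricted to the box.\<close>

definition pyramid :: "real^'n \<Rightarrow> real^'n \<Rightarrow> real^'n \<Rightarrow> real \<Rightarrow> real \<Rightarrow> real^'n \<Rightarrow> ereal" where
  "pyramid s x0 y c \<tau> = (\<lambda>x. ereal (leg (\<lambda>_. 0) (slab 0 s) (x - x0) + \<tau> * ((x - x0) \<bullet> y + c)) + convex_indicator \<A> x)"

text \<open>The coefficient of \<open>\<tau> ^ d\<close>. Only \<open>s = One\<close> gives the
  density; general side lengths enter for degenerate boxes, where the limit need only exist.\<close>

definition Phi :: "real^'n \<Rightarrow> real^'n \<Rightarrow> real^'n \<Rightarrow> real \<Rightarrow> real" where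
  "Phi s x0 y c = (\<Sum>i\<le>d. leading_weight d i * Z (pyramid s x0 y c (real i)))"

lemma pyramid_affine:
  "(\<lambda>x. legA (\<lambda>w. x0 \<bullet> w) (slab 0 s) x + ereal ((\<tau> *\<^sub>R y) \<bullet> x + \<tau> * (c - x0 \<bullet> y))) = pyramid s x0 y c \<tau>"
proof
  fix x
  have "(\<tau> *\<^sub>R y) \<bullet> x + \<tau> * (c - x0 \<bullet> y) = \<tau> * ((x - x0) \<bullet> y + c)"
    by (simp add: inner_diff_left inner_commute algebra_simps)
  then show "legA (\<lambda>w. x0 \<bullet> w) (slab 0 s) x + ereal ((\<tau> *\<^sub>R y) \<bullet> x + \<tau> * (c - x0 \<bullet> y)) = pyramid s x0 y c \<tau> x"
    unfolding legA_def leg_linear pyramid_def by (simp add: convex_indicator_def)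
qed

lemma linear_convex: "convex_on UNIV (\<lambda>w::real^'n. x0 \<bullet> w + b)"
  by (intro convex_onI) (auto simp: inner_add_right algebra_simps)

lemma pyramid_Gamma:
  assumes "\<And>i. i \<in> Basis \<Longrightarrow> 0 \<le> s \<bullet> i"
  shows "pyramid s x0 y c \<tau> \<in> \<Gamma>"
proof -
  have "legA (\<lambda>w. x0 \<bullet> w) (slab 0 s) \<in> \<Gamma>"
    using slab_nonempty[of s 0, OF assms] linear_convex[of x0 0]
    by (intro legA_Gamma slab_compact_convex) auto
  from Gamma_affine[OF this, of "\<tau> *\<^sub>R y" "\<tau> * (c - x0 \<bullet> y)"] show ?thesis
    by (simp only: pyramid_affine)
qed

lemma pyramid_tendsto:
  assumes s: "\<And>i. i \<in> Basis \<Longrightarrow> 0 \<le> s \<bullet> i" and lim: "X \<longlonglongrightarrow> x0" "Y \<longlonglongrightarrow> y" "C \<longlonglongrightarrow> c"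
  shows "(\<lambda>j. Z (pyramid s (X j) (Y j) (C j) \<tau>)) \<longlonglongrightarrow> Z (pyramid s x0 y c \<tau>)"
proof (rule PV_tendsto[OF PV _ pyramid_Gamma[OF s]])
  show "range (\<lambda>j. pyramid s (X j) (Y j) (C j) \<tau>) \<subseteq> \<Gamma>" using pyramid_Gamma[OF s] by blast
  have ne: "slab 0 s \<noteq> {}" using slab_nonempty[of s 0, OF s] by blast
  show "epi_converges (\<lambda>j. pyramid s (X j) (Y j) (C j) \<tau>) (pyramid s x0 y c \<tau>)"
    unfolding pyramid_def
    by (intro epi_converges_indicator_continuous A tendsto_add tendsto_mult tendsto_const tendsto_inner
        tendsto_diff lim leg_tendsto slab_compact_convex ne continuous_on_const)
qed

lemma Phi_tendsto:
  assumes "\<And>i. i \<in> Basis \<Longrightarrow> 0 \<le> s \<bullet> i" "X \<longlonglongrightarrow> x0" "Y \<longlonglongrightarrow> y" "C \<longlonglongrightarrow> c"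
  shows "(\<lambda>j. Phi s (X j) (Y j) (C j)) \<longlonglongrightarrow> Phi s x0 y c"
  unfolding Phi_def by (intro tendsto_sum tendsto_mult tendsto_const pyramid_tendsto assms)

text \<open>Passing from \<open>c\<close> to the constant term \<open>c - x0 \<bullet> y\<close> is
  a linear change of variables, so the value of \<open>Z\<close> at the pyramid is a polynomial in
  \<open>(y, c)\<close>, and \<open>Phi\<close> is its component of degree \<open>d\<close>.\<close>

lemma Phi_homogeneous:
  assumes s: "\<And>i. i \<in> Basis \<Longrightarrow> 0 \<le> s \<bullet> i"
  shows "homogeneous_polynomial d (\<lambda>(y, c). Phi s x0 y c)"
proof -
  define p where "p = (\<lambda>(y, c). Z (pyramid s x0 y c 1))"
  have legG: "legA (\<lambda>w. x0 \<bullet> w) (slab 0 s) \<in> \<Gamma>"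
    using slab_nonempty[of s 0, OF s] linear_convex[of x0 0]
    by (intro legA_Gamma slab_compact_convex) auto
  have p: "p = (\<lambda>z. (\<lambda>(y, s'). Z (\<lambda>x. legA (\<lambda>w. x0 \<bullet> w) (slab 0 s) x + ereal (y \<bullet> x + s')))
      ((\<lambda>z. (fst z, snd z - x0 \<bullet> fst z)) z))"
    using pyramid_affine[of x0 s 1] by (auto simp: p_def fun_eq_iff)
  have "polynomial_of_degree_le d p"
    unfolding p
  proof (rule polynomial_degree_le_compose[OF PV_polynomial[OF PV legG]])
    fix b :: "(real^'n) \<times> real"
    have "(\<lambda>z. (fst z, snd z - x0 \<bullet> fst z) \<bullet> b) = (\<lambda>z. 0 + z \<bullet> (fst b - snd b *\<^sub>R x0, snd b))"
      by (auto simp: inner_prod_def inner_diff_right inner_commute algebra_simps)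
    then show "polynomial_of_degree_le 1 (\<lambda>z. (fst z, snd z - x0 \<bullet> fst z) \<bullet> b)"
      by (simp only: polynomial_degree_le_affine)
  qed
  then have "homogeneous_polynomial d (\<lambda>z. \<Sum>i\<le>d. leading_weight d i * p (real i *\<^sub>R z))"
    by (rule homogeneous_leading_part)
  moreover have "p (real i *\<^sub>R z) = Z (pyramid s x0 (fst z) (snd z) (real i))" for i z
    by (simp add: p_def case_prod_unfold pyramid_def distrib_left)
  ultimately show ?thesis by (simp add: Phi_def case_prod_unfold)
qed

text \<open>
  Rescaling the small box to \<open>slab 0 s\<close> turns its position and the value of \<open>u\<close> into an affine
  function with coefficients of order \<open>1 / \<epsilon>\<close>, so that only the leading part survives.
\<close>

lemma E_small_box:
  assumes u: "C11 u g L" and s: "\<And>i. i \<in> Basis \<Longrightarrow> 0 \<le> s \<bullet> i"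
    and a: "a \<longlonglongrightarrow> a'" and e: "\<And>j. \<epsilon> j > 0" "\<epsilon> \<longlonglongrightarrow> 0"
  shows "(\<lambda>j. E u (slab (a j) (\<epsilon> j *\<^sub>R s)) / \<epsilon> j ^ CARD('n)) \<longlonglongrightarrow> Phi s (g a') a' (g a' \<bullet> a' - u a')"
proof -
  note cu = C11_continuous[OF u]
  define Q where "Q j = slab (a j) (\<epsilon> j *\<^sub>R s)" for j
  define G where "G j = g (a j)" for j
  define c where "c j = G j \<bullet> a j - u (a j)" for j
  define aff where "aff j x = (x - G j) \<bullet> a j + c j" for j x
  define H where "H j x = leg u (Q j) x / \<epsilon> j - aff j x / \<epsilon> j" for j x
  \<comment> \<open>For fixed \<open>\<tau>\<close> these functions converge; the rescaled conjugate
    itself is the case \<open>\<tau> = 1 / \<epsilon> j\<close>, which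
    \<open>leading_weight_lim\<close> reaches from the fixed values \<open>0..d\<close>.\<close>
  define FF where "FF j \<tau> = (\<lambda>x. ereal (H j x + \<tau> * aff j x) + convex_indicator \<A> x)" for j \<tau>
  define h where "h = leg (\<lambda>_. 0) (slab 0 s)"
  have limG: "G \<longlonglongrightarrow> g a'"
    unfolding G_def using u a by (intro continuous_on_tendsto_compose[of UNIV g]) (auto simp: C11_def)
  have limc: "c \<longlonglongrightarrow> g a' \<bullet> a' - u a'"
    unfolding c_def by (intro tendsto_diff tendsto_inner limG a continuous_on_tendsto_compose[OF cu[of UNIV] a]) auto
  have Qne: "a j \<in> Q j" for j unfolding Q_def using s e(1)[of j] by (intro slab_nonempty) (auto simp: zero_le_mult_iff)
  have Qc: "compact (Q j)" "convex (Q j)" for j unfolding Q_def by (rule slab_compact_convex)+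
  have ne0: "slab 0 s \<noteq> {}" using slab_nonempty[of s 0, OF s] by blast
  have legG: "legA u (Q j) \<in> \<Gamma>" for j using Qne by (intro legA_Gamma C11_convex[OF u] Qc) auto
  have FG: "FF j \<tau> \<in> \<Gamma>" for j \<tau>
  proof -
    define \<sigma> where "\<sigma> = \<tau> - 1 / \<epsilon> j"
    have "(\<lambda>x. ereal (1 / \<epsilon> j) * legA u (Q j) x + ereal ((\<sigma> *\<^sub>R a j) \<bullet> x + \<sigma> * (c j - G j \<bullet> a j))) \<in> \<Gamma>"
      using e(1)[of j] by (intro Gamma_affine Gamma_scale legG) simp
    moreover have "(\<lambda>x. ereal (1 / \<epsilon> j) * legA u (Q j) x + ereal ((\<sigma> *\<^sub>R a j) \<bullet> x + \<sigma> * (c j - G j \<bullet> a j))) = FF j \<tau>"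
      using e(1)[of j]
      by (auto simp: fun_eq_iff legA_def FF_def H_def aff_def convex_indicator_def \<sigma>_def inner_diff_left
          inner_diff_right inner_commute field_simps)
    ultimately show ?thesis by simp
  qed
  have EF: "E u (Q j) = \<epsilon> j ^ (CARD('n) + d) * Z (FF j (1 / \<epsilon> j))" for j
  proof -
    have "legA u (Q j) = (\<lambda>x. ereal (\<epsilon> j) * FF j (1 / \<epsilon> j) x)"
      using e(1)[of j] by (auto simp: fun_eq_iff legA_def FF_def H_def convex_indicator_def field_simps)
    then show ?thesis unfolding E_def using Z_scale[OF FG e(1)] by simp
  qed
  have poly: "\<exists>b. \<forall>t. Z (FF j t) = (\<Sum>k\<le>d. b k * t ^ k)" for j
  proof -
    have "(\<lambda>x. FF j 0 x + ereal (t * (a j \<bullet> x + (c j - G j \<bullet> a j)))) = FF j t" for t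
      by (auto simp: fun_eq_iff FF_def aff_def convex_indicator_def inner_diff_left inner_commute algebra_simps)
    then show ?thesis using Z_line[OF FG[of j 0], of "a j" "c j - G j \<bullet> a j"] by simp
  qed
  then obtain b where b: "\<And>j t. Z (FF j t) = (\<Sum>k\<le>d. b j k * t ^ k)" by metis
  have up: "H j x \<le> h (x - G j)" for j x
  proof -
    have "leg u (Q j) x \<le> \<epsilon> j * h (x - G j) + aff j x"
    proof (rule leg_least)
      show "Q j \<noteq> {}" using Qne by blast
      fix w assume w: "w \<in> Q j"
      define t where "t = (1 / \<epsilon> j) *\<^sub>R (w - a j)"
      have wt: "w = a j + \<epsilon> j *\<^sub>R t" using e(1)[of j] by (simp add: t_def)
      have "t \<in> slab 0 s" using w e(1)[of j] unfolding wt Q_def mem_slab by (auto simp: inner_add_left zero_le_mult_iff)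
      from leg_upper[OF slab_compact_convex(1) continuous_on_const this, of "x - G j" 0]
      have "(x - G j) \<bullet> t \<le> h (x - G j)" by (simp add: h_def)
      then have "\<epsilon> j * ((x - G j) \<bullet> t) \<le> \<epsilon> j * h (x - G j)" using e(1)[of j] by (intro mult_left_mono) auto
      moreover have "0 \<le> u w - u (a j) - (w - a j) \<bullet> G j" using u unfolding C11_def G_def by blast
      ultimately show "x \<bullet> w - u w \<le> \<epsilon> j * h (x - G j) + aff j x"
        by (simp add: wt aff_def c_def inner_add_right inner_diff_left inner_commute algebra_simps)
    qed
    then show ?thesis using e(1)[of j] by (simp add: H_def field_simps)
  qed
  \<comment> \<open>The quadratic bound enters here: the remainder of \<open>u\<close> over the box
    is of order \<open>\<epsilon>^2\<close>, and the rescaling costs one factor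
    \<open>\<epsilon>\<close>.\<close>
  have low: "h (x - G j) - \<epsilon> j * (\<bar>L\<bar> * (norm s)\<^sup>2) \<le> H j x" for j x
  proof -
    obtain t where t: "t \<in> slab 0 s" "h (x - G j) = (x - G j) \<bullet> t - 0"
      unfolding h_def by (rule leg_attained[OF slab_compact_convex(1) ne0 continuous_on_const])
    define w where "w = a j + \<epsilon> j *\<^sub>R t"
    have w: "w \<in> Q j" using t(1) e(1)[of j] by (auto simp: Q_def w_def mem_slab inner_add_left)
    have nt: "norm t \<le> norm s" using t(1) by (intro norm_le_componentwise) (auto simp: mem_slab)
    have "u w - u (a j) - (w - a j) \<bullet> G j \<le> L * (norm (w - a j))\<^sup>2" using u unfolding C11_def G_def by blast
    also have "\<dots> \<le> \<bar>L\<bar> * (norm (w - a j))\<^sup>2" by (intro mult_right_mono) auto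
    also have "(norm (w - a j))\<^sup>2 = (\<epsilon> j)\<^sup>2 * (norm t)\<^sup>2" by (simp add: w_def power_mult_distrib)
    also have "\<bar>L\<bar> * \<dots> \<le> \<bar>L\<bar> * ((\<epsilon> j)\<^sup>2 * (norm s)\<^sup>2)" by (intro mult_left_mono power_mono nt) auto
    finally have "u w - u (a j) - (w - a j) \<bullet> G j \<le> \<epsilon> j * (\<epsilon> j * (\<bar>L\<bar> * (norm s)\<^sup>2))"
      by (simp add: power2_eq_square algebra_simps)
    moreover have "x \<bullet> w - u w \<le> leg u (Q j) x" by (rule leg_upper[OF Qc(1) cu w])
    ultimately have "\<epsilon> j * (h (x - G j) - \<epsilon> j * (\<bar>L\<bar> * (norm s)\<^sup>2)) \<le> leg u (Q j) x - aff j x"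
      by (simp add: t(2) w_def aff_def c_def inner_add_right inner_diff_left inner_commute algebra_simps)
    then show ?thesis using e(1)[of j] unfolding H_def diff_divide_distrib[symmetric]
      by (simp add: pos_le_divide_eq mult.commute)
  qed
  have limZ: "(\<lambda>j. Z (FF j \<tau>)) \<longlonglongrightarrow> Z (pyramid s (g a') a' (g a' \<bullet> a' - u a') \<tau>)" for \<tau>
  proof (rule PV_tendsto[OF PV _ pyramid_Gamma[OF s]])
    show "range (\<lambda>j. FF j \<tau>) \<subseteq> \<Gamma>" using FG by blast
    have "(\<lambda>j. H j (X j) + \<tau> * aff j (X j)) \<longlonglongrightarrow> h (x - g a') + \<tau> * ((x - g a') \<bullet> a' + (g a' \<bullet> a' - u a'))"
      if X: "X \<longlonglongrightarrow> x" for X x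
    proof (intro tendsto_add tendsto_mult tendsto_const)
      have hl: "(\<lambda>j. h (X j - G j)) \<longlonglongrightarrow> h (x - g a')"
        unfolding h_def by (intro leg_tendsto slab_compact_convex ne0 continuous_on_const tendsto_diff X limG)
      have "(\<lambda>j. h (X j - G j) - \<epsilon> j * (\<bar>L\<bar> * (norm s)\<^sup>2)) \<longlonglongrightarrow> h (x - g a') - 0 * (\<bar>L\<bar> * (norm s)\<^sup>2)"
        by (intro tendsto_diff hl tendsto_mult e(2) tendsto_const)
      then have l: "(\<lambda>j. h (X j - G j) - \<epsilon> j * (\<bar>L\<bar> * (norm s)\<^sup>2)) \<longlonglongrightarrow> h (x - g a')" by simp
      show "(\<lambda>j. H j (X j)) \<longlonglongrightarrow> h (x - g a')"
        by (rule tendsto_sandwich[OF _ _ l hl]) (auto intro: up low always_eventually)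
      show "(\<lambda>j. aff j (X j)) \<longlonglongrightarrow> (x - g a') \<bullet> a' + (g a' \<bullet> a' - u a')"
        unfolding aff_def by (intro tendsto_add tendsto_inner tendsto_diff X limG limc a)
    qed
    then show "epi_converges (\<lambda>j. FF j \<tau>) (pyramid s (g a') a' (g a' \<bullet> a' - u a') \<tau>)"
      unfolding FF_def pyramid_def h_def[symmetric]
      by (intro epi_converges_indicator_continuous A)
  qed
  have top: "filterlim (\<lambda>j. 1 / \<epsilon> j) at_top sequentially"
    using filterlim_inverse_at_top[OF e(2)] e(1) by (simp add: inverse_eq_divide)
  have "(\<lambda>j. Z (FF j (1 / \<epsilon> j)) / (1 / \<epsilon> j) ^ d) \<longlonglongrightarrow> Phi s (g a') a' (g a' \<bullet> a' - u a')"
    unfolding Phi_def by (rule leading_weight_lim[where p = "\<lambda>j t. Z (FF j t)", OF b top limZ])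
  moreover have "Z (FF j (1 / \<epsilon> j)) / (1 / \<epsilon> j) ^ d = E u (Q j) / \<epsilon> j ^ CARD('n)" for j
    using e(1)[of j] by (simp add: EF power_add power_divide)
  ultimately show ?thesis by (simp add: Q_def)
qed

lemma E_split_half:
  assumes u: "convex_on UNIV u" and t: "\<And>i. i \<in> Basis \<Longrightarrow> 0 \<le> t \<bullet> i" and k: "k \<in> Basis"
    and 0: "E u (slab (a + (t \<bullet> k / 2) *\<^sub>R k) (t - (t \<bullet> k) *\<^sub>R k)) = 0"
  shows "E u (slab a t) = E u (slab a (t - (t \<bullet> k / 2) *\<^sub>R k))
    + E u (slab (a + (t \<bullet> k / 2) *\<^sub>R k) (t - (t \<bullet> k / 2) *\<^sub>R k))"
proof -
  have "t \<bullet> k - t \<bullet> k / 2 = t \<bullet> k / 2" by simp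
  then show ?thesis using E_slab_cut[OF u t k, of "t \<bullet> k / 2" a] 0 t[OF k] by simp
qed

text \<open>Induction on the number of nonzero sides. The sections produced by halving have fewer,
  so they contribute nothing and \<open>E\<close> is additive. On boxes of size
  \<open>\<epsilon>\<close> it is of order \<open>\<epsilon>^n\<close>, which is negligible against
  \<open>\<epsilon>\<close> to the smaller dimension of the box.\<close>

lemma E_degenerate_C11:
  assumes u: "C11 u g L" and s: "\<And>i. i \<in> Basis \<Longrightarrow> 0 \<le> s \<bullet> i" and k: "k \<in> Basis" "s \<bullet> k = 0"
  shows "E u (slab a s) = 0"
  using s k
proof (induction "card {i \<in> Basis. s \<bullet> i \<noteq> 0}" arbitrary: a s k rule: less_induct)
  case less
  define S where "S = {i \<in> Basis. s \<bullet> i \<noteq> 0}"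
  have S: "S \<subseteq> Basis" "finite S" by (auto simp: S_def)
  have "S \<subset> Basis" using less.prems by (auto simp: S_def)
  then have cardS: "card S < CARD('n)" using psubset_card_mono[OF finite_Basis] by (metis DIM_cart DIM_real mult.right_neutral)
  show ?case
  proof (rule bisection_zero[OF S(1) less.prems(1)])
    show "s \<bullet> i = 0" if "i \<in> Basis - S" for i using that by (auto simp: S_def)
  next
    fix a t k assume kS: "k \<in> S" and t: "\<And>i. i \<in> Basis \<Longrightarrow> 0 \<le> t \<bullet> i" "\<And>i. i \<in> Basis - S \<Longrightarrow> t \<bullet> i = 0"
    have kB: "k \<in> Basis" using kS S by blast
    define t' where "t' = t - (t \<bullet> k) *\<^sub>R k"
    have t'i: "t' \<bullet> i = (if i = k then 0 else t \<bullet> i)" if "i \<in> Basis" for i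
      using that kB by (auto simp: t'_def inner_diff_left inner_Basis)
    have "{i \<in> Basis. t' \<bullet> i \<noteq> 0} \<subseteq> S - {k}"
    proof
      fix i assume "i \<in> {i \<in> Basis. t' \<bullet> i \<noteq> 0}"
      then have i: "i \<in> Basis" "i \<noteq> k" "t \<bullet> i \<noteq> 0" using t'i[of i] by (auto split: if_splits)
      then show "i \<in> S - {k}" using t(2)[of i] by auto
    qed
    then have "card {i \<in> Basis. t' \<bullet> i \<noteq> 0} < card S"
      using kS S(2) by (meson card_Diff1_less card_mono finite_Diff le_less_trans)
    then have "E u (slab (a + (t \<bullet> k / 2) *\<^sub>R k) t') = 0"
      using t'i t(1) kB by (intro less.hyps[of t' k]) (auto simp: S_def)
    then show "E u (slab a t) = E u (slab a (t - (t \<bullet> k / 2) *\<^sub>R k))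
      + E u (slab (a + (t \<bullet> k / 2) *\<^sub>R k) (t - (t \<bullet> k / 2) *\<^sub>R k))"
      unfolding t'_def by (intro E_split_half C11_convex[OF u] t kB)
  next
    fix a :: "nat \<Rightarrow> real^'n" and a' \<epsilon>
    assume lim: "a \<longlonglongrightarrow> a'" "\<And>j. \<epsilon> j > (0::real)" "\<epsilon> \<longlonglongrightarrow> 0"
    have "(\<lambda>j. E u (slab (a j) (\<epsilon> j *\<^sub>R s)) / \<epsilon> j ^ CARD('n) * \<epsilon> j ^ (CARD('n) - card S))
        \<longlonglongrightarrow> Phi s (g a') a' (g a' \<bullet> a' - u a') * 0 ^ (CARD('n) - card S)"
      by (intro tendsto_mult E_small_box[OF u less.prems(1) lim] tendsto_power lim)
    moreover have "E u (slab (a j) (\<epsilon> j *\<^sub>R s)) / \<epsilon> j ^ CARD('n) * \<epsilon> j ^ (CARD('n) - card S)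
        = E u (slab (a j) (\<epsilon> j *\<^sub>R s)) / \<epsilon> j ^ card S" for j
    proof -
      have "\<epsilon> j ^ CARD('n) = \<epsilon> j ^ card S * \<epsilon> j ^ (CARD('n) - card S)"
        using cardS by (simp flip: power_add)
      then show ?thesis using lim(2)[of j] by simp
    qed
    ultimately show "(\<lambda>j. E u (slab (a j) (\<epsilon> j *\<^sub>R s)) / \<epsilon> j ^ card S) \<longlonglongrightarrow> 0"
      using cardS by (simp add: power_0_left)
  qed
qed

text \<open>The difference of both sides is additive under halving, since the sections are
  degenerate, and it is \<open>o(\<epsilon>^n)\<close> on small cubes because both sides have the
  same density; bisection makes it vanish.\<close>

lemma E_cube:
  assumes u: "C11 u g L" and r: "r > 0"
  shows "E u (slab a (r *\<^sub>R One)) = integral (slab a (r *\<^sub>R One)) (\<lambda>w. Phi One (g w) w (g w \<bullet> w - u w))"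
proof -
  define \<psi> where "\<psi> w = Phi One (g w) w (g w \<bullet> w - u w)" for w
  have one: "0 \<le> (One::real^'n) \<bullet> i" if "i \<in> Basis" for i using that by (simp add: One_inner)
  have g: "continuous_on UNIV g" using u by (simp add: C11_def)
  have cont: "continuous_on UNIV \<psi>"
    unfolding continuous_on_sequentially comp_def
  proof (intro allI ballI impI, elim conjE)
    fix X and x :: "real^'n" assume X: "X \<longlonglongrightarrow> x"
    have G: "(\<lambda>j. g (X j)) \<longlonglongrightarrow> g x" by (rule continuous_on_tendsto_compose[OF g X]) auto
    show "(\<lambda>j. \<psi> (X j)) \<longlonglongrightarrow> \<psi> x"
      unfolding \<psi>_def
      by (intro Phi_tendsto one G X tendsto_diff tendsto_inner continuous_on_tendsto_compose[OF C11_continuous[OF u, of UNIV] X]) auto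
  qed
  have "E u (slab a (r *\<^sub>R One)) - integral (slab a (r *\<^sub>R One)) \<psi> = 0"
  proof (rule bisection_zero[where S = Basis and G = "\<lambda>a t. E u (slab a t) - integral (slab a t) \<psi>"])
    show "0 \<le> (r *\<^sub>R One :: real^'n) \<bullet> i" if "i \<in> Basis" for i using r one[OF that] by simp
  next
    fix a t k :: "real^'n" assume k: "k \<in> Basis" and t: "\<And>i. i \<in> Basis \<Longrightarrow> 0 \<le> t \<bullet> i"
    define t' where "t' = t - (t \<bullet> k) *\<^sub>R k"
    have "0 \<le> t' \<bullet> i" if "i \<in> Basis" for i
      using that k t by (auto simp: t'_def inner_diff_left inner_Basis)
    moreover have "t' \<bullet> k = 0" using k by (simp add: t'_def inner_diff_left)
    ultimately have "E u (slab (a + (t \<bullet> k / 2) *\<^sub>R k) t') = 0"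
      using k by (intro E_degenerate_C11[OF u, of t' k])
    then have "E u (slab a t) = E u (slab a (t - (t \<bullet> k / 2) *\<^sub>R k))
      + E u (slab (a + (t \<bullet> k / 2) *\<^sub>R k) (t - (t \<bullet> k / 2) *\<^sub>R k))"
      unfolding t'_def by (intro E_split_half C11_convex[OF u] t k)
    moreover have "integral (slab a t) \<psi> = integral (slab a (t - (t \<bullet> k / 2) *\<^sub>R k)) \<psi>
      + integral (slab (a + (t \<bullet> k / 2) *\<^sub>R k) (t - (t \<bullet> k / 2) *\<^sub>R k)) \<psi>"
    proof -
      have int: "\<psi> integrable_on cbox a (a + t)"
        by (rule integrable_continuous) (rule continuous_on_subset[OF cont subset_UNIV])
      have h: "t \<bullet> k - t \<bullet> k / 2 = t \<bullet> k / 2" by simp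
      show ?thesis
        using integral_split[OF int k, of "a \<bullet> k + t \<bullet> k / 2"] slab_cut(1,2)[OF k, of "t \<bullet> k / 2" t a] t[OF k]
        by (simp add: slab_def[of a t, symmetric] h)
    qed
    ultimately show "E u (slab a t) - integral (slab a t) \<psi>
      = E u (slab a (t - (t \<bullet> k / 2) *\<^sub>R k)) - integral (slab a (t - (t \<bullet> k / 2) *\<^sub>R k)) \<psi>
      + (E u (slab (a + (t \<bullet> k / 2) *\<^sub>R k) (t - (t \<bullet> k / 2) *\<^sub>R k))
        - integral (slab (a + (t \<bullet> k / 2) *\<^sub>R k) (t - (t \<bullet> k / 2) *\<^sub>R k)) \<psi>)"
      by simp
  next
    fix a :: "nat \<Rightarrow> real^'n" and a' \<epsilon>
    assume lim: "a \<longlonglongrightarrow> a'" "\<And>j. \<epsilon> j > (0::real)" "\<epsilon> \<longlonglongrightarrow> 0"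
    have e: "\<epsilon> j * r > 0" for j using lim(2) r by simp
    have e0: "(\<lambda>j. \<epsilon> j * r) \<longlonglongrightarrow> 0" using tendsto_mult[OF lim(3) tendsto_const[of r]] by simp
    have "(\<lambda>j. r ^ CARD('n) * (E u (slab (a j) ((\<epsilon> j * r) *\<^sub>R One)) / (\<epsilon> j * r) ^ CARD('n)
        - integral (slab (a j) ((\<epsilon> j * r) *\<^sub>R One)) \<psi> / (\<epsilon> j * r) ^ DIM(real^'n)))
      \<longlonglongrightarrow> r ^ CARD('n) * (\<psi> a' - \<psi> a')"
      unfolding \<psi>_def[of a']
      by (intro tendsto_mult tendsto_diff tendsto_const E_small_box[OF u one lim(1) e e0]
          integral_small_cube[OF cont lim(1) e e0, unfolded \<psi>_def[of a']])
    moreover have "r ^ CARD('n) * (E u (slab (a j) ((\<epsilon> j * r) *\<^sub>R One)) / (\<epsilon> j * r) ^ CARD('n)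
        - integral (slab (a j) ((\<epsilon> j * r) *\<^sub>R One)) \<psi> / (\<epsilon> j * r) ^ DIM(real^'n))
      = (E u (slab (a j) (\<epsilon> j *\<^sub>R r *\<^sub>R One)) - integral (slab (a j) (\<epsilon> j *\<^sub>R r *\<^sub>R One)) \<psi>) / \<epsilon> j ^ card (Basis :: (real^'n) set)" for j
      using r lim(2)[of j] by (simp add: power_mult_distrib field_simps)
    ultimately show "(\<lambda>j. (E u (slab (a j) (\<epsilon> j *\<^sub>R r *\<^sub>R One)) - integral (slab (a j) (\<epsilon> j *\<^sub>R r *\<^sub>R One)) \<psi>)
      / \<epsilon> j ^ card (Basis :: (real^'n) set)) \<longlonglongrightarrow> 0" by simp
  qed auto
  then show ?thesis by (simp add: \<psi>_def[abs_def])
qed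

end


section \<open>Regularized conjugates\<close>

lemma convex_epigraph:
  fixes f :: "real^'n \<Rightarrow> ereal"
  assumes f: "f \<in> Conv"
  shows "convex (ereal_epigraph f)"
proof (rule convexI)
  fix p q :: "(real^'n) \<times> real" and u v :: real
  assume *: "p \<in> ereal_epigraph f" "q \<in> ereal_epigraph f" "0 \<le> u" "0 \<le> v" "u + v = 1"
  show "u *\<^sub>R p + v *\<^sub>R q \<in> ereal_epigraph f"
  proof (cases "v = 0 \<or> v = 1")
    case True
    then show ?thesis using * by auto
  next
    case False
    then have v: "0 < v" "v < 1" and u: "u = 1 - v" using * by auto
    have le: "f (fst p) \<le> ereal (snd p)" "f (fst q) \<le> ereal (snd q)"
      using * by (auto simp: ereal_epigraph_def case_prod_unfold)
    have "f (u *\<^sub>R fst p + v *\<^sub>R fst q) \<le> ereal (1 - v) * f (fst p) + ereal v * f (fst q)"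
      using f v unfolding u by (auto simp: Conv_def ereal_convex_def)
    also have "\<dots> \<le> ereal (1 - v) * ereal (snd p) + ereal v * ereal (snd q)"
      using v le by (intro add_mono ereal_mult_left_mono) auto
    finally show ?thesis by (simp add: ereal_epigraph_def u case_prod_unfold)
  qed
qed

text \<open>Separate \<open>(x, c)\<close> from the epigraph. A separating hyperplane that is not
  vertical is an affine minorant. A vertical one can occur when \<open>f x\<close> is infinite; then
  a large multiple of it is added to a minorant found at a point of the domain, where separation
  cannot be vertical.\<close>

lemma Conv_affine_minorant:
  fixes f :: "real^'n \<Rightarrow> ereal"
  assumes f: "f \<in> Conv" and c: "ereal c < f x"
  obtains w s where "\<And>z. ereal (z \<bullet> w - s) \<le> f z" "c < x \<bullet> w - s"
proof -
  have sep: "\<exists>a \<alpha> b. a \<bullet> y + \<alpha> * r < b \<and> (\<forall>z q. f z \<le> ereal q \<longrightarrow> b < a \<bullet> z + \<alpha> * q)"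
    if r: "ereal r < f y" for y r
  proof -
    have "(y, r) \<notin> ereal_epigraph f" using r by (auto simp: ereal_epigraph_def)
    then obtain a b where ab: "a \<bullet> (y, r) < b" "\<forall>p\<in>ereal_epigraph f. b < a \<bullet> p"
      using separating_hyperplane_closed_point[OF convex_epigraph[OF f] closed_epigraph[OF f]] by blast
    have "fst a \<bullet> y + snd a * r < b" using ab(1) by (simp add: inner_prod_def)
    moreover have "b < fst a \<bullet> z + snd a * q" if "f z \<le> ereal q" for z q
      using ab(2)[rule_format, of "(z, q)"] that by (simp add: ereal_epigraph_def inner_prod_def)
    ultimately show ?thesis by blast
  qed
  have minorant: "ereal (z \<bullet> ((-1 / \<alpha>) *\<^sub>R a) - (- b / \<alpha>)) \<le> f z"
    if al: "\<alpha> > 0" and ab: "\<forall>z q. f z \<le> ereal q \<longrightarrow> b < a \<bullet> z + \<alpha> * q" for a \<alpha> b z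
  proof (cases "f z")
    case (real q)
    then have "b < a \<bullet> z + \<alpha> * q" using ab by simp
    then show ?thesis using al real by (simp add: field_simps inner_commute)
  next
    case MInf
    then show ?thesis using f by (auto simp: Conv_def)
  qed simp
  obtain x0 q0 where x0: "f x0 = ereal q0"
    using f by (auto simp: Conv_def) (metis ereal_cases)
  obtain a0 \<alpha>0 b0 where 0: "a0 \<bullet> x0 + \<alpha>0 * (q0 - 1) < b0" "\<forall>z q. f z \<le> ereal q \<longrightarrow> b0 < a0 \<bullet> z + \<alpha>0 * q"
    using sep[of "q0 - 1" x0] x0 by auto
  have "b0 < a0 \<bullet> x0 + \<alpha>0 * q0" using 0(2) x0 by simp
  then have "\<alpha>0 > 0" using 0(1) by (simp add: algebra_simps)
  define w0 s0 where "w0 = (-1 / \<alpha>0) *\<^sub>R a0" and "s0 = - b0 / \<alpha>0"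
  have m0: "ereal (z \<bullet> w0 - s0) \<le> f z" for z
    unfolding w0_def s0_def by (rule minorant[OF \<open>\<alpha>0 > 0\<close> 0(2)])
  obtain a \<alpha> b where ab: "a \<bullet> x + \<alpha> * c < b" "\<forall>z q. f z \<le> ereal q \<longrightarrow> b < a \<bullet> z + \<alpha> * q"
    using sep[OF c] by blast
  \<comment> \<open>The epigraph is unbounded upwards, so a negative coefficient would violate the
    separation high above \<open>x0\<close>.\<close>
  have "\<alpha> \<ge> 0"
  proof (rule ccontr)
    assume "\<not> \<alpha> \<ge> 0"
    then have neg: "\<alpha> < 0" by simp
    define q where "q = max q0 ((b - a \<bullet> x0) / \<alpha>)"
    have "f x0 \<le> ereal q" by (simp add: x0 q_def)
    then have "b < a \<bullet> x0 + \<alpha> * q" using ab(2) by blast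
    moreover have "(b - a \<bullet> x0) / \<alpha> \<le> q" by (simp add: q_def)
    then have "\<alpha> * q \<le> b - a \<bullet> x0" using neg by (simp add: divide_le_eq mult.commute)
    ultimately show False by simp
  qed
  show ?thesis
  proof (cases "\<alpha> = 0")
    case False
    then have al: "\<alpha> > 0" using \<open>\<alpha> \<ge> 0\<close> by simp
    have "c < x \<bullet> ((-1 / \<alpha>) *\<^sub>R a) - (- b / \<alpha>)" using ab(1) al by (simp add: field_simps inner_commute)
    then show ?thesis by (rule that[OF minorant[OF al ab(2)]])
  next
    case True
    then have ax: "a \<bullet> x < b" and az: "\<And>z q. f z \<le> ereal q \<Longrightarrow> b < a \<bullet> z" using ab by auto
    \<comment> \<open>Large enough for \<open>t * (b - a \<bullet> x)\<close> to lift the first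
      minorant above \<open>c\<close> at \<open>x\<close>; on the domain of \<open>f\<close> the
      added term is not positive.\<close>
    define t where "t = (\<bar>c - (x \<bullet> w0 - s0)\<bar> + 1) / (b - a \<bullet> x)"
    have t: "t > 0" using ax by (simp add: t_def)
    have "ereal (z \<bullet> (w0 - t *\<^sub>R a) - (s0 - t * b)) \<le> f z" for z
    proof (cases "f z")
      case (real q)
      have "t * (b - a \<bullet> z) \<le> 0" using az[of z q] real t by (intro mult_nonneg_nonpos) auto
      moreover have "z \<bullet> w0 - s0 \<le> q" using m0[of z] real by simp
      ultimately show ?thesis using real by (simp add: inner_diff_right inner_commute algebra_simps)
    next
      case MInf
      then show ?thesis using f by (auto simp: Conv_def)
    qed simp
    moreover have "c < x \<bullet> (w0 - t *\<^sub>R a) - (s0 - t * b)"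
    proof -
      have "t * (b - a \<bullet> x) = \<bar>c - (x \<bullet> w0 - s0)\<bar> + 1" using ax by (simp add: t_def)
      then show ?thesis by (simp add: inner_diff_right inner_commute algebra_simps)
    qed
    ultimately show ?thesis by (rule that)
  qed
qed

definition reg_value :: "(real^'n \<Rightarrow> ereal) \<Rightarrow> real \<Rightarrow> real^'n \<Rightarrow> real^'n \<Rightarrow> real" where
  "reg_value f \<kappa> x w = x \<bullet> w - real_of_ereal (f x) - \<kappa> * (norm x)\<^sup>2"

definition reg_point :: "(real^'n \<Rightarrow> ereal) \<Rightarrow> real \<Rightarrow> real^'n \<Rightarrow> real^'n" where
  "reg_point f \<kappa> w = (SOME x. x \<in> effective_domain f \<and>
     (\<forall>z\<in>effective_domain f. reg_value f \<kappa> z w \<le> reg_value f \<kappa> x w))"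

text \<open>The conjugate of \<open>f + \<kappa> |x|^2\<close>. Its maximizer
  \<open>reg_point\<close> turns out to be unique and to be the gradient.\<close>

definition reg_conj :: "(real^'n \<Rightarrow> ereal) \<Rightarrow> real \<Rightarrow> real^'n \<Rightarrow> real" where
  "reg_conj f \<kappa> w = reg_value f \<kappa> (reg_point f \<kappa> w) w"

lemma reg_point_exists:
  fixes f :: "real^'n \<Rightarrow> ereal"
  assumes f: "f \<in> Conv" and \<kappa>: "\<kappa> > 0"
  shows "\<exists>x. x \<in> effective_domain f \<and> (\<forall>z\<in>effective_domain f. reg_value f \<kappa> z w \<le> reg_value f \<kappa> x w)"
proof -
  obtain x0 where x0: "x0 \<in> effective_domain f"
    using f by (auto simp: Conv_def effective_domain_def)
  obtain q0 where q0: "f x0 = ereal q0" using Conv_finite[OF f x0] by blast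
  have "ereal (q0 - 1) < f x0" by (simp add: q0)
  then obtain w0 s0 where m0: "\<And>z. ereal (z \<bullet> w0 - s0) \<le> f z"
    using Conv_affine_minorant[OF f] by metis
  \<comment> \<open>\<open>f\<close> is only lower semi-continuous. Minimizing the continuous
    function \<open>val\<close> over the closed epigraph instead allows the usual compactness
    argument.\<close>
  define val where "val p = snd p + \<kappa> * (norm (fst p))\<^sup>2 - fst p \<bullet> w" for p :: "(real^'n) \<times> real"
  define v0 where "v0 = val (x0, q0)"
  define K where "K = ereal_epigraph f \<inter> {p. val p \<le> v0}"
  have cval: "continuous_on S val" for S unfolding val_def by (intro continuous_intros)
  have "closed {p. val p \<le> v0}" by (intro closed_Collect_le cval continuous_intros)
  then have "closed K" unfolding K_def by (intro closed_Int closed_epigraph[OF f])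
  moreover have "bounded K"
  proof -
    \<comment> \<open>\<open>R\<close> satisfies \<open>\<kappa> * R > N + M\<close> and
      \<open>R \<ge> 1\<close>, so that the quadratic term beats \<open>N * norm z + M\<close>
      outside the ball of radius \<open>R\<close>.\<close>
    define N M R where "N = norm (w - w0)" and "M = \<bar>s0 + v0\<bar>" and "R = 1 + (N + M) / \<kappa>"
    have NM: "N \<ge> 0" "M \<ge> 0" by (auto simp: N_def M_def)
    have R1: "R \<ge> 1" using NM \<kappa> by (simp add: R_def)
    have "fst p \<in> cball 0 R \<and> snd p \<in> {- (R * norm w0) - s0 .. v0 + R * norm w}" if p: "p \<in> K" for p
    proof -
      define z r where "z = fst p" and "r = snd p"
      have fz: "f z \<le> ereal r" and vz: "r + \<kappa> * (norm z)\<^sup>2 - z \<bullet> w \<le> v0"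
        using p by (auto simp: K_def ereal_epigraph_def val_def z_def r_def case_prod_unfold)
      have "ereal (z \<bullet> w0 - s0) \<le> ereal r" using m0[of z] fz by (rule order.trans)
      then have rz: "z \<bullet> w0 - s0 \<le> r" by simp
      have "z \<bullet> (w - w0) \<le> norm z * N" unfolding N_def by (rule norm_cauchy_schwarz)
      then have q: "\<kappa> * (norm z)\<^sup>2 \<le> norm z * N + M" using vz rz by (simp add: inner_diff_right M_def)
      have zR: "norm z \<le> R"
      proof (rule ccontr)
        assume "\<not> norm z \<le> R"
        then have z: "norm z > R" by simp
        have "\<kappa> * R = \<kappa> + (N + M)" using \<kappa> by (simp add: R_def field_simps)
        then have NMR: "N + M < \<kappa> * R" using \<kappa> by simp
        have "norm z * N + M \<le> norm z * N + norm z * M"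
          using z R1 NM mult_right_mono[of 1 "norm z" M] by simp
        also have "\<dots> = norm z * (N + M)" by (simp add: algebra_simps)
        also have "norm z * (N + M) < norm z * (\<kappa> * R)" using z R1 NMR by (intro mult_strict_left_mono) auto
        also have "\<dots> \<le> norm z * (\<kappa> * norm z)" using z \<kappa> by (intro mult_left_mono) auto
        finally show False using q by (simp add: power2_eq_square mult_ac)
      qed
      have b: "\<bar>z \<bullet> v\<bar> \<le> R * norm v" for v
        using Cauchy_Schwarz_ineq2[of z v] mult_right_mono[OF zR, of "norm v"] by simp
      have "0 \<le> \<kappa> * (norm z)\<^sup>2" using \<kappa> by simp
      then have "r \<le> v0 + R * norm w" "- (R * norm w0) - s0 \<le> r"
        using vz rz b[of w] b[of w0] by (auto simp: abs_le_iff)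
      then show ?thesis using zR by (simp add: z_def r_def)
    qed
    then have "K \<subseteq> cball 0 R \<times> {- (R * norm w0) - s0 .. v0 + R * norm w}" by auto
    then show ?thesis by (rule bounded_subset[rotated]) (intro bounded_Times bounded_cball bounded_closed_interval)
  qed
  ultimately have "compact K" by (simp add: compact_eq_bounded_closed)
  moreover have K0: "(x0, q0) \<in> K" by (simp add: K_def v0_def ereal_epigraph_def q0)
  ultimately obtain p where p: "p \<in> K" "\<And>q. q \<in> K \<Longrightarrow> val p \<le> val q"
    using continuous_attains_inf[of K val] cval by blast
  define x where "x = fst p"
  have fx: "f x \<le> ereal (snd p)" using p(1) by (auto simp: K_def ereal_epigraph_def x_def case_prod_unfold)
  have dom: "x \<in> effective_domain f" using fx by (auto simp: effective_domain_def)
  have "ereal (real_of_ereal (f x)) \<le> ereal (snd p)" using fx Conv_finite[OF f dom] by simp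
  then have le: "real_of_ereal (f x) \<le> snd p" by simp
  have pv: "val p \<le> v0" using p(1) by (simp add: K_def)
  have "reg_value f \<kappa> z w \<le> reg_value f \<kappa> x w" if z: "z \<in> effective_domain f" for z
  proof -
    have E: "(z, real_of_ereal (f z)) \<in> ereal_epigraph f"
      using Conv_finite[OF f z] by (simp add: ereal_epigraph_def)
    have "val p \<le> val (z, real_of_ereal (f z))"
    proof (cases "val (z, real_of_ereal (f z)) \<le> v0")
      case True
      then show ?thesis using E by (intro p(2)) (simp add: K_def)
    qed (use pv in simp)
    then show ?thesis using le by (simp add: val_def reg_value_def x_def)
  qed
  then show ?thesis using dom by blast
qed

lemma reg_point:
  assumes "f \<in> Conv" "\<kappa> > 0"
  shows "reg_point f \<kappa> w \<in> effective_domain f"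
    and "z \<in> effective_domain f \<Longrightarrow> reg_value f \<kappa> z w \<le> reg_conj f \<kappa> w"
  using someI_ex[OF reg_point_exists[OF assms, of w]] by (auto simp: reg_point_def reg_conj_def)

text \<open>Strong concavity: the point at parameter \<open>t\<close> between maximizer and
  \<open>z\<close> cannot beat the maximizer, but gains
  \<open>t * (1 - t) * \<kappa> |z - x|^2\<close> over the interpolated value. Divide by
  \<open>t\<close> and let it tend to 0.\<close>

lemma reg_point_strict:
  fixes f :: "real^'n \<Rightarrow> ereal"
  assumes f: "f \<in> Conv" and \<kappa>: "\<kappa> > 0" and z: "z \<in> effective_domain f"
  shows "reg_value f \<kappa> z w + \<kappa> * (norm (z - reg_point f \<kappa> w))\<^sup>2 \<le> reg_conj f \<kappa> w"
proof -
  define x where "x = reg_point f \<kappa> w"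
  have x: "x \<in> effective_domain f" unfolding x_def by (rule reg_point(1)[OF f \<kappa>])
  have fx: "f x = ereal (real_of_ereal (f x))" and fz: "f z = ereal (real_of_ereal (f z))"
    using Conv_finite[OF f] x z by blast+
  have main: "reg_value f \<kappa> z w + \<kappa> * (1 - t) * (norm (z - x))\<^sup>2 \<le> reg_conj f \<kappa> w" if t: "0 < t" "t < 1" for t
  proof -
    define v where "v = (1 - t) *\<^sub>R x + t *\<^sub>R z"
    have "f v \<le> ereal (1 - t) * f x + ereal t * f z"
      unfolding v_def using f t by (auto simp: Conv_def ereal_convex_def)
    also have "\<dots> = ereal (1 - t) * ereal (real_of_ereal (f x)) + ereal t * ereal (real_of_ereal (f z))"
      using fx fz by simp
    also have "\<dots> = ereal ((1 - t) * real_of_ereal (f x) + t * real_of_ereal (f z))" by simp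
    finally have fv: "f v \<le> ereal ((1 - t) * real_of_ereal (f x) + t * real_of_ereal (f z))" .
    then have vd: "v \<in> effective_domain f" by (auto simp: effective_domain_def)
    have "ereal (real_of_ereal (f v)) \<le> ereal ((1 - t) * real_of_ereal (f x) + t * real_of_ereal (f z))"
      using fv Conv_finite[OF f vd] by simp
    then have fv': "real_of_ereal (f v) \<le> (1 - t) * real_of_ereal (f x) + t * real_of_ereal (f z)" by simp
    have nv: "(norm v)\<^sup>2 = (1 - t) * (norm x)\<^sup>2 + t * (norm z)\<^sup>2 - t * (1 - t) * (norm (z - x))\<^sup>2"
      unfolding v_def power2_norm_eq_inner
      by (simp add: inner_add_left inner_add_right inner_diff_left inner_diff_right inner_commute algebra_simps)
    have vw: "v \<bullet> w = (1 - t) * (x \<bullet> w) + t * (z \<bullet> w)" by (simp add: v_def inner_add_left)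
    have "(1 - t) * reg_value f \<kappa> x w + t * reg_value f \<kappa> z w + t * (\<kappa> * (1 - t) * (norm (z - x))\<^sup>2) \<le> reg_value f \<kappa> v w"
      using fv' unfolding reg_value_def nv vw by (simp add: algebra_simps)
    also have "\<dots> \<le> reg_value f \<kappa> x w" using reg_point(2)[OF f \<kappa> vd, of w] by (simp add: reg_conj_def x_def)
    finally have "t * (reg_value f \<kappa> z w + \<kappa> * (1 - t) * (norm (z - x))\<^sup>2) \<le> t * reg_value f \<kappa> x w"
      by (simp add: algebra_simps)
    then show ?thesis using t by (simp add: reg_conj_def x_def)
  qed
  define D where "D = \<kappa> * (norm (z - x))\<^sup>2"
  \<comment> \<open>The parameters \<open>1 / (j + 2)\<close> lie strictly between 0 and 1 for every
    \<open>j\<close>.\<close>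
  have "(\<lambda>j. reg_value f \<kappa> z w + (1 - inverse (real (Suc (Suc j)))) * D) \<longlonglongrightarrow> reg_value f \<kappa> z w + (1 - 0) * D"
    by (intro tendsto_intros LIMSEQ_Suc[OF LIMSEQ_inverse_real_of_nat])
  moreover have "reg_value f \<kappa> z w + (1 - inverse (real (Suc (Suc j)))) * D \<le> reg_conj f \<kappa> w" for j
    using main[of "inverse (real (Suc (Suc j)))"] by (simp add: D_def mult_ac inverse_less_1_iff)
  ultimately have "reg_value f \<kappa> z w + (1 - 0) * D \<le> reg_conj f \<kappa> w"
    by (intro LIMSEQ_le_const2) auto
  then show ?thesis by (simp add: D_def x_def)
qed

text \<open>Adding the strict inequalities for two parameters shows that the maximizer is Lipschitz
  with constant \<open>1 / (2 * \<kappa>)\<close>; this bounds the remainder of the first order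
  expansion.\<close>

lemma reg_conj_C11:
  fixes f :: "real^'n \<Rightarrow> ereal"
  assumes f: "f \<in> Conv" and \<kappa>: "\<kappa> > 0"
  shows "C11 (reg_conj f \<kappa>) (reg_point f \<kappa>) (1 / (2 * \<kappa>))"
proof -
  let ?u = "reg_conj f \<kappa>" and ?g = "reg_point f \<kappa>"
  have shift: "reg_value f \<kappa> x z = reg_value f \<kappa> x w + (z - w) \<bullet> x" for x w z
    by (simp add: reg_value_def inner_diff_left inner_commute[of x z] inner_commute[of x w])
  have low: "?u w + (z - w) \<bullet> ?g w \<le> ?u z" for w z
    using reg_point(2)[OF f \<kappa> reg_point(1)[OF f \<kappa>, of w], of z] shift[of "?g w" z w] by (simp add: reg_conj_def)
  have lip: "norm (?g z - ?g w) \<le> (1 / (2 * \<kappa>)) * norm (z - w)" for w z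
  proof -
    have "reg_value f \<kappa> (?g z) w + \<kappa> * (norm (?g z - ?g w))\<^sup>2 \<le> ?u w"
      "reg_value f \<kappa> (?g w) z + \<kappa> * (norm (?g w - ?g z))\<^sup>2 \<le> ?u z"
      by (intro reg_point_strict f \<kappa> reg_point)+
    then have "2 * \<kappa> * (norm (?g z - ?g w))\<^sup>2 \<le> (z - w) \<bullet> (?g z - ?g w)"
      using shift[of "?g z" w z] shift[of "?g w" z w]
      by (simp add: reg_conj_def norm_minus_commute inner_diff_left inner_diff_right algebra_simps)
    also have "\<dots> \<le> norm (z - w) * norm (?g z - ?g w)" by (rule norm_cauchy_schwarz)
    finally have "norm (?g z - ?g w) * (2 * \<kappa> * norm (?g z - ?g w)) \<le> norm (?g z - ?g w) * norm (z - w)"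
      by (simp add: power2_eq_square mult_ac)
    then have "2 * \<kappa> * norm (?g z - ?g w) \<le> norm (z - w)"
      by (cases "norm (?g z - ?g w) = 0") (auto simp: mult_le_cancel_left_pos)
    then show ?thesis using \<kappa> by (simp add: field_simps)
  qed
  have "continuous_on UNIV ?g"
  proof (rule continuous_onI)
    fix x :: "real^'n" and e :: real assume e: "e > 0"
    show "\<exists>\<delta>>0. \<forall>x'\<in>UNIV. dist x' x < \<delta> \<longrightarrow> dist (?g x') (?g x) \<le> e"
    proof (intro exI[of _ "2 * \<kappa> * e"] conjI ballI impI)
      fix x' assume "dist x' x < 2 * \<kappa> * e"
      then have "(1 / (2 * \<kappa>)) * norm (x' - x) \<le> e" using \<kappa> by (simp add: dist_norm field_simps)
      then show "dist (?g x') (?g x) \<le> e" using lip[of x' x] by (simp add: dist_norm)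
    qed (use e \<kappa> in simp)
  qed
  moreover have "?u z - ?u w - (z - w) \<bullet> ?g w \<le> (1 / (2 * \<kappa>)) * (norm (z - w))\<^sup>2" for w z
  proof -
    have "?u z - ?u w - (z - w) \<bullet> ?g w \<le> (z - w) \<bullet> (?g z - ?g w)"
      using low[of z w] by (simp add: inner_diff_left inner_diff_right algebra_simps)
    also have "\<dots> \<le> norm (z - w) * norm (?g z - ?g w)" by (rule norm_cauchy_schwarz)
    also have "\<dots> \<le> norm (z - w) * ((1 / (2 * \<kappa>)) * norm (z - w))" by (intro mult_left_mono lip) auto
    finally show ?thesis by (simp add: power2_eq_square mult_ac)
  qed
  ultimately show ?thesis using low unfolding C11_def by (simp add: algebra_simps)
qed

lemma conjugate_Conv:
  fixes u :: "real^'n \<Rightarrow> real"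
  assumes "\<And>w. x0 \<bullet> w - u w \<le> s"
  shows "(\<lambda>x. SUP w. ereal (x \<bullet> w - u w)) \<in> Conv"
proof -
  define f where "f x = (SUP w. ereal (x \<bullet> w - u w))" for x
  have le: "ereal (x \<bullet> w - u w) \<le> f x" for x w unfolding f_def by (rule SUP_upper) simp
  have ninf: "f x \<noteq> -\<infinity>" for x using le[of x 0] by auto
  have "f x0 \<le> ereal s" unfolding f_def using assms by (intro SUP_least) simp
  then have fin: "f x0 \<noteq> \<infinity>" by auto
  have "ereal_convex f"
    unfolding ereal_convex_def
  proof (intro allI ballI)
    fix x y :: "real^'n" and t :: real assume t: "t \<in> {0<..<1}"
    have "ereal (((1 - t) *\<^sub>R x + t *\<^sub>R y) \<bullet> w - u w) \<le> ereal (1 - t) * f x + ereal t * f y" for w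
    proof -
      have "ereal (((1 - t) *\<^sub>R x + t *\<^sub>R y) \<bullet> w - u w)
          = ereal (1 - t) * ereal (x \<bullet> w - u w) + ereal t * ereal (y \<bullet> w - u w)"
        by (simp add: inner_add_left algebra_simps)
      also have "\<dots> \<le> ereal (1 - t) * f x + ereal t * f y"
        using t by (intro add_mono ereal_mult_left_mono le) auto
      finally show ?thesis .
    qed
    then show "f ((1 - t) *\<^sub>R x + t *\<^sub>R y) \<le> ereal (1 - t) * f x + ereal t * f y"
      unfolding f_def[of "(1 - t) *\<^sub>R x + t *\<^sub>R y"] by (intro SUP_least)
  qed
  moreover have "lsc f"
    unfolding lsc_def le_Liminf_iff
  proof (intro allI impI)
    fix x y assume "y < f x"
    then obtain w where w: "y < ereal (x \<bullet> w - u w)" unfolding f_def less_SUP_iff by blast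
    have "((\<lambda>z. ereal (z \<bullet> w - u w)) \<longlongrightarrow> ereal (x \<bullet> w - u w)) (at x)" by (intro tendsto_intros)
    then have "\<forall>\<^sub>F z in at x. y < ereal (z \<bullet> w - u w)" using w by (rule order_tendstoD(1))
    then show "\<forall>\<^sub>F z in at x. y < f z" by eventually_elim (erule order.strict_trans2[OF _ le])
  qed
  ultimately show ?thesis using ninf fin unfolding Conv_def f_def by blast
qed

section \<open>Density of the regularized conjugates, and the support of the density\<close>

context PV_setting
begin

text \<open>Lower half: an affine minorant of \<open>f\<close> with slope \<open>w\<close> bounds
  \<open>u j w\<close> from above for all \<open>j\<close>, and \<open>w\<close> lies in the growing
  cubes eventually. Upper half: at a fixed \<open>x\<close> the regularization costs at most
  \<open>\<kappa> |x|^2\<close>, which tends to 0.\<close>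

lemma E_dense:
  assumes f: "f \<in> \<Gamma>"
  defines "u \<equiv> \<lambda>j::nat. reg_conj f (inverse (real (Suc j)))"
    and "Q \<equiv> \<lambda>j::nat. slab (- (real (Suc j) *\<^sub>R One)) ((2 * real (Suc j)) *\<^sub>R One)"
  shows "(\<lambda>j. E (u j) (Q j)) \<longlonglongrightarrow> Z f"
  unfolding E_def
proof (rule PV_tendsto[OF PV _ f])
  have fC: "f \<in> Conv" using f Gamma_Conv by blast
  have \<kappa>: "inverse (real (Suc j)) > 0" for j by simp
  have conv: "convex_on UNIV (u j)" for j unfolding u_def by (rule C11_convex[OF reg_conj_C11[OF fC \<kappa>]])
  have Qne: "- (real (Suc j) *\<^sub>R One) \<in> Q j" for j
    unfolding Q_def by (rule slab_nonempty) (simp add: One_inner)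
  have Qc: "compact (Q j)" "convex (Q j)" for j unfolding Q_def by (rule slab_compact_convex)+
  have "legA (u j) (Q j) \<in> \<Gamma>" for j using Qne by (intro legA_Gamma conv Qc) blast
  then show "range (\<lambda>j. legA (u j) (Q j)) \<subseteq> \<Gamma>" by blast
  show "epi_converges (\<lambda>j. legA (u j) (Q j)) f"
  proof (rule epi_convergesI)
    show "f x \<noteq> -\<infinity>" for x by (rule Gamma_not_MInf[OF f])
  next
    fix x X c assume X: "X \<longlonglongrightarrow> x" and c: "ereal c < f x"
    obtain w s where ws: "\<And>z. ereal (z \<bullet> w - s) \<le> f z" "c < x \<bullet> w - s"
      using Conv_affine_minorant[OF fC c] by metis
    have us: "u j w \<le> s" for j
    proof -
      define p where "p = reg_point f (inverse (real (Suc j))) w"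
      have "p \<in> effective_domain f" unfolding p_def by (rule reg_point(1)[OF fC \<kappa>])
      then have "f p = ereal (real_of_ereal (f p))" by (rule Conv_finite[OF fC])
      then have "ereal (p \<bullet> w - s) \<le> ereal (real_of_ereal (f p))" using ws(1)[of p] by simp
      then have "p \<bullet> w - real_of_ereal (f p) \<le> s" by simp
      moreover have "0 \<le> inverse (real (Suc j)) * (norm p)\<^sup>2" by simp
      ultimately show ?thesis unfolding u_def reg_conj_def reg_value_def p_def[symmetric] by linarith
    qed
    have "(\<lambda>j. X j \<bullet> w - s) \<longlonglongrightarrow> x \<bullet> w - s" by (intro tendsto_intros X)
    then have "\<forall>\<^sub>F j in sequentially. c < X j \<bullet> w - s" using ws(2) by (rule order_tendstoD(1))
    moreover have "\<forall>\<^sub>F j in sequentially. real j > norm w"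
      using filterlim_real_sequentially by (simp add: filterlim_at_top_dense)
    ultimately show "\<forall>\<^sub>F j in sequentially. ereal c < legA (u j) (Q j) (X j)"
    proof eventually_elim
      case (elim j)
      have "w \<in> Q j"
        unfolding Q_def mem_slab
      proof
        fix i :: "real^'n" assume i: "i \<in> Basis"
        have "\<bar>w \<bullet> i\<bar> \<le> real (Suc j)" using Basis_le_norm[OF i, of w] elim(2) by simp
        then show "- (real (Suc j) *\<^sub>R One) \<bullet> i \<le> w \<bullet> i \<and> w \<bullet> i \<le> - (real (Suc j) *\<^sub>R One) \<bullet> i + ((2 * real (Suc j)) *\<^sub>R One) \<bullet> i"
          using i by (simp add: One_inner abs_le_iff)
      qed
      from leg_upper[OF Qc(1) convex_on_UNIV_continuous[OF conv[of j]] this, of "X j"]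
      have "c < leg (u j) (Q j) (X j)" using us[of j] elim(1) by simp
      then show ?case by (simp add: legA_def convex_indicator_def)
    qed
  next
    fix x assume "f x \<noteq> \<infinity>"
    then have x: "x \<in> effective_domain f" by (simp add: effective_domain_def)
    then have xA: "x \<in> \<A>" using Gamma_dom(2)[OF f] by blast
    have fx: "f x = ereal (real_of_ereal (f x))" by (rule Conv_finite[OF fC x])
    have le: "legA (u j) (Q j) x \<le> ereal (real_of_ereal (f x) + inverse (real (Suc j)) * (norm x)\<^sup>2)" for j
    proof -
      have "leg (u j) (Q j) x \<le> real_of_ereal (f x) + inverse (real (Suc j)) * (norm x)\<^sup>2"
      proof (rule leg_least)
        show "Q j \<noteq> {}" using Qne by blast
        fix w
        show "x \<bullet> w - u j w \<le> real_of_ereal (f x) + inverse (real (Suc j)) * (norm x)\<^sup>2"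
          using reg_point(2)[OF fC \<kappa> x, of j w] by (simp add: u_def reg_value_def)
      qed
      then show ?thesis using xA by (simp add: legA_def convex_indicator_def)
    qed
    have "(\<lambda>j. real_of_ereal (f x) + inverse (real (Suc j)) * (norm x)\<^sup>2) \<longlonglongrightarrow> real_of_ereal (f x) + 0 * (norm x)\<^sup>2"
      by (intro tendsto_intros LIMSEQ_inverse_real_of_nat)
    then have lim: "(\<lambda>j. real_of_ereal (f x) + inverse (real (Suc j)) * (norm x)\<^sup>2) \<longlonglongrightarrow> real_of_ereal (f x)" by simp
    have "\<forall>\<^sub>F j in sequentially. legA (u j) (Q j) x < ereal c" if "f x < ereal c" for c
    proof -
      have "ereal (real_of_ereal (f x)) < ereal c" using that fx by simp
      then have "\<forall>\<^sub>F j in sequentially. real_of_ereal (f x) + inverse (real (Suc j)) * (norm x)\<^sup>2 < c"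
        by (intro order_tendstoD(2)[OF lim]) simp
      then show ?thesis by eventually_elim (use le in \<open>meson ereal_less_le less_ereal.simps(1) order.strict_trans1\<close>)
    qed
    then show "\<exists>X. X \<longlonglongrightarrow> x \<and> (\<forall>c. f x < ereal c \<longrightarrow> (\<forall>\<^sub>F j in sequentially. legA (u j) (Q j) (X j) < ereal c))"
      by (intro exI[of _ "\<lambda>_. x"]) simp
  qed
qed

text \<open>Uniformly close functions have uniformly close restricted conjugates, so the vanishing
  on degenerate boxes extends to functions with kinks, such as the maximum used in
  \<open>Phi_vanishes\<close>.\<close>

lemma E_degenerate:
  assumes u: "convex_on UNIV u" and us: "\<And>j. C11 (us j) (gs j) (Ls j)"
    and approx: "\<And>j w. \<bar>us j w - u w\<bar> \<le> \<eta> j" "\<eta> \<longlonglongrightarrow> 0"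
    and s: "\<And>i. i \<in> Basis \<Longrightarrow> 0 \<le> s \<bullet> i" and k: "k \<in> Basis" "s \<bullet> k = 0"
  shows "E u (slab a s) = 0"
proof -
  let ?Q = "slab a s"
  have ne: "?Q \<noteq> {}" using slab_nonempty[OF s] by blast
  note Qc = slab_compact_convex[of a s]
  have "(\<lambda>j. E (us j) ?Q) \<longlonglongrightarrow> E u ?Q"
    unfolding E_def
  proof (rule PV_tendsto[OF PV])
    show "legA u ?Q \<in> \<Gamma>" by (intro legA_Gamma u Qc ne)
    show "range (\<lambda>j. legA (us j) ?Q) \<subseteq> \<Gamma>" using legA_Gamma[OF C11_convex[OF us] Qc ne] by blast
    show "epi_converges (\<lambda>j. legA (us j) ?Q) (legA u ?Q)"
      unfolding legA_def
    proof (rule epi_converges_indicator_continuous[OF A])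
      fix X :: "nat \<Rightarrow> real^'n" and x assume X: "X \<longlonglongrightarrow> x"
      have diff: "\<bar>leg (us j) ?Q y - leg u ?Q y\<bar> \<le> \<eta> j" for j y
      proof -
        have "leg (us j) ?Q y \<le> leg u ?Q y + \<eta> j"
        proof (rule leg_least[OF ne])
          fix w assume "w \<in> ?Q"
          from leg_upper[OF Qc(1) convex_on_UNIV_continuous[OF u] this, of y] approx(1)[of j w]
          show "y \<bullet> w - us j w \<le> leg u ?Q y + \<eta> j" by (simp add: abs_le_iff)
        qed
        moreover have "leg u ?Q y \<le> leg (us j) ?Q y + \<eta> j"
        proof (rule leg_least[OF ne])
          fix w assume "w \<in> ?Q"
          from leg_upper[OF Qc(1) C11_continuous[OF us[of j]] this, of y] approx(1)[of j w]
          show "y \<bullet> w - u w \<le> leg (us j) ?Q y + \<eta> j" by (simp add: abs_le_iff)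
        qed
        ultimately show ?thesis by (simp add: abs_le_iff)
      qed
      have "(\<lambda>j. leg (us j) ?Q (X j) - leg u ?Q (X j)) \<longlonglongrightarrow> 0"
        by (rule Lim_null_comparison[OF _ approx(2)]) (use diff in \<open>auto intro!: always_eventually\<close>)
      from tendsto_add[OF this leg_tendsto[OF Qc(1) ne convex_on_UNIV_continuous[OF u] X]]
      show "(\<lambda>j. leg (us j) ?Q (X j)) \<longlonglongrightarrow> leg u ?Q x" by simp
    qed
  qed
  moreover have "E (us j) ?Q = 0" for j by (rule E_degenerate_C11[OF us s k])
  ultimately show ?thesis by (simp add: LIMSEQ_const_iff)
qed

text \<open>
  Boxes containing the origin are covered by assumption, and every box is obtained from those
  by cutting.
\<close>

lemma E_zero_boxes:
  assumes u: "convex_on UNIV u"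
    and deg: "\<And>a s k. (\<And>i. i \<in> Basis \<Longrightarrow> 0 \<le> s \<bullet> i) \<Longrightarrow> k \<in> Basis \<Longrightarrow> s \<bullet> k = 0 \<Longrightarrow> E u (slab a s) = 0"
    and origin: "\<And>a s. (\<And>i. i \<in> Basis \<Longrightarrow> 0 \<le> s \<bullet> i) \<Longrightarrow> 0 \<in> slab a s \<Longrightarrow> E u (slab a s) = 0"
    and t: "\<And>i. i \<in> Basis \<Longrightarrow> 0 \<le> t \<bullet> i"
  shows "E u (slab a t) = 0"
proof -
  have "E u (slab a t) = 0" if "finite U" "U \<subseteq> Basis" "\<And>i. i \<in> Basis \<Longrightarrow> 0 \<le> t \<bullet> i"
    "\<And>i. i \<in> Basis - U \<Longrightarrow> a \<bullet> i \<le> 0 \<and> 0 \<le> a \<bullet> i + t \<bullet> i" for U a t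
    using that
  proof (induction U arbitrary: a t rule: finite_induct)
    case empty
    then show ?case by (intro origin) (auto simp: mem_slab)
  next
    case (insert k U)
    have k: "k \<in> Basis" and U: "U \<subseteq> Basis" using insert.prems(1) by auto
    have ki: "k \<bullet> i = (if i = k then 1 else 0)" if "i \<in> Basis" for i
      using that k by (simp add: inner_Basis)
    have IH: "E u (slab b v) = 0" if "\<And>i. i \<in> Basis \<Longrightarrow> 0 \<le> v \<bullet> i" "b \<bullet> k \<le> 0" "0 \<le> b \<bullet> k + v \<bullet> k"
      "\<And>i. i \<in> Basis - insert k U \<Longrightarrow> b \<bullet> i = a \<bullet> i \<and> v \<bullet> i = t \<bullet> i" for b v
    proof (rule insert.IH[OF U that(1)])
      fix i assume i: "i \<in> Basis - U"
      show "b \<bullet> i \<le> 0 \<and> 0 \<le> b \<bullet> i + v \<bullet> i"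
      proof (cases "i = k")
        case True
        then show ?thesis using that(2,3) by simp
      next
        case False
        then show ?thesis using that(4)[of i] insert.prems(3)[of i] i by simp
      qed
    qed
    have D: "E u (slab b (v - (v \<bullet> k) *\<^sub>R k)) = 0" if "\<And>i. i \<in> Basis \<Longrightarrow> 0 \<le> v \<bullet> i" for b v
      by (rule deg[OF _ k]) (use that k ki in \<open>auto simp: inner_diff_left\<close>)
    consider "a \<bullet> k > 0" | "a \<bullet> k + t \<bullet> k < 0" | "a \<bullet> k \<le> 0" "0 \<le> a \<bullet> k + t \<bullet> k" by linarith
    then show ?case
    proof cases
      case 1
      \<comment> \<open>The box is extended down to 0 in coordinate \<open>k\<close>. The extended
        box and the added piece both contain 0 in this coordinate, so the induction hypothesis
        applies to them.\<close>
      define b v where "b = a - (a \<bullet> k) *\<^sub>R k" and "v = t + (a \<bullet> k) *\<^sub>R k"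
      have vi: "v \<bullet> i = (if i = k then t \<bullet> k + a \<bullet> k else t \<bullet> i)" if "i \<in> Basis" for i
        using ki[OF that] by (simp add: v_def inner_add_left)
      have bi: "b \<bullet> i = (if i = k then 0 else a \<bullet> i)" if "i \<in> Basis" for i
        using ki[OF that] by (simp add: b_def inner_diff_left)
      have v0: "0 \<le> v \<bullet> i" if "i \<in> Basis" for i using vi[OF that] insert.prems(2)[OF that] insert.prems(2)[OF k] 1 by simp
      have cut: "E u (slab b v) + E u (slab (b + (a \<bullet> k) *\<^sub>R k) (v - (v \<bullet> k) *\<^sub>R k))
        = E u (slab b (v - (v \<bullet> k - a \<bullet> k) *\<^sub>R k)) + E u (slab (b + (a \<bullet> k) *\<^sub>R k) (v - (a \<bullet> k) *\<^sub>R k))"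
        using 1 vi[OF k] insert.prems(2)[OF k] by (intro E_slab_cut u v0 k) auto
      have "E u (slab b v) = 0" using vi bi v0 k insert.prems(2)[OF k] 1 by (intro IH) auto
      moreover have "E u (slab b (v - (v \<bullet> k - a \<bullet> k) *\<^sub>R k)) = 0"
        using vi bi v0 k ki insert.prems(2) 1 by (intro IH) (auto simp: inner_diff_left)
      ultimately show ?thesis using cut D[OF v0] by (simp add: b_def v_def)
    next
      case 2
      \<comment> \<open>The mirror case: the box is extended up to 0 in coordinate
        \<open>k\<close>.\<close>
      define v where "v = t - (a \<bullet> k + t \<bullet> k) *\<^sub>R k"
      have vi: "v \<bullet> i = (if i = k then - (a \<bullet> k) else t \<bullet> i)" if "i \<in> Basis" for i
        using ki[OF that] by (simp add: v_def inner_diff_left)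
      have v0: "0 \<le> v \<bullet> i" if "i \<in> Basis" for i using vi[OF that] insert.prems(2)[OF that] insert.prems(2)[OF k] 2 by simp
      have cut: "E u (slab a v) + E u (slab (a + (t \<bullet> k) *\<^sub>R k) (v - (v \<bullet> k) *\<^sub>R k))
        = E u (slab a (v - (v \<bullet> k - t \<bullet> k) *\<^sub>R k)) + E u (slab (a + (t \<bullet> k) *\<^sub>R k) (v - (t \<bullet> k) *\<^sub>R k))"
        using 2 vi[OF k] insert.prems(2)[OF k] by (intro E_slab_cut u v0 k) auto
      have "E u (slab a v) = 0" using vi v0 k insert.prems(2)[OF k] 2 by (intro IH) auto
      moreover have "E u (slab (a + (t \<bullet> k) *\<^sub>R k) (v - (t \<bullet> k) *\<^sub>R k)) = 0"
        using vi v0 k ki insert.prems(2) 2 by (intro IH) (auto simp: inner_diff_left inner_add_left)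
      moreover have vk: "v \<bullet> k = - (a \<bullet> k)" using vi[OF k] by simp
      have "v - (v \<bullet> k - t \<bullet> k) *\<^sub>R k = t" unfolding vk v_def using ki[OF k] by (simp add: algebra_simps)
      ultimately show ?thesis using cut D[OF v0] by simp
    next
      case 3
      then show ?thesis using insert.prems(2) by (intro IH) auto
    qed
  qed
  from this[of Basis t a] show ?thesis using t by simp
qed

text \<open>Take \<open>(y, c)\<close> with \<open>c > 0\<close> and
  \<open>\<langle>x0, y\<rangle> - c\<close> above the support function of \<open>C\<close>, and let
  \<open>u\<close> be the maximum of that support function and
  \<open>\<langle>x0, \<cdot>\<rangle> - c\<close>. Then \<open>u 0 = 0\<close>, so on a box through
  0 the conjugate is nonnegative, and it vanishes on \<open>C\<close>. Thus \<open>E u\<close>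
  vanishes on all boxes, while near \<open>y\<close> the function \<open>u\<close> is affine and its
  small boxes compute \<open>Phi One x0 y c\<close>. Such \<open>(y, c)\<close> form an open set,
  enough for a homogeneous polynomial.\<close>

lemma Phi_vanishes:
  assumes C: "compact C" "convex C" "C \<noteq> {}" "C \<subseteq> interior \<O>"
    and van: "\<And>f. f \<in> \<Gamma> \<Longrightarrow> (\<And>x. 0 \<le> f x) \<Longrightarrow> (\<And>x. x \<in> C \<Longrightarrow> f x = 0) \<Longrightarrow> Z f = 0"
    and x0: "x0 \<notin> C"
  shows "Phi One x0 y c = 0"
proof -
  define h where "h = leg (\<lambda>_. 0) C"
  note hC = C(1,3) continuous_on_const[of C "0::real"]
  have hup: "p \<bullet> w \<le> h w" if "p \<in> C" for p w
    using leg_upper[OF C(1) continuous_on_const that, of w 0] by (simp add: h_def inner_commute)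
  have hatt: "\<exists>p\<in>C. h w = p \<bullet> w" for w
    using leg_attained[OF hC, of w] unfolding h_def by (metis diff_zero inner_commute)
  have h0: "h 0 = 0" using hatt[of 0] by auto
  have hcont: "continuous_on UNIV h"
    unfolding continuous_on_sequentially comp_def h_def using leg_tendsto[OF hC] by blast
  define U where "U = {p :: (real^'n) \<times> real. 0 < snd p} \<inter> {p. h (fst p) < x0 \<bullet> fst p - snd p}"
  have "open U"
    unfolding U_def by (intro open_Int open_Collect_less continuous_intros continuous_on_compose2[OF hcont]) auto
  moreover have "U \<noteq> {}"
  proof -
    obtain a b where ab: "a \<bullet> x0 < b" "\<forall>p\<in>C. b < a \<bullet> p"
      using separating_hyperplane_closed_point[OF C(2) compact_imp_closed[OF C(1)] x0] by blast
    obtain p where p: "p \<in> C" "h (- a) = p \<bullet> (- a)" using hatt by blast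
    then have "h (- a) < - b" using ab(2)[rule_format, OF p(1)] by (simp add: inner_commute)
    \<comment> \<open>A hyperplane separating \<open>x0\<close> from \<open>C\<close> gives the
      slope; half of the gap is left for \<open>c\<close>.\<close>
    then have "(- a, (b - a \<bullet> x0) / 2) \<in> U" using ab(1) by (simp add: U_def inner_commute field_simps)
    then show ?thesis by blast
  qed
  moreover have "(\<lambda>(y, c). Phi One x0 y c) q = 0" if q: "q \<in> U" for q
  proof -
    obtain y c where yc: "q = (y, c)" by fastforce
    have c: "c > 0" and hy: "h y < x0 \<bullet> y - c" using q by (auto simp: U_def yc)
    define u where "u w = max (h w) (x0 \<bullet> w - c)" for w
    define f where "f x = (SUP w. ereal (x \<bullet> w - u w))" for x
    \<comment> \<open>\<open>u\<close> is everywhere attained by an affine minorant with slope in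
      \<open>insert x0 C\<close>. This yields the convexity, and the boundedness of the slopes makes
      the regularized conjugates of \<open>f\<close> converge to \<open>u\<close> uniformly.\<close>
    have att: "\<exists>x v. (x \<in> insert x0 C) \<and> u w = x \<bullet> w - v \<and> (\<forall>z. x \<bullet> z - v \<le> u z)" for w
    proof (cases "h w \<ge> x0 \<bullet> w - c")
      case True
      obtain p where p: "p \<in> C" "h w = p \<bullet> w" using hatt by blast
      then show ?thesis using True hup[OF p(1)]
        by (intro exI[of _ p] exI[of _ 0]) (auto simp: u_def le_max_iff_disj)
    next
      case False
      then show ?thesis by (intro exI[of _ x0] exI[of _ c]) (auto simp: u_def le_max_iff_disj)
    qed
    have "convex_on UNIV u"
    proof (rule convex_onI)
      fix t :: real and w z :: "real^'n" assume t: "0 < t" "t < 1"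
      obtain x v where xv: "u ((1 - t) *\<^sub>R w + t *\<^sub>R z) = x \<bullet> ((1 - t) *\<^sub>R w + t *\<^sub>R z) - v" "\<forall>z. x \<bullet> z - v \<le> u z"
        using att by blast
      have "x \<bullet> ((1 - t) *\<^sub>R w + t *\<^sub>R z) - v = (1 - t) * (x \<bullet> w - v) + t * (x \<bullet> z - v)"
        by (simp add: inner_add_right algebra_simps)
      also have "\<dots> \<le> (1 - t) * u w + t * u z" using t xv(2) by (intro add_mono mult_left_mono) auto
      finally show "u ((1 - t) *\<^sub>R w + t *\<^sub>R z) \<le> (1 - t) * u w + t * u z" using xv(1) by simp
    qed simp
    note u = this
    have "x0 \<bullet> w - u w \<le> c" for w by (simp add: u_def)
    then have fC: "f \<in> Conv" unfolding f_def[abs_def] by (rule conjugate_Conv)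
    define \<kappa> where "\<kappa> j = inverse (real (Suc j))" for j
    have \<kappa>: "\<kappa> j > 0" for j by (simp add: \<kappa>_def)
    have \<kappa>lim: "\<kappa> \<longlonglongrightarrow> 0" unfolding \<kappa>_def by (rule LIMSEQ_inverse_real_of_nat)
    have "compact (insert x0 C)" using C(1) by simp
    from compact_imp_bounded[OF this, unfolded bounded_iff]
    obtain R where R': "\<forall>x\<in>insert x0 C. norm x \<le> R" by (elim exE)
    note R = R'[rule_format]
    have approx: "\<bar>reg_conj f (\<kappa> j) w - u w\<bar> \<le> \<kappa> j * R\<^sup>2" for j w
    proof -
      obtain x v where xv: "x \<in> insert x0 C" "u w = x \<bullet> w - v" "\<forall>z. x \<bullet> z - v \<le> u z" using att by blast
      have "f x \<le> ereal v" unfolding f_def using xv(3) by (intro SUP_least) (simp add: algebra_simps)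
      then have dom: "x \<in> effective_domain f" by (auto simp: effective_domain_def)
      have "ereal (real_of_ereal (f x)) \<le> ereal v" using \<open>f x \<le> ereal v\<close> Conv_finite[OF fC dom] by simp
      then have fxv: "real_of_ereal (f x) \<le> v" by simp
      have "(norm x)\<^sup>2 \<le> R\<^sup>2" using R[OF xv(1)] by (intro power_mono) auto
      then have "\<kappa> j * (norm x)\<^sup>2 \<le> \<kappa> j * R\<^sup>2" using \<kappa>[of j] by (intro mult_left_mono) auto
      then have low: "u w - \<kappa> j * R\<^sup>2 \<le> reg_conj f (\<kappa> j) w"
        using reg_point(2)[OF fC \<kappa> dom, of j w] fxv xv(2) by (simp add: reg_value_def)
      define p where "p = reg_point f (\<kappa> j) w"
      have pd: "p \<in> effective_domain f" unfolding p_def by (rule reg_point(1)[OF fC \<kappa>])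
      have "ereal (p \<bullet> w - u w) \<le> f p" unfolding f_def by (rule SUP_upper) simp
      then have "ereal (p \<bullet> w - u w) \<le> ereal (real_of_ereal (f p))" using Conv_finite[OF fC pd] by simp
      then have "p \<bullet> w - u w \<le> real_of_ereal (f p)" by simp
      moreover have "0 \<le> \<kappa> j * (norm p)\<^sup>2" using \<kappa>[of j] by simp
      ultimately have "reg_conj f (\<kappa> j) w \<le> u w" by (simp add: reg_conj_def reg_value_def p_def)
      moreover have "0 \<le> \<kappa> j * R\<^sup>2" using \<kappa>[of j] by simp
      ultimately show ?thesis using low by (simp add: abs_le_iff)
    qed
    have "(\<lambda>j. \<kappa> j * R\<^sup>2) \<longlonglongrightarrow> 0 * R\<^sup>2"
      unfolding \<kappa>_def by (intro tendsto_intros LIMSEQ_inverse_real_of_nat)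
    then have \<kappa>0: "(\<lambda>j. \<kappa> j * R\<^sup>2) \<longlonglongrightarrow> 0" by simp
    have deg: "E u (slab a s) = 0" if "\<And>i. i \<in> Basis \<Longrightarrow> 0 \<le> s \<bullet> i" "k \<in> Basis" "s \<bullet> k = 0" for a s k
      by (rule E_degenerate[OF u reg_conj_C11[OF fC \<kappa>] approx \<kappa>0 that])
    have u0: "u 0 = 0" using c by (simp add: u_def h0)
    have origin: "E u (slab a s) = 0" if s: "\<And>i. i \<in> Basis \<Longrightarrow> 0 \<le> s \<bullet> i" and 0: "0 \<in> slab a s" for a s
      unfolding E_def
    proof (rule van)
      have ne: "slab a s \<noteq> {}" using 0 by blast
      show "legA u (slab a s) \<in> \<Gamma>" by (intro legA_Gamma u slab_compact_convex ne)
      have nn: "0 \<le> leg u (slab a s) x" for x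
        using leg_upper[OF slab_compact_convex(1) convex_on_UNIV_continuous[OF u] 0, of x] u0 by simp
      then show "0 \<le> legA u (slab a s) x" for x by (simp add: legA_def convex_indicator_def)
      fix x assume x: "x \<in> C"
      then have "x \<in> \<A>" using C(4) interior_subset OA by blast
      moreover have "leg u (slab a s) x \<le> 0"
        by (rule leg_least[OF ne]) (use hup[OF x] in \<open>auto simp: u_def le_max_iff_disj\<close>)
      ultimately show "legA u (slab a s) x = 0" using nn[of x] by (simp add: legA_def convex_indicator_def)
    qed
    have zero: "E u (slab y (\<epsilon> *\<^sub>R One)) = 0" if "\<epsilon> > 0" for \<epsilon>
      using that by (intro E_zero_boxes[OF u deg origin]) (auto simp: One_inner)
    define u' where "u' w = x0 \<bullet> w - c" for w
    have "C11 u' (\<lambda>_. x0) 0" by (simp add: C11_def u'_def inner_diff_left inner_commute[of x0])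
    moreover have "0 \<le> (One::real^'n) \<bullet> i" if "i \<in> Basis" for i using that by (simp add: One_inner)
    ultimately have lim: "(\<lambda>j. E u' (slab y (\<kappa> j *\<^sub>R One)) / \<kappa> j ^ CARD('n)) \<longlonglongrightarrow> Phi One x0 y (x0 \<bullet> y - u' y)"
      using \<kappa> \<kappa>lim by (intro E_small_box[of u' "\<lambda>_. x0"]) auto
    have "open {w. h w < x0 \<bullet> w - c}" by (intro open_Collect_less hcont continuous_intros)
    moreover have "y \<in> {w. h w < x0 \<bullet> w - c}" using hy by simp
    ultimately obtain e where e: "e > 0" "ball y e \<subseteq> {w. h w < x0 \<bullet> w - c}" by (rule openE)
    have "(\<lambda>j. \<kappa> j * norm (One::real^'n)) \<longlonglongrightarrow> 0 * norm (One::real^'n)"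
      unfolding \<kappa>_def by (intro tendsto_intros LIMSEQ_inverse_real_of_nat)
    then have "\<forall>\<^sub>F j in sequentially. \<kappa> j * norm (One::real^'n) < e" using e(1) by (intro order_tendstoD(2)) auto
    then have "\<forall>\<^sub>F j in sequentially. E u' (slab y (\<kappa> j *\<^sub>R One)) / \<kappa> j ^ CARD('n) = 0"
    proof eventually_elim
      case (elim j)
      have "u w = u' w" if w: "w \<in> slab y (\<kappa> j *\<^sub>R One)" for w
      proof -
        have "norm (w - y) \<le> norm (\<kappa> j *\<^sub>R (One::real^'n))"
          using w \<kappa>[of j] by (intro norm_le_componentwise) (auto simp: mem_slab inner_diff_left One_inner)
        then have "w \<in> ball y e" using elim \<kappa>[of j] by (simp add: dist_norm norm_minus_commute)
        then show ?thesis using e(2) by (auto simp: u_def u'_def)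
      qed
      then have "legA u' (slab y (\<kappa> j *\<^sub>R One)) = legA u (slab y (\<kappa> j *\<^sub>R One))"
        by (simp add: legA_def leg_def cong: image_cong)
      then show ?case using zero[OF \<kappa>] by (simp add: E_def)
    qed
    then have "(\<lambda>j. E u' (slab y (\<kappa> j *\<^sub>R One)) / \<kappa> j ^ CARD('n)) \<longlonglongrightarrow> 0" by (rule tendsto_eventually)
    then have "Phi One x0 y (x0 \<bullet> y - u' y) = 0" using lim LIMSEQ_unique by blast
    then show ?thesis by (simp add: yc u'_def)
  qed
  ultimately have "(\<lambda>(y, c). Phi One x0 y c) = (\<lambda>_. 0)"
    by (intro homogeneous_polynomial_vanishes[OF Phi_homogeneous]) (auto simp: One_inner)
  then show ?thesis by (metis case_prod_conv)
qed

end


section \<open>Recovering the density\<close>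

context AO_density
begin

interpretation zphi: PV_setting \<A> \<O> \<Gamma> d Zphi
  by unfold_locales (rule Zphi_PV)

text \<open>For \<open>w\<close> inside the shifted cube \<open>x0\<close> is the strict minimizer
  and the function value there is \<open>\<tau> * c\<close>; for \<open>w\<close> outside there is
  no minimizer in the interior of \<open>B\<close>. The boundary of the cube is a null set, and if
  \<open>x0\<close> is not in the interior of \<open>B\<close> both integrands vanish.\<close>

lemma pyramid_integral:
  "Zphi (zphi.pyramid One x0 y c \<tau>)
    = (LINT w|lebesgue. indicator (slab 0 One) w * \<phi> x0 (w + \<tau> *\<^sub>R y, \<tau> * c))"
proof -
  define h where "h = leg (\<lambda>_. 0) (slab 0 (One::real^'n))"
  have one: "0 \<le> (One::real^'n) \<bullet> i" if "i \<in> Basis" for i using that by (simp add: One_inner)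
  have ne: "slab 0 (One::real^'n) \<noteq> {}" using slab_nonempty[of One 0, OF one] by blast
  note hQ = slab_compact_convex(1)[of 0 "One::real^'n"] ne continuous_on_const[of "slab 0 (One::real^'n)" "0::real"]
  have hup: "z \<bullet> q \<le> h z" if "q \<in> slab 0 One" for z q
    using leg_upper[OF hQ(1) continuous_on_const that, of z 0] by (simp add: h_def)
  have hle: "h z \<le> b" if "\<And>q. q \<in> slab 0 One \<Longrightarrow> z \<bullet> q \<le> b" for z b
    unfolding h_def using that by (intro leg_least ne) simp
  have h0: "h 0 = 0" using hup[of 0 0] hle[of 0 0] slab_nonempty[of One 0, OF one] by force
  have hadd: "h (z + z') \<le> h z + h z'" for z z'
    by (rule hle) (use hup in \<open>auto simp: inner_add_left intro: add_mono\<close>)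
  have hscale: "h (t *\<^sub>R z) \<le> t * h z" if "t \<ge> 0" for t z
    by (rule hle) (use hup that in \<open>auto intro: mult_left_mono\<close>)
  define F where "F x = h (x - x0) + \<tau> * ((x - x0) \<bullet> y + c)" for x
  have G: "zphi.pyramid One x0 y c \<tau> \<in> \<Gamma>" by (rule zphi.pyramid_Gamma[OF one])
  have BA: "x \<in> \<A>" if "x \<in> B" for x using that BO interior_subset OA by blast
  have real: "real_of_ereal (zphi.pyramid One x0 y c \<tau> x) = F x" if "x \<in> B" for x
    using BA[OF that] by (simp add: zphi.pyramid_def F_def h_def convex_indicator_def)
  have cF: "continuous_on B F" using continuous_on_eq[OF B_continuous[OF G] real] by simp
  have "AE w in lebesgue. w \<notin> slab (\<tau> *\<^sub>R y) One - box (\<tau> *\<^sub>R y) (\<tau> *\<^sub>R y + One)"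
    using negligible_frontier_interval[of "\<tau> *\<^sub>R y" "\<tau> *\<^sub>R y + One"]
    by (intro AE_not_in) (simp add: negligible_iff_null_sets slab_def)
  then have AE: "AE w in lebesgue. argmin_density F w = indicator (slab (\<tau> *\<^sub>R y) One) w * \<phi> x0 (w, \<tau> * c)"
  proof eventually_elim
    case (elim w)
    define w' where "w' = w - \<tau> *\<^sub>R y"
    define x where "x = argmin_on B F w"
    have x: "x \<in> B" "\<And>z. z \<in> B \<Longrightarrow> F x - x \<bullet> w \<le> F z - z \<bullet> w"
      unfolding x_def using argmin_on_in argmin_on_le cF by auto
    have dens: "argmin_density F w = \<phi> x (w, F x)" by (simp add: argmin_density_def x_def)
    have val: "F z - z \<bullet> w = h (z - x0) - (z - x0) \<bullet> w' + (\<tau> * c - x0 \<bullet> w)" for z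
      by (simp add: F_def w'_def inner_diff_left inner_diff_right algebra_simps)
    have notint: "\<phi> x (w, F x) = 0" if "x \<notin> interior B" using that supp phi_zero by blast
    show ?case
    proof (cases "w \<in> slab (\<tau> *\<^sub>R y) One")
      case True
      then have "w \<in> box (\<tau> *\<^sub>R y) (\<tau> *\<^sub>R y + One)" using elim by blast
      have w': "w' \<in> box 0 One"
        unfolding mem_box
      proof
        fix i :: "real^'n" assume i: "i \<in> Basis"
        then have "\<tau> * (y \<bullet> i) < w \<bullet> i" "w \<bullet> i < \<tau> * (y \<bullet> i) + 1"
          using \<open>w \<in> box (\<tau> *\<^sub>R y) (\<tau> *\<^sub>R y + One)\<close> by (auto simp: mem_box inner_add_left One_inner)
        then show "0 \<bullet> i < w' \<bullet> i \<and> w' \<bullet> i < One \<bullet> i" using i by (simp add: w'_def inner_diff_left One_inner)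
      qed
      have strict: "z \<bullet> w' < h z" if "z \<noteq> 0" for z
      proof -
        obtain e where e: "e > 0" "cball w' e \<subseteq> box 0 One"
          using w' open_box open_contains_cball by blast
        define q where "q = w' + (e / norm z) *\<^sub>R z"
        have "q \<in> cball w' e" using that e(1) by (simp add: q_def dist_norm)
        then have "q \<in> slab 0 One" using e(2) box_subset_cbox[of 0 One] by (auto simp: slab_def)
        from hup[OF this, of z] have "z \<bullet> w' + (e / norm z) * (z \<bullet> z) \<le> h z" by (simp add: q_def inner_add_right)
        moreover have "(e / norm z) * (z \<bullet> z) > 0" using that e(1) by simp
        ultimately show ?thesis by linarith
      qed
      have min: "F x0 - x0 \<bullet> w < F z - z \<bullet> w" if "z \<noteq> x0" for z
        using strict[of "z - x0"] that h0 by (simp add: val)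
      have Fx0: "F x0 = \<tau> * c" by (simp add: F_def h0)
      show ?thesis
      proof (cases "x \<in> interior B")
        case intB: True
        have "x = x0"
        proof (rule ccontr)
          assume ne: "x \<noteq> x0"
          obtain e where e: "e > 0" "cball x e \<subseteq> B" using intB mem_interior_cball by blast
          \<comment> \<open>\<open>x0\<close> may lie outside \<open>B\<close>, so only a short step
            from \<open>x\<close> towards it is taken. By homogeneity of \<open>h\<close> it
            multiplies the positive excess \<open>h - \<langle>\<cdot>, w'\<rangle>\<close> by at
            most \<open>1 - t\<close>.\<close>
          define t where "t = min (1/2) (e / norm (x0 - x))"
          have t: "0 < t" "t < 1" using e(1) ne by (auto simp: t_def)
          have "t * norm (x0 - x) \<le> e / norm (x0 - x) * norm (x0 - x)" by (intro mult_right_mono) (auto simp: t_def)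
          then have "t * norm (x0 - x) \<le> e" using ne by simp
          then have "x + t *\<^sub>R (x0 - x) \<in> cball x e" using t by (simp add: dist_norm)
          then have le: "F x - x \<bullet> w \<le> F (x + t *\<^sub>R (x0 - x)) - (x + t *\<^sub>R (x0 - x)) \<bullet> w"
            using e(2) by (intro x(2)) blast
          have eq: "x + t *\<^sub>R (x0 - x) - x0 = (1 - t) *\<^sub>R (x - x0)" by (simp add: algebra_simps)
          have "h (x - x0) - (x - x0) \<bullet> w' \<le> (1 - t) * (h (x - x0) - (x - x0) \<bullet> w')"
            using le hscale[of "1 - t" "x - x0"] t unfolding val eq by (simp add: algebra_simps)
          then have "t * (h (x - x0) - (x - x0) \<bullet> w') \<le> 0" by (simp add: algebra_simps)
          then show False using strict[of "x - x0"] ne t(1) by (simp add: mult_le_0_iff)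
        qed
        then show ?thesis using True dens Fx0 by simp
      next
        case False
        have "\<phi> x0 (w, \<tau> * c) = 0"
        proof (cases "x0 \<in> tensor_support \<phi>")
          case True
          then have "x0 \<in> interior B" using supp by blast
          moreover have "x = x0"
            using x(2)[of x0] min[of x] \<open>x0 \<in> interior B\<close> interior_subset by force
          ultimately show ?thesis using False by simp
        qed (simp add: phi_zero)
        then show ?thesis using notint[OF False] dens by simp
      qed
    next
      case False
      have "x \<notin> interior B"
      proof
        assume "x \<in> interior B"
        then obtain e where e: "e > 0" "cball x e \<subseteq> B" using mem_interior_cball by blast
        \<comment> \<open>Minimality at \<open>x\<close> together with the subadditivity of
          \<open>h\<close> moves the inequality to the apex; testing it with \<open>e\<close> times
          plus and minus a basis vector puts \<open>w'\<close> into the cube.\<close>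
        have *: "z \<bullet> w' \<le> h z" if z: "norm z \<le> e" for z
        proof -
          have "F x - x \<bullet> w \<le> F (x + z) - (x + z) \<bullet> w" using e(2) z by (intro x(2)) (auto simp: dist_norm)
          then have "h (x - x0) - (x - x0) \<bullet> w' \<le> h ((x - x0) + z) - ((x - x0) + z) \<bullet> w'"
            unfolding val by (simp add: algebra_simps)
          then show ?thesis using hadd[of "x - x0" z] by (simp add: inner_add_left)
        qed
        obtain i where i: "i \<in> Basis" "\<not> (0 \<le> w' \<bullet> i \<and> w' \<bullet> i \<le> 1)"
          using False by (auto simp: mem_slab w'_def inner_diff_left One_inner)
        have ni: "norm i = 1" using i(1) by simp
        have q: "0 \<le> e * (i \<bullet> q)" "e * (i \<bullet> q) \<le> e" if "q \<in> slab 0 One" for q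
        proof -
          have "0 \<le> q \<bullet> i" "q \<bullet> i \<le> 1" using that i(1) by (auto simp: mem_slab One_inner)
          then show "0 \<le> e * (i \<bullet> q)" "e * (i \<bullet> q) \<le> e"
            using e(1) mult_left_mono[of "q \<bullet> i" 1 e] by (simp_all add: inner_commute)
        qed
        have up: "h (e *\<^sub>R i) \<le> e" by (rule hle) (simp add: q)
        have dn: "h (- e *\<^sub>R i) \<le> 0" by (rule hle) (simp add: q)
        have "(e *\<^sub>R i) \<bullet> w' \<le> h (e *\<^sub>R i)" "(- e *\<^sub>R i) \<bullet> w' \<le> h (- e *\<^sub>R i)"
          by (rule *, use ni e(1) in simp)+
        then have "e * (i \<bullet> w') \<le> e" "- e * (i \<bullet> w') \<le> 0"
          using up dn unfolding inner_scaleR_left by linarith+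
        then show False using i(2) e(1) by (auto simp: inner_commute zero_le_mult_iff)
      qed
      then show ?thesis using False notint dens by simp
    qed
  qed
  have m1: "argmin_density F \<in> borel_measurable lebesgue" by (rule argmin_density_measurable[OF cF])
  have cphi: "continuous_on UNIV (\<lambda>w. \<phi> x0 (w, b))" for b
    using continuous_on_compose2[OF cont, of UNIV "\<lambda>w. (x0, (w, b))"] by (simp add: continuous_intros)
  have m2: "(\<lambda>w. indicator (slab (\<tau> *\<^sub>R y) One) w * \<phi> x0 (w, \<tau> * c)) \<in> borel_measurable lebesgue"
  proof -
    have "(\<lambda>w. \<phi> x0 (w, \<tau> * c)) \<in> borel_measurable borel" by (rule borel_measurable_continuous_onI[OF cphi])
    then have "(\<lambda>w. indicator (slab (\<tau> *\<^sub>R y) One) w * \<phi> x0 (w, \<tau> * c)) \<in> borel_measurable borel"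
      by (intro borel_measurable_times borel_measurable_indicator) (auto simp: slab_def)
    then show ?thesis by (simp add: measurable_completion)
  qed
  have "Zphi (zphi.pyramid One x0 y c \<tau>) = argmin_integral F"
    unfolding hessian_integral_eq(2)[OF G] by (rule argmin_integral_cong[OF B_continuous[OF G] real])
  also have "\<dots> = (LINT w|lebesgue. indicator (slab (\<tau> *\<^sub>R y) One) w * \<phi> x0 (w, \<tau> * c))"
    unfolding argmin_integral_def by (rule integral_cong_AE[OF m1 m2 AE])
  also have "\<dots> = (LINT w|lebesgue. indicator (slab (\<tau> *\<^sub>R y) One) (\<tau> *\<^sub>R y + w) * \<phi> x0 (\<tau> *\<^sub>R y + w, \<tau> * c))"
    by (rule lebesgue_integral_translate[OF m2, symmetric])
  also have "(\<lambda>w. indicator (slab (\<tau> *\<^sub>R y) One) (\<tau> *\<^sub>R y + w) * \<phi> x0 (\<tau> *\<^sub>R y + w, \<tau> * c))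
      = (\<lambda>w. indicator (slab 0 One) w * \<phi> x0 (w + \<tau> *\<^sub>R y, \<tau> * c))"
    by (auto simp: indicator_def mem_slab inner_add_left add.commute fun_eq_iff)
  finally show ?thesis .
qed

text \<open>For every \<open>w\<close> in the cube the weighted sum over \<open>i\<close> is the
  leading part of a shifted homogeneous polynomial, hence independent of \<open>w\<close>; the unit
  cube has volume 1, so no factor remains.\<close>

lemma Phi_Zphi: "zphi.Phi One x0 y c = \<phi> x0 (y, c)"
proof -
  have int: "integrable lebesgue (\<lambda>w. indicator (slab 0 One) w * \<phi> x0 (w + \<tau> *\<^sub>R y, \<tau> * c))" for \<tau>
  proof -
    have "continuous_on (slab 0 One) (\<lambda>w. \<phi> x0 (w + \<tau> *\<^sub>R y, \<tau> * c))"
      using continuous_on_compose2[OF cont, of "slab 0 One" "\<lambda>w. (x0, (w + \<tau> *\<^sub>R y, \<tau> * c))"] by (simp add: continuous_intros)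
    from borel_integrable_compact[OF slab_compact_convex(1) this]
    have i: "integrable lborel (\<lambda>w. indicator (slab 0 One) w * \<phi> x0 (w + \<tau> *\<^sub>R y, \<tau> * c))" by simp
    then show ?thesis by (subst integrable_completion) (auto dest: borel_measurable_integrable)
  qed
  have "zphi.Phi One x0 y c = (\<Sum>i\<le>d. (LINT w|lebesgue. leading_weight d i *
      (indicator (slab 0 One) w * \<phi> x0 (w + real i *\<^sub>R y, real i * c))))"
    unfolding zphi.Phi_def pyramid_integral by simp
  also have "\<dots> = (LINT w|lebesgue. (\<Sum>i\<le>d. leading_weight d i *
      (indicator (slab 0 One) w * \<phi> x0 (w + real i *\<^sub>R y, real i * c))))"
    by (intro Bochner_Integration.integral_sum[symmetric] integrable_mult_right int)
  also have "\<dots> = (LINT w|lebesgue. indicator (slab 0 (One::real^'n)) w * \<phi> x0 (y, c))"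
  proof (rule Bochner_Integration.integral_cong[OF refl])
    fix w :: "real^'n"
    have "(\<Sum>i\<le>d. leading_weight d i * \<phi> x0 ((w, 0) + real i *\<^sub>R (y, c))) = \<phi> x0 (y, c)"
      by (rule leading_part_shifted[OF hom])
    then show "(\<Sum>i\<le>d. leading_weight d i * (indicator (slab 0 One) w * \<phi> x0 (w + real i *\<^sub>R y, real i * c)))
      = indicator (slab 0 One) w * \<phi> x0 (y, c)"
      by (simp add: indicator_def)
  qed
  also have "\<dots> = measure lebesgue (slab 0 (One::real^'n)) * \<phi> x0 (y, c)" by simp
  also have "measure lebesgue (slab 0 (One::real^'n)) = 1"
    by (simp add: slab_def content_cbox_cases One_inner)
  finally show ?thesis by simp
qed

end

section \<open>Existence and uniqueness of the density\<close>

lemma PV_diff: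
  assumes "Z \<in> PV d k \<Gamma>" "Z' \<in> PV d k \<Gamma>"
  shows "(\<lambda>f. Z f - Z' f) \<in> PV d k \<Gamma>"
  unfolding PV_def
proof (intro CollectI conjI)
  show "continuous_map (subtopology epi_topology \<Gamma>) euclideanreal (\<lambda>f. Z f - Z' f)"
    using assms by (intro continuous_map_diff) (auto simp: PV_def)
  show "valuation_on \<Gamma> (\<lambda>f. Z f - Z' f)"
    using assms unfolding PV_def valuation_on_def by (auto simp: algebra_simps)
  show "polynomial_valued d \<Gamma> (\<lambda>f. Z f - Z' f)"
    unfolding polynomial_valued_def
  proof
    fix f assume "f \<in> \<Gamma>"
    then have "polynomial_of_degree_le d (\<lambda>(y, s). Z (\<lambda>x. f x + ereal (y \<bullet> x + s)))"
      "polynomial_of_degree_le d (\<lambda>(y, s). Z' (\<lambda>x. f x + ereal (y \<bullet> x + s)))"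
      using assms by (auto simp: PV_def polynomial_valued_def)
    from polynomial_degree_le_add[OF this(1) polynomial_degree_le_cmult[OF this(2), of "-1"]]
    show "polynomial_of_degree_le d (\<lambda>(y, s). Z (\<lambda>x. f x + ereal (y \<bullet> x + s)) - Z' (\<lambda>x. f x + ereal (y \<bullet> x + s)))"
      by (simp add: case_prod_unfold)
  qed
  show "\<forall>f\<in>\<Gamma>. \<forall>t>0. Z (\<lambda>x. ereal t * f x) - Z' (\<lambda>x. ereal t * f x) = t ^ k * (Z f - Z' f)"
    using assms by (auto simp: PV_def algebra_simps)
qed

lemma compact_in_interior_of_convex_body:
  fixes S K :: "'a::euclidean_space set"
  assumes S: "convex S" "interior S \<noteq> {}" and K: "compact K" "K \<subseteq> interior S"
  obtains B where "compact B" "convex B" "interior B \<noteq> {}" "K \<subseteq> interior B" "B \<subseteq> interior S"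
proof -
  obtain p where p: "p \<in> interior S" using S(2) by blast
  \<comment> \<open>The extra point keeps the interior of the hull nonempty when \<open>K\<close> is
    empty.\<close>
  define K' where "K' = insert p K"
  have K': "compact K'" "K' \<subseteq> interior S" using K p by (auto simp: K'_def)
  then have "K' \<inter> - interior S = {}" by blast
  from separate_compact_closed[OF K'(1) closed_Compl[OF open_interior] this]
  obtain \<delta> where \<delta>: "\<delta> > 0" "\<forall>x\<in>K'. \<forall>y\<in>- interior S. \<delta> \<le> dist x y" by blast
  define W where "W = {x + y | x y. x \<in> K' \<and> y \<in> cball 0 (\<delta>/2)}"
  have W: "compact W" unfolding W_def by (intro compact_sums K' compact_cball)
  have WS: "W \<subseteq> interior S"
    unfolding W_def
  proof clarify
    fix x y :: 'a assume "x \<in> K'" "y \<in> cball 0 (\<delta>/2)"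
    then show "x + y \<in> interior S" using \<delta>(2)[rule_format, of x "x + y"] \<delta>(1) by (force simp: dist_norm)
  qed
  have KW: "K' \<subseteq> interior (convex hull W)"
  proof
    fix x assume x: "x \<in> K'"
    have "cball x (\<delta>/2) \<subseteq> W"
    proof
      fix z assume "z \<in> cball x (\<delta>/2)"
      then have "z = x + (z - x)" "z - x \<in> cball 0 (\<delta>/2)" by (auto simp: dist_norm norm_minus_commute)
      then show "z \<in> W" using x unfolding W_def by blast
    qed
    also have "W \<subseteq> convex hull W" by (rule hull_subset)
    finally show "x \<in> interior (convex hull W)" using \<delta>(1) by (intro mem_interior_cball[THEN iffD2] exI[of _ "\<delta>/2"]) simp
  qed
  show ?thesis
  proof (rule that[of "convex hull W"])
    show "compact (convex hull W)" by (rule compact_convex_hull[OF W])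
    show "convex (convex hull W)" by (rule convex_convex_hull)
    show "interior (convex hull W) \<noteq> {}" "K \<subseteq> interior (convex hull W)" using KW by (auto simp: K'_def)
    show "convex hull W \<subseteq> interior S" by (rule hull_minimal[where S = convex, OF WS]) (rule convex_interior[OF S(1)])
  qed
qed

context AO_setting
begin

lemma density_body:
  assumes "\<phi> \<in> Cc_Sym d" "tensor_support \<phi> \<subseteq> interior \<O>"
  obtains B where "AO_density \<A> \<O> \<Gamma> d \<phi> B"
proof -
  have "compact (tensor_support \<phi>)" using assms(1) by (simp add: Cc_Sym_def)
  then obtain B where "compact B" "convex B" "interior B \<noteq> {}" "tensor_support \<phi> \<subseteq> interior B" "B \<subseteq> interior \<O>"
    using compact_in_interior_of_convex_body[OF O(2,3) _ assms(2)] by metis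
  then have "AO_density \<A> \<O> \<Gamma> d \<phi> B" using assms(1) by unfold_locales auto
  then show ?thesis by (rule that)
qed

lemma Zphi_in_PV:
  assumes "\<phi> \<in> Cc_Sym d" "tensor_support \<phi> \<subseteq> interior \<O>"
  shows "f \<in> \<Gamma> \<Longrightarrow> integrable (hessian_measure0 f) (hessian_integrand \<phi> f)"
    and "(\<lambda>f. integral\<^sup>L (hessian_measure0 f) (hessian_integrand \<phi> f)) \<in> PV d (CARD('n) + d) \<Gamma>"
proof -
  obtain B where "AO_density \<A> \<O> \<Gamma> d \<phi> B" using density_body[OF assms] by blast
  then interpret AO_density \<A> \<O> \<Gamma> d \<phi> B .
  show "f \<in> \<Gamma> \<Longrightarrow> integrable (hessian_measure0 f) (hessian_integrand \<phi> f)" by (rule hessian_integral_eq(1))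
  show "Zphi \<in> PV d (CARD('n) + d) \<Gamma>" by (rule Zphi_PV)
qed

end

context PV_setting
begin

definition density :: "real^'n \<Rightarrow> (real^'n) \<times> real \<Rightarrow> real" where
  "density x0 = (\<lambda>(y, c). Phi One x0 y c)"

lemma One_nonneg: "i \<in> Basis \<Longrightarrow> 0 \<le> (One::real^'n) \<bullet> i"
  by (simp add: One_inner)

lemma density_Cc: "density \<in> Cc_Sym d" and density_support: "tensor_support density \<subseteq> interior \<O>"
proof -
  obtain C where C: "compact C" "convex C" "C \<noteq> {}" "C \<subseteq> interior \<O>"
    "\<forall>f\<in>\<Gamma>. (\<forall>x. 0 \<le> f x) \<longrightarrow> (\<forall>x\<in>C. f x = 0) \<longrightarrow> Z f = 0"
    by (rule Z_vanishes_off_compact)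
  have van: "Z f = 0" if "f \<in> \<Gamma>" "\<And>x. 0 \<le> f x" "\<And>x. x \<in> C \<Longrightarrow> f x = 0" for f
    using C(5) that by simp
  have Phi0: "Phi One x y c = 0" if "x \<notin> C" for x y c
    using van by (rule Phi_vanishes[OF C(1-4) _ that])
  have "density x = (\<lambda>_. 0)" if "x \<notin> C" for x
    by (simp add: density_def Phi0[OF that] case_prod_unfold)
  then have "{x. density x \<noteq> (\<lambda>_. 0)} \<subseteq> C" by blast
  then have sub: "tensor_support density \<subseteq> C"
    unfolding tensor_support_def using compact_imp_closed[OF C(1)] by (rule closure_minimal)
  then show "tensor_support density \<subseteq> interior \<O>" using C(4) by blast
  have "compact (tensor_support density)"
  proof -
    have "compact (tensor_support density \<inter> C)"
      unfolding tensor_support_def by (rule closed_Int_compact[OF closed_closure C(1)])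
    moreover have "tensor_support density \<inter> C = tensor_support density" using sub by blast
    ultimately show ?thesis by simp
  qed
  moreover have "range density \<subseteq> Sym d"
    unfolding density_def Sym_def using Phi_homogeneous[OF One_nonneg] by auto
  moreover have "continuous_on UNIV density"
  proof (rule continuous_on_coordinatewise_then_product)
    fix z :: "(real^'n) \<times> real"
    show "continuous_on UNIV (\<lambda>x. density x z)"
      unfolding continuous_on_sequentially comp_def density_def case_prod_unfold
      by (intro allI ballI impI, elim conjE) (intro Phi_tendsto One_nonneg tendsto_const)
  qed
  ultimately show "density \<in> Cc_Sym d" by (simp add: Cc_Sym_def)
qed

text \<open>\<open>E_cube\<close> evaluates the approximants of \<open>E_dense\<close> as integrals
  of \<open>Phi\<close>.\<close>

lemma Phi_eq_zero_imp_zero: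
  assumes "\<And>x y c. Phi One x y c = 0" and f: "f \<in> \<Gamma>"
  shows "Z f = 0"
proof -
  have fC: "f \<in> Conv" using f Gamma_Conv by blast
  have "E (reg_conj f (inverse (real (Suc j)))) (slab (- (real (Suc j) *\<^sub>R One)) ((2 * real (Suc j)) *\<^sub>R One)) = 0" for j
    using E_cube[OF reg_conj_C11[OF fC], of "inverse (real (Suc j))" "2 * real (Suc j)"] by (simp add: assms(1))
  then show ?thesis using E_dense[OF f] by (simp add: LIMSEQ_const_iff)
qed

text \<open>\<open>Phi\<close> depends only on the values at pyramids, which belong to
  \<open>\<Gamma>\<close>, and for the integral functional it returns \<open>\<phi>\<close>.\<close>

lemma density_unique:
  assumes \<phi>: "\<phi> \<in> Cc_Sym d" "tensor_support \<phi> \<subseteq> interior \<O>"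
    and rep: "\<And>f. f \<in> \<Gamma> \<Longrightarrow> Z f = integral\<^sup>L (hessian_measure0 f) (hessian_integrand \<phi> f)"
  shows "\<phi> = density"
proof -
  obtain B where "AO_density \<A> \<O> \<Gamma> d \<phi> B" using density_body[OF \<phi>] by blast
  then interpret D: AO_density \<A> \<O> \<Gamma> d \<phi> B .
  interpret P: PV_setting \<A> \<O> \<Gamma> d D.Zphi by unfold_locales (rule D.Zphi_PV)
  have "P.Phi One x y c = Phi One x y c" for x y c
    unfolding P.Phi_def Phi_def using rep[OF pyramid_Gamma[OF One_nonneg]] by simp
  then have "\<phi> x (y, c) = Phi One x y c" for x y c using D.Phi_Zphi by metis
  then show ?thesis by (auto simp: density_def fun_eq_iff)
qed

text \<open>\<open>Phi\<close> is linear in the functional and agrees for \<open>Z\<close> and for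
  the integral with density \<open>Phi\<close>, so their difference, again in the same space, has
  \<open>Phi = 0\<close>.\<close>

lemma density_represents:
  assumes f: "f \<in> \<Gamma>"
  shows "Z f = integral\<^sup>L (hessian_measure0 f) (hessian_integrand density f)"
proof -
  obtain B where "AO_density \<A> \<O> \<Gamma> d density B" using density_body[OF density_Cc density_support] by blast
  then interpret D: AO_density \<A> \<O> \<Gamma> d density B .
  interpret P: PV_setting \<A> \<O> \<Gamma> d D.Zphi by unfold_locales (rule D.Zphi_PV)
  interpret R: PV_setting \<A> \<O> \<Gamma> d "\<lambda>f. Z f - D.Zphi f"
    by unfold_locales (rule PV_diff[OF PV D.Zphi_PV])
  have "R.Phi One x y c = 0" for x y c
  proof -
    have "R.Phi One x y c = Phi One x y c - P.Phi One x y c"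
      unfolding R.Phi_def P.Phi_def Phi_def by (simp add: sum_subtractf right_diff_distrib)
    also have "P.Phi One x y c = Phi One x y c" using D.Phi_Zphi[of x y c] by (simp add: density_def)
    finally show ?thesis by simp
  qed
  then have "Z f - D.Zphi f = 0" using f by (rule R.Phi_eq_zero_imp_zero)
  then show ?thesis by simp
qed

end

theorem theorem1p9:
  fixes \<A> \<O> :: "(real^'n) set"
    and \<Gamma> :: "((real^'n) \<Rightarrow> ereal) set"
    and d :: nat
  assumes "closed \<A>" "convex \<A>" "interior \<A> \<noteq> {}"
    and "closed \<O>" "convex \<O>" "interior \<O> \<noteq> {}"
    and "\<O> \<subseteq> \<A>"
    and "AO_cone \<A> \<O> \<Gamma>"
  shows "(\<forall>Z \<in> PV d (CARD('n) + d) \<Gamma>.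
            \<exists>!\<phi>. \<phi> \<in> Cc_Sym d \<and> tensor_support \<phi> \<subseteq> interior \<O> \<and>
              (\<forall>f\<in>\<Gamma>. Z f = integral\<^sup>L (hessian_measure0 f) (hessian_integrand \<phi> f)))
       \<and> (\<forall>\<phi> \<in> Cc_Sym d. tensor_support \<phi> \<subseteq> interior \<O> \<longrightarrow>
            (\<forall>f\<in>\<Gamma>. integrable (hessian_measure0 f) (hessian_integrand \<phi> f)) \<and>
            (\<lambda>f. integral\<^sup>L (hessian_measure0 f) (hessian_integrand \<phi> f)) \<in> PV d (CARD('n) + d) \<Gamma>)"
proof -
  interpret AO_setting \<A> \<O> \<Gamma> using assms by unfold_locales
  show ?thesis
  proof (intro conjI ballI impI)
    fix Z assume "Z \<in> PV d (CARD('n) + d) \<Gamma>"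
    then interpret P: PV_setting \<A> \<O> \<Gamma> d Z by unfold_locales
    show "\<exists>!\<phi>. \<phi> \<in> Cc_Sym d \<and> tensor_support \<phi> \<subseteq> interior \<O> \<and>
        (\<forall>f\<in>\<Gamma>. Z f = integral\<^sup>L (hessian_measure0 f) (hessian_integrand \<phi> f))"
    proof (rule ex1I[of _ P.density])
      show "P.density \<in> Cc_Sym d \<and> tensor_support P.density \<subseteq> interior \<O> \<and>
          (\<forall>f\<in>\<Gamma>. Z f = integral\<^sup>L (hessian_measure0 f) (hessian_integrand P.density f))"
        using P.density_Cc P.density_support P.density_represents by blast
    qed (use P.density_unique in blast)
  qed (use Zphi_in_PV in blast)+
qed

end
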